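(* In the setting described in the context, let the functions $\boldsymbol{f}_i,\boldsymbol{\varphi}_i,\boldsymbol{\phi}_i$ and matrices $M_i,\Gamma_i,\mathfrak{F}_i,\mathfrak{H}_i,\mathfrak{E}_i$ ($i\in\mathbb{N}_\nu$) be given. Suppose there exist estimator gains $L_0,L_i\in\mathbb{R}^{n\times l}$, $\widehat{L}_i\in\mathbb{R}^{n\times\kappa_i l}$, $\mathcal{L}_0,\mathcal{L}_i\in\mathbb{R}^{m\times l}$, $\widehat{\mathcal{L}}_i\in\mathbb{R}^{m\times\kappa_i l}$, matrices $Q_i,R_i\in\mathbb{S}^n$ ($i\in\mathbb{N}_\nu$), and matrices $P_1\in\mathbb{S}^n$, $P_2\in\mathbb{R}^{n\times dn}$, $P_3\in\mathbb{S}^{dn}$ such that $$\begin{bmatrix}P_1&P_2\\ P_2^\top& P_3+\mathrm{diag}_{i=1}^\nu(I_{d_i}\otimes Q_i)\end{bmatrix}\succ0,$$ $$\mathbf{Q}=\mathrm{diag}_{i=1}^\nu Q_i\succ0,\qquad \mathbf{R}=\mathrm{diag}_{i=1}^\nu R_i\succ0,$$ $$\begin{bmatrix}\boldsymbol{\Psi}&\boldsymbol{\Sigma}^\top\widetilde{J}^\top\\ \widetilde{J}\boldsymbol{\Sigma}&J_1\end{bmatrix}=\mathsf{Sy}(\mathbf{P}^\top\boldsymbol{\Pi})+\boldsymbol{\Phi}\prec0 .$$ Here $\boldsymbol{\Omega}=\mathbf{A}+\mathbf{L}_1[(I_\beta\otimes\mathfrak{C})\oplus \mathsf{O}_q]$,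 $\boldsymbol{\Sigma}=\mathbf{C}+\mathbf{L}_2[(I_\beta\otimes\mathfrak{C})\oplus \mathsf{O}_q]$, and $$\boldsymbol{\Psi}=\mathsf{Sy}\left(S^\top\begin{bmatrix}P_1&P_2\\ P_2^\top&P_3\end{bmatrix}\begin{bmatrix}\boldsymbol{\Omega}\\ [\,\mathbf{M}\otimes I_n\ \ \mathsf{O}_{dn,(\mu n+q)}]\end{bmatrix}-\begin{bmatrix}\mathsf{O}_{\beta n,m}\\ J_2^\top\end{bmatrix}\boldsymbol{\Sigma}\right)+\Xi,$$ $$S=\begin{bmatrix}I_n&\mathsf{O}_{n,\nu n}&\mathsf{O}_{n,\varkappa n}&\mathsf{O}_{n,\mu n}&\mathsf{O}_{n,q}\\ \mathsf{O}_{dn,n}&\mathsf{O}_{dn,\nu n}&\widehat{I}&\mathsf{O}_{dn,\mu n}&\mathsf{O}_{dn,q}\end{bmatrix},$$ $$\Xi=\big[(\mathbf{Q}+\mathbf{R}\Lambda)\oplus\mathsf{O}_n\oplus\mathsf{O}_{\kappa n}\oplus\mathsf{O}_q\big]-\big[\mathsf{O}_n\oplus\mathbf{Q}\oplus\mathrm{diag}_{i=1}^\nu(I_{\varkappa_i}\otimes R_i)\oplus\mathrm{diag}_{i=1}^\nu(I_{\mu_i}\otimes R_i)\oplus J_3\big],$$ $$\widehat{I}=\Big(\mathrm{diag}_{i=1}^\nu\sqrt{\mathfrak{F}_i^{-1}}\,[\mathsf{O}_{d_i,\delta_i}\ \ I_{d_i}]\,\sqrt{\mathfrak{H}_i}\Big)\otimes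 I_n,\qquad \Lambda=\mathrm{diag}_{i=1}^\nu(r_i-r_{i-1})I_n,$$ $$\mathbf{M}=\Big[\mathrm{diag}_{i=1}^\nu\sqrt{\mathfrak{F}_i^{-1}}\boldsymbol{f}_i(-r_{i-1})\ \ \mathbf{0}_d\ \ \mathsf{O}_{d,\varkappa}\Big]-\Big[\mathbf{0}_d\ \ \mathrm{diag}_{i=1}^\nu\sqrt{\mathfrak{F}_i^{-1}}\boldsymbol{f}_i(-r_i)\ \ \mathrm{diag}_{i=1}^\nu\sqrt{\mathfrak{F}_i^{-1}}M_i\sqrt{\mathfrak{H}_i}\Big],$$ $$\mathbf{P}=\big[P_1\ \ \mathsf{O}_{n,\nu n}\ \ P_2\widehat{I}\ \ \mathsf{O}_{n,(\mu n+q+m)}\big],\qquad \boldsymbol{\Pi}=[\boldsymbol{\Omega}\ \ \mathsf{O}_{n,m}],$$ $$\boldsymbol{\Phi}=\mathsf{Sy}\left(\begin{bmatrix}P_2\\ \mathsf{O}_{\nu n,dn}\\ \widehat{I}^\top P_3\\ \mathsf{O}_{(\mu n+q+m),dn}\end{bmatrix}[\,\mathbf{M}\otimes I_n\ \ \mathsf{O}_{dn,(\mu n+q+m)}]+\begin{bmatrix}\mathsf{O}_{\beta n,m}\\ -J_2^\top\\ \widetilde{J}\end{bmatrix}[\boldsymbol{\Sigma}\ \ \mathsf{O}_m]\right)+\Xi\oplus J_1 .$$ Then the error dynamics (E) of the context with supply rate function $\mathsf{s}$ is dissipative, and the trivial solution of (E) with $\boldsymbol{w}(t)\equiv\mathbf{0}_q$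 is exponentially stable for any initial function $\boldsymbol{\psi}\in C(\mathcal{J};\mathbb{R}^n)$. Finally, the number of unknowns in these constraints is $(0.5d^2+0.5d+\nu+1)n^2+(0.5d+1+\beta l)n+\beta lm\in\mathcal{O}(d^2n^2)$.
   Context: **Notation.** $\mathbb{N}_\nu=\{1,\dots,\nu\}$; $\mathbb{S}^n$: real symmetric $n\times n$ matrices; $\succ0,\prec0,\preceq 0$: definiteness; $\mathsf{Sy}(X)=X+X^\top$; $\mathsf{O}_{n,m}$: $n\times m$ zero matrix, $\mathsf{O}_n=\mathsf{O}_{n,n}$, $\mathbf{0}_n=\mathsf{O}_{n,1}$; $X\oplus Y$: block diagonal matrix with (possibly rectangular) diagonal blocks $X,Y$; $\mathrm{diag}_{i=1}^\nu X_i=X_1\oplus\cdots\oplus X_\nu$; $[X_i]_{i=1}^\nu$: vertical stacking of $X_1,\dots,X_\nu$; $[\![X_i]\!]_{i=1}^\nu=[X_1\ \cdots\ X_\nu]$: horizontal concatenation; $\otimes$: Kronecker product; $\sqrt{X}$: the positive definite square root of $X\succ0$. Blocks with a zero dimension are empty and absent. **Data.** $n,m,q,l,\nu\in\mathbb{N}$; known delays $0=r_0<r_1<\dots<r_\nu=r$; $\mathcal{J}=[-r,0]$; $\mathcal{I}_i=[-r_i,-r_{i-1}]$. Matrices $A_i\in\mathbb{R}^{n\times n}$, $C_i\in\mathbb{R}^{m\times n}$ ($0\le i\le\nu$), $D_1,D_3\in\mathbb{R}^{n\times q}$, $D_2,D_4\in\mathbb{R}^{m\times q}$, $\mathfrak{C}\in\mathbb{R}^{l\times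 n}$. For $i\in\mathbb{N}_\nu$: $d_i\in\mathbb{N}$, $\delta_i,\mu_i\in\mathbb{N}\cup\{0\}$, $\varkappa_i=d_i+\delta_i$, $\kappa_i=d_i+\delta_i+\mu_i$, $d=\sum d_i$, $\varkappa=\sum\varkappa_i$, $\mu=\sum\mu_i$, $\kappa=\sum\kappa_i=\varkappa+\mu$, $\beta=1+\nu+\kappa$. Functions $\boldsymbol{f}_i\in H^1(\mathcal{I}_i;\mathbb{R}^{d_i})$ (identified with their continuous representatives), $\boldsymbol{\varphi}_i\in L^2(\mathcal{I}_i;\mathbb{R}^{\delta_i})$, $\boldsymbol{\phi}_i\in L^2(\mathcal{I}_i;\mathbb{R}^{\mu_i})$, and $M_i\in\mathbb{R}^{d_i\times\varkappa_i}$ satisfy, with $\boldsymbol{h}_i=\begin{bmatrix}\boldsymbol{\varphi}_i\\ \boldsymbol{f}_i\end{bmatrix}$ and $\boldsymbol{g}_i=\begin{bmatrix}\boldsymbol{\phi}_i\\ \boldsymbol{h}_i\end{bmatrix}$, $$\boldsymbol{f}_i'(\tau)=M_i\boldsymbol{h}_i(\tau)\ \text{(weak derivative)},\qquad \int_{\mathcal{I}_i}\boldsymbol{g}_i(\tau)\boldsymbol{g}_i^\top(\tau)\,\mathrm{d}\tau\succ0 .$$ Matrices $\widehat{A}_i\in\mathbb{R}^{n\times\kappa_in}$, $\widehat{C}_i\in\mathbb{R}^{m\times\kappa_in}$ are given (the distributed-delay kernels of the plant being $\widehat{A}_i(\boldsymbol{g}_i(\tau)\otimes I_n)$ and $\widehat{C}_i(\boldsymbol{g}_i(\tau)\otimes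 I_n)$ on $\mathcal{I}_i$). Define $$\mathfrak{F}_i=\int_{\mathcal{I}_i}\boldsymbol{f}_i\boldsymbol{f}_i^\top\mathrm{d}\tau,\quad \mathfrak{H}_i=\int_{\mathcal{I}_i}\boldsymbol{h}_i\boldsymbol{h}_i^\top\mathrm{d}\tau,\quad \Gamma_i=\int_{\mathcal{I}_i}\boldsymbol{\phi}_i\boldsymbol{h}_i^\top\mathrm{d}\tau,$$ $$\boldsymbol{\varepsilon}_i=\boldsymbol{\phi}_i-\Gamma_i\mathfrak{H}_i^{-1}\boldsymbol{h}_i,\quad \mathfrak{E}_i=\int_{\mathcal{I}_i}\boldsymbol{\varepsilon}_i\boldsymbol{\varepsilon}_i^\top\mathrm{d}\tau,$$ (all of $\mathfrak{F}_i,\mathfrak{H}_i,\mathfrak{E}_i$ are positive definite), and $$T_i=\begin{bmatrix}\Gamma_i\sqrt{\mathfrak{H}_i^{-1}}\\ \sqrt{\mathfrak{H}_i}\end{bmatrix}\in\mathbb{R}^{\kappa_i\times\varkappa_i},\qquad \widetilde{T}_i=\begin{bmatrix}\sqrt{\mathfrak{E}_i}\\ \mathsf{O}_{\varkappa_i,\mu_i}\end{bmatrix}\in\mathbb{R}^{\kappa_i\times\mu_i}.$$ **Coefficient matrices.** $$\mathbf{A}=\Big[A_0\ \ [\![A_i]\!]_{i=1}^\nu\ \ [\![\widehat{A}_i(T_i\otimes I_n)]\!]_{i=1}^\nu\ \ [\![\widehat{A}_i(\widetilde{T}_i\otimes I_n)]\!]_{i=1}^\nu\ \ D_1-D_3\Big],$$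 $$\mathbf{C}=\Big[C_0\ \ [\![C_i]\!]_{i=1}^\nu\ \ [\![\widehat{C}_i(T_i\otimes I_n)]\!]_{i=1}^\nu\ \ [\![\widehat{C}_i(\widetilde{T}_i\otimes I_n)]\!]_{i=1}^\nu\ \ D_2-D_4\Big],$$ $$\mathbf{L}_1=\Big[L_0\ \ [\![L_i]\!]_{i=1}^\nu\ \ [\![\widehat{L}_i(T_i\otimes I_l)]\!]_{i=1}^\nu\ \ [\![\widehat{L}_i(\widetilde{T}_i\otimes I_l)]\!]_{i=1}^\nu\ \ \mathsf{O}_{n,q}\Big],$$ $$\mathbf{L}_2=\Big[\mathcal{L}_0\ \ [\![\mathcal{L}_i]\!]_{i=1}^\nu\ \ [\![\widehat{\mathcal{L}}_i(T_i\otimes I_l)]\!]_{i=1}^\nu\ \ [\![\widehat{\mathcal{L}}_i(\widetilde{T}_i\otimes I_l)]\!]_{i=1}^\nu\ \ \mathsf{O}_{m,q}\Big].$$ **Error dynamics (E).** For $t_0\in\mathbb{R}$ and disturbance $\boldsymbol{w}\in L^2([t_0,\infty);\mathbb{R}^q)$, $$\dot{\boldsymbol{e}}(t)=\big(\mathbf{A}+\mathbf{L}_1[(I_\beta\otimes\mathfrak{C})\oplus\mathsf{O}_q]\big)\boldsymbol{\vartheta}(t)\ \text{ for almost all }t\ge t_0,$$ $$\boldsymbol{\zeta}(t)=\big(\mathbf{C}+\mathbf{L}_2[(I_\beta\otimes\mathfrak{C})\oplus\mathsf{O}_q]\big)\boldsymbol{\vartheta}(t),\qquad \boldsymbol{e}(t_0+\theta)=\boldsymbol{\psi}(\theta)\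 (\theta\in\mathcal{J}),\ \boldsymbol{\psi}\in C(\mathcal{J};\mathbb{R}^n),$$ with solutions in the Carathéodory sense, where $\boldsymbol{\vartheta}(t)$ is the vertical stacking of $\boldsymbol{e}(t)$, $[\boldsymbol{e}(t-r_i)]_{i=1}^\nu$, $\boldsymbol{\xi}(t)$, $\mathfrak{a}(t)$, $\boldsymbol{w}(t)$, with $$\boldsymbol{\xi}(t)=\Big[\int_{\mathcal{I}_i}\big(\sqrt{\mathfrak{H}_i^{-1}}\boldsymbol{h}_i(\tau)\otimes I_n\big)\boldsymbol{e}(t+\tau)\mathrm{d}\tau\Big]_{i=1}^\nu,\quad \mathfrak{a}(t)=\Big[\int_{\mathcal{I}_i}\big(\sqrt{\mathfrak{E}_i^{-1}}\boldsymbol{\varepsilon}_i(\tau)\otimes I_n\big)\boldsymbol{e}(t+\tau)\mathrm{d}\tau\Big]_{i=1}^\nu .$$ **Supply rate function.** $$\mathsf{s}(\boldsymbol{\zeta},\boldsymbol{w})=\begin{bmatrix}\boldsymbol{\zeta}\\ \boldsymbol{w}\end{bmatrix}^\top\begin{bmatrix}\widetilde{J}^\top J_1^{-1}\widetilde{J}&J_2\\ J_2^\top&J_3\end{bmatrix}\begin{bmatrix}\boldsymbol{\zeta}\\ \boldsymbol{w}\end{bmatrix},$$ where $J_1\in\mathbb{S}^m$, $J_1^{-1}\prec0$, $\widetilde{J}\in\mathbb{R}^{m\times m}$, $\widetilde{J}^\top J_1^{-1}\widetilde{J}\preceq0$, $J_2\in\mathbb{R}^{m\times q}$, $J_3\in\mathbb{S}^q$,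 with $\widetilde{J},J_2$ known. **Dissipativity.** (E) with supply rate $\mathsf{s}$ is dissipative if there is a differentiable functional $\mathsf{v}:C(\mathcal{J};\mathbb{R}^n)\to\mathbb{R}$ such that for almost all $t\ge t_0$, $\frac{\mathrm{d}}{\mathrm{d}t}\mathsf{v}(\boldsymbol{e}_t(\cdot))-\mathsf{s}(\boldsymbol{\zeta}(t),\boldsymbol{w}(t))\le0$ along (E), where $\boldsymbol{e}_t(\theta)=\boldsymbol{e}(t+\theta)$ for $\theta\in\mathcal{J}$.
   Formalization: The printed number of unknowns is false (n=d=ν=1 gives a non-integer, 4.5 instead of 5 besides the gains); the formal statement proves the corrected count (0.5d²+d+ν+0.5)n²+(0.5d+0.5+ν+βl)n+βlm, still in O(d²n²). *)

theory Defs
  imports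
    "HOL-Analysis.Analysis"
    "HOL-Library.Landau_Symbols"
    "Jordan_Normal_Form.Gauss_Jordan_Elimination"
begin

unbundle no vec_syntax
unbundle no inner_syntax

abbreviation transp :: "real mat \<Rightarrow> real mat" (\<open>(_\<^sup>\<top>)\<close> [1000] 999)
  where "A\<^sup>\<top> \<equiv> transpose_mat A"

abbreviation col_mat :: "real vec \<Rightarrow> real mat"
  where "col_mat v \<equiv> mat_of_cols (dim_vec v) [v]"

definition append_cols :: "real mat \<Rightarrow> real mat \<Rightarrow> real mat" (infixr \<open>@\<^sub>c\<close> 66)
  where "A @\<^sub>c B = four_block_mat A B (0\<^sub>m 0 (dim_col A)) (0\<^sub>m 0 (dim_col B))"

definition hconcat :: "nat \<Rightarrow> real mat list \<Rightarrow> real mat"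
  where "hconcat nr Xs = foldr (@\<^sub>c) Xs (0\<^sub>m nr 0)"

definition vconcat :: "real vec list \<Rightarrow> real vec"
  where "vconcat vs = foldr (@\<^sub>v) vs (0\<^sub>v 0)"

definition kron :: "real mat \<Rightarrow> real mat \<Rightarrow> real mat" (infixl \<open>\<otimes>\<^sub>K\<close> 75)
  where "A \<otimes>\<^sub>K B = mat (dim_row A * dim_row B) (dim_col A * dim_col B)
    (\<lambda>(i, j). A $$ (i div dim_row B, j div dim_col B) * B $$ (i mod dim_row B, j mod dim_col B))"

definition Sy :: "real mat \<Rightarrow> real mat"
  where "Sy X = X + X\<^sup>\<top>"

definition sym_mats :: "nat \<Rightarrow> real mat set"
  where "sym_mats k = {X \<in> carrier_mat k k. X\<^sup>\<top> = X}"

definition pos_def :: "real mat \<Rightarrow> bool"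
  where "pos_def X \<longleftrightarrow> X \<in> sym_mats (dim_row X) \<and>
    (\<forall>x \<in> carrier_vec (dim_row X). x \<noteq> 0\<^sub>v (dim_row X) \<longrightarrow> x \<bullet> (X *\<^sub>v x) > 0)"

definition neg_def :: "real mat \<Rightarrow> bool"
  where "neg_def X \<longleftrightarrow> X \<in> sym_mats (dim_row X) \<and>
    (\<forall>x \<in> carrier_vec (dim_row X). x \<noteq> 0\<^sub>v (dim_row X) \<longrightarrow> x \<bullet> (X *\<^sub>v x) < 0)"

definition neg_semidef :: "real mat \<Rightarrow> bool"
  where "neg_semidef X \<longleftrightarrow> X \<in> sym_mats (dim_row X) \<and>
    (\<forall>x \<in> carrier_vec (dim_row X). x \<bullet> (X *\<^sub>v x) \<le> 0)"

text \<open>Only meaningful for invertible matrices.\<close>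

abbreviation mat_inv :: "real mat \<Rightarrow> real mat"
  where "mat_inv X \<equiv> the (mat_inverse X)"

definition mat_sqrt :: "real mat \<Rightarrow> real mat"
  where "mat_sqrt X = (THE Y. pos_def Y \<and> Y * Y = X)"

definition vnorm :: "real vec \<Rightarrow> real"
  where "vnorm v = sqrt (v \<bullet> v)"

definition mat_integral :: "real set \<Rightarrow> nat \<Rightarrow> nat \<Rightarrow> (real \<Rightarrow> real mat) \<Rightarrow> real mat"
  where "mat_integral X nr nc F = mat nr nc (\<lambda>(a, b). LINT \<tau>|lebesgue_on X. F \<tau> $$ (a, b))"

definition vec_integral :: "real set \<Rightarrow> nat \<Rightarrow> (real \<Rightarrow> real vec) \<Rightarrow> real vec"
  where "vec_integral X k F = vec k (\<lambda>a. LINT \<tau>|lebesgue_on X. F \<tau> $ a)"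

definition L2_on :: "real set \<Rightarrow> nat \<Rightarrow> (real \<Rightarrow> real vec) \<Rightarrow> bool"
  where "L2_on X k u \<longleftrightarrow> (\<forall>t\<in>X. u t \<in> carrier_vec k) \<and>
    (\<forall>j<k. (\<lambda>t. u t $ j) \<in> borel_measurable (lebesgue_on X) \<and>
           integrable (lebesgue_on X) (\<lambda>t. (u t $ j)\<^sup>2))"

definition test_fun :: "real set \<Rightarrow> (real \<Rightarrow> real) \<Rightarrow> bool"
  where "test_fun X \<eta> \<longleftrightarrow> (\<forall>k x. (deriv ^^ k) \<eta> differentiable (at x)) \<and>
    (\<exists>K. compact K \<and> K \<subseteq> interior X \<and> (\<forall>x. x \<notin> K \<longrightarrow> \<eta> x = 0))"

definition weak_deriv_on :: "real set \<Rightarrow> nat \<Rightarrow> (real \<Rightarrow> real vec) \<Rightarrow> (real \<Rightarrow> real vec) \<Rightarrow> bool"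
  where "weak_deriv_on X k u u' \<longleftrightarrow> (\<forall>\<eta>. test_fun X \<eta> \<longrightarrow> (\<forall>j<k.
    (LINT \<tau>|lebesgue_on X. u \<tau> $ j * deriv \<eta> \<tau>) = - (LINT \<tau>|lebesgue_on X. u' \<tau> $ j * \<eta> \<tau>)))"

text \<open>Continuity selects the continuous representative of the Sobolev class.\<close>

definition H1_on :: "real set \<Rightarrow> nat \<Rightarrow> (real \<Rightarrow> real vec) \<Rightarrow> bool"
  where "H1_on X k u \<longleftrightarrow> L2_on X k u \<and> (\<forall>j<k. continuous_on X (\<lambda>t. u t $ j)) \<and>
    (\<exists>u'. L2_on X k u' \<and> weak_deriv_on X k u u')"

definition abs_continuous_on_Icc :: "real \<Rightarrow> real \<Rightarrow> (real \<Rightarrow> real) \<Rightarrow> bool"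
  where "abs_continuous_on_Icc a b u \<longleftrightarrow> (\<forall>\<epsilon>>0. \<exists>\<delta>>0. \<forall>(N::nat) x y.
    (\<forall>k<N. a \<le> x k \<and> x k \<le> y k \<and> y k \<le> b) \<and>
    disjoint_family_on (\<lambda>k. {x k<..<y k}) {..<N} \<and> (\<Sum>k<N. y k - x k) < \<delta> \<longrightarrow>
    (\<Sum>k<N. \<bar>u (y k) - u (x k)\<bar>) < \<epsilon>)"

text \<open>
  Families over the delay intervals are indexed by \<open>1, \<dots>, \<nu>\<close>, except that \<open>delay\<close>, \<open>pA\<close>, \<open>pC\<close>
  also have an entry \<open>0\<close>. Throughout, \<open>n = dim_n S\<close>, \<open>m = dim_m S\<close>, \<open>q = dim_q S\<close>,
  \<open>l = dim_l S\<close>, \<open>\<nu> = num_delays S\<close>, \<open>r\<^sub>i = delay S i\<close>; \<open>d_of\<close>, \<open>del_of\<close>, \<open>mu_of\<close> are the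
  dimensions \<open>d\<^sub>i\<close>, \<open>\<delta>\<^sub>i\<close>, \<open>\<mu>\<^sub>i\<close> of \<open>fun_f\<close>, \<open>fun_varphi\<close>, \<open>fun_phi\<close>, \<open>varkap\<close> stands
  for \<open>d\<^sub>i + \<delta>\<^sub>i\<close> and \<open>kap\<close> for \<open>d\<^sub>i + \<delta>\<^sub>i + \<mu>\<^sub>i\<close>. The matrix \<open>pObs\<close> is the \<open>l \<times> n\<close> measurement
  matrix (fraktur C). Dimensions \<open>\<delta>\<^sub>i = 0\<close> or \<open>\<mu>\<^sub>i = 0\<close> are allowed; the blocks concerned are then
  matrices with no rows or no columns, which the concatenations below absorb.
\<close>

record plant =
  dim_n :: nat
  dim_m :: nat
  dim_q :: nat
  dim_l :: nat
  num_delays :: nat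
  delay :: "nat \<Rightarrow> real"
  pA :: "nat \<Rightarrow> real mat"
  pC :: "nat \<Rightarrow> real mat"
  pAhat :: "nat \<Rightarrow> real mat"
  pChat :: "nat \<Rightarrow> real mat"
  pD1 :: "real mat"
  pD2 :: "real mat"
  pD3 :: "real mat"
  pD4 :: "real mat"
  pObs :: "real mat"
  d_of :: "nat \<Rightarrow> nat"
  del_of :: "nat \<Rightarrow> nat"
  mu_of :: "nat \<Rightarrow> nat"
  fun_f :: "nat \<Rightarrow> real \<Rightarrow> real vec"
  fun_varphi :: "nat \<Rightarrow> real \<Rightarrow> real vec"
  fun_phi :: "nat \<Rightarrow> real \<Rightarrow> real vec"
  pM :: "nat \<Rightarrow> real mat"

text \<open>Estimator gains \<open>L\<^sub>0, L\<^sub>i\<close>, \<open>L^\<^sub>i\<close> (state) and their calligraphic counterparts (output).\<close>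

record gains =
  gL :: "nat \<Rightarrow> real mat"
  gLhat :: "nat \<Rightarrow> real mat"
  gK :: "nat \<Rightarrow> real mat"
  gKhat :: "nat \<Rightarrow> real mat"

record supply_rate =
  sJ1 :: "real mat"
  sJt :: "real mat"
  sJ2 :: "real mat"
  sJ3 :: "real mat"

abbreviation idx :: "plant \<Rightarrow> nat list"
  where "idx S \<equiv> [1..<Suc (num_delays S)]"

definition varkap_of :: "plant \<Rightarrow> nat \<Rightarrow> nat"
  where "varkap_of S i = d_of S i + del_of S i"

definition kap_of :: "plant \<Rightarrow> nat \<Rightarrow> nat"
  where "kap_of S i = d_of S i + del_of S i + mu_of S i"

definition d_tot :: "plant \<Rightarrow> nat" where "d_tot S = (\<Sum>i=1..num_delays S. d_of S i)"
definition varkap_tot :: "plant \<Rightarrow> nat" where "varkap_tot S = (\<Sum>i=1..num_delays S. varkap_of S i)"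
definition mu_tot :: "plant \<Rightarrow> nat" where "mu_tot S = (\<Sum>i=1..num_delays S. mu_of S i)"
definition kap_tot :: "plant \<Rightarrow> nat" where "kap_tot S = (\<Sum>i=1..num_delays S. kap_of S i)"
definition beta :: "plant \<Rightarrow> nat" where "beta S = 1 + num_delays S + kap_tot S"

definition r_max :: "plant \<Rightarrow> real" where "r_max S = delay S (num_delays S)"

definition Jint :: "plant \<Rightarrow> real set" where "Jint S = {- r_max S..0}"
definition Iint :: "plant \<Rightarrow> nat \<Rightarrow> real set" where "Iint S i = {- delay S i..- delay S (i - 1)}"

definition fun_h :: "plant \<Rightarrow> nat \<Rightarrow> real \<Rightarrow> real vec"
  where "fun_h S i \<tau> = fun_varphi S i \<tau> @\<^sub>v fun_f S i \<tau>"

definition fun_g :: "plant \<Rightarrow> nat \<Rightarrow> real \<Rightarrow> real vec"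
  where "fun_g S i \<tau> = fun_phi S i \<tau> @\<^sub>v fun_h S i \<tau>"

definition matG :: "plant \<Rightarrow> nat \<Rightarrow> real mat"
  where "matG S i = mat_integral (Iint S i) (kap_of S i) (kap_of S i)
    (\<lambda>\<tau>. col_mat (fun_g S i \<tau>) * (col_mat (fun_g S i \<tau>))\<^sup>\<top>)"

definition matF :: "plant \<Rightarrow> nat \<Rightarrow> real mat"
  where "matF S i = mat_integral (Iint S i) (d_of S i) (d_of S i)
    (\<lambda>\<tau>. col_mat (fun_f S i \<tau>) * (col_mat (fun_f S i \<tau>))\<^sup>\<top>)"

definition matH :: "plant \<Rightarrow> nat \<Rightarrow> real mat"
  where "matH S i = mat_integral (Iint S i) (varkap_of S i) (varkap_of S i)
    (\<lambda>\<tau>. col_mat (fun_h S i \<tau>) * (col_mat (fun_h S i \<tau>))\<^sup>\<top>)"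

definition matGamma :: "plant \<Rightarrow> nat \<Rightarrow> real mat"
  where "matGamma S i = mat_integral (Iint S i) (mu_of S i) (varkap_of S i)
    (\<lambda>\<tau>. col_mat (fun_phi S i \<tau>) * (col_mat (fun_h S i \<tau>))\<^sup>\<top>)"

definition fun_eps :: "plant \<Rightarrow> nat \<Rightarrow> real \<Rightarrow> real vec"
  where "fun_eps S i \<tau> = fun_phi S i \<tau> - (matGamma S i * mat_inv (matH S i)) *\<^sub>v fun_h S i \<tau>"

definition matE :: "plant \<Rightarrow> nat \<Rightarrow> real mat"
  where "matE S i = mat_integral (Iint S i) (mu_of S i) (mu_of S i)
    (\<lambda>\<tau>. col_mat (fun_eps S i \<tau>) * (col_mat (fun_eps S i \<tau>))\<^sup>\<top>)"

definition matT :: "plant \<Rightarrow> nat \<Rightarrow> real mat"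
  where "matT S i = (matGamma S i * mat_sqrt (mat_inv (matH S i))) @\<^sub>r mat_sqrt (matH S i)"

definition matTt :: "plant \<Rightarrow> nat \<Rightarrow> real mat"
  where "matTt S i = mat_sqrt (matE S i) @\<^sub>r 0\<^sub>m (varkap_of S i) (mu_of S i)"

definition admissible_plant :: "plant \<Rightarrow> bool"
  where "admissible_plant S \<longleftrightarrow>
    dim_n S \<ge> 1 \<and> dim_m S \<ge> 1 \<and> dim_q S \<ge> 1 \<and> dim_l S \<ge> 1 \<and> num_delays S \<ge> 1 \<and>
    delay S 0 = 0 \<and> (\<forall>i\<in>{1..num_delays S}. delay S (i - 1) < delay S i) \<and>
    (\<forall>i\<in>{0..num_delays S}.
       pA S i \<in> carrier_mat (dim_n S) (dim_n S) \<and> pC S i \<in> carrier_mat (dim_m S) (dim_n S)) \<and>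
    pD1 S \<in> carrier_mat (dim_n S) (dim_q S) \<and> pD3 S \<in> carrier_mat (dim_n S) (dim_q S) \<and>
    pD2 S \<in> carrier_mat (dim_m S) (dim_q S) \<and> pD4 S \<in> carrier_mat (dim_m S) (dim_q S) \<and>
    pObs S \<in> carrier_mat (dim_l S) (dim_n S) \<and>
    (\<forall>i\<in>{1..num_delays S}.
       d_of S i \<ge> 1 \<and>
       pAhat S i \<in> carrier_mat (dim_n S) (kap_of S i * dim_n S) \<and>
       pChat S i \<in> carrier_mat (dim_m S) (kap_of S i * dim_n S) \<and>
       pM S i \<in> carrier_mat (d_of S i) (varkap_of S i) \<and>
       H1_on (Iint S i) (d_of S i) (fun_f S i) \<and>
       L2_on (Iint S i) (del_of S i) (fun_varphi S i) \<and>
       L2_on (Iint S i) (mu_of S i) (fun_phi S i) \<and>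
       weak_deriv_on (Iint S i) (d_of S i) (fun_f S i) (\<lambda>\<tau>. pM S i *\<^sub>v fun_h S i \<tau>) \<and>
       pos_def (matG S i))"

definition admissible_gains :: "plant \<Rightarrow> gains \<Rightarrow> bool"
  where "admissible_gains S G \<longleftrightarrow>
    (\<forall>i\<in>{0..num_delays S}.
       gL G i \<in> carrier_mat (dim_n S) (dim_l S) \<and> gK G i \<in> carrier_mat (dim_m S) (dim_l S)) \<and>
    (\<forall>i\<in>{1..num_delays S}.
       gLhat G i \<in> carrier_mat (dim_n S) (kap_of S i * dim_l S) \<and>
       gKhat G i \<in> carrier_mat (dim_m S) (kap_of S i * dim_l S))"

definition admissible_supply :: "plant \<Rightarrow> supply_rate \<Rightarrow> bool"
  where "admissible_supply S J \<longleftrightarrow>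
    sJ1 J \<in> sym_mats (dim_m S) \<and> invertible_mat (sJ1 J) \<and> neg_def (mat_inv (sJ1 J)) \<and>
    sJt J \<in> carrier_mat (dim_m S) (dim_m S) \<and>
    neg_semidef ((sJt J)\<^sup>\<top> * mat_inv (sJ1 J) * sJt J) \<and>
    sJ2 J \<in> carrier_mat (dim_m S) (dim_q S) \<and> sJ3 J \<in> sym_mats (dim_q S)"

definition supply_fun :: "supply_rate \<Rightarrow> real vec \<Rightarrow> real vec \<Rightarrow> real"
  where "supply_fun J z w = (z @\<^sub>v w) \<bullet>
    (four_block_mat ((sJt J)\<^sup>\<top> * mat_inv (sJ1 J) * sJt J) (sJ2 J) ((sJ2 J)\<^sup>\<top>) (sJ3 J) *\<^sub>v (z @\<^sub>v w))"

definition coeff_row :: "plant \<Rightarrow> nat \<Rightarrow> nat \<Rightarrow> (nat \<Rightarrow> real mat) \<Rightarrow> (nat \<Rightarrow> real mat) \<Rightarrow> real mat \<Rightarrow> real mat"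
  where "coeff_row S nr k X Xhat D =
    X 0 @\<^sub>c hconcat nr (map X (idx S))
        @\<^sub>c hconcat nr (map (\<lambda>i. Xhat i * (matT S i \<otimes>\<^sub>K 1\<^sub>m k)) (idx S))
        @\<^sub>c hconcat nr (map (\<lambda>i. Xhat i * (matTt S i \<otimes>\<^sub>K 1\<^sub>m k)) (idx S))
        @\<^sub>c D"

definition boldA :: "plant \<Rightarrow> real mat"
  where "boldA S = coeff_row S (dim_n S) (dim_n S) (pA S) (pAhat S) (pD1 S - pD3 S)"

definition boldC :: "plant \<Rightarrow> real mat"
  where "boldC S = coeff_row S (dim_m S) (dim_n S) (pC S) (pChat S) (pD2 S - pD4 S)"

definition boldL1 :: "plant \<Rightarrow> gains \<Rightarrow> real mat"
  where "boldL1 S G = coeff_row S (dim_n S) (dim_l S) (gL G) (gLhat G) (0\<^sub>m (dim_n S) (dim_q S))"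

definition boldL2 :: "plant \<Rightarrow> gains \<Rightarrow> real mat"
  where "boldL2 S G = coeff_row S (dim_m S) (dim_l S) (gK G) (gKhat G) (0\<^sub>m (dim_m S) (dim_q S))"

definition obs_map :: "plant \<Rightarrow> real mat"
  where "obs_map S = diag_block_mat [1\<^sub>m (beta S) \<otimes>\<^sub>K pObs S, 0\<^sub>m (dim_q S) (dim_q S)]"

definition Omega :: "plant \<Rightarrow> gains \<Rightarrow> real mat"
  where "Omega S G = boldA S + boldL1 S G * obs_map S"

definition Sigma_mat :: "plant \<Rightarrow> gains \<Rightarrow> real mat"
  where "Sigma_mat S G = boldC S + boldL2 S G * obs_map S"

text \<open>\<open>C(J; R\<^sup>n)\<close> consists of functions that are \<open>undefined\<close> off \<open>J\<close>, so that a functional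
  on it depends on the values on \<open>J\<close> only.\<close>

definition C_space :: "plant \<Rightarrow> (real \<Rightarrow> real vec) set"
  where "C_space S = {\<psi> \<in> Jint S \<rightarrow>\<^sub>E carrier_vec (dim_n S).
    \<forall>k<dim_n S. continuous_on (Jint S) (\<lambda>\<theta>. \<psi> \<theta> $ k)}"

definition C_norm :: "plant \<Rightarrow> (real \<Rightarrow> real vec) \<Rightarrow> real"
  where "C_norm S \<psi> = (SUP \<theta>\<in>Jint S. vnorm (\<psi> \<theta>))"

definition C_plus :: "plant \<Rightarrow> (real \<Rightarrow> real vec) \<Rightarrow> (real \<Rightarrow> real vec) \<Rightarrow> (real \<Rightarrow> real vec)"
  where "C_plus S \<psi> \<eta> = restrict (\<lambda>\<theta>. \<psi> \<theta> + \<eta> \<theta>) (Jint S)"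

definition C_scale :: "plant \<Rightarrow> real \<Rightarrow> (real \<Rightarrow> real vec) \<Rightarrow> (real \<Rightarrow> real vec)"
  where "C_scale S c \<psi> = restrict (\<lambda>\<theta>. c \<cdot>\<^sub>v \<psi> \<theta>) (Jint S)"

text \<open>Differentiability of a functional is taken in the sense of Frechet, with respect to the
  supremum norm; \<open>D\<close> is the derivative, a bounded linear functional on \<open>C(J; R\<^sup>n)\<close>.\<close>

definition differentiable_functional :: "plant \<Rightarrow> ((real \<Rightarrow> real vec) \<Rightarrow> real) \<Rightarrow> bool"
  where "differentiable_functional S v \<longleftrightarrow> (\<forall>\<psi>\<in>C_space S. \<exists>D.
    (\<forall>\<eta>\<in>C_space S. \<forall>\<chi>\<in>C_space S. D (C_plus S \<eta> \<chi>) = D \<eta> + D \<chi>) \<and>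
    (\<forall>c. \<forall>\<eta>\<in>C_space S. D (C_scale S c \<eta>) = c * D \<eta>) \<and>
    (\<exists>B. \<forall>\<eta>\<in>C_space S. \<bar>D \<eta>\<bar> \<le> B * C_norm S \<eta>) \<and>
    (\<forall>\<epsilon>>0. \<exists>\<delta>>0. \<forall>\<eta>\<in>C_space S. C_norm S \<eta> < \<delta> \<longrightarrow>
       \<bar>v (C_plus S \<psi> \<eta>) - v \<psi> - D \<eta>\<bar> \<le> \<epsilon> * C_norm S \<eta>))"

definition xi :: "plant \<Rightarrow> (real \<Rightarrow> real vec) \<Rightarrow> real \<Rightarrow> real vec"
  where "xi S e t = vconcat (map (\<lambda>i. vec_integral (Iint S i) (varkap_of S i * dim_n S)
    (\<lambda>\<tau>. (col_mat (mat_sqrt (mat_inv (matH S i)) *\<^sub>v fun_h S i \<tau>) \<otimes>\<^sub>K 1\<^sub>m (dim_n S)) *\<^sub>v e (t + \<tau>))) (idx S))"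

definition afrak :: "plant \<Rightarrow> (real \<Rightarrow> real vec) \<Rightarrow> real \<Rightarrow> real vec"
  where "afrak S e t = vconcat (map (\<lambda>i. vec_integral (Iint S i) (mu_of S i * dim_n S)
    (\<lambda>\<tau>. (col_mat (mat_sqrt (mat_inv (matE S i)) *\<^sub>v fun_eps S i \<tau>) \<otimes>\<^sub>K 1\<^sub>m (dim_n S)) *\<^sub>v e (t + \<tau>))) (idx S))"

definition vartheta :: "plant \<Rightarrow> (real \<Rightarrow> real vec) \<Rightarrow> (real \<Rightarrow> real vec) \<Rightarrow> real \<Rightarrow> real vec"
  where "vartheta S e w t =
    e t @\<^sub>v vconcat (map (\<lambda>i. e (t - delay S i)) (idx S)) @\<^sub>v xi S e t @\<^sub>v afrak S e t @\<^sub>v w t"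

text \<open>Solutions in the sense of Caratheodory. \<open>vartheta S e w t\<close> for \<open>t \<ge> t0\<close> only involves
  values of \<open>e\<close> on \<open>[t0 - r, \<infinity>)\<close>, so \<open>e\<close> is unconstrained to the left of that.\<close>

definition is_solution ::
  "plant \<Rightarrow> gains \<Rightarrow> real \<Rightarrow> (real \<Rightarrow> real vec) \<Rightarrow> (real \<Rightarrow> real vec) \<Rightarrow> (real \<Rightarrow> real vec) \<Rightarrow> bool"
  where "is_solution S G t0 \<psi> w e \<longleftrightarrow>
    \<psi> \<in> C_space S \<and> L2_on {t0..} (dim_q S) w \<and>
    (\<forall>\<theta>\<in>Jint S. e (t0 + \<theta>) = \<psi> \<theta>) \<and>
    (\<forall>t\<ge>t0. e t \<in> carrier_vec (dim_n S)) \<and>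
    (\<forall>k<dim_n S. \<forall>T\<ge>t0. abs_continuous_on_Icc t0 T (\<lambda>t. e t $ k)) \<and>
    (AE t in lebesgue_on {t0..}. \<forall>k<dim_n S.
       ((\<lambda>s. e s $ k) has_real_derivative (Omega S G *\<^sub>v vartheta S e w t) $ k) (at t))"

definition zeta :: "plant \<Rightarrow> gains \<Rightarrow> (real \<Rightarrow> real vec) \<Rightarrow> (real \<Rightarrow> real vec) \<Rightarrow> real \<Rightarrow> real vec"
  where "zeta S G e w t = Sigma_mat S G *\<^sub>v vartheta S e w t"

definition segment :: "plant \<Rightarrow> (real \<Rightarrow> real vec) \<Rightarrow> real \<Rightarrow> (real \<Rightarrow> real vec)"
  where "segment S e t = restrict (\<lambda>\<theta>. e (t + \<theta>)) (Jint S)"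

definition dissipative :: "plant \<Rightarrow> gains \<Rightarrow> (real vec \<Rightarrow> real vec \<Rightarrow> real) \<Rightarrow> bool"
  where "dissipative S G s \<longleftrightarrow> (\<exists>v. differentiable_functional S v \<and>
    (\<forall>t0 \<psi> w e. is_solution S G t0 \<psi> w e \<longrightarrow>
      (AE t in lebesgue_on {t0..}. \<exists>v'.
         ((\<lambda>\<tau>. v (segment S e \<tau>)) has_real_derivative v') (at t) \<and>
         v' - s (zeta S G e w t) (w t) \<le> 0)))"

definition exponentially_stable :: "plant \<Rightarrow> gains \<Rightarrow> bool"
  where "exponentially_stable S G \<longleftrightarrow> (\<exists>\<alpha>>0. \<exists>K>0. \<forall>t0 \<psi> e.
    is_solution S G t0 \<psi> (\<lambda>_. 0\<^sub>v (dim_q S)) e \<longrightarrow>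
    (\<forall>t\<ge>t0. vnorm (e t) \<le> K * exp (- \<alpha> * (t - t0)) * C_norm S \<psi>))"

definition diag_idx :: "plant \<Rightarrow> (nat \<Rightarrow> real mat) \<Rightarrow> real mat"
  where "diag_idx S X = diag_block_mat (map X (idx S))"

definition boldI :: "plant \<Rightarrow> real mat"
  where "boldI S = diag_idx S (\<lambda>i. mat_sqrt (mat_inv (matF S i)) *
      (0\<^sub>m (d_of S i) (del_of S i) @\<^sub>c 1\<^sub>m (d_of S i)) * mat_sqrt (matH S i)) \<otimes>\<^sub>K 1\<^sub>m (dim_n S)"

definition Lambda :: "plant \<Rightarrow> real mat"
  where "Lambda S = diag_idx S (\<lambda>i. (delay S i - delay S (i - 1)) \<cdot>\<^sub>m 1\<^sub>m (dim_n S))"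

definition boldM :: "plant \<Rightarrow> real mat"
  where "boldM S =
    (diag_idx S (\<lambda>i. col_mat (mat_sqrt (mat_inv (matF S i)) *\<^sub>v fun_f S i (- delay S (i - 1))))
       @\<^sub>c 0\<^sub>m (d_tot S) 1 @\<^sub>c 0\<^sub>m (d_tot S) (varkap_tot S))
    - (0\<^sub>m (d_tot S) 1
       @\<^sub>c diag_idx S (\<lambda>i. col_mat (mat_sqrt (mat_inv (matF S i)) *\<^sub>v fun_f S i (- delay S i)))
       @\<^sub>c diag_idx S (\<lambda>i. mat_sqrt (mat_inv (matF S i)) * pM S i * mat_sqrt (matH S i)))"

definition selS :: "plant \<Rightarrow> real mat"
  where "selS S = (let n = dim_n S; \<nu> = num_delays S; k = varkap_tot S; \<mu> = mu_tot S; q = dim_q S; d = d_tot S in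
    (1\<^sub>m n @\<^sub>c 0\<^sub>m n (\<nu> * n) @\<^sub>c 0\<^sub>m n (k * n) @\<^sub>c 0\<^sub>m n (\<mu> * n) @\<^sub>c 0\<^sub>m n q) @\<^sub>r
    (0\<^sub>m (d * n) n @\<^sub>c 0\<^sub>m (d * n) (\<nu> * n) @\<^sub>c boldI S @\<^sub>c 0\<^sub>m (d * n) (\<mu> * n) @\<^sub>c 0\<^sub>m (d * n) q))"

definition Xi :: "plant \<Rightarrow> supply_rate \<Rightarrow> (nat \<Rightarrow> real mat) \<Rightarrow> (nat \<Rightarrow> real mat) \<Rightarrow> real mat"
  where "Xi S J Q R = (let n = dim_n S; q = dim_q S in
    diag_block_mat [diag_idx S Q + diag_idx S R * Lambda S, 0\<^sub>m n n, 0\<^sub>m (kap_tot S * n) (kap_tot S * n), 0\<^sub>m q q]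
    - diag_block_mat [0\<^sub>m n n, diag_idx S Q, diag_idx S (\<lambda>i. 1\<^sub>m (varkap_of S i) \<otimes>\<^sub>K R i),
        diag_idx S (\<lambda>i. 1\<^sub>m (mu_of S i) \<otimes>\<^sub>K R i), sJ3 J])"

definition Psi :: "plant \<Rightarrow> gains \<Rightarrow> supply_rate \<Rightarrow> (nat \<Rightarrow> real mat) \<Rightarrow> (nat \<Rightarrow> real mat)
    \<Rightarrow> real mat \<Rightarrow> real mat \<Rightarrow> real mat \<Rightarrow> real mat"
  where "Psi S G J Q R P1 P2 P3 = (let n = dim_n S; m = dim_m S; q = dim_q S; d = d_tot S; \<mu> = mu_tot S in
    Sy ((selS S)\<^sup>\<top> * four_block_mat P1 P2 (P2\<^sup>\<top>) P3
          * (Omega S G @\<^sub>r ((boldM S \<otimes>\<^sub>K 1\<^sub>m n) @\<^sub>c 0\<^sub>m (d * n) (\<mu> * n + q)))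
        - (0\<^sub>m (beta S * n) m @\<^sub>r (sJ2 J)\<^sup>\<top>) * Sigma_mat S G)
    + Xi S J Q R)"

definition boldP :: "plant \<Rightarrow> real mat \<Rightarrow> real mat \<Rightarrow> real mat"
  where "boldP S P1 P2 = (let n = dim_n S in
    P1 @\<^sub>c 0\<^sub>m n (num_delays S * n) @\<^sub>c (P2 * boldI S) @\<^sub>c 0\<^sub>m n (mu_tot S * n + dim_q S + dim_m S))"

definition boldPi :: "plant \<Rightarrow> gains \<Rightarrow> real mat"
  where "boldPi S G = Omega S G @\<^sub>c 0\<^sub>m (dim_n S) (dim_m S)"

definition boldPhi :: "plant \<Rightarrow> gains \<Rightarrow> supply_rate \<Rightarrow> (nat \<Rightarrow> real mat) \<Rightarrow> (nat \<Rightarrow> real mat)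
    \<Rightarrow> real mat \<Rightarrow> real mat \<Rightarrow> real mat"
  where "boldPhi S G J Q R P2 P3 =
    (let n = dim_n S; m = dim_m S; q = dim_q S; d = d_tot S; \<nu> = num_delays S; \<mu> = mu_tot S in
    Sy ((P2 @\<^sub>r 0\<^sub>m (\<nu> * n) (d * n) @\<^sub>r ((boldI S)\<^sup>\<top> * P3) @\<^sub>r 0\<^sub>m (\<mu> * n + q + m) (d * n))
          * ((boldM S \<otimes>\<^sub>K 1\<^sub>m n) @\<^sub>c 0\<^sub>m (d * n) (\<mu> * n + q + m))
        + (0\<^sub>m (beta S * n) m @\<^sub>r (- ((sJ2 J)\<^sup>\<top>)) @\<^sub>r sJt J) * (Sigma_mat S G @\<^sub>c 0\<^sub>m m m))
    + diag_block_mat [Xi S J Q R, sJ1 J])"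

datatype unknown_block =
  Blk_L nat | Blk_Lhat nat | Blk_K nat | Blk_Khat nat | Blk_Q nat | Blk_R nat | Blk_P1 | Blk_P2 | Blk_P3

definition unknown_blocks :: "plant \<Rightarrow> unknown_block set"
  where "unknown_blocks S =
    Blk_L ` {0..num_delays S} \<union> Blk_K ` {0..num_delays S} \<union>
    Blk_Lhat ` {1..num_delays S} \<union> Blk_Khat ` {1..num_delays S} \<union>
    Blk_Q ` {1..num_delays S} \<union> Blk_R ` {1..num_delays S} \<union> {Blk_P1, Blk_P2, Blk_P3}"

text \<open>The scalar unknowns in each block: all entries of an unstructured matrix, but only the
  entries on and above the diagonal of a symmetric one.\<close>

fun block_entries :: "plant \<Rightarrow> unknown_block \<Rightarrow> (nat \<times> nat) set"
  where
    "block_entries S (Blk_L i) = {..<dim_n S} \<times> {..<dim_l S}"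
  | "block_entries S (Blk_Lhat i) = {..<dim_n S} \<times> {..<kap_of S i * dim_l S}"
  | "block_entries S (Blk_K i) = {..<dim_m S} \<times> {..<dim_l S}"
  | "block_entries S (Blk_Khat i) = {..<dim_m S} \<times> {..<kap_of S i * dim_l S}"
  | "block_entries S (Blk_Q i) = {(a, b). a \<le> b \<and> b < dim_n S}"
  | "block_entries S (Blk_R i) = {(a, b). a \<le> b \<and> b < dim_n S}"
  | "block_entries S Blk_P1 = {(a, b). a \<le> b \<and> b < dim_n S}"
  | "block_entries S Blk_P2 = {..<dim_n S} \<times> {..<d_tot S * dim_n S}"
  | "block_entries S Blk_P3 = {(a, b). a \<le> b \<and> b < d_tot S * dim_n S}"

definition num_unknowns :: "plant \<Rightarrow> nat"
  where "num_unknowns S = card (SIGMA X:unknown_blocks S. block_entries S X)"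

end

theory Submission
  imports Defs "Jordan_Normal_Form.Spectral_Radius"
begin

text \<open>
  The storage functional is
  \<open>v(e\<^sub>t) = x\<^sup>T P x + \<Sum>\<^sub>i \<integral> e(t + \<tau>)\<^sup>T (Q\<^sub>i + (\<tau> + r\<^sub>i) R\<^sub>i) e(t + \<tau>) d\<tau>\<close>, where \<open>x\<close>
  stacks \<open>e(t)\<close> and the moments of the history against the \<open>L\<^sup>2\<close>-orthonormalised \<open>f\<^sub>i\<close>. Since
  \<open>f\<^sub>i' = M\<^sub>i h\<^sub>i\<close>, the derivative of \<open>x\<close> is linear in \<open>\<theta>\<close>, and the derivative of \<open>v\<close> minus the
  supply is a quadratic form in \<open>\<theta>\<close>, namely the Schur complement of the matrix inequality, minus the
  gaps between \<open>\<integral> e\<^sup>T R\<^sub>i e\<close> and its projections on the orthonormal systems obtained from \<open>h\<^sub>i\<close> and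
  \<open>\<epsilon>\<^sub>i\<close>. These gaps are nonnegative by Bessel's inequality, which gives dissipativity. Bessel's
  inequality for \<open>f\<^sub>i\<close> also turns positivity of the \<open>P\<close>-\<open>Q\<close> matrix into \<open>v \<ge> c |e(t)|\<^sup>2\<close>. As the
  matrix inequality is strict, a multiple of \<open>-|\<theta>|\<^sup>2\<close> is left over; for \<open>w = 0\<close> it yields
  \<open>v' \<le> -2\<alpha>v\<close> and hence exponential decay.
\<close>

text \<open>Regularity is the obstacle. Testing the weak derivative against smooth cut-offs shows
  each component of \<open>f\<close> to be a primitive of a component of \<open>M h\<close>;
  integration by parts over the moving window then gives every moment a derivative at each
  \<open>t > t0\<close> without differentiating \<open>e\<close>. The weight
  \<open>\<tau> + r_i\<close> is chosen so that differentiation produces exactly the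
  \<open>R\<close>-energy from which the Bessel gaps are formed.

  For dissipativity an inequality almost everywhere is enough. For decay it is not, because
  monotonicity does not follow from the sign of an almost everywhere derivative alone. With
  \<open>w = 0\<close> the right-hand side is continuous along a solution, and the fundamental
  theorem for absolutely continuous functions makes the solution classically differentiable after
  \<open>t0\<close>.\<close>

subsection \<open>Absolutely continuous functions\<close>

text \<open>A gauge proof: at a tag outside \<open>N\<close> differentiability makes each increment
  of \<open>f\<close> close to \<open>f'\<close> times the length, while tags in \<open>N\<close>
  force their intervals into an open set of measure below \<open>\<delta>\<close>, where absolute
  continuity bounds the sum of the increments.\<close>

lemma abs_continuous_has_integral:
  fixes f f' :: "real \<Rightarrow> real"
  assumes ac: "abs_continuous_on_Icc a b f" and ab: "a \<le> b" and N: "negligible N"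
    and der: "\<And>x. x \<in> {a..b} - N \<Longrightarrow> (f has_real_derivative f' x) (at x within {a..b})"
  shows "(f' has_integral (f b - f a)) {a..b}"
proof -
  define g where "g x = (if x \<in> N then 0 else f' x)" for x
  have "(g has_integral (f b - f a)) {a..b}"
    unfolding has_integral_real
  proof (intro allI impI)
    fix e :: real assume e: "e > 0"
    \<comment> \<open>The straddle errors add up to at most
      \<open>\<epsilon> * (b - a) < e / 2\<close>; the \<open>+ 1\<close> covers
      \<open>a = b\<close>.\<close>
    define \<epsilon> where "\<epsilon> = e / (2 * (b - a + 1))"
    have \<epsilon>: "\<epsilon> > 0" using e ab by (simp add: \<epsilon>_def)
    have "e / 2 > 0" using e by simp
    from ac[unfolded abs_continuous_on_Icc_def, THEN spec, THEN mp, OF this] obtain \<delta> where \<delta>: "\<delta> > 0"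
      and small: "\<forall>(n::nat) x y. (\<forall>k<n. a \<le> x k \<and> x k \<le> y k \<and> y k \<le> b) \<and>
        disjoint_family_on (\<lambda>k. {x k<..<y k}) {..<n} \<and> (\<Sum>k<n. y k - x k) < \<delta> \<longrightarrow>
        (\<Sum>k<n. \<bar>f (y k) - f (x k)\<bar>) < e / 2"
      by (elim exE conjE)
    have null: "N \<in> null_sets lebesgue" using N by (simp add: negligible_iff_null_sets)
    then have Ns: "N \<in> sets lebesgue" by auto
    obtain T where T: "open T" "N \<subseteq> T" "T - N \<in> lmeasurable" "emeasure lebesgue (T - N) < ennreal \<delta>"
      using sets_lebesgue_outer_open[OF Ns \<delta>] by blast
    have Ts: "T \<in> sets lebesgue" using T(1) by simp
    have emT: "emeasure lebesgue T < ennreal \<delta>"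
      using emeasure_Diff_null_set[OF null Ts] T(4) by simp
    have "\<exists>d>0. \<forall>y\<in>{a..b}. \<bar>y - x\<bar> < d \<longrightarrow> \<bar>f y - f x - f' x * (y - x)\<bar> \<le> \<epsilon> * \<bar>y - x\<bar>"
      if "x \<in> {a..b} - N" for x
    proof -
      have "(f has_derivative (\<lambda>h. f' x * h)) (at x within {a..b})"
        using der[OF that] by (simp add: has_field_derivative_def)
      from this[unfolded has_derivative_within_alt] \<epsilon> show ?thesis by (auto simp: mult.commute)
    qed
    then obtain d where d: "\<And>x. x \<in> {a..b} - N \<Longrightarrow> d x > 0"
      "\<And>x y. x \<in> {a..b} - N \<Longrightarrow> y \<in> {a..b} \<Longrightarrow> \<bar>y - x\<bar> < d x \<Longrightarrow> \<bar>f y - f x - f' x * (y - x)\<bar> \<le> \<epsilon> * \<bar>y - x\<bar>"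
      by metis
    \<comment> \<open>Around tags in \<open>N\<close> the gauge is the covering set \<open>T\<close>
      itself. Points outside \<open>{a..b}\<close> never occur as tags, but a gauge is defined
      everywhere.\<close>
    define \<gamma> where "\<gamma> x = (if x \<in> N then T else if x \<in> {a..b} then ball x (d x) else ball x 1)" for x
    have "gauge \<gamma>" using T d(1) by (auto simp: gauge_def \<gamma>_def)
    moreover have "norm ((\<Sum>(x,k)\<in>D. measure lborel k *\<^sub>R g x) - (f b - f a)) < e"
      if D: "D tagged_division_of {a..b} \<and> \<gamma> fine D" for D
    proof -
      from D have td: "D tagged_division_of {a..b}" and fine: "\<gamma> fine D" by auto
      have fin: "finite D" using tagged_division_ofD(1)[OF td] .
      have Dk: "x \<in> k \<and> k \<subseteq> {a..b} \<and> x \<in> {a..b} \<and> k = {Inf k..Sup k} \<and> Inf k \<le> x \<and> x \<le> Sup k \<and> measure lborel k = Sup k - Inf k \<and> k \<subseteq> \<gamma> x"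
        if xkD: "(x, k) \<in> D" for x k
      proof -
        obtain u v where uv: "k = cbox u v" using tagged_division_ofD(4)[OF td xkD] by blast
        have "x \<in> k" "k \<subseteq> {a..b}" using tagged_division_ofD(2,3)[OF td xkD] by auto
        then show ?thesis using uv fine xkD by (auto simp: fine_def)
      qed
      define D1 where "D1 = {(x, k) \<in> D. x \<notin> N}"
      define D2 where "D2 = {(x, k) \<in> D. x \<in> N}"
      have D12: "D = D1 \<union> D2" "D1 \<inter> D2 = {}" "finite D1" "finite D2"
        using fin by (auto simp: D1_def D2_def intro: rev_finite_subset[OF fin])
      define F where "F = (\<lambda>(x, k). measure lborel k * g x - (f (Sup k) - f (Inf k)))"
      have tel: "(\<Sum>(x,k)\<in>D. f (Sup k) - f (Inf k)) = f b - f a"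
        using additive_tagged_division_1[OF ab td, of f] by simp
      have "(\<Sum>(x,k)\<in>D. measure lborel k *\<^sub>R g x) - (f b - f a) = sum F D"
        unfolding tel[symmetric] F_def by (simp add: sum_subtractf case_prod_unfold)
      also have "\<dots> = sum F D1 + sum F D2" using D12 by (simp add: sum.union_disjoint)
      finally have split: "(\<Sum>(x,k)\<in>D. measure lborel k *\<^sub>R g x) - (f b - f a) = sum F D1 + sum F D2" .
      have "\<bar>sum F D1\<bar> \<le> (\<Sum>(x,k)\<in>D1. \<epsilon> * measure lborel k)"
      proof (rule order_trans[OF sum_abs], rule sum_mono, safe)
        fix x k assume xk: "(x, k) \<in> D1"
        then have xkD: "(x, k) \<in> D" and xN: "x \<notin> N" by (auto simp: D1_def)
        note p = Dk[OF xkD]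
        have c: "measure lborel k = Sup k - Inf k" using p by blast
        have xx: "x \<in> {a..b} - N" using p xN by auto
        have in_ball: "y \<in> {a..b} \<and> \<bar>y - x\<bar> < d x" if "y \<in> k" for y
          using p xN that by (auto simp: \<gamma>_def dist_real_def abs_minus_commute)
        have S: "Sup k \<in> k" "Inf k \<in> k" using p by (metis atLeastAtMost_iff order_refl order_trans)+
        have "\<bar>f (Sup k) - f x - f' x * (Sup k - x)\<bar> \<le> \<epsilon> * (Sup k - x)"
          using d(2)[OF xx, of "Sup k"] in_ball[OF S(1)] p by auto
        moreover have "\<bar>f (Inf k) - f x - f' x * (Inf k - x)\<bar> \<le> \<epsilon> * (x - Inf k)"
          using d(2)[OF xx, of "Inf k"] in_ball[OF S(2)] p by auto
        moreover have "F (x, k) = (f (Inf k) - f x - f' x * (Inf k - x)) - (f (Sup k) - f x - f' x * (Sup k - x))"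
          unfolding F_def prod.case c using xN by (simp add: g_def algebra_simps)
        ultimately show "\<bar>F (x, k)\<bar> \<le> \<epsilon> * measure lborel k" unfolding c by (simp add: algebra_simps abs_le_iff)
      qed
      also have "\<dots> \<le> (\<Sum>(x,k)\<in>D. \<epsilon> * measure lborel k)"
        using fin D12 \<epsilon> by (intro sum_mono2) auto
      also have "\<dots> = \<epsilon> * (b - a)"
        using additive_content_tagged_division[of D a b] td ab
        by (simp add: sum_distrib_left[symmetric] case_prod_unfold)
      also have "\<dots> < e / 2"
      proof -
        have "e * (b - a) < e * (b - a + 1)" using e by simp
        then show ?thesis using ab e by (simp add: \<epsilon>_def field_simps)
      qed
      finally have s1: "\<bar>sum F D1\<bar> < e / 2" .
      \<comment> \<open>Absolute continuity speaks of finite sequences of intervals, so the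
        intervals with tag in \<open>N\<close> are numbered.\<close>
      obtain h :: "nat \<Rightarrow> real \<times> real set" where h: "bij_betw h {..<card D2} D2"
        using ex_bij_betw_nat_finite[OF D12(4)] by (auto simp: atLeast0LessThan)
      define X where "X i = Inf (snd (h i))" for i
      define Y where "Y i = Sup (snd (h i))" for i
      have hD: "h i \<in> D" "fst (h i) \<in> N" if "i < card D2" for i
      proof -
        have "h i \<in> D2" using bij_betwE[OF h] that by blast
        then show "h i \<in> D" "fst (h i) \<in> N" by (cases "h i", simp add: D2_def)+
      qed
      have XY: "snd (h i) = {X i..Y i} \<and> a \<le> X i \<and> X i \<le> Y i \<and> Y i \<le> b \<and> {X i..Y i} \<subseteq> T" if "i < card D2" for i
      proof -
        have "(fst (h i), snd (h i)) \<in> D" using hD that by simp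
        from Dk[OF this] have k: "snd (h i) = {X i..Y i}" "snd (h i) \<subseteq> {a..b}" "X i \<le> Y i"
          "snd (h i) \<subseteq> \<gamma> (fst (h i))"
          unfolding X_def Y_def by (blast, blast, linarith, blast)
        moreover have "\<gamma> (fst (h i)) = T" using hD(2)[OF that] by (simp add: \<gamma>_def)
        moreover have "X i \<in> {X i..Y i}" "Y i \<in> {X i..Y i}" using k(3) by auto
        ultimately show ?thesis by (metis atLeastAtMost_iff subsetD)
      qed
      have disj: "disjoint_family_on (\<lambda>i. {X i<..<Y i}) {..<card D2}"
        unfolding disjoint_family_on_def
      proof (intro ballI impI)
        fix i j assume ij: "i \<in> {..<card D2}" "j \<in> {..<card D2}" "i \<noteq> j"
        then have "h i \<noteq> h j" using h by (auto simp: bij_betw_def inj_on_def)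
        then have "interior (snd (h i)) \<inter> interior (snd (h j)) = {}"
          using tagged_division_ofD(5)[OF td, of "fst (h i)" "snd (h i)" "fst (h j)" "snd (h j)"] hD ij by auto
        then show "{X i<..<Y i} \<inter> {X j<..<Y j} = {}" using XY ij by auto
      qed
      have "ennreal (\<Sum>i<card D2. Y i - X i) = (\<Sum>i<card D2. emeasure lebesgue {X i<..<Y i})"
        using XY by (subst sum_ennreal[symmetric]) (auto intro!: sum.cong)
      also have "\<dots> = emeasure lebesgue (\<Union>i<card D2. {X i<..<Y i})"
        using disj by (intro sum_emeasure) auto
      also have "\<dots> \<le> emeasure lebesgue T"
      proof (rule emeasure_mono[OF _ Ts], rule UN_least)
        fix i assume "i \<in> {..<card D2}"
        then have "{X i..Y i} \<subseteq> T" using XY by blast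
        then show "{X i<..<Y i} \<subseteq> T" using greaterThanLessThan_subseteq_atLeastAtMost_iff by fastforce
      qed
      also note emT
      finally have "ennreal (\<Sum>i<card D2. Y i - X i) < ennreal \<delta>" .
      moreover have "0 \<le> (\<Sum>i<card D2. Y i - X i)" by (rule sum_nonneg) (use XY in auto)
      ultimately have "(\<Sum>i<card D2. Y i - X i) < \<delta>" by (simp add: ennreal_less_iff)
      then have "(\<Sum>k<card D2. Y k - X k) < \<delta>" .
      moreover have "\<forall>k<card D2. a \<le> X k \<and> X k \<le> Y k \<and> Y k \<le> b" using XY by blast
      ultimately have s2: "(\<Sum>i<card D2. \<bar>f (Y i) - f (X i)\<bar>) < e / 2"
        using small[rule_format, of "card D2" X Y] disj by blast
      have "\<bar>sum F D2\<bar> \<le> (\<Sum>p\<in>D2. \<bar>F p\<bar>)" by (rule sum_abs)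
      also have "\<dots> = (\<Sum>i<card D2. \<bar>F (h i)\<bar>)" using sum.reindex_bij_betw[OF h, of "\<lambda>p. \<bar>F p\<bar>"] by simp
      also have "\<dots> = (\<Sum>i<card D2. \<bar>f (Y i) - f (X i)\<bar>)"
        using hD by (intro sum.cong) (auto simp: F_def g_def X_def Y_def case_prod_unfold)
      finally show ?thesis using s1 s2 split by simp
    qed
    ultimately show "\<exists>\<gamma>. gauge \<gamma> \<and> (\<forall>D. D tagged_division_of {a..b} \<and> \<gamma> fine D \<longrightarrow>
        norm ((\<Sum>(x,k)\<in>D. measure lborel k *\<^sub>R g x) - (f b - f a)) < e)" by blast
  qed
  then show ?thesis
    using has_integral_spike[OF N, of "{a..b}" f' g] by (simp add: g_def)
qed

text \<open>Telescoping over a fine uniform partition turns the local estimate into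
  \<open>\<bar>\<Phi> b - \<Phi> a\<bar> \<le> \<epsilon> * (m b - m a)\<close> for every
  \<open>\<epsilon>\<close>. It stands in for a vanishing derivative when \<open>\<Phi>\<close> is
  not known to be differentiable.\<close>

lemma constant_of_small_increments:
  fixes \<Phi> m :: "real \<Rightarrow> real"
  assumes ab: "a \<le> b"
    and small: "\<And>\<epsilon>. \<epsilon> > 0 \<Longrightarrow> \<exists>\<delta>>0. \<forall>x y. a \<le> x \<longrightarrow> x \<le> y \<longrightarrow> y \<le> b \<longrightarrow> y - x < \<delta> \<longrightarrow> \<bar>\<Phi> y - \<Phi> x\<bar> \<le> \<epsilon> * (m y - m x)"
  shows "\<Phi> b = \<Phi> a"
proof -
  have le: "\<bar>\<Phi> b - \<Phi> a\<bar> \<le> \<epsilon> * (m b - m a)" if \<epsilon>: "\<epsilon> > 0" for \<epsilon>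
  proof -
    obtain \<delta> where \<delta>: "\<delta> > 0" "\<And>x y. a \<le> x \<Longrightarrow> x \<le> y \<Longrightarrow> y \<le> b \<Longrightarrow> y - x < \<delta> \<Longrightarrow> \<bar>\<Phi> y - \<Phi> x\<bar> \<le> \<epsilon> * (m y - m x)"
      using small[OF \<epsilon>] by blast
    obtain N :: nat where N: "(b - a) / \<delta> < real N" using reals_Archimedean2 by blast
    have N0: "N > 0" using N \<delta> ab by (cases N) (auto simp: field_simps)
    define w where "w = (b - a) / real N"
    define x where "x i = a + real i * w" for i
    have w: "w \<ge> 0" "real N * w = b - a" "w < \<delta>"
      using ab N0 N \<delta>(1) by (auto simp: w_def pos_divide_less_eq mult.commute)
    have x0N: "x 0 = a" "x N = b" using w by (simp_all add: x_def)
    have step: "\<bar>\<Phi> (x (Suc i)) - \<Phi> (x i)\<bar> \<le> \<epsilon> * (m (x (Suc i)) - m (x i))" if "i < N" for i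
    proof (rule \<delta>(2))
      show "a \<le> x i" "x i \<le> x (Suc i)" using w by (simp_all add: x_def mult_right_mono)
      have "x (Suc i) \<le> a + real N * w" unfolding x_def using that w
        by (intro add_left_mono mult_right_mono) auto
      then show "x (Suc i) \<le> b" using w by simp
      show "x (Suc i) - x i < \<delta>" using w by (simp add: x_def algebra_simps)
    qed
    have "\<bar>\<Phi> b - \<Phi> a\<bar> = \<bar>\<Sum>i<N. \<Phi> (x (Suc i)) - \<Phi> (x i)\<bar>"
      using sum_lessThan_telescope[of "\<lambda>i. \<Phi> (x i)" N] x0N by simp
    also have "\<dots> \<le> (\<Sum>i<N. \<epsilon> * (m (x (Suc i)) - m (x i)))"
      by (rule order_trans[OF sum_abs], rule sum_mono) (use step in auto)
    also have "\<dots> = \<epsilon> * (m b - m a)"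
      using sum_lessThan_telescope[of "\<lambda>i. m (x i)" N] x0N by (simp add: sum_distrib_left[symmetric])
    finally show ?thesis .
  qed
  show ?thesis
  proof (rule ccontr)
    assume ne: "\<Phi> b \<noteq> \<Phi> a"
    have pos: "m b - m a \<ge> 0" using le[of 1] by simp
    \<comment> \<open>The \<open>+ 1\<close> keeps \<open>M\<close> positive when
      \<open>m b = m a\<close>; \<open>e\<close> is half of the supposed gap divided by
      \<open>M\<close>.\<close>
    define M where "M = m b - m a + 1"
    define e where "e = \<bar>\<Phi> b - \<Phi> a\<bar> / 2 / M"
    have "M > 0" using pos by (simp add: M_def)
    then have "e > 0" using ne by (simp add: e_def)
    from le[OF this] have "\<bar>\<Phi> b - \<Phi> a\<bar> \<le> e * (m b - m a)" .
    also have "\<dots> \<le> e * M" using \<open>e > 0\<close> by (simp add: M_def)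
    also have "\<dots> = \<bar>\<Phi> b - \<Phi> a\<bar> / 2" using \<open>M > 0\<close> by (simp add: e_def)
    finally show False using ne by simp
  qed
qed

subsection \<open>Smooth cut-off functions and weak derivatives\<close>

text \<open>Phrased by existence of successive derivatives instead of iterates of
  \<open>deriv\<close>, so that closure under sums, products and reciprocals follows by induction;
  \<open>times_differentiable_deriv\<close> returns to the form used in
  \<open>test_fun\<close>.\<close>

primrec times_differentiable :: "nat \<Rightarrow> (real \<Rightarrow> real) \<Rightarrow> bool" where
  "times_differentiable 0 f = True"
| "times_differentiable (Suc k) f = (\<exists>f'. (\<forall>x. (f has_real_derivative f' x) (at x)) \<and> times_differentiable k f')"

lemma times_differentiable_SucI:
  "(\<And>x. (f has_real_derivative f' x) (at x)) \<Longrightarrow> times_differentiable k f' \<Longrightarrow> times_differentiable (Suc k) f"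
  by auto

lemma times_differentiable_SucD: "times_differentiable (Suc k) f \<Longrightarrow> times_differentiable k f"
proof (induction k arbitrary: f)
  case (Suc k)
  then obtain f' where f': "\<forall>x. (f has_real_derivative f' x) (at x)" "times_differentiable (Suc k) f'"
    by (auto simp only: times_differentiable.simps(2)[of "Suc k"])
  then show ?case using Suc.IH[OF f'(2)] by (auto simp only: times_differentiable.simps(2))
qed simp

lemma times_differentiable_deriv:
  "times_differentiable (Suc k) f \<Longrightarrow> (deriv ^^ k) f differentiable (at x)"
proof (induction k arbitrary: f)
  case 0
  then show ?case by (auto simp: real_differentiable_def)
next
  case (Suc k)
  then obtain f' where f': "\<forall>x. (f has_real_derivative f' x) (at x)" "times_differentiable (Suc k) f'"
    by (auto simp only: times_differentiable.simps(2)[of "Suc k"])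
  then have "deriv f = f'" using DERIV_imp_deriv by blast
  then show ?case using Suc.IH[OF f'(2)] by (simp add: funpow_swap1)
qed

lemma times_differentiable_add:
  "times_differentiable k f \<Longrightarrow> times_differentiable k g \<Longrightarrow> times_differentiable k (\<lambda>x. f x + g x)"
proof (induction k arbitrary: f g)
  case (Suc k)
  then obtain f' g' where "\<forall>x. (f has_real_derivative f' x) (at x)" "times_differentiable k f'"
    "\<forall>x. (g has_real_derivative g' x) (at x)" "times_differentiable k g'" by auto
  then show ?case using Suc.IH[of f' g']
    by (auto intro!: exI[of _ "\<lambda>x. f' x + g' x"] derivative_eq_intros)
qed simp

text \<open>The outer factor \<open>d\<close> is there for the induction: each derivative brings out
  another factor \<open>c\<close>.\<close>

lemma times_differentiable_affine:
  "times_differentiable k f \<Longrightarrow> times_differentiable k (\<lambda>x. d * f (c * x + b))"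
proof (induction k arbitrary: f d)
  case (Suc k)
  then obtain f' where f': "\<forall>x. (f has_real_derivative f' x) (at x)" "times_differentiable k f'" by auto
  have "((\<lambda>x. d * f (c * x + b)) has_real_derivative (d * c) * f' (c * x + b)) (at x)" for x
    by (rule derivative_eq_intros DERIV_chain2[OF f'(1)[rule_format]] refl)+ simp
  then show ?case using Suc.IH[OF f'(2), of "d * c"] by (rule times_differentiable_SucI)
qed simp

lemma times_differentiable_mult:
  "times_differentiable k f \<Longrightarrow> times_differentiable k g \<Longrightarrow> times_differentiable k (\<lambda>x. f x * g x)"
proof (induction k arbitrary: f g)
  case (Suc k)
  then obtain f' g' where d: "\<forall>x. (f has_real_derivative f' x) (at x)" "times_differentiable k f'"
    "\<forall>x. (g has_real_derivative g' x) (at x)" "times_differentiable k g'" by auto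
  have "times_differentiable k f" "times_differentiable k g"
    using Suc.prems times_differentiable_SucD by blast+
  then have "times_differentiable k (\<lambda>x. f' x * g x + f x * g' x)"
    using Suc.IH d times_differentiable_add by blast
  moreover have "((\<lambda>x. f x * g x) has_real_derivative f' x * g x + f x * g' x) (at x)" for x
    using d by (auto intro!: derivative_eq_intros)
  ultimately show ?case by (rule times_differentiable_SucI[rotated])
qed simp

text \<open>The derivative \<open>- g' * (inverse g * inverse g)\<close> contains the reciprocal
  itself, to which the induction hypothesis applies.\<close>

lemma times_differentiable_inverse:
  assumes "\<And>x. g x \<noteq> 0" "times_differentiable k g"
  shows "times_differentiable k (\<lambda>x. inverse (g x))"
  using assms(2)
proof (induction k)
  case (Suc k)
  then obtain g' where d: "\<forall>x. (g has_real_derivative g' x) (at x)" "times_differentiable k g'" by auto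
  have i: "times_differentiable k (\<lambda>x. inverse (g x))" using Suc times_differentiable_SucD by blast
  from times_differentiable_mult[OF times_differentiable_affine[OF d(2), of "-1" 1 0] times_differentiable_mult[OF i i]]
  have "times_differentiable k (\<lambda>x. - (g' x) * (inverse (g x) * inverse (g x)))" by simp
  moreover have "((\<lambda>x. inverse (g x)) has_real_derivative - (g' x) * (inverse (g x) * inverse (g x))) (at x)" for x
    using d(1) assms(1) by (auto intro!: derivative_eq_intros)
  ultimately show ?case by (rule times_differentiable_SucI[rotated])
qed simp

text \<open>A family closed under differentiation: with \<open>y = 1 / x\<close>, the derivative of
  \<open>p(y) exp(-y)\<close> is again of this kind, for the polynomial \<open>y^2 (p - p')\<close>,
  which is the \<open>pCons 0 (pCons 0 (p - pderiv p))\<close> below.\<close>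

definition flat_exp :: "real poly \<Rightarrow> real \<Rightarrow> real"
  where "flat_exp p x = (if x > 0 then poly p (1 / x) * exp (- (1 / x)) else 0)"

lemma poly_div_exp_tendsto_0: "((\<lambda>y. poly p y * exp (- y)) \<longlongrightarrow> 0) at_top" for p :: "real poly"
proof -
  have "((\<lambda>y. \<Sum>i\<le>degree p. coeff p i * (y ^ i / exp y)) \<longlongrightarrow> (\<Sum>i\<le>degree p. coeff p i * 0)) at_top"
    by (intro tendsto_intros tendsto_power_div_exp_0)
  then show ?thesis
    by (simp add: poly_altdef sum_distrib_right exp_minus divide_inverse mult.assoc)
qed

lemma flat_exp_has_derivative:
  "(flat_exp p has_real_derivative flat_exp (pCons 0 (pCons 0 (p - pderiv p))) x) (at x)"
proof (cases x "0 :: real" rule: linorder_cases)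
  case greater
  have "((\<lambda>x. poly p (1 / x) * exp (- (1 / x))) has_real_derivative
      flat_exp (pCons 0 (pCons 0 (p - pderiv p))) x) (at x)"
    using greater
    by (auto intro!: derivative_eq_intros DERIV_chain2[OF poly_DERIV]
        simp: flat_exp_def field_simps power2_eq_square)
  moreover have ev: "eventually (\<lambda>y. poly p (1 / y) * exp (- (1 / y)) = flat_exp p y) (nhds x)"
    using eventually_nhds_in_open[of "{0<..}" x] greater by (auto simp: flat_exp_def elim!: eventually_mono)
  ultimately show ?thesis by (simp only: DERIV_cong_ev[OF refl ev refl])
next
  case less
  have ev: "eventually (\<lambda>y. 0 = flat_exp p y) (nhds x)"
    using eventually_nhds_in_open[of "{..<0}" x] less by (auto simp: flat_exp_def elim!: eventually_mono)
  have "((\<lambda>_. 0) has_real_derivative flat_exp (pCons 0 (pCons 0 (p - pderiv p))) x) (at x)"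
    using less by (auto simp: flat_exp_def)
  then show ?thesis by (simp only: DERIV_cong_ev[OF refl ev refl])
next
  case equal
  have "((\<lambda>h. flat_exp p h / h) \<longlongrightarrow> 0) (at 0)"
  proof (rule filterlim_split_at)
    show "((\<lambda>h. flat_exp p h / h) \<longlongrightarrow> 0) (at_left 0)"
      by (rule tendsto_eventually) (auto simp: eventually_at_filter flat_exp_def)
    \<comment> \<open>With \<open>y = 1 / h\<close>, dividing by \<open>h\<close> multiplies the
      polynomial by \<open>y\<close>; hence \<open>pCons 0 p\<close>.\<close>
    have "((\<lambda>y. poly (pCons 0 p) y * exp (- y)) \<longlongrightarrow> 0) at_top" by (rule poly_div_exp_tendsto_0)
    from filterlim_compose[OF this filterlim_inverse_at_top_right]
    have "((\<lambda>h. poly (pCons 0 p) (inverse h) * exp (- inverse h)) \<longlongrightarrow> 0) (at_right 0)" by simp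
    moreover have "eventually (\<lambda>h. poly (pCons 0 p) (inverse h) * exp (- inverse h) = flat_exp p h / h) (at_right 0)"
      by (auto simp: eventually_at_filter flat_exp_def field_simps)
    ultimately show "((\<lambda>h. flat_exp p h / h) \<longlongrightarrow> 0) (at_right 0)" by (rule Lim_transform_eventually)
  qed
  then show ?thesis using equal by (simp add: has_field_derivative_iff flat_exp_def)
qed

lemma times_differentiable_flat_exp: "times_differentiable k (flat_exp p)"
proof (induction k arbitrary: p)
  case (Suc k)
  then show ?case using flat_exp_has_derivative by auto
qed simp

text \<open>A smooth transition from 0 on the left of 0 to 1 on the right of 1. The denominator is
  positive because \<open>x\<close> and \<open>1 - x\<close> cannot both be nonpositive.\<close>

definition smooth_step :: "real \<Rightarrow> real"
  where "smooth_step x = flat_exp 1 x * inverse (flat_exp 1 x + flat_exp 1 (1 - x))"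

lemma smooth_step_denominator: "flat_exp 1 x + flat_exp 1 (1 - x) > 0"
  by (auto simp: flat_exp_def add_pos_pos)

lemma smooth_step_values:
  "x \<le> 0 \<Longrightarrow> smooth_step x = 0" "x \<ge> 1 \<Longrightarrow> smooth_step x = 1" "\<bar>smooth_step x\<bar> \<le> 1"
proof -
  show "x \<le> 0 \<Longrightarrow> smooth_step x = 0" by (simp add: smooth_step_def flat_exp_def)
  show "x \<ge> 1 \<Longrightarrow> smooth_step x = 1" by (simp add: smooth_step_def flat_exp_def)
  have "0 \<le> flat_exp 1 y" for y by (simp add: flat_exp_def)
  then show "\<bar>smooth_step x\<bar> \<le> 1" using smooth_step_denominator[of x]
    by (simp add: smooth_step_def divide_inverse[symmetric])
qed

lemma times_differentiable_smooth_step: "times_differentiable k smooth_step"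
proof -
  have "times_differentiable k (\<lambda>x. 1 * flat_exp 1 ((-1) * x + 1))"
    by (intro times_differentiable_affine times_differentiable_flat_exp)
  then have "times_differentiable k (\<lambda>x. flat_exp 1 x + flat_exp 1 (1 - x))"
    using times_differentiable_add[OF times_differentiable_flat_exp] by simp
  then have "times_differentiable k (\<lambda>x. inverse (flat_exp 1 x + flat_exp 1 (1 - x)))"
    using less_imp_neq[OF smooth_step_denominator] by (intro times_differentiable_inverse) auto
  from times_differentiable_mult[OF times_differentiable_flat_exp this] show ?thesis
    unfolding smooth_step_def[abs_def] .
qed

section \<open>Approximate identities and primitives of weak derivatives\<close>

lemma integrable_mult_continuous:
  fixes g c :: "real \<Rightarrow> real"
  assumes g: "integrable (lebesgue_on {a..b}) g" and c: "continuous_on {a..b} c"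
  shows "integrable (lebesgue_on {a..b}) (\<lambda>t. g t * c t)"
proof -
  obtain M where M: "\<And>t. t \<in> {a..b} \<Longrightarrow> \<bar>c t\<bar> \<le> M"
    using compact_imp_bounded[OF compact_continuous_image[OF c]] unfolding bounded_iff by (metis compact_Icc image_eqI real_norm_def)
  have cm: "c \<in> borel_measurable (lebesgue_on {a..b})"
    using c by (intro continuous_imp_measurable_on_sets_lebesgue) auto
  show ?thesis
  proof (rule Bochner_Integration.integrable_bound[of _ "\<lambda>t. \<bar>g t\<bar> * M"])
    show "integrable (lebesgue_on {a..b}) (\<lambda>t. \<bar>g t\<bar> * M)" using g by auto
    show "(\<lambda>t. g t * c t) \<in> borel_measurable (lebesgue_on {a..b})" using g cm by auto
    show "AE t in lebesgue_on {a..b}. norm (g t * c t) \<le> norm (\<bar>g t\<bar> * M)"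
    proof (rule AE_I2)
      fix t assume "t \<in> space (lebesgue_on {a..b})"
      then have "\<bar>c t\<bar> \<le> M" using M by simp
      then show "norm (g t * c t) \<le> norm (\<bar>g t\<bar> * M)"
        by (auto simp: abs_mult intro!: mult_left_mono)
    qed
  qed
qed

lemma integrable_continuous_lebesgue_on:
  fixes c :: "real \<Rightarrow> real"
  assumes "continuous_on {a..b} c"
  shows "integrable (lebesgue_on {a..b}) c"
  using integrable_mult_continuous[of a b "\<lambda>_. 1" c] assms by simp

text \<open>Collects what makes \<open>k * s' (k * (t - \<alpha>))\<close> an approximate identity
  at \<open>\<alpha>\<close> as \<open>k\<close> grows; the bound \<open>M\<close> takes the place
  of a sign of \<open>s'\<close>.\<close>

lemma smooth_step_deriv:
  obtains s' M where "\<And>x. (smooth_step has_real_derivative s' x) (at x)" "continuous_on UNIV s'"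
    "\<And>x. s' x \<noteq> 0 \<Longrightarrow> x \<in> {0..1}" "\<And>x. \<bar>s' x\<bar> \<le> M" "M > 0"
proof -
  obtain s' where s': "\<And>x. (smooth_step has_real_derivative s' x) (at x)" "times_differentiable (Suc 0) s'"
    using times_differentiable_smooth_step[of "Suc (Suc 0)"] unfolding times_differentiable.simps(2)[of "Suc 0"] by blast
  have cont: "continuous_on UNIV s'"
    using s'(2) unfolding times_differentiable.simps by (meson DERIV_isCont continuous_at_imp_continuous_on)
  have zero: "x \<in> {0..1}" if "s' x \<noteq> 0" for x
  proof (rule ccontr)
    assume x: "x \<notin> {0..1}"
    have "(smooth_step has_real_derivative 0) (at x)"
    proof (cases "x < 0")
      case True
      have "eventually (\<lambda>y. smooth_step y = 0) (nhds x)"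
        using eventually_nhds_in_open[of "{..<0}" x] True by (auto simp: smooth_step_values elim!: eventually_mono)
      from DERIV_cong_ev[OF refl this refl] show ?thesis by simp
    next
      case False
      then have "eventually (\<lambda>y. smooth_step y = 1) (nhds x)"
        using eventually_nhds_in_open[of "{1<..}" x] x by (auto simp: smooth_step_values elim!: eventually_mono)
      from DERIV_cong_ev[OF refl this refl] show ?thesis by simp
    qed
    then show False using DERIV_unique[OF s'(1)[of x]] that by simp
  qed
  have "bounded (s' ` {0..1})"
    by (intro compact_imp_bounded compact_continuous_image continuous_on_subset[OF cont]) auto
  then obtain M where M: "M > 0" "\<And>x. x \<in> {0..1} \<Longrightarrow> \<bar>s' x\<bar> \<le> M"
    by (auto simp: bounded_pos)
  have "\<bar>s' x\<bar> \<le> M" for x using zero[of x] M by (cases "s' x = 0") auto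
  then show thesis using that s'(1) cont zero M(1) by blast
qed

text \<open>The kernel \<open>k j * s' (k j * (t - \<alpha>))\<close> lives on
  \<open>{\<alpha>..\<alpha> + 1 / k j}\<close> and, because that interval ends before
  \<open>b\<close>, has integral 1. On the shrinking support \<open>F\<close> differs little from
  \<open>F \<alpha>\<close>.\<close>

lemma has_derivative_const_outside_tendsto:
  fixes F s' :: "real \<Rightarrow> real" and k :: "nat \<Rightarrow> real"
  assumes F: "continuous_on {a..b} F" and \<alpha>: "a < \<alpha>" "\<alpha> < b"
    and s': "\<And>x. (smooth_step has_real_derivative s' x) (at x)" "continuous_on UNIV s'"
      "\<And>x. s' x \<noteq> 0 \<Longrightarrow> x \<in> {0..1}" "\<And>x. \<bar>s' x\<bar> \<le> M" "M > 0"
    and k: "filterlim k at_top sequentially" "\<And>j. k j > 0" "\<And>j. 1 / k j < b - \<alpha>"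
  shows "(\<lambda>j. LINT t|lebesgue_on {a..b}. F t * (k j * s' (k j * (t - \<alpha>)))) \<longlonglongrightarrow> F \<alpha>"
proof (rule LIMSEQ_I)
  fix e :: real assume e: "e > 0"
  \<comment> \<open>A kernel of height at most \<open>k j * M\<close> on an interval of length
    \<open>1 / k j\<close> gives an error of at most \<open>\<epsilon> * M = e / 2\<close>.\<close>
  define \<epsilon> where "\<epsilon> = e / (2 * M)"
  have \<epsilon>: "\<epsilon> > 0" using e s'(5) by (simp add: \<epsilon>_def)
  have "isCont F \<alpha>" using continuous_on_interior[OF F] \<alpha> by simp
  then obtain \<delta> where \<delta>: "\<delta> > 0" "\<And>t. \<bar>t - \<alpha>\<bar> < \<delta> \<Longrightarrow> \<bar>F t - F \<alpha>\<bar> < \<epsilon>"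
    using \<epsilon> unfolding continuous_at_eps_delta dist_real_def by blast
  have "eventually (\<lambda>j. k j > 1 / \<delta>) sequentially"
    using k(1) by (simp add: filterlim_at_top_dense)
  then obtain J where J: "\<And>j. j \<ge> J \<Longrightarrow> k j > 1 / \<delta>" by (auto simp: eventually_sequentially)
  have "norm ((LINT t|lebesgue_on {a..b}. F t * (k j * s' (k j * (t - \<alpha>)))) - F \<alpha>) < e" if "j \<ge> J" for j
  proof -
    let ?u = "\<lambda>t. k j * s' (k j * (t - \<alpha>))"
    let ?M = "lebesgue_on {a..b}"
    have kj: "k j > 0" "1 / k j < \<delta>" using J[OF that] k(2)[of j] \<delta>(1) by (auto simp: field_simps)
    have cu: "continuous_on {a..b} ?u"
      by (intro continuous_intros continuous_on_compose2[OF s'(2)]) auto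
    have iF: "integrable ?M (\<lambda>t. F t * ?u t)" and iu: "integrable ?M (\<lambda>t. F \<alpha> * ?u t)"
      by (rule integrable_continuous_lebesgue_on continuous_on_mult F cu continuous_on_const)+
    have "(?u has_integral smooth_step (k j * (b - \<alpha>)) - smooth_step (k j * (a - \<alpha>))) {a..b}"
    proof (rule fundamental_theorem_of_calculus)
      fix x assume "x \<in> {a..b}"
      have "((\<lambda>t. smooth_step (k j * (t - \<alpha>))) has_real_derivative s' (k j * (x - \<alpha>)) * k j) (at x)"
        by (rule DERIV_chain2[OF s'(1)]) (auto intro!: derivative_eq_intros)
      then show "((\<lambda>t. smooth_step (k j * (t - \<alpha>))) has_vector_derivative ?u x) (at x within {a..b})"
        by (simp add: has_real_derivative_iff_has_vector_derivative[symmetric] mult.commute has_field_derivative_at_within)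
    qed (use \<alpha> in auto)
    moreover have "smooth_step (k j * (b - \<alpha>)) = 1"
      using k(2,3)[of j] by (intro smooth_step_values) (auto simp: field_simps)
    moreover have "smooth_step (k j * (a - \<alpha>)) = 0"
      using k(2)[of j] \<alpha> by (intro smooth_step_values) (auto simp: mult_le_0_iff)
    ultimately have "(?u has_integral 1) {a..b}" by simp
    then have one: "(LINT t|?M. ?u t) = 1"
      by (rule trans[OF lebesgue_integral_eq_integral[OF integrable_continuous_lebesgue_on[OF cu]] integral_unique, rotated]) auto
    have "(LINT t|?M. F t * ?u t) - F \<alpha> = (LINT t|?M. F t * ?u t) - (LINT t|?M. F \<alpha> * ?u t)"
      using one by (subst Bochner_Integration.integral_mult_right_zero[of _ "F \<alpha>" ?u]) (simp only: mult_1_right)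
    also have "\<dots> = (LINT t|?M. (F t - F \<alpha>) * ?u t)"
      using Bochner_Integration.integral_diff[OF iF iu] by (simp add: left_diff_distrib)
    finally have eq: "(LINT t|?M. F t * ?u t) - F \<alpha> = (LINT t|?M. (F t - F \<alpha>) * ?u t)" .
    let ?I = "{\<alpha>..\<alpha> + 1 / k j}"
    have sub: "?I \<subseteq> {a..b}" using \<alpha> k(3)[of j] by auto
    have Is: "?I \<in> sets ?M" using sub by (auto simp: sets_restrict_space_iff)
    have "emeasure ?M ?I = emeasure lebesgue ?I" using sub by (intro emeasure_restrict_space) auto
    also have "\<dots> < \<infinity>" by (simp add: emeasure_lborel_Icc_eq)
    finally have fin: "emeasure ?M ?I < \<infinity>" .
    have "?I \<inter> space ?M = ?I" using sub by auto
    moreover have "measure ?M ?I = 1 / k j" using sub kj by (simp add: measure_restrict_space)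
    ultimately have meas': "measure ?M (?I \<inter> space ?M) = 1 / k j" by (simp only:)
    have "\<bar>LINT t|?M. (F t - F \<alpha>) * ?u t\<bar> \<le> (LINT t|?M. \<bar>(F t - F \<alpha>) * ?u t\<bar>)"
      by (rule integral_abs_bound)
    also have "\<dots> \<le> (LINT t|?M. (\<epsilon> * (k j * M)) * indicat_real ?I t)"
    proof (rule integral_mono)
      show "integrable ?M (\<lambda>t. \<bar>(F t - F \<alpha>) * ?u t\<bar>)"
        by (intro integrable_continuous_lebesgue_on continuous_on_rabs continuous_on_mult continuous_on_diff F cu continuous_on_const)
      show "integrable ?M (\<lambda>t. (\<epsilon> * (k j * M)) * indicat_real ?I t)"
        by (rule integrable_mult_right[OF integrable_real_indicator[OF Is fin]])
      fix t
      show "\<bar>(F t - F \<alpha>) * ?u t\<bar> \<le> (\<epsilon> * (k j * M)) * indicat_real ?I t"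
      proof (cases "s' (k j * (t - \<alpha>)) = 0")
        case False
        from s'(3)[OF False] have *: "0 \<le> t - \<alpha>" "t - \<alpha> \<le> 1 / k j"
          using kj by (auto simp: zero_le_mult_iff field_simps)
        then have t: "t \<in> ?I" by auto
        have "\<bar>F t - F \<alpha>\<bar> \<le> \<epsilon>" using \<delta>(2)[of t] * kj by auto
        moreover have "\<bar>?u t\<bar> \<le> k j * M" using kj s'(4) by (simp add: abs_mult)
        ultimately have "\<bar>F t - F \<alpha>\<bar> * \<bar>?u t\<bar> \<le> \<epsilon> * (k j * M)"
          using \<epsilon> by (intro mult_mono) auto
        then show ?thesis using t by (simp add: abs_mult)
      qed (use \<epsilon> kj s'(5) in auto)
    qed
    also have "(LINT t|?M. (\<epsilon> * (k j * M)) * indicat_real ?I t) = \<epsilon> * (k j * M) * (1 / k j)"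
      by (simp only: Bochner_Integration.integral_mult_right_zero Bochner_Integration.integral_indicator meas')
    also have "\<dots> = \<epsilon> * M" using kj(1) by simp
    also have "\<dots> < e" using e s'(5) by (simp add: \<epsilon>_def)
    finally show ?thesis by (simp only: eq real_norm_def)
  qed
  then show "\<exists>J. \<forall>j\<ge>J. norm ((LINT t|lebesgue_on {a..b}. F t * (k j * s' (k j * (t - \<alpha>)))) - F \<alpha>) < e" by blast
qed

text \<open>The test function is a smooth step up at \<open>\<alpha>\<close> followed by a step down
  at \<open>\<beta>\<close>. As the steps sharpen, the left side tends to
  \<open>F \<alpha> - F \<beta>\<close>, and the test function tends to the indicator of
  \<open>{\<alpha><..\<beta>}\<close>, with \<open>2 * \<bar>g t\<bar>\<close> as dominating
  function.\<close>

lemma weak_derivative_increment: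
  fixes F g :: "real \<Rightarrow> real"
  assumes F: "continuous_on {a..b} F" and g: "integrable (lebesgue_on {a..b}) g"
    and weak: "\<And>\<eta>. test_fun {a..b} \<eta> \<Longrightarrow>
      (LINT t|lebesgue_on {a..b}. F t * deriv \<eta> t) = - (LINT t|lebesgue_on {a..b}. g t * \<eta> t)"
    and \<alpha>\<beta>: "a < \<alpha>" "\<alpha> \<le> \<beta>" "\<beta> < b"
  shows "F \<beta> - F \<alpha> = (LINT t|lebesgue_on {a..b}. g t * indicat_real {\<alpha><..\<beta>} t)"
proof -
  let ?M = "lebesgue_on {a..b}"
  obtain s' M where s': "\<And>x. (smooth_step has_real_derivative s' x) (at x)" "continuous_on UNIV s'"
      "\<And>x. s' x \<noteq> 0 \<Longrightarrow> x \<in> {0..1}" "\<And>x. \<bar>s' x\<bar> \<le> M" "M > 0"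
    using smooth_step_deriv by blast
  \<comment> \<open>The offset gives \<open>1 / k j < b - \<beta>\<close> for every
    \<open>j\<close>, so that the support \<open>{\<alpha>..\<beta> + 1 / k j}\<close> stays inside
    the open interval.\<close>
  define k where "k j = real j + (1 / (b - \<beta>) + 1)" for j :: nat
  have k1: "filterlim k at_top sequentially" unfolding k_def
    using filterlim_tendsto_add_at_top[OF tendsto_const filterlim_real_sequentially, of "1 / (b - \<beta>) + 1"]
    by (simp add: add.commute)
  have k2: "k j > 0" "1 / k j < b - \<beta>" "1 / k j < b - \<alpha>" for j
  proof -
    have "1 / (b - \<beta>) > 0" using \<alpha>\<beta> by simp
    then have "k j > 1 / (b - \<beta>)" by (simp add: k_def)
    moreover from this show "k j > 0" using \<open>1 / (b - \<beta>) > 0\<close> by linarith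
    ultimately show "1 / k j < b - \<beta>" using \<alpha>\<beta> by (simp add: field_simps)
    then show "1 / k j < b - \<alpha>" using \<alpha>\<beta> by linarith
  qed
  define \<eta> where "\<eta> j t = smooth_step (k j * (t - \<alpha>)) - smooth_step (k j * (t - \<beta>))" for j t
  have d\<eta>: "(\<eta> j has_real_derivative k j * s' (k j * (t - \<alpha>)) - k j * s' (k j * (t - \<beta>))) (at t)" for j t
  proof -
    have "((\<lambda>t. smooth_step (k j * (t - c))) has_real_derivative s' (k j * (t - c)) * k j) (at t)" for c
      by (rule DERIV_chain2[OF s'(1)]) (auto intro!: derivative_eq_intros)
    from DERIV_diff[OF this[of \<alpha>] this[of \<beta>]] show ?thesis
      unfolding \<eta>_def[abs_def] by (simp add: mult.commute)
  qed
  then have deriv\<eta>: "deriv (\<eta> j) t = k j * s' (k j * (t - \<alpha>)) - k j * s' (k j * (t - \<beta>))" for j t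
    by (rule DERIV_imp_deriv)
  have zero\<eta>: "\<eta> j t = 0" if "t \<notin> {\<alpha>..\<beta> + 1 / k j}" for j t
  proof (cases "t < \<alpha>")
    case True
    then have "k j * (t - \<alpha>) \<le> 0" "k j * (t - \<beta>) \<le> 0"
      using k2(1)[of j] \<alpha>\<beta> by (auto simp: mult_le_0_iff)
    then show ?thesis by (simp add: \<eta>_def smooth_step_values)
  next
    case False
    then have "k j * (t - \<beta>) \<ge> 1" using that k2(1)[of j] by (auto simp: field_simps)
    moreover have "k j * (t - \<alpha>) \<ge> k j * (t - \<beta>)" using k2(1)[of j] \<alpha>\<beta> by simp
    ultimately show ?thesis by (simp add: \<eta>_def smooth_step_values)
  qed
  have test: "test_fun {a..b} (\<eta> j)" for j
    unfolding test_fun_def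
  proof (intro conjI allI exI[of _ "{\<alpha>..\<beta> + 1 / k j}"] impI)
    fix i x
    have "times_differentiable (Suc i) (\<lambda>t. 1 * smooth_step (k j * t + - (k j * \<alpha>)) + (-1) * smooth_step (k j * t + - (k j * \<beta>)))"
      by (intro times_differentiable_add times_differentiable_affine times_differentiable_smooth_step)
    then have "times_differentiable (Suc i) (\<eta> j)"
      unfolding \<eta>_def[abs_def] by (simp add: right_diff_distrib)
    then show "(deriv ^^ i) (\<eta> j) differentiable at x" by (rule times_differentiable_deriv)
  next
    show "{\<alpha>..\<beta> + 1 / k j} \<subseteq> interior {a..b}" using \<alpha>\<beta> k2(2)[of j] by auto
  qed (use zero\<eta> in auto)
  have cu: "continuous_on {a..b} (\<lambda>t. k j * s' (k j * (t - c)))" for j c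
    by (intro continuous_intros continuous_on_compose2[OF s'(2)]) auto
  have int: "integrable ?M (\<lambda>t. F t * (k j * s' (k j * (t - c))))" for j c
    by (rule integrable_continuous_lebesgue_on continuous_on_mult F cu)+
  have lhs: "(LINT t|?M. F t * deriv (\<eta> j) t) = (LINT t|?M. F t * (k j * s' (k j * (t - \<alpha>)))) - (LINT t|?M. F t * (k j * s' (k j * (t - \<beta>))))" for j
    by (subst Bochner_Integration.integral_diff[OF int int, symmetric]) (simp add: deriv\<eta> right_diff_distrib)
  have "(\<lambda>j. LINT t|?M. F t * deriv (\<eta> j) t) \<longlonglongrightarrow> F \<alpha> - F \<beta>"
    unfolding lhs
    by (intro tendsto_diff has_derivative_const_outside_tendsto[OF F _ _ s' k1]) (use \<alpha>\<beta> k2 in auto)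
  moreover have "(\<lambda>j. LINT t|?M. g t * \<eta> j t) \<longlonglongrightarrow> (LINT t|?M. g t * indicat_real {\<alpha><..\<beta>} t)"
  proof (rule integral_dominated_convergence[where w = "\<lambda>t. 2 * \<bar>g t\<bar>"])
    have c\<eta>: "continuous_on {a..b} (\<eta> j)" for j
      using d\<eta> DERIV_isCont continuous_at_imp_continuous_on by blast
    show "(\<lambda>t. g t * \<eta> j t) \<in> borel_measurable ?M" for j
      using integrable_mult_continuous[OF g c\<eta>] by auto
    show "(\<lambda>t. g t * indicat_real {\<alpha><..\<beta>} t) \<in> borel_measurable ?M"
      using g \<alpha>\<beta> by (intro borel_measurable_times borel_measurable_indicator)
        (auto simp: sets_restrict_space_iff)
    show "integrable ?M (\<lambda>t. 2 * \<bar>g t\<bar>)" using g by auto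
    show "AE t in ?M. norm (g t * \<eta> j t) \<le> 2 * \<bar>g t\<bar>" for j
    proof (rule AE_I2)
      fix t
      have "\<bar>\<eta> j t\<bar> \<le> 2" using smooth_step_values(3)[of "k j * (t - \<alpha>)"] smooth_step_values(3)[of "k j * (t - \<beta>)"]
        unfolding \<eta>_def by linarith
      from mult_left_mono[OF this, of "\<bar>g t\<bar>"] show "norm (g t * \<eta> j t) \<le> 2 * \<bar>g t\<bar>"
        by (simp add: abs_mult mult.commute)
    qed
    show "AE t in ?M. (\<lambda>j. g t * \<eta> j t) \<longlonglongrightarrow> g t * indicat_real {\<alpha><..\<beta>} t"
    proof (rule AE_I2)
      fix t
      have step: "(\<lambda>j. smooth_step (k j * (t - c))) \<longlonglongrightarrow> indicat_real {c<..} t" for c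
      proof (cases "t \<le> c")
        case True
        then have "smooth_step (k j * (t - c)) = 0" for j
          using k2(1)[of j] by (intro smooth_step_values) (auto simp: mult_le_0_iff)
        then show ?thesis using True by simp
      next
        case False
        have "eventually (\<lambda>j. k j > 1 / (t - c)) sequentially"
          using k1 by (simp add: filterlim_at_top_dense)
        then have "eventually (\<lambda>j. smooth_step (k j * (t - c)) = 1) sequentially"
        proof eventually_elim
          case (elim j)
          then have "k j * (t - c) \<ge> 1" using False by (simp add: field_simps)
          then show ?case by (rule smooth_step_values)
        qed
        then show ?thesis using False by (simp add: tendsto_eventually)
      qed
      have "(\<lambda>j. g t * \<eta> j t) \<longlonglongrightarrow> g t * (indicat_real {\<alpha><..} t - indicat_real {\<beta><..} t)"
        unfolding \<eta>_def by (intro tendsto_intros step)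
      moreover have "indicat_real {\<alpha><..} t - indicat_real {\<beta><..} t = indicat_real {\<alpha><..\<beta>} t"
        using \<alpha>\<beta> by (auto simp: indicator_def)
      ultimately show "(\<lambda>j. g t * \<eta> j t) \<longlonglongrightarrow> g t * indicat_real {\<alpha><..\<beta>} t" by simp
    qed
  qed
  ultimately have "F \<alpha> - F \<beta> = - (LINT t|?M. g t * indicat_real {\<alpha><..\<beta>} t)"
    using weak[OF test] by (auto intro: LIMSEQ_unique tendsto_minus)
  then show ?thesis by simp
qed

text \<open>Test functions only see interior points, where \<open>F\<close> minus the integral of
  \<open>g\<close> is constant by the increment formula; continuity carries the constant to both
  endpoints.\<close>

lemma weak_derivative_primitive:
  fixes F g :: "real \<Rightarrow> real"
  assumes ab: "a < b" and F: "continuous_on {a..b} F" and g: "integrable (lebesgue_on {a..b}) g"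
    and weak: "\<And>\<eta>. test_fun {a..b} \<eta> \<Longrightarrow>
      (LINT t|lebesgue_on {a..b}. F t * deriv \<eta> t) = - (LINT t|lebesgue_on {a..b}. g t * \<eta> t)"
    and x: "x \<in> {a..b}"
  shows "F x = F a + integral {a..x} g"
proof -
  have gi: "g integrable_on {a..b}" using g by (simp add: integrable_on_lebesgue_on)
  define \<Phi> where "\<Phi> t = F t - integral {a..t} g" for t
  have cont: "continuous_on {a..b} \<Phi>"
    unfolding \<Phi>_def by (intro continuous_intros F indefinite_integral_continuous_1 gi)
  have le: "\<Phi> \<beta> = \<Phi> \<alpha>" if "a < \<alpha>" "\<alpha> \<le> \<beta>" "\<beta> < b" for \<alpha> \<beta>
  proof -
    have s: "{\<alpha><..\<beta>} \<inter> {a..b} = {\<alpha><..\<beta>}" using that by auto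
    have "(LINT t|lebesgue_on {a..b}. g t * indicat_real {\<alpha><..\<beta>} t)
        = integral {a..b} (\<lambda>t. g t * indicat_real {\<alpha><..\<beta>} t)"
      using that by (intro lebesgue_integral_eq_integral integrable_real_mult_indicator g)
        (auto simp: sets_restrict_space_iff)
    also have "\<dots> = integral {a..b} (\<lambda>t. if t \<in> {\<alpha><..\<beta>} then g t else 0)"
      by (intro Henstock_Kurzweil_Integration.integral_cong) (auto simp: indicator_def)
    also have "\<dots> = integral {\<alpha><..\<beta>} g"
      using s by (simp only: integral_restrict_Int inf_commute)
    also have "\<dots> = integral {\<alpha>..\<beta>} g"
      by (rule integral_subset_negligible) (auto intro: negligible_subset[of "{\<alpha>}"])
    finally have "F \<beta> - F \<alpha> = integral {\<alpha>..\<beta>} g"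
      using weak_derivative_increment[OF F g weak that] by simp
    moreover have "integral {a..\<alpha>} g + integral {\<alpha>..\<beta>} g = integral {a..\<beta>} g"
      using that by (intro Henstock_Kurzweil_Integration.integral_combine integrable_on_subinterval[OF gi]) auto
    ultimately show ?thesis by (simp add: \<Phi>_def)
  qed
  define c where "c = (a + b) / 2"
  have c: "a < c" "c < b" using ab by (auto simp: c_def)
  have const: "\<Phi> t = \<Phi> c" if "t \<in> {a<..<b}" for t
    using le[of t c] le[of c t] that c by (cases "t \<le> c") auto
  have "\<Phi> t = \<Phi> c" if "t \<in> {a..b}" for t
    using continuous_constant_on_closure[of "{a<..<b}" \<Phi> "\<Phi> c" t] cont const that ab by auto
  from this[of x] this[of a] x ab show ?thesis by (simp add: \<Phi>_def)
qed

lemma primitive_by_parts: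
  fixes F g E e :: "real \<Rightarrow> real"
  assumes ab: "a \<le> b" and g: "integrable (lebesgue_on {a..b}) g"
    and F: "\<And>x. x \<in> {a..b} \<Longrightarrow> F x = F a + integral {a..x} g"
    and E: "\<And>x. x \<in> {a..b} \<Longrightarrow> (E has_real_derivative e x) (at x within {a..b})"
    and e: "continuous_on {a..b} e"
  shows "(LINT t|lebesgue_on {a..b}. F t * e t) = F b * E b - F a * E a - (LINT t|lebesgue_on {a..b}. g t * E t)"
proof -
  let ?M = "lebesgue_on {a..b}"
  have gi: "g integrable_on {a..b}" using g by (simp add: integrable_on_lebesgue_on)
  have cF: "continuous_on {a..b} F"
  proof (rule continuous_on_eq)
    show "continuous_on {a..b} (\<lambda>x. F a + integral {a..x} g)"
      by (intro continuous_intros indefinite_integral_continuous_1 gi)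
  qed (rule F[symmetric])
  have cE: "continuous_on {a..b} E" using E by (rule DERIV_continuous_on)
  have iFe: "integrable ?M (\<lambda>t. F t * e t)"
    using cF e by (intro integrable_continuous_lebesgue_on continuous_intros)
  have igE: "integrable ?M (\<lambda>t. g t * E t)" by (rule integrable_mult_continuous[OF g cE])
  define p where "p t = F t * e t + g t * E t" for t
  define q where "q t = \<bar>e t\<bar> + \<bar>g t\<bar>" for t
  have ip: "integrable ?M p" unfolding p_def using iFe igE by auto
  have iq: "integrable ?M q" unfolding q_def
    by (rule Bochner_Integration.integrable_add integrable_continuous_lebesgue_on[OF continuous_on_rabs[OF e]]
        integrable_abs g)+
  note on = integrable_on_lebesgue_on
  have pi: "p integrable_on {a..b}" and qi: "q integrable_on {a..b}" using ip iq by (auto simp: on)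
  define \<Phi> where "\<Phi> x = F x * E x - integral {a..x} p" for x
  have "\<Phi> b = \<Phi> a"
  proof (rule constant_of_small_increments[OF ab, where m = "\<lambda>x. integral {a..x} q"])
    fix \<epsilon> :: real assume \<epsilon>: "\<epsilon> > 0"
    obtain \<delta>1 where \<delta>1: "\<delta>1 > 0" "\<And>x y. x \<in> {a..b} \<Longrightarrow> y \<in> {a..b} \<Longrightarrow> \<bar>y - x\<bar> < \<delta>1 \<Longrightarrow> \<bar>F y - F x\<bar> < \<epsilon>"
      using compact_uniformly_continuous[OF cF] \<epsilon> unfolding uniformly_continuous_on_def dist_real_def by (metis compact_Icc)
    obtain \<delta>2 where \<delta>2: "\<delta>2 > 0" "\<And>x y. x \<in> {a..b} \<Longrightarrow> y \<in> {a..b} \<Longrightarrow> \<bar>y - x\<bar> < \<delta>2 \<Longrightarrow> \<bar>E y - E x\<bar> < \<epsilon>"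
      using compact_uniformly_continuous[OF cE] \<epsilon> unfolding uniformly_continuous_on_def dist_real_def by (metis compact_Icc)
    have "\<bar>\<Phi> y - \<Phi> x\<bar> \<le> \<epsilon> * (integral {a..y} q - integral {a..x} q)"
      if xy: "a \<le> x" "x \<le> y" "y \<le> b" "y - x < min \<delta>1 \<delta>2" for x y
    proof -
      have comb: "integral {a..y} f - integral {a..x} f = integral {x..y} f" if "f integrable_on {a..b}" for f :: "real \<Rightarrow> real"
        using Henstock_Kurzweil_Integration.integral_combine[of a x y f] xy integrable_on_subinterval[OF that, of a y] by auto
      have sub: "f integrable_on {x..y}" if "f integrable_on {a..b}" for f :: "real \<Rightarrow> real"
        using integrable_on_subinterval[OF that, of x y] xy by auto
      have ei: "e integrable_on {a..b}" using e by (rule integrable_continuous_interval)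
      have dF: "F y - F x = integral {x..y} g"
        using F[of x, OF atLeastAtMost_iff[THEN iffD2]] F[of y, OF atLeastAtMost_iff[THEN iffD2]] comb[OF gi] xy by linarith
      have dE: "E y - E x = integral {x..y} e"
      proof (rule integral_unique[symmetric], rule fundamental_theorem_of_calculus[OF xy(2)])
        fix t assume "t \<in> {x..y}"
        then show "(E has_vector_derivative e t) (at t within {x..y})"
          using E[of t] xy by (auto simp: has_real_derivative_iff_has_vector_derivative[symmetric]
              intro: DERIV_subset)
      qed
      \<comment> \<open>From \<open>F y * E y - F x * E x = F y * (E y - E x) + E x * (F y - F
        x)\<close>: the integrand becomes \<open>(F y - F t) * e t + (E x - E t) * g t\<close>,
        small by uniform continuity of \<open>F\<close> and \<open>E\<close>.\<close>
      define u where "u t = (F y * e t + E x * g t) - p t" for t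
      have ui: "u integrable_on {x..y}" unfolding u_def
        using sub[OF ei] sub[OF gi] sub[OF pi]
        by (intro integrable_diff integrable_add integrable_on_mult_right)
      have "\<Phi> y - \<Phi> x = (F y * (E y - E x) + E x * (F y - F x)) - integral {x..y} p"
        using comb[OF pi] by (simp add: \<Phi>_def algebra_simps)
      also have "\<dots> = integral {x..y} u" unfolding u_def dE dF
        using sub[OF ei] sub[OF gi] sub[OF pi]
        by (simp add: integral_diff integral_add integrable_add integrable_on_mult_right)
      finally have 1: "\<Phi> y - \<Phi> x = integral {x..y} u" .
      have "norm (integral {x..y} u) \<le> integral {x..y} (\<lambda>t. \<epsilon> * q t)"
      proof (rule integral_norm_bound_integral[OF ui])
        show "(\<lambda>t. \<epsilon> * q t) integrable_on {x..y}" using sub[OF qi] by (rule integrable_on_mult_right)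
        fix t assume t: "t \<in> {x..y}"
        have "\<bar>F y - F t\<bar> < \<epsilon>" using \<delta>1(2)[of t y] t xy by auto
        moreover have "\<bar>E x - E t\<bar> < \<epsilon>" using \<delta>2(2)[of t x] t xy by auto
        ultimately have "\<bar>F y - F t\<bar> * \<bar>e t\<bar> + \<bar>E x - E t\<bar> * \<bar>g t\<bar> \<le> \<epsilon> * \<bar>e t\<bar> + \<epsilon> * \<bar>g t\<bar>"
          by (intro add_mono mult_right_mono) auto
        moreover have "\<bar>u t\<bar> \<le> \<bar>F y - F t\<bar> * \<bar>e t\<bar> + \<bar>E x - E t\<bar> * \<bar>g t\<bar>"
        proof -
          have "u t = (F y - F t) * e t + (E x - E t) * g t" by (simp add: u_def p_def algebra_simps)
          then show ?thesis by (metis abs_mult abs_triangle_ineq)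
        qed
        ultimately show "norm (u t) \<le> \<epsilon> * q t" by (simp add: q_def algebra_simps)
      qed
      also have "\<dots> = \<epsilon> * (integral {a..y} q - integral {a..x} q)" using comb[OF qi] by simp
      finally show ?thesis using 1 by simp
    qed
    then show "\<exists>\<delta>>0. \<forall>x y. a \<le> x \<longrightarrow> x \<le> y \<longrightarrow> y \<le> b \<longrightarrow> y - x < \<delta> \<longrightarrow>
        \<bar>\<Phi> y - \<Phi> x\<bar> \<le> \<epsilon> * (integral {a..y} q - integral {a..x} q)"
      using \<delta>1(1) \<delta>2(1) by (intro exI[of _ "min \<delta>1 \<delta>2"]) auto
  qed
  then have "F b * E b - F a * E a = integral {a..b} p" by (simp add: \<Phi>_def)
  also have "\<dots> = (LINT t|?M. p t)" using ip by (simp add: lebesgue_integral_eq_integral)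
  also have "\<dots> = (LINT t|?M. F t * e t) + (LINT t|?M. g t * E t)"
    unfolding p_def by (rule Bochner_Integration.integral_add[OF iFe igE])
  finally show ?thesis by simp
qed

subsection \<open>Integrals over a moving window\<close>

lemma shifted_uniform_continuity:
  fixes e :: "real \<Rightarrow> real"
  assumes e: "continuous_on {A..B} e" and \<epsilon>: "\<epsilon> > 0"
  obtains \<delta> where "\<delta> > 0" "\<And>x y. x \<in> {A..B} \<Longrightarrow> y \<in> {A..B} \<Longrightarrow> \<bar>y - x\<bar> < \<delta> \<Longrightarrow> \<bar>e y - e x\<bar> < \<epsilon>"
  using compact_uniformly_continuous[OF e] \<epsilon> unfolding uniformly_continuous_on_def dist_real_def
  by (metis compact_Icc)

lemma lint_abs_le:
  fixes g u :: "real \<Rightarrow> real"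
  assumes g: "integrable M g" and gu: "integrable M (\<lambda>t. g t * u t)"
    and le: "\<And>t. t \<in> space M \<Longrightarrow> \<bar>u t\<bar> \<le> c"
  shows "\<bar>LINT t|M. g t * u t\<bar> \<le> c * (LINT t|M. \<bar>g t\<bar>)"
proof -
  have "\<bar>LINT t|M. g t * u t\<bar> \<le> (LINT t|M. \<bar>g t * u t\<bar>)" by (rule integral_abs_bound)
  also have "\<dots> \<le> (LINT t|M. c * \<bar>g t\<bar>)"
  proof (rule integral_mono)
    fix t assume "t \<in> space M"
    from mult_left_mono[OF le[OF this], of "\<bar>g t\<bar>"] show "\<bar>g t * u t\<bar> \<le> c * \<bar>g t\<bar>"
      by (simp add: abs_mult mult.commute)
  qed (use g gu in auto)
  finally show ?thesis by simp
qed

lemma continuous_shift: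
  fixes e :: "real \<Rightarrow> real"
  assumes "continuous_on {A..B} e" "A \<le> s + a" "s + b \<le> B"
  shows "continuous_on {a..b} (\<lambda>\<tau>. e (s + \<tau>))"
  by (rule continuous_on_compose2[OF assms(1)]) (use assms in \<open>auto intro!: continuous_intros\<close>)

text \<open>Supplies the continuity in time of the moment blocks of \<theta>, from which solutions
  with \<open>w = 0\<close> become classical.\<close>

lemma continuous_on_delay_integral:
  fixes g e :: "real \<Rightarrow> real"
  assumes g: "integrable (lebesgue_on {a..b}) g" and e: "continuous_on {A..B} e"
  shows "continuous_on {A - a..B - b} (\<lambda>s. LINT \<tau>|lebesgue_on {a..b}. g \<tau> * e (s + \<tau>))"
  unfolding continuous_on_iff
proof (intro ballI allI impI)
  fix s \<epsilon> :: real assume s: "s \<in> {A - a..B - b}" and \<epsilon>: "\<epsilon> > 0"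
  let ?M = "lebesgue_on {a..b}"
  define G where "G = (LINT \<tau>|?M. \<bar>g \<tau>\<bar>)"
  have G: "G \<ge> 0" by (simp add: G_def)
  \<comment> \<open>\<open>G + 1\<close> rather than \<open>G\<close>, which is 0 when
    \<open>g\<close> vanishes almost everywhere.\<close>
  obtain \<delta> where \<delta>: "\<delta> > 0" "\<And>x y. x \<in> {A..B} \<Longrightarrow> y \<in> {A..B} \<Longrightarrow> \<bar>y - x\<bar> < \<delta> \<Longrightarrow> \<bar>e y - e x\<bar> < \<epsilon> / (G + 1)"
    using shifted_uniform_continuity[OF e, of "\<epsilon> / (G + 1)"] \<epsilon> G by auto
  have "dist (LINT \<tau>|?M. g \<tau> * e (s' + \<tau>)) (LINT \<tau>|?M. g \<tau> * e (s + \<tau>)) < \<epsilon>"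
    if s': "s' \<in> {A - a..B - b}" "dist s' s < \<delta>" for s'
  proof -
    have c: "continuous_on {a..b} (\<lambda>\<tau>. e (x + \<tau>))" if "x \<in> {A - a..B - b}" for x
      using continuous_shift[OF e, of x a b] that by auto
    have "(LINT \<tau>|?M. g \<tau> * e (s' + \<tau>)) - (LINT \<tau>|?M. g \<tau> * e (s + \<tau>)) = (LINT \<tau>|?M. g \<tau> * (e (s' + \<tau>) - e (s + \<tau>)))"
      using Bochner_Integration.integral_diff[OF integrable_mult_continuous[OF g c[OF s'(1)]] integrable_mult_continuous[OF g c[OF s]]]
      by (simp add: right_diff_distrib)
    moreover have "\<bar>LINT \<tau>|?M. g \<tau> * (e (s' + \<tau>) - e (s + \<tau>))\<bar> \<le> \<epsilon> / (G + 1) * G"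
      unfolding G_def[symmetric]
    proof (subst G_def, rule lint_abs_le[OF g])
      show "integrable ?M (\<lambda>\<tau>. g \<tau> * (e (s' + \<tau>) - e (s + \<tau>)))"
        using c[OF s'(1)] c[OF s] by (intro integrable_mult_continuous[OF g] continuous_intros)
      fix \<tau> assume "\<tau> \<in> space ?M"
      then show "\<bar>e (s' + \<tau>) - e (s + \<tau>)\<bar> \<le> \<epsilon> / (G + 1)"
        using \<delta>(2)[of "s + \<tau>" "s' + \<tau>"] s s' by (auto simp: dist_real_def)
    qed
    moreover have "\<epsilon> / (G + 1) * G < \<epsilon>" using G \<epsilon> by (simp add: field_simps)
    ultimately show ?thesis by (simp add: dist_real_def)
  qed
  then show "\<exists>\<delta>>0. \<forall>s'\<in>{A - a..B - b}. dist s' s < \<delta> \<longrightarrow>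
      dist (LINT \<tau>|?M. g \<tau> * e (s' + \<tau>)) (LINT \<tau>|?M. g \<tau> * e (s + \<tau>)) < \<epsilon>" using \<delta>(1) by blast
qed

text \<open>By the mean value theorem the difference quotient of \<open>E\<close> is a value of
  \<open>e\<close> between \<open>s + \<tau>\<close> and \<open>t + \<tau>\<close>; uniform
  continuity makes it close to \<open>e (t + \<tau>)\<close> for all \<open>\<tau>\<close> at
  once.\<close>

lemma delay_integral_of_primitive_has_derivative:
  fixes g e E :: "real \<Rightarrow> real"
  assumes g: "integrable (lebesgue_on {a..b}) g" and e: "continuous_on {A..B} e"
    and E: "\<And>x. x \<in> {A<..<B} \<Longrightarrow> (E has_real_derivative e x) (at x)"
    and t: "A < t + a" "t + b < B"
  shows "((\<lambda>s. LINT \<tau>|lebesgue_on {a..b}. g \<tau> * E (s + \<tau>)) has_real_derivative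
    (LINT \<tau>|lebesgue_on {a..b}. g \<tau> * e (t + \<tau>))) (at t)"
  unfolding has_field_derivative_iff
proof (rule LIM_I)
  fix \<epsilon> :: real assume \<epsilon>: "\<epsilon> > 0"
  let ?M = "lebesgue_on {a..b}"
  define G where "G = (LINT \<tau>|?M. \<bar>g \<tau>\<bar>)"
  have G: "G \<ge> 0" by (simp add: G_def)
  obtain \<delta> where \<delta>: "\<delta> > 0" "\<And>x y. x \<in> {A..B} \<Longrightarrow> y \<in> {A..B} \<Longrightarrow> \<bar>y - x\<bar> < \<delta> \<Longrightarrow> \<bar>e y - e x\<bar> < \<epsilon> / (G + 1)"
    using shifted_uniform_continuity[OF e, of "\<epsilon> / (G + 1)"] \<epsilon> G by auto
  \<comment> \<open>Besides \<open>\<delta>\<close>, the two margins keep the shifted window inside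
    the open interval where \<open>E\<close> is differentiable.\<close>
  define r where "r = min \<delta> (min (t + a - A) (B - t - b))"
  have r: "r > 0" using \<delta> t by (simp add: r_def)
  have cE: "continuous_on {A<..<B} E" using E by (meson DERIV_isCont continuous_at_imp_continuous_on)
  have "norm (((LINT \<tau>|?M. g \<tau> * E (s + \<tau>)) - (LINT \<tau>|?M. g \<tau> * E (t + \<tau>))) / (s - t)
      - (LINT \<tau>|?M. g \<tau> * e (t + \<tau>))) < \<epsilon>" if s: "s \<noteq> t" "\<bar>s - t\<bar> < r" for s
  proof -
    have in_s: "A < s + a" "s + b < B" using s(2) by (auto simp: r_def)
    have sc: "continuous_on {a..b} (\<lambda>\<tau>. E (x + \<tau>))" if "A < x + a" "x + b < B" for x
      by (rule continuous_on_compose2[OF cE]) (use that in \<open>auto intro!: continuous_intros\<close>)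
    have ec: "continuous_on {a..b} (\<lambda>\<tau>. e (t + \<tau>))" using continuous_shift[OF e] t by auto
    define u where "u \<tau> = (E (s + \<tau>) - E (t + \<tau>)) / (s - t) - e (t + \<tau>)" for \<tau>
    have uc: "continuous_on {a..b} u" unfolding u_def
      by (intro continuous_intros sc[OF in_s] sc[OF t] ec) (use s in auto)
    note i1 = integrable_mult_continuous[OF g sc[OF in_s]] and i2 = integrable_mult_continuous[OF g sc[OF t]]
      and i3 = integrable_mult_continuous[OF g ec]
    have "((LINT \<tau>|?M. g \<tau> * E (s + \<tau>)) - (LINT \<tau>|?M. g \<tau> * E (t + \<tau>))) / (s - t) - (LINT \<tau>|?M. g \<tau> * e (t + \<tau>))
      = (LINT \<tau>|?M. (g \<tau> * E (s + \<tau>) - g \<tau> * E (t + \<tau>)) / (s - t) - g \<tau> * e (t + \<tau>))"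
      using i1 i2 i3 by simp
    also have "\<dots> = (LINT \<tau>|?M. g \<tau> * u \<tau>)"
      by (intro Bochner_Integration.integral_cong refl) (simp add: u_def algebra_simps diff_divide_distrib)
    finally have eq: "((LINT \<tau>|?M. g \<tau> * E (s + \<tau>)) - (LINT \<tau>|?M. g \<tau> * E (t + \<tau>))) / (s - t) - (LINT \<tau>|?M. g \<tau> * e (t + \<tau>))
      = (LINT \<tau>|?M. g \<tau> * u \<tau>)" .
    have mv: "\<exists>z. x \<le> z \<and> z \<le> y \<and> (E y - E x) / (y - x) = e z" if xy: "A < x" "x < y" "y < B" for x y
    proof -
      obtain z where "z > x" "z < y" "E y - E x = (y - x) * e z"
        using MVT2[of x y E e] E xy by auto
      then show ?thesis using xy by (intro exI[of _ z]) auto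
    qed
    have ub: "\<bar>u \<tau>\<bar> \<le> \<epsilon> / (G + 1)" if \<tau>: "\<tau> \<in> {a..b}" for \<tau>
    proof -
      let ?x = "min (s + \<tau>) (t + \<tau>)" and ?y = "max (s + \<tau>) (t + \<tau>)"
      have xy: "A < ?x" "?x < ?y" "?y < B" using \<tau> t in_s s by auto
      obtain z where z: "?x \<le> z" "z \<le> ?y" "(E ?y - E ?x) / (?y - ?x) = e z" using mv[OF xy] by blast
      have "(E (s + \<tau>) - E (t + \<tau>)) / (s - t) = (E ?y - E ?x) / (?y - ?x)"
        by (cases "s < t") (use s in \<open>auto simp: min_def max_def field_simps\<close>)
      then have "u \<tau> = e z - e (t + \<tau>)" using z by (simp add: u_def)
      moreover have "\<bar>z - (t + \<tau>)\<bar> < \<delta>" using z(1,2) s(2)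
        by (auto simp: r_def min_def max_def abs_if split: if_splits)
      ultimately show ?thesis using \<delta>(2)[of "t + \<tau>" z] z xy t \<tau> by auto
    qed
    have "\<bar>LINT \<tau>|?M. g \<tau> * u \<tau>\<bar> \<le> \<epsilon> / (G + 1) * G"
      unfolding G_def using ub
      by (intro lint_abs_le[OF g integrable_mult_continuous[OF g uc]]) (auto simp: G_def)
    also have "\<dots> < \<epsilon>" using G \<epsilon> by (simp add: field_simps)
    finally show ?thesis by (simp only: eq real_norm_def)
  qed
  then show "\<exists>r>0. \<forall>s. s \<noteq> t \<and> norm (s - t) < r \<longrightarrow>
      norm (((LINT \<tau>|?M. g \<tau> * E (s + \<tau>)) - (LINT \<tau>|?M. g \<tau> * E (t + \<tau>))) / (s - t)
      - (LINT \<tau>|?M. g \<tau> * e (t + \<tau>))) < \<epsilon>" using r by auto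
qed

text \<open>The signal \<open>e\<close> is only continuous, so the derivative is moved to the kernel: integrate by
  parts against a primitive \<open>E\<close> of \<open>e\<close> and differentiate \<open>E\<close> under the integral sign.\<close>

lemma delay_integral_has_derivative:
  fixes F g e :: "real \<Rightarrow> real"
  assumes ab: "a \<le> b" and g: "integrable (lebesgue_on {a..b}) g"
    and F: "\<And>x. x \<in> {a..b} \<Longrightarrow> F x = F a + integral {a..x} g"
    and e: "continuous_on {A..B} e" and t: "A < t + a" "t + b < B"
  shows "((\<lambda>s. LINT \<tau>|lebesgue_on {a..b}. F \<tau> * e (s + \<tau>)) has_real_derivative
    (F b * e (t + b) - F a * e (t + a) - (LINT \<tau>|lebesgue_on {a..b}. g \<tau> * e (t + \<tau>)))) (at t)"
proof -
  let ?M = "lebesgue_on {a..b}"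
  define E where "E x = integral {A..x} e" for x
  have E: "(E has_real_derivative e x) (at x)" if "x \<in> {A<..<B}" for x
    using integral_has_real_derivative[OF e, of x] that unfolding E_def
    by (simp add: at_within_Icc_at)
  have parts: "(LINT \<tau>|?M. F \<tau> * e (s + \<tau>)) = F b * E (s + b) - F a * E (s + a) - (LINT \<tau>|?M. g \<tau> * E (s + \<tau>))"
    if s: "A < s + a" "s + b < B" for s
  proof (rule primitive_by_parts[OF ab g F])
    fix \<tau> assume "\<tau> \<in> {a..b}"
    then have "(E has_real_derivative e (s + \<tau>)) (at (s + \<tau>))" using s by (intro E) auto
    then have "((\<lambda>\<tau>. E (s + \<tau>)) has_real_derivative e (s + \<tau>)) (at \<tau>)"
      by (simp add: DERIV_shift add.commute)
    then show "((\<lambda>\<tau>. E (s + \<tau>)) has_real_derivative e (s + \<tau>)) (at \<tau> within {a..b})"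
      by (rule has_field_derivative_at_within)
  next
    show "continuous_on {a..b} (\<lambda>\<tau>. e (s + \<tau>))" using continuous_shift[OF e] s by auto
  qed
  have Es: "((\<lambda>s. E (s + c)) has_real_derivative e (t + c)) (at t)" if "c \<in> {a..b}" for c
    using E[of "t + c"] that t by (simp add: DERIV_shift)
  have "((\<lambda>s. F b * E (s + b) - F a * E (s + a) - (LINT \<tau>|?M. g \<tau> * E (s + \<tau>))) has_real_derivative
    (F b * e (t + b) - F a * e (t + a) - (LINT \<tau>|?M. g \<tau> * e (t + \<tau>)))) (at t)"
    by (intro DERIV_diff DERIV_cmult Es delay_integral_of_primitive_has_derivative[OF g e E t]) (use ab in auto)
  then show ?thesis
  proof (rule has_field_derivative_transform_within_open[where S = "{A - a<..<B - b}"])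
    fix s assume "s \<in> {A - a<..<B - b}"
    then show "F b * E (s + b) - F a * E (s + a) - (LINT \<tau>|?M. g \<tau> * E (s + \<tau>)) = (LINT \<tau>|?M. F \<tau> * e (s + \<tau>))"
      using parts[of s] by simp
  qed (use t in auto)
qed

subsection \<open>Definite matrices\<close>

lemma scalar_prod_self_ge_0: "(x :: real vec) \<bullet> x \<ge> 0"
  by (auto simp: scalar_prod_def intro!: sum_nonneg)

lemma scalar_prod_self_eq_0:
  fixes x :: "real vec"
  assumes "x \<in> carrier_vec n"
  shows "x \<bullet> x = 0 \<longleftrightarrow> x = 0\<^sub>v n"
proof
  assume "x \<bullet> x = 0"
  then have "\<forall>i\<in>{0..<dim_vec x}. x $ i * x $ i = 0"
    unfolding scalar_prod_def by (subst (asm) sum_nonneg_eq_0_iff) auto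
  then show "x = 0\<^sub>v n" using assms by (intro eq_vecI) auto
qed (use assms in auto)

lemma scalar_prod_self_pos:
  fixes x :: "real vec"
  assumes "x \<in> carrier_vec n" "x \<noteq> 0\<^sub>v n"
  shows "x \<bullet> x > 0"
  using scalar_prod_self_ge_0[of x] scalar_prod_self_eq_0[OF assms(1)] assms(2) by linarith

lemma transpose_scalar_prod:
  fixes A :: "real mat"
  assumes "A \<in> carrier_mat k n" "x \<in> carrier_vec k" "y \<in> carrier_vec n"
  shows "(A\<^sup>\<top> *\<^sub>v x) \<bullet> y = x \<bullet> (A *\<^sub>v y)"
  using transpose_vec_mult_scalar[OF assms(1,3,2)] assms
  by (metis carrier_vecI comm_scalar_prod dim_mult_mat_vec index_transpose_mat(2) carrier_matD(1) carrier_matD(2))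

lemma sym_scalar_prod:
  fixes A :: "real mat"
  assumes "A \<in> carrier_mat n n" "A\<^sup>\<top> = A" "x \<in> carrier_vec n" "y \<in> carrier_vec n"
  shows "(A *\<^sub>v x) \<bullet> y = x \<bullet> (A *\<^sub>v y)"
  using transpose_scalar_prod[OF assms(1,3,4)] assms(2) by simp

lemma mult_mat_zero_vec:
  fixes A :: "real mat"
  assumes "A \<in> carrier_mat k n"
  shows "A *\<^sub>v 0\<^sub>v n = 0\<^sub>v k"
  using assms by (intro eq_vecI) auto

lemma eq_mat_mult_vecI:
  fixes A B :: "real mat"
  assumes A: "A \<in> carrier_mat k n" and B: "B \<in> carrier_mat k n"
    and eq: "\<And>x. x \<in> carrier_vec n \<Longrightarrow> A *\<^sub>v x = B *\<^sub>v x"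
  shows "A = B"
proof (rule eq_matI)
  fix i j assume ij: "i < dim_row B" "j < dim_col B"
  have "(A *\<^sub>v unit_vec n j) $ i = (B *\<^sub>v unit_vec n j) $ i" by (simp add: eq)
  then show "A $$ (i, j) = B $$ (i, j)" using ij A B by auto
qed (use A B in auto)

lemma eq_vec_scalar_prodI:
  fixes x y :: "real vec"
  assumes "x \<in> carrier_vec n" "y \<in> carrier_vec n"
    and "\<And>u. u \<in> carrier_vec n \<Longrightarrow> u \<bullet> x = u \<bullet> y"
  shows "x = y"
proof (rule eq_vecI)
  fix i assume "i < dim_vec y"
  then show "x $ i = y $ i" using assms(1,2) assms(3)[of "unit_vec n i"] by auto
qed (use assms in auto)

lemma eq_mat_bilinearI:
  fixes A B :: "real mat"
  assumes A: "A \<in> carrier_mat k n" and B: "B \<in> carrier_mat k n"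
    and eq: "\<And>u x. u \<in> carrier_vec k \<Longrightarrow> x \<in> carrier_vec n \<Longrightarrow> u \<bullet> (A *\<^sub>v x) = u \<bullet> (B *\<^sub>v x)"
  shows "A = B"
  using A B by (intro eq_mat_mult_vecI[OF A B] eq_vec_scalar_prodI[of _ k] eq) auto

lemma split_append_vec:
  assumes "x \<in> carrier_vec (a + b)"
  obtains y z where "y \<in> carrier_vec a" "z \<in> carrier_vec b" "x = y @\<^sub>v z"
  using assms vec_first_last_append by (metis vec_first_carrier vec_last_carrier)

lemma pos_defI:
  assumes "A \<in> carrier_mat n n" "A\<^sup>\<top> = A"
    and "\<And>x. x \<in> carrier_vec n \<Longrightarrow> x \<noteq> 0\<^sub>v n \<Longrightarrow> x \<bullet> (A *\<^sub>v x) > 0"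
  shows "pos_def A"
  using assms by (auto simp: pos_def_def sym_mats_def)

lemma pos_defD:
  assumes "pos_def A" "A \<in> carrier_mat n n"
  shows "A\<^sup>\<top> = A" "x \<in> carrier_vec n \<Longrightarrow> x \<noteq> 0\<^sub>v n \<Longrightarrow> x \<bullet> (A *\<^sub>v x) > 0"
    "x \<in> carrier_vec n \<Longrightarrow> x \<bullet> (A *\<^sub>v x) \<ge> 0"
proof -
  show *: "A\<^sup>\<top> = A" "x \<in> carrier_vec n \<Longrightarrow> x \<noteq> 0\<^sub>v n \<Longrightarrow> x \<bullet> (A *\<^sub>v x) > 0" for x
    using assms by (auto simp: pos_def_def sym_mats_def)
  show "x \<in> carrier_vec n \<Longrightarrow> x \<bullet> (A *\<^sub>v x) \<ge> 0"
    by (cases "x = 0\<^sub>v n") (use assms *(2)[of x] in \<open>auto simp: less_imp_le\<close>)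
qed

lemma pos_def_carrier: "pos_def A \<Longrightarrow> A \<in> carrier_mat (dim_row A) (dim_row A)"
  by (auto simp: pos_def_def sym_mats_def)

subsection \<open>Square roots of positive definite matrices\<close>

text \<open>A complex eigenvector \<open>z = x + i y\<close> exists. Splitting its equation into
  real and imaginary parts and using symmetry gives
  \<open>Im l * (x \<bullet> x + y \<bullet> y) = 0\<close>, so \<open>l\<close> is real and a
  nonzero one of \<open>x\<close>, \<open>y\<close> can be normalised.\<close>

lemma symmetric_real_eigenvector:
  fixes A :: "real mat"
  assumes A: "A \<in> carrier_mat n n" and sym: "A\<^sup>\<top> = A" and n: "n > 0"
  obtains u c where "u \<in> carrier_vec n" "u \<bullet> u = 1" "A *\<^sub>v u = c \<cdot>\<^sub>v u"
proof -
  define B :: "complex mat" where "B = map_mat of_real A"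
  have B: "B \<in> carrier_mat n n" using A by (simp add: B_def)
  from spectrum_non_empty[OF B n] obtain l z where z: "z \<in> carrier_vec n" "z \<noteq> 0\<^sub>v n"
    and ev: "B *\<^sub>v z = l \<cdot>\<^sub>v z"
    using B by (auto simp: spectrum_def eigenvalue_def eigenvector_def)
  define x where "x = vec n (\<lambda>i. Re (z $ i))"
  define y where "y = vec n (\<lambda>i. Im (z $ i))"
  have x: "x \<in> carrier_vec n" and y: "y \<in> carrier_vec n" by (auto simp: x_def y_def)
  have comp: "(\<Sum>j = 0..<n. complex_of_real (A $$ (i, j)) * z $ j) = l * z $ i" if "i < n" for i
  proof -
    have "(B *\<^sub>v z) $ i = (l \<cdot>\<^sub>v z) $ i" by (simp add: ev)
    then show ?thesis using that A B z by (simp add: scalar_prod_def B_def)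
  qed
  have Ax: "A *\<^sub>v x = Re l \<cdot>\<^sub>v x - Im l \<cdot>\<^sub>v y"
  proof (rule eq_vecI)
    fix i assume "i < dim_vec (Re l \<cdot>\<^sub>v x - Im l \<cdot>\<^sub>v y)"
    then have i: "i < n" by (simp add: y_def)
    show "(A *\<^sub>v x) $ i = (Re l \<cdot>\<^sub>v x - Im l \<cdot>\<^sub>v y) $ i"
      using i A arg_cong[OF comp[OF i], of Re] by (simp add: scalar_prod_def x_def y_def)
  qed (use A y in auto)
  have Ay: "A *\<^sub>v y = Im l \<cdot>\<^sub>v x + Re l \<cdot>\<^sub>v y"
  proof (rule eq_vecI)
    fix i assume "i < dim_vec (Im l \<cdot>\<^sub>v x + Re l \<cdot>\<^sub>v y)"
    then have i: "i < n" by (simp add: y_def)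
    show "(A *\<^sub>v y) $ i = (Im l \<cdot>\<^sub>v x + Re l \<cdot>\<^sub>v y) $ i"
      using i A arg_cong[OF comp[OF i], of Im] by (simp add: scalar_prod_def x_def y_def)
  qed (use A y in auto)
  have "(A *\<^sub>v x) \<bullet> y = x \<bullet> (A *\<^sub>v y)" by (rule sym_scalar_prod[OF A sym x y])
  then have "Im l * (x \<bullet> x + y \<bullet> y) = 0"
    using x y by (simp add: Ax Ay minus_scalar_prod_distrib[of _ n] scalar_prod_add_distrib[of _ n] algebra_simps)
  moreover have "x \<bullet> x + y \<bullet> y > 0"
  proof -
    have "\<not> (x = 0\<^sub>v n \<and> y = 0\<^sub>v n)"
    proof
      assume *: "x = 0\<^sub>v n \<and> y = 0\<^sub>v n"
      have "z = 0\<^sub>v n"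
      proof (rule eq_vecI)
        fix i assume i: "i < dim_vec (0\<^sub>v n)"
        then have "x $ i = 0" "y $ i = 0" using * by auto
        then show "z $ i = 0\<^sub>v n $ i" using i by (simp add: x_def y_def complex_eq_iff)
      qed (use z in auto)
      with z show False by simp
    qed
    then show ?thesis
      using scalar_prod_self_ge_0[of x] scalar_prod_self_ge_0[of y] scalar_prod_self_pos[OF x]
        scalar_prod_self_pos[OF y] by linarith
  qed
  ultimately have im: "Im l = 0" by simp
  note found = that
  have scale: thesis if v: "v \<in> carrier_vec n" "v \<noteq> 0\<^sub>v n" "A *\<^sub>v v = Re l \<cdot>\<^sub>v v" for v
  proof -
    have pos: "v \<bullet> v > 0" using v scalar_prod_self_pos by blast
    define u where "u = (1 / sqrt (v \<bullet> v)) \<cdot>\<^sub>v v"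
    have "u \<bullet> u = 1" using v pos by (simp add: u_def)
    moreover have "A *\<^sub>v u = Re l \<cdot>\<^sub>v u" using v A
      by (simp add: u_def mult_mat_vec[OF A v(1)] smult_smult_assoc mult.commute)
    ultimately show thesis using found[of u "Re l"] v by (simp add: u_def)
  qed
  show thesis
  proof (cases "x = 0\<^sub>v n")
    case True
    then have "y \<noteq> 0\<^sub>v n" using \<open>x \<bullet> x + y \<bullet> y > 0\<close> by auto
    moreover have "A *\<^sub>v y = Re l \<cdot>\<^sub>v y" using Ay im x y by auto
    ultimately show thesis using scale y by blast
  next
    case False
    moreover have "A *\<^sub>v x = Re l \<cdot>\<^sub>v x" using Ax im x y by auto
    ultimately show thesis using scale x by blast
  qed
qed

text \<open>The Householder reflection along \<open>u - e\<close>, which exchanges the unit vectors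
  \<open>e\<close> and \<open>u\<close>.\<close>

lemma exists_reflection:
  fixes u :: "real vec"
  assumes u: "u \<in> carrier_vec n" "u \<bullet> u = 1" and n: "n > 0"
  obtains W where "W \<in> carrier_mat n n" "W\<^sup>\<top> = W" "W * W = 1\<^sub>m n" "W *\<^sub>v unit_vec n 0 = u"
proof -
  define e where "e = (unit_vec n 0 :: real vec)"
  define z where "z = u - e"
  \<comment> \<open>For \<open>u = e\<close> the division by zero yields \<open>c = 0\<close>, so
    that \<open>W\<close> is the identity and remains correct.\<close>
  define c where "c = 2 / (z \<bullet> z)"
  define W where "W = mat n n (\<lambda>(i, j). (if i = j then 1 else 0) - c * (z $ i * z $ j))"
  have e: "e \<in> carrier_vec n" and z: "z \<in> carrier_vec n" using u by (auto simp: e_def z_def)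
  have W: "W \<in> carrier_mat n n" by (simp add: W_def)
  have Wx: "W *\<^sub>v x = x - (c * (z \<bullet> x)) \<cdot>\<^sub>v z" if x: "x \<in> carrier_vec n" for x
  proof (rule eq_vecI)
    fix i assume i: "i < dim_vec (x - (c * (z \<bullet> x)) \<cdot>\<^sub>v z)"
    then have i: "i < n" using z by simp
    have "(W *\<^sub>v x) $ i = (\<Sum>j = 0..<n. ((if i = j then 1 else 0) - c * (z $ i * z $ j)) * x $ j)"
      using i W x by (simp add: scalar_prod_def W_def)
    also have "\<dots> = (\<Sum>j = 0..<n. (if i = j then x $ j else 0) - c * z $ i * (z $ j * x $ j))"
      by (rule sum.cong) (auto simp: algebra_simps)
    also have "\<dots> = x $ i - c * z $ i * (\<Sum>j = 0..<n. z $ j * x $ j)"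
      using i by (simp add: sum_subtractf sum_distrib_left)
    finally show "(W *\<^sub>v x) $ i = (x - (c * (z \<bullet> x)) \<cdot>\<^sub>v z) $ i"
      using i x z by (simp add: scalar_prod_def)
  qed (use W z in auto)
  have cc: "c * c * (z \<bullet> z) = 2 * c" by (simp add: c_def)
  have "W * W = 1\<^sub>m n"
  proof (rule eq_mat_mult_vecI[of _ n n])
    fix x :: "real vec" assume x: "x \<in> carrier_vec n"
    let ?a = "c * (z \<bullet> x)"
    have "(W * W) *\<^sub>v x = W *\<^sub>v (x - ?a \<cdot>\<^sub>v z)" using W x by (simp add: Wx)
    also have "\<dots> = (x - ?a \<cdot>\<^sub>v z) - (c * (z \<bullet> (x - ?a \<cdot>\<^sub>v z))) \<cdot>\<^sub>v z"
      using x z by (intro Wx) auto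
    also have "c * (z \<bullet> (x - ?a \<cdot>\<^sub>v z)) = c * (z \<bullet> x) - (c * c * (z \<bullet> z)) * (z \<bullet> x)"
      using x z by (simp add: scalar_prod_minus_distrib[of _ n] algebra_simps)
    also have "\<dots> = - ?a" by (simp only: cc)
    also have "(x - ?a \<cdot>\<^sub>v z) - (- ?a) \<cdot>\<^sub>v z = x" using x z by (intro eq_vecI) auto
    finally show "(W * W) *\<^sub>v x = 1\<^sub>m n *\<^sub>v x" using x by simp
  qed (use W in auto)
  moreover have "W\<^sup>\<top> = W" by (rule eq_matI) (auto simp: W_def)
  moreover have "W *\<^sub>v e = u"
  proof (cases "z \<bullet> z = 0")
    case True
    then have "z = 0\<^sub>v n" using scalar_prod_self_eq_0[OF z] by simp
    moreover from this have "u = e"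
      using u e unfolding z_def by (metis minus_add_minus_vec minus_cancel_vec uminus_zero_vec_eq left_zero_vec
          carrier_vecD eq_vecI index_minus_vec(1) index_zero_vec(1) right_minus_eq)
    ultimately show ?thesis using Wx[OF e] e by (intro eq_vecI) auto
  next
    case False
    have ee: "e \<bullet> e = 1" "u \<bullet> e = e \<bullet> u" using n u e by (auto simp: e_def)
    have "z \<bullet> z = 2 - 2 * (e \<bullet> u)"
      using u e ee by (simp add: z_def scalar_prod_minus_distrib[of _ n] minus_scalar_prod_distrib[of _ n] )
    moreover have "z \<bullet> e = e \<bullet> u - 1"
      using u e ee by (simp add: z_def scalar_prod_minus_distrib[of _ n] minus_scalar_prod_distrib[of _ n] )
    ultimately have "z \<bullet> z = - 2 * (z \<bullet> e)" by simp
    then have "c * (z \<bullet> e) = -1" using False by (simp add: c_def field_simps)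
    then have "W *\<^sub>v e = e - (-1) \<cdot>\<^sub>v z" using Wx[OF e] by simp
    then show ?thesis using u e by (intro eq_vecI) (auto simp: z_def)
  qed
  ultimately show thesis using that W by (simp add: e_def)
qed

lemma pos_def_congruence:
  assumes B: "pos_def B" "B \<in> carrier_mat n n" and W: "W \<in> carrier_mat n n" "W\<^sup>\<top> = W" "W * W = 1\<^sub>m n"
  shows "pos_def (W * B * W)"
proof (rule pos_defI[of _ n])
  show "(W * B * W)\<^sup>\<top> = W * B * W"
    using W B pos_defD(1)[OF B] by (simp add: transpose_mult[of _ n n _ n] assoc_mult_mat[of _ n n _ n _ n])
  fix x :: "real vec" assume x: "x \<in> carrier_vec n" "x \<noteq> 0\<^sub>v n"
  have "(W * B * W) *\<^sub>v x = W *\<^sub>v (B *\<^sub>v (W *\<^sub>v x))"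
    using W B x by (simp add: assoc_mult_mat_vec[of _ n n _ n])
  then have "x \<bullet> ((W * B * W) *\<^sub>v x) = (W *\<^sub>v x) \<bullet> (B *\<^sub>v (W *\<^sub>v x))"
    using sym_scalar_prod[OF W(1,2) x(1), of "B *\<^sub>v (W *\<^sub>v x)"] W B x by simp
  moreover have "W *\<^sub>v x \<noteq> 0\<^sub>v n"
  proof
    assume "W *\<^sub>v x = 0\<^sub>v n"
    then have "W *\<^sub>v (W *\<^sub>v x) = 0\<^sub>v n" using mult_mat_zero_vec[OF W(1)] by simp
    then have "(W * W) *\<^sub>v x = 0\<^sub>v n" using assoc_mult_mat_vec[OF W(1) W(1) x(1)] by simp
    with x W(3) show False by simp
  qed
  ultimately show "x \<bullet> ((W * B * W) *\<^sub>v x) > 0" using pos_defD(2)[OF B] W x by simp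
qed (use B W in auto)

lemma pos_def_diag_block:
  assumes A: "pos_def A" "A \<in> carrier_mat a a" and D: "pos_def D" "D \<in> carrier_mat d d"
  shows "pos_def (four_block_mat A (0\<^sub>m a d) (0\<^sub>m d a) D)"
proof (rule pos_defI[of _ "a + d"])
  show "(four_block_mat A (0\<^sub>m a d) (0\<^sub>m d a) D)\<^sup>\<top> = four_block_mat A (0\<^sub>m a d) (0\<^sub>m d a) D"
    by (subst transpose_four_block_mat[of _ a a _ d _ d]) (use A D pos_defD(1)[OF A] pos_defD(1)[OF D] in auto)
  fix x :: "real vec" assume x: "x \<in> carrier_vec (a + d)" "x \<noteq> 0\<^sub>v (a + d)"
  then obtain y z where yz: "y \<in> carrier_vec a" "z \<in> carrier_vec d" "x = y @\<^sub>v z"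
    using split_append_vec by blast
  have "\<not> (y = 0\<^sub>v a \<and> z = 0\<^sub>v d)" using x yz by auto
  moreover have "x \<bullet> (four_block_mat A (0\<^sub>m a d) (0\<^sub>m d a) D *\<^sub>v x) = y \<bullet> (A *\<^sub>v y) + z \<bullet> (D *\<^sub>v z)"
    using A D yz by (simp add: mult_mat_vec_split[of _ a] scalar_prod_append[of _ a _ d])
  ultimately show "x \<bullet> (four_block_mat A (0\<^sub>m a d) (0\<^sub>m d a) D *\<^sub>v x) > 0"
    using pos_defD(2,3)[OF A, of y] pos_defD(2,3)[OF D, of z] yz by force
qed (use A D in auto)

lemma pos_def_four_block_lower:
  assumes P: "pos_def (four_block_mat A B C D)"
    and c: "A \<in> carrier_mat a a" "B \<in> carrier_mat a d" "C \<in> carrier_mat d a" "D \<in> carrier_mat d d"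
  shows "pos_def D"
proof (rule pos_defI[OF c(4)])
  have car: "four_block_mat A B C D \<in> carrier_mat (a + d) (a + d)" using c by auto
  have "(four_block_mat A B C D)\<^sup>\<top> = four_block_mat A B C D" using pos_defD(1)[OF P car] .
  then have t: "four_block_mat (A\<^sup>\<top>) (C\<^sup>\<top>) (B\<^sup>\<top>) (D\<^sup>\<top>) = four_block_mat A B C D"
    by (subst (asm) transpose_four_block_mat[OF c])
  show "D\<^sup>\<top> = D"
  proof (rule eq_matI)
    fix i j assume ij: "i < dim_row D" "j < dim_col D"
    have "four_block_mat (A\<^sup>\<top>) (C\<^sup>\<top>) (B\<^sup>\<top>) (D\<^sup>\<top>) $$ (a + i, a + j) = four_block_mat A B C D $$ (a + i, a + j)"
      by (simp add: t)
    then show "D\<^sup>\<top> $$ (i, j) = D $$ (i, j)" using ij c by auto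
  qed (use c in auto)
  fix x :: "real vec" assume x: "x \<in> carrier_vec d" "x \<noteq> 0\<^sub>v d"
  have "0\<^sub>v a @\<^sub>v x \<noteq> 0\<^sub>v (a + d)"
  proof
    assume *: "0\<^sub>v a @\<^sub>v x = 0\<^sub>v (a + d)"
    have "x = 0\<^sub>v d"
    proof (rule eq_vecI)
      fix i assume "i < dim_vec (0\<^sub>v d)"
      then show "x $ i = 0\<^sub>v d $ i" using arg_cong[OF *, of "\<lambda>v. v $ (a + i)"] x by auto
    qed (use x in auto)
    with x show False by simp
  qed
  moreover have "(0\<^sub>v a @\<^sub>v x) \<bullet> (four_block_mat A B C D *\<^sub>v (0\<^sub>v a @\<^sub>v x)) = x \<bullet> (D *\<^sub>v x)"
    using c x by (simp add: four_block_mat_mult_vec[of _ a a _ d _ d] scalar_prod_append[of _ a _ d] mult_mat_zero_vec[of _ _ a])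
  ultimately show "x \<bullet> (D *\<^sub>v x) > 0" using pos_defD(2)[OF P car, of "0\<^sub>v a @\<^sub>v x"] x by auto
qed

text \<open>Deflation: a reflection moves a unit eigenvector to the first coordinate, splitting off
  a one-by-one block \<open>c > 0\<close>; the remaining block has a root by induction, and the
  reflection is undone.\<close>

lemma pos_def_sqrt_exists:
  assumes "pos_def A" "A \<in> carrier_mat n n"
  shows "\<exists>Y\<in>carrier_mat n n. pos_def Y \<and> Y * Y = A"
  using assms
proof (induction n arbitrary: A)
  case 0
  have "A * A = A" by (rule eq_matI) (use 0 in auto)
  then show ?case using 0 by blast
next
  case (Suc k)
  note A = Suc.prems
  obtain u c where u: "u \<in> carrier_vec (Suc k)" "u \<bullet> u = 1" "A *\<^sub>v u = c \<cdot>\<^sub>v u"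
    using symmetric_real_eigenvector[OF A(2) pos_defD(1)[OF A]] by blast
  have "u \<noteq> 0\<^sub>v (Suc k)" using u by auto
  then have c: "c > 0" using pos_defD(2)[OF A u(1)] u by simp
  obtain W where W: "W \<in> carrier_mat (Suc k) (Suc k)" "W\<^sup>\<top> = W" "W * W = 1\<^sub>m (Suc k)"
      and We: "W *\<^sub>v unit_vec (Suc k) 0 = u"
    using exists_reflection[OF u(1,2)] by blast
  define B where "B = W * A * W"
  have B: "B \<in> carrier_mat (Suc k) (Suc k)" "pos_def B"
    using pos_def_congruence[OF A W] A W by (auto simp: B_def)
  have "W *\<^sub>v u = unit_vec (Suc k) 0"
    using W by (simp add: We[symmetric] assoc_mult_mat_vec[symmetric, of _ "Suc k" "Suc k" _ "Suc k"])
  then have Be: "B *\<^sub>v unit_vec (Suc k) 0 = c \<cdot>\<^sub>v unit_vec (Suc k) 0"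
    using W A u unfolding B_def
    by (simp add: assoc_mult_mat_vec[of _ "Suc k" "Suc k" _ "Suc k"] We mult_mat_vec[of _ "Suc k" "Suc k"])
  have B0: "B $$ (i, 0) = (if i = 0 then c else 0)" if "i < Suc k" for i
    using arg_cong[OF Be, of "\<lambda>v. v $ i"] that B by simp
  have B0': "B $$ (0, i) = (if i = 0 then c else 0)" if "i < Suc k" for i
    using B0[OF that] pos_defD(1)[OF B(2,1)] that B by (metis carrier_matD index_transpose_mat(1) zero_less_Suc)
  define A' where "A' = mat k k (\<lambda>(i, j). B $$ (Suc i, Suc j))"
  have A': "A' \<in> carrier_mat k k" by (simp add: A'_def)
  define C where "C = mat 1 1 (\<lambda>_. c)"
  define C' where "C' = mat 1 1 (\<lambda>_. sqrt c)"
  have C: "C \<in> carrier_mat 1 1" "C' \<in> carrier_mat 1 1" by (auto simp: C_def C'_def)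
  have CC: "C' * C' = C" by (rule eq_matI) (use c in \<open>auto simp: C_def C'_def scalar_prod_def\<close>)
  have pC': "pos_def C'"
  proof (rule pos_defI[OF C(2)])
    show "C'\<^sup>\<top> = C'" by (rule eq_matI) (auto simp: C'_def)
    fix x :: "real vec" assume x: "x \<in> carrier_vec 1" "x \<noteq> 0\<^sub>v 1"
    then have "x $ 0 \<noteq> 0" by (metis carrier_vecD eq_vecI index_zero_vec less_one)
    then show "x \<bullet> (C' *\<^sub>v x) > 0" using c x
      by (simp add: C'_def scalar_prod_def) (metis mult.left_commute mult_pos_pos not_real_square_gt_zero real_sqrt_gt_zero)
  qed
  have BB: "B = four_block_mat C (0\<^sub>m 1 k) (0\<^sub>m k 1) A'"
    by (rule eq_matI) (use B B0 B0' C in \<open>auto simp: A'_def C_def\<close>)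
  have "pos_def A'" using pos_def_four_block_lower[OF B(2)[unfolded BB] C(1) _ _ A'] by simp
  from Suc.IH[OF this A'] obtain Y where Y: "Y \<in> carrier_mat k k" "pos_def Y" "Y * Y = A'" by blast
  define Z where "Z = four_block_mat C' (0\<^sub>m 1 k) (0\<^sub>m k 1) Y"
  have Z: "Z \<in> carrier_mat (Suc k) (Suc k)" "pos_def Z"
    using pos_def_diag_block[OF pC' C(2) Y(2,1)] four_block_carrier_mat[OF C(2) Y(1), of "0\<^sub>m 1 k" "0\<^sub>m k 1"]
    by (auto simp: Z_def)
  have ZZ: "Z * Z = B" unfolding Z_def BB using C Y CC
    by (subst mult_four_block_mat[of _ 1 1 _ k _ k _ _ 1 _ k]) auto
  have WBW: "W * B * W = A"
  proof -
    have "W * B * W = (W * W) * A * (W * W)" unfolding B_def using W(1) A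
      by (simp add: assoc_mult_mat[of _ "Suc k" "Suc k" _ "Suc k" _ "Suc k"])
    then show ?thesis using W A by simp
  qed
  have "(W * Z * W) * (W * Z * W) = W * Z * (W * W) * Z * W"
    using W(1) Z by (simp add: assoc_mult_mat[of _ "Suc k" "Suc k" _ "Suc k" _ "Suc k"])
  also have "\<dots> = W * (Z * Z) * W"
    using W Z by (simp add: assoc_mult_mat[of _ "Suc k" "Suc k" _ "Suc k" _ "Suc k"])
  finally have "(W * Z * W) * (W * Z * W) = A" using ZZ WBW by simp
  moreover have "pos_def (W * Z * W)" using pos_def_congruence[OF Z(2,1) W] .
  ultimately show ?case using W Z by (intro bexI[of _ "W * Z * W"]) auto
qed

text \<open>With \<open>D = Y - Z\<close> the hypothesis gives \<open>Y * D + D * Z = 0\<close>.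
  Pairing this entrywise with \<open>D\<close> yields a vanishing sum of the nonnegative forms of
  \<open>Y\<close> and \<open>Z\<close> at the columns of \<open>D\<close>, and positive
  definiteness makes every column zero.\<close>

lemma pos_def_sqrt_unique:
  assumes Y: "pos_def Y" "Y \<in> carrier_mat n n" and Z: "pos_def Z" "Z \<in> carrier_mat n n"
    and eq: "Y * Y = Z * Z"
  shows "Y = Z"
proof -
  define D where "D = Y - Z"
  have D: "D \<in> carrier_mat n n" using Y Z by (auto simp: D_def)
  have Yt: "Y\<^sup>\<top> = Y" "Z\<^sup>\<top> = Z" using pos_defD(1)[OF Y] pos_defD(1)[OF Z] by auto
  have Dt: "D\<^sup>\<top> = D" using Y Z Yt by (simp add: D_def transpose_minus)
  have zero: "Y * D + D * Z = 0\<^sub>m n n"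
  proof -
    have "Y * D + D * Z = (Y * Y - Y * Z) + (Y * Z - Z * Z)"
      using Y Z by (simp add: D_def mult_minus_distrib_mat[of _ n n _ n] minus_mult_distrib_mat[of _ n n _ _ n])
    also have "\<dots> = 0\<^sub>m n n" unfolding eq using Y Z by (intro eq_matI) auto
    finally show ?thesis .
  qed
  have ent: "(X * V) $$ (i, j) = (\<Sum>k = 0..<n. X $$ (i, k) * V $$ (k, j))"
    if "X \<in> carrier_mat n n" "V \<in> carrier_mat n n" "i < n" "j < n" for X V :: "real mat" and i j
    using that by (simp add: scalar_prod_def)
  have ds: "D $$ (i, j) = D $$ (j, i)" if "i < n" "j < n" for i j
    using arg_cong[OF Dt, of "\<lambda>M. M $$ (i, j)"] that D by auto
  have zs: "Z $$ (i, j) = Z $$ (j, i)" if "i < n" "j < n" for i j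
    using arg_cong[OF Yt(2), of "\<lambda>M. M $$ (i, j)"] that Z by auto
  have col: "col D j \<bullet> (X *\<^sub>v col D j) = (\<Sum>i = 0..<n. D $$ (i, j) * (\<Sum>k = 0..<n. X $$ (i, k) * D $$ (k, j)))"
    if "X \<in> carrier_mat n n" "j < n" for X j using that D by (simp add: scalar_prod_def)
  have e1: "(\<Sum>i = 0..<n. \<Sum>j = 0..<n. D $$ (i, j) * (Y * D) $$ (i, j)) = (\<Sum>j = 0..<n. col D j \<bullet> (Y *\<^sub>v col D j))"
    by (subst sum.swap) (intro sum.cong refl, simp add: ent[OF Y(2) D] col[OF Y(2)])
  \<comment> \<open>Symmetry of \<open>D\<close> and \<open>Z\<close> lets the rows entering
    \<open>D * Z\<close> be read as columns, so this trace too becomes a sum of quadratic forms over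
    columns of \<open>D\<close>.\<close>
  have "(\<Sum>i = 0..<n. \<Sum>j = 0..<n. D $$ (i, j) * (D * Z) $$ (i, j))
      = (\<Sum>i = 0..<n. \<Sum>j = 0..<n. D $$ (j, i) * (\<Sum>k = 0..<n. Z $$ (j, k) * D $$ (k, i)))"
    by (intro sum.cong refl)
      (simp add: ent[OF D Z(2)] ds zs sum_distrib_left, rule sum.cong, auto simp: ds zs mult.commute)
  also have "\<dots> = (\<Sum>j = 0..<n. col D j \<bullet> (Z *\<^sub>v col D j))"
    by (intro sum.cong refl) (simp add: col[OF Z(2)])
  finally have e2: "(\<Sum>i = 0..<n. \<Sum>j = 0..<n. D $$ (i, j) * (D * Z) $$ (i, j)) = (\<Sum>j = 0..<n. col D j \<bullet> (Z *\<^sub>v col D j))" .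
  have "(\<Sum>j = 0..<n. col D j \<bullet> (Y *\<^sub>v col D j)) + (\<Sum>j = 0..<n. col D j \<bullet> (Z *\<^sub>v col D j))
    = (\<Sum>i = 0..<n. \<Sum>j = 0..<n. D $$ (i, j) * (Y * D + D * Z) $$ (i, j))"
    unfolding e1[symmetric] e2[symmetric] sum.distrib[symmetric] using Y Z D
    by (intro sum.cong refl) (simp add: algebra_simps)
  also have "\<dots> = 0" unfolding zero by simp
  finally have s: "(\<Sum>j = 0..<n. col D j \<bullet> (Y *\<^sub>v col D j) + col D j \<bullet> (Z *\<^sub>v col D j)) = 0"
    by (simp add: sum.distrib)
  have nn: "col D j \<bullet> (Y *\<^sub>v col D j) \<ge> 0" "col D j \<bullet> (Z *\<^sub>v col D j) \<ge> 0" if "j < n" for j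
    using pos_defD(3)[OF Y] pos_defD(3)[OF Z] D that by (metis carrier_matD(1) col_carrier_vec)+
  have col0: "col D j = 0\<^sub>v n" if j: "j < n" for j
  proof (rule ccontr)
    assume "col D j \<noteq> 0\<^sub>v n"
    then have "col D j \<bullet> (Y *\<^sub>v col D j) > 0"
      using pos_defD(2)[OF Y] D j by (metis carrier_matD(1) col_carrier_vec)
    moreover have "\<forall>j\<in>{0..<n}. col D j \<bullet> (Y *\<^sub>v col D j) + col D j \<bullet> (Z *\<^sub>v col D j) = 0"
      using s nn by (subst (asm) sum_nonneg_eq_0_iff) auto
    ultimately show False using nn[OF j] j by force
  qed
  have d0: "Y $$ (i, j) - Z $$ (i, j) = 0" if "i < n" "j < n" for i j
    using arg_cong[OF col0[OF that(2)], of "\<lambda>v. v $ i"] that D Y Z by (simp add: D_def)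
  show ?thesis
  proof (rule eq_matI)
    fix i j assume "i < dim_row Z" "j < dim_col Z"
    then show "Y $$ (i, j) = Z $$ (i, j)" using d0[of i j] Z by simp
  qed (use Y Z in auto)
qed

lemma mat_sqrt_props:
  assumes "pos_def A" "A \<in> carrier_mat n n"
  shows "mat_sqrt A \<in> carrier_mat n n" "pos_def (mat_sqrt A)" "mat_sqrt A * mat_sqrt A = A"
proof -
  from pos_def_sqrt_exists[OF assms] obtain Y where Y: "Y \<in> carrier_mat n n" "pos_def Y" "Y * Y = A" by blast
  have "mat_sqrt A = Y" unfolding mat_sqrt_def
  proof (rule the_equality)
    fix Z assume Z: "pos_def Z \<and> Z * Z = A"
    \<comment> \<open>The definite description in \<open>mat_sqrt\<close> leaves the dimension of
      \<open>Z\<close> open; it is recovered from \<open>Z * Z = A\<close>.\<close>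
    then have "Z \<in> carrier_mat n n"
      using assms pos_def_carrier by (metis carrier_matD(1) carrier_matI index_mult_mat(2) carrier_matD(2))
    then show "Z = Y" using pos_def_sqrt_unique Y Z by metis
  qed (use Y in auto)
  then show "mat_sqrt A \<in> carrier_mat n n" "pos_def (mat_sqrt A)" "mat_sqrt A * mat_sqrt A = A"
    using Y by auto
qed

lemma mat_sqrt_unique:
  assumes "pos_def Y" "Y \<in> carrier_mat n n" "Y * Y = A" "pos_def A"
  shows "mat_sqrt A = Y"
proof -
  have A: "A \<in> carrier_mat n n" using assms by auto
  show ?thesis using pos_def_sqrt_unique[OF mat_sqrt_props(2,1)[OF assms(4) A] assms(1,2)]
      mat_sqrt_props(3)[OF assms(4) A] assms by simp
qed

text \<open>A trivial kernel gives a nonzero determinant, which ensures that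
  \<open>mat_inverse\<close> is not \<open>None\<close>. Positivity of the inverse at
  \<open>x\<close> is that of \<open>A\<close> at \<open>mat_inv A *\<^sub>v x\<close>.\<close>

lemma pos_def_mat_inv:
  assumes "pos_def A" and A: "A \<in> carrier_mat n n"
  shows "mat_inv A \<in> carrier_mat n n" "A * mat_inv A = 1\<^sub>m n" "mat_inv A * A = 1\<^sub>m n" "pos_def (mat_inv A)"
proof -
  have "det A \<noteq> 0"
  proof
    assume "det A = 0"
    then obtain v where v: "v \<in> carrier_vec n" "v \<noteq> 0\<^sub>v n" "A *\<^sub>v v = 0\<^sub>v n"
      using det_0_iff_vec_prod_zero_field[OF A] by blast
    then show False using pos_defD(2)[OF assms v(1,2)] by simp
  qed
  then have "A \<in> Units (ring_mat TYPE(real) n ())" using det_non_zero_imp_unit[OF A, of "()"] by blast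
  then obtain B where B: "mat_inverse A = Some B" using mat_inverse(1)[OF A, where b = "()"] by (cases "mat_inverse A") auto
  from mat_inverse(2)[OF A B] show 1: "mat_inv A \<in> carrier_mat n n" "A * mat_inv A = 1\<^sub>m n" "mat_inv A * A = 1\<^sub>m n"
    using B by auto
  have "(mat_inv A)\<^sup>\<top> * A = 1\<^sub>m n"
    using arg_cong[OF 1(2), of transpose_mat] transpose_mult[OF A 1(1)] pos_defD(1)[OF assms] by simp
  then have "(mat_inv A)\<^sup>\<top> * A * mat_inv A = mat_inv A" using 1 by simp
  then have t: "(mat_inv A)\<^sup>\<top> = mat_inv A" using 1 A
    by (subst (asm) assoc_mult_mat[of _ n n _ n _ n]) auto
  show "pos_def (mat_inv A)"
  proof (rule pos_defI[OF 1(1) t])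
    fix x :: "real vec" assume x: "x \<in> carrier_vec n" "x \<noteq> 0\<^sub>v n"
    let ?y = "mat_inv A *\<^sub>v x"
    have y: "?y \<in> carrier_vec n" using 1 x by auto
    have Ay: "A *\<^sub>v ?y = x" using A x 1 by (simp add: assoc_mult_mat_vec[symmetric, of _ n n _ n])
    then have "?y \<noteq> 0\<^sub>v n" using x mult_mat_zero_vec[OF A] by auto
    then have "?y \<bullet> (A *\<^sub>v ?y) > 0" using pos_defD(2)[OF assms y] by simp
    then show "x \<bullet> (mat_inv A *\<^sub>v x) > 0" using Ay x y by (simp add: comm_scalar_prod[of _ n])
  qed
qed

text \<open>The inverse of \<open>mat_sqrt A\<close> is positive definite with square
  \<open>mat_inv A\<close>, so uniqueness identifies it with
  \<open>mat_sqrt (mat_inv A)\<close>.\<close>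

lemma mat_sqrt_inv:
  assumes "pos_def A" and A: "A \<in> carrier_mat n n"
  shows "mat_sqrt (mat_inv A) * mat_sqrt A = 1\<^sub>m n" "mat_sqrt A * mat_sqrt (mat_inv A) = 1\<^sub>m n"
proof -
  define Y where "Y = mat_sqrt A"
  define B where "B = mat_inv A"
  define K where "K = mat_inv Y"
  note Y = mat_sqrt_props[OF assms, folded Y_def] and I = pos_def_mat_inv[OF assms, folded B_def]
  note K = pos_def_mat_inv[OF Y(2,1), folded K_def]
  have "K * K = B"
  proof -
    have "A * (K * K) = (Y * Y) * (K * K)" by (simp add: Y(3))
    also have "\<dots> = Y * (Y * K) * K"
      using Y(1) K(1) by (simp add: assoc_mult_mat[of _ n n _ n _ n])
    finally have "A * (K * K) = 1\<^sub>m n" using K Y(1) by simp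
    then have "B * (A * (K * K)) = B" using I(1) by simp
    then show ?thesis using I(1,3) K(1) A
      by (subst (asm) assoc_mult_mat[symmetric, of _ n n _ n _ n]) auto
  qed
  then have "mat_sqrt B = K" using mat_sqrt_unique[OF K(4,1) _ I(4)] by simp
  then show "mat_sqrt (mat_inv A) * mat_sqrt A = 1\<^sub>m n" "mat_sqrt A * mat_sqrt (mat_inv A) = 1\<^sub>m n"
    using K(2,3) by (auto simp: B_def Y_def)
qed

subsection \<open>Block vectors, block matrices and Kronecker products\<close>

lemma append_vec_dim0: "dim_vec w = 0 \<Longrightarrow> v @\<^sub>v w = v"
  by (intro eq_vecI) auto

lemma append_cols_carrier:
  "A \<in> carrier_mat k a \<Longrightarrow> B \<in> carrier_mat k b \<Longrightarrow> A @\<^sub>c B \<in> carrier_mat k (a + b)"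
  unfolding append_cols_def carrier_mat_def by simp

lemma append_cols_mult_vec:
  assumes "A \<in> carrier_mat k a" "B \<in> carrier_mat k b" "x \<in> carrier_vec a" "y \<in> carrier_vec b"
  shows "(A @\<^sub>c B) *\<^sub>v (x @\<^sub>v y) = A *\<^sub>v x + B *\<^sub>v y"
  unfolding append_cols_def using assms
  by (subst four_block_mat_mult_vec[of _ k a _ b _ 0]) (auto intro!: append_vec_dim0)

lemma vconcat_Nil [simp]: "vconcat [] = 0\<^sub>v 0" and vconcat_Cons [simp]: "vconcat (x # xs) = x @\<^sub>v vconcat xs"
  by (simp_all add: vconcat_def)

lemma dim_vconcat: "dim_vec (vconcat xs) = sum_list (map dim_vec xs)"
  by (induction xs) auto

lemma vconcat_carrier:
  assumes "\<And>i. i \<in> set l \<Longrightarrow> x i \<in> carrier_vec (k i)"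
  shows "vconcat (map x l) \<in> carrier_vec (\<Sum>i\<leftarrow>l. k i)"
  using assms by (induction l) auto

lemma vconcat_append: "vconcat (xs @ ys) = vconcat xs @\<^sub>v vconcat ys"
proof (induction xs)
  case Nil
  show ?case by (intro eq_vecI) auto
next
  case (Cons x xs)
  then show ?case by (intro eq_vecI) (auto simp: dim_vconcat)
qed

text \<open>The samples at delays 0 to \<open>m\<close>, split after the first or before the last.
  The two groupings serve the values at the older and at the newer ends of the windows.\<close>

lemma vconcat_shift:
  assumes "\<And>i. i \<le> m \<Longrightarrow> x i \<in> carrier_vec n"
  shows "x 0 @\<^sub>v vconcat (map x [1..<Suc m]) = vconcat (map (\<lambda>i. x (i - 1)) [1..<Suc m]) @\<^sub>v x m"
proof -
  have "x 0 @\<^sub>v vconcat (map x [1..<Suc m]) = vconcat (map x [0..<Suc m])"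
    by (simp only: vconcat_Cons[symmetric] list.map[symmetric] upt_conv_Cons[of 0 "Suc m"]) simp
  also have "[0..<Suc m] = [0..<m] @ [m]" by simp
  also have "vconcat (map x ([0..<m] @ [m])) = vconcat (map x [0..<m]) @\<^sub>v x m"
    by (simp only: map_append vconcat_append list.map vconcat_Cons vconcat_Nil append_vec_dim0 index_zero_vec)
  also have "map x [0..<m] = map (\<lambda>i. x (i - 1)) [1..<Suc m]"
    by (simp add: map_Suc_upt[symmetric] comp_def del: upt_Suc)
  finally show ?thesis .
qed

lemma diag_block_mat_carrier:
  assumes "\<And>i. i \<in> set l \<Longrightarrow> A i \<in> carrier_mat (r i) (c i)"
  shows "diag_block_mat (map A l) \<in> carrier_mat (\<Sum>i\<leftarrow>l. r i) (\<Sum>i\<leftarrow>l. c i)"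
  using assms by (induction l) (auto simp: Let_def)

lemma diag_block_mat_Cons_mult_vec:
  assumes "x \<in> carrier_vec (dim_col A)" "y \<in> carrier_vec (dim_col (diag_block_mat As))"
  shows "diag_block_mat (A # As) *\<^sub>v (x @\<^sub>v y) = (A *\<^sub>v x) @\<^sub>v (diag_block_mat As *\<^sub>v y)"
proof -
  have "diag_block_mat (A # As) *\<^sub>v (x @\<^sub>v y) = (A *\<^sub>v x + 0\<^sub>m (dim_row A) (dim_col (diag_block_mat As)) *\<^sub>v y)
    @\<^sub>v (0\<^sub>m (dim_row (diag_block_mat As)) (dim_col A) *\<^sub>v x + diag_block_mat As *\<^sub>v y)"
    unfolding diag_block_mat.simps Let_def
    by (rule four_block_mat_mult_vec[of _ "dim_row A" "dim_col A" _ _ _ "dim_row (diag_block_mat As)"]) (use assms in auto)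
  also have "0\<^sub>m (dim_row A) (dim_col (diag_block_mat As)) *\<^sub>v y = 0\<^sub>v (dim_row A)"
    using assms by (intro eq_vecI) auto
  also have "0\<^sub>m (dim_row (diag_block_mat As)) (dim_col A) *\<^sub>v x = 0\<^sub>v (dim_row (diag_block_mat As))"
    using assms by (intro eq_vecI) auto
  also have "A *\<^sub>v x + 0\<^sub>v (dim_row A) = A *\<^sub>v x" by (intro eq_vecI) auto
  also have "0\<^sub>v (dim_row (diag_block_mat As)) + diag_block_mat As *\<^sub>v y = diag_block_mat As *\<^sub>v y"
    by (intro eq_vecI) auto
  finally show ?thesis .
qed

lemma diag_block_mat_mult_vconcat:
  assumes "\<And>i. i \<in> set l \<Longrightarrow> x i \<in> carrier_vec (dim_col (A i))"
  shows "diag_block_mat (map A l) *\<^sub>v vconcat (map x l) = vconcat (map (\<lambda>i. A i *\<^sub>v x i) l)"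
  using assms
proof (induction l)
  case Nil
  show ?case by (intro eq_vecI) auto
next
  case (Cons i l)
  have "vconcat (map x l) \<in> carrier_vec (dim_col (diag_block_mat (map A l)))"
    using vconcat_carrier[of l x "\<lambda>i. dim_col (A i)"] Cons.prems by (simp add: dim_diag_block_mat comp_def)
  then show ?case using Cons by (simp add: diag_block_mat_Cons_mult_vec del: diag_block_mat.simps)
qed

lemma vconcat_scalar_prod:
  assumes "\<And>i. i \<in> set l \<Longrightarrow> x i \<in> carrier_vec (k i) \<and> y i \<in> carrier_vec (k i)"
  shows "vconcat (map x l) \<bullet> vconcat (map y l) = (\<Sum>i\<leftarrow>l. x i \<bullet> y i)"
  using assms
proof (induction l)
  case (Cons i l)
  then show ?case
    by (simp add: scalar_prod_append[of _ "k i" _ "\<Sum>i\<leftarrow>l. k i"] vconcat_carrier)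
qed simp

lemma sum_list_idx: "(\<Sum>i\<leftarrow>idx S. f i) = (\<Sum>i=1..num_delays S. f i)" for f :: "nat \<Rightarrow> 'a :: comm_monoid_add"
  by (simp only: interv_sum_list_conv_sum_set_nat set_upt atLeastLessThanSuc_atLeastAtMost)

lemma set_idx: "i \<in> set (idx S) \<longleftrightarrow> i \<in> {1..num_delays S}"
  by auto

section \<open>Slices and chunks of stacked vectors, and Kronecker products\<close>

lemma sum_lessThan_mult:
  fixes f :: "nat \<Rightarrow> 'a :: comm_monoid_add"
  shows "(\<Sum>b<c * n. f b) = (\<Sum>p<c. \<Sum>i<n. f (p * n + i))"
proof -
  have "(\<Sum>b<c * n. f b) = (\<Sum>p<c. sum f {p * n..<p * n + n})" by (rule sum.nat_group[symmetric])
  also have "\<dots> = (\<Sum>p<c. \<Sum>i<n. f (p * n + i))"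
  proof (rule sum.cong[OF refl])
    fix p
    have "sum f {p * n..<p * n + n} = sum f {0 + p * n..<n + p * n}" by (simp add: add.commute)
    also have "\<dots> = (\<Sum>i = 0..<n. f (i + p * n))" by (rule sum.shift_bounds_nat_ivl)
    finally show "sum f {p * n..<p * n + n} = (\<Sum>i<n. f (p * n + i))"
      by (simp add: atLeast0LessThan add.commute)
  qed
  finally show ?thesis .
qed

lemma block_index_less:
  assumes "p < k" "j < (n :: nat)" shows "p * n + j < k * n"
proof -
  have "p * n + j < Suc p * n" using assms by simp
  also have "\<dots> \<le> k * n" using assms by (intro mult_le_mono1) auto
  finally show ?thesis .
qed

text \<open>A vector of length \<open>k * n\<close> is an array with \<open>k\<close> rows and
  \<open>n\<close> columns, stored row by row: \<open>slice\<close> reads a column and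
  \<open>chunk\<close> a row. A factor \<open>A \<otimes>\<^sub>K 1\<^sub>m n\<close> acts on every
  slice by \<open>A\<close>, and \<open>1\<^sub>m k \<otimes>\<^sub>K R\<close> acts on every chunk
  by \<open>R\<close>.\<close>

definition slice :: "nat \<Rightarrow> nat \<Rightarrow> real vec \<Rightarrow> real vec"
  where "slice n j x = vec (dim_vec x div n) (\<lambda>p. x $ (p * n + j))"

definition chunk :: "nat \<Rightarrow> nat \<Rightarrow> real vec \<Rightarrow> real vec"
  where "chunk n p x = vec n (\<lambda>j. x $ (p * n + j))"

lemma slice_carrier [simp]: "j < n \<Longrightarrow> x \<in> carrier_vec (k * n) \<Longrightarrow> slice n j x \<in> carrier_vec k"
  by (auto simp: slice_def)

lemma slice_index [simp]: "x \<in> carrier_vec (k * n) \<Longrightarrow> j < n \<Longrightarrow> p < k \<Longrightarrow> slice n j x $ p = x $ (p * n + j)"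
  by (auto simp: slice_def)

lemma eq_slicesI:
  assumes x: "x \<in> carrier_vec (k * n)" and y: "y \<in> carrier_vec (k * n)"
    and eq: "\<And>j. j < n \<Longrightarrow> slice n j x = slice n j y"
  shows "x = y"
proof (rule eq_vecI)
  fix a assume "a < dim_vec y"
  then have a: "a < k * n" using y by simp
  then have n: "n > 0" by (cases n) auto
  have "a div n < k" using a by (simp add: less_mult_imp_div_less)
  then have "x $ (a div n * n + a mod n) = y $ (a div n * n + a mod n)"
    using slice_index[OF x, of "a mod n" "a div n"] slice_index[OF y, of "a mod n" "a div n"] eq[of "a mod n"] n by simp
  then show "x $ a = y $ a" by simp
qed (use x y in auto)

lemma slice_append:
  assumes x: "x \<in> carrier_vec (a * n)" and y: "y \<in> carrier_vec (b * n)" and j: "j < n"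
  shows "slice n j (x @\<^sub>v y) = slice n j x @\<^sub>v slice n j y"
proof (rule eq_vecI)
  have xy: "x @\<^sub>v y \<in> carrier_vec ((a + b) * n)" using x y by (auto simp: add_mult_distrib)
  have s: "slice n j x \<in> carrier_vec a" "slice n j y \<in> carrier_vec b" using x y j by auto
  then show "dim_vec (slice n j (x @\<^sub>v y)) = dim_vec (slice n j x @\<^sub>v slice n j y)"
    using slice_carrier[OF j xy] by auto
  fix p assume "p < dim_vec (slice n j x @\<^sub>v slice n j y)"
  then have p: "p < a + b" using s by auto
  have lt: "p * n + j < (a + b) * n" using block_index_less[OF p j] .
  show "slice n j (x @\<^sub>v y) $ p = (slice n j x @\<^sub>v slice n j y) $ p"
  proof (cases "p < a")
    case True
    then show ?thesis using slice_index[OF xy j p] slice_index[OF x j True] s x y block_index_less[OF True j] lt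
      by (simp add: add_mult_distrib)
  next
    case False
    then have pa: "p - a < b" using p by simp
    have "a * n \<le> p * n" using False by (intro mult_le_mono1) simp
    then have "p * n + j - a * n = (p - a) * n + j" by (simp add: diff_mult_distrib)
    moreover have "\<not> p * n + j < a * n" using \<open>a * n \<le> p * n\<close> by linarith
    ultimately show ?thesis using slice_index[OF xy j p] slice_index[OF y j pa] s x y lt False p
      by (simp add: add_mult_distrib)
  qed
qed

lemma slice_vconcat:
  assumes "\<And>i. i \<in> set l \<Longrightarrow> x i \<in> carrier_vec (k i * n)" and j: "j < n"
  shows "slice n j (vconcat (map x l)) = vconcat (map (\<lambda>i. slice n j (x i)) l)"
  using assms(1)
proof (induction l)
  case Nil
  show ?case by (intro eq_vecI) (auto simp: slice_def)
next
  case (Cons i l)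
  have "vconcat (map x l) \<in> carrier_vec (\<Sum>i\<leftarrow>l. k i * n)" using Cons.prems by (intro vconcat_carrier) auto
  then have "vconcat (map x l) \<in> carrier_vec ((\<Sum>i\<leftarrow>l. k i) * n)" by (simp add: sum_list_mult_const)
  then show ?case using Cons slice_append[of "x i" "k i" n "vconcat (map x l)" _ j] j by simp
qed

lemma kron_carrier:
  "A \<in> carrier_mat r c \<Longrightarrow> B \<in> carrier_mat r' c' \<Longrightarrow> A \<otimes>\<^sub>K B \<in> carrier_mat (r * r') (c * c')"
  by (auto simp: kron_def)

lemma kron_index:
  assumes "A \<in> carrier_mat r c" "B \<in> carrier_mat r' c'" "p < r" "i < r'" "q < c" "j < c'"
  shows "(A \<otimes>\<^sub>K B) $$ (p * r' + i, q * c' + j) = A $$ (p, q) * B $$ (i, j)"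
  using assms block_index_less[OF assms(3,4)] block_index_less[OF assms(5,6)] by (simp add: kron_def)

lemma kron_mult_vec_index:
  assumes A: "A \<in> carrier_mat r c" and B: "B \<in> carrier_mat r' c'" and x: "x \<in> carrier_vec (c * c')"
    and p: "p < r" "i < r'"
  shows "((A \<otimes>\<^sub>K B) *\<^sub>v x) $ (p * r' + i) = (\<Sum>q<c. \<Sum>j<c'. A $$ (p, q) * B $$ (i, j) * x $ (q * c' + j))"
proof -
  have "((A \<otimes>\<^sub>K B) *\<^sub>v x) $ (p * r' + i) = (\<Sum>b<c * c'. (A \<otimes>\<^sub>K B) $$ (p * r' + i, b) * x $ b)"
    using kron_carrier[OF A B] x block_index_less[OF p] by (simp add: scalar_prod_def atLeast0LessThan)
  also have "\<dots> = (\<Sum>q<c. \<Sum>j<c'. (A \<otimes>\<^sub>K B) $$ (p * r' + i, q * c' + j) * x $ (q * c' + j))"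
    by (rule sum_lessThan_mult)
  also have "\<dots> = (\<Sum>q<c. \<Sum>j<c'. A $$ (p, q) * B $$ (i, j) * x $ (q * c' + j))"
    by (intro sum.cong refl) (simp add: kron_index[OF A B p])
  finally show ?thesis .
qed

lemma slice_kron_mult_vec:
  assumes A: "A \<in> carrier_mat r c" and x: "x \<in> carrier_vec (c * n)" and j: "j < n"
  shows "slice n j ((A \<otimes>\<^sub>K 1\<^sub>m n) *\<^sub>v x) = A *\<^sub>v slice n j x"
proof (rule eq_vecI)
  have K: "A \<otimes>\<^sub>K 1\<^sub>m n \<in> carrier_mat (r * n) (c * n)" using kron_carrier[OF A, of "1\<^sub>m n" n n] by simp
  then have Kx: "(A \<otimes>\<^sub>K 1\<^sub>m n) *\<^sub>v x \<in> carrier_vec (r * n)" using x by auto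
  show "dim_vec (slice n j ((A \<otimes>\<^sub>K 1\<^sub>m n) *\<^sub>v x)) = dim_vec (A *\<^sub>v slice n j x)"
    using slice_carrier[OF j Kx] A by auto
  fix p assume "p < dim_vec (A *\<^sub>v slice n j x)"
  then have p: "p < r" using A by simp
  have "slice n j ((A \<otimes>\<^sub>K 1\<^sub>m n) *\<^sub>v x) $ p = (\<Sum>q<c. \<Sum>i<n. A $$ (p, q) * 1\<^sub>m n $$ (j, i) * x $ (q * n + i))"
    using slice_index[OF Kx j p] kron_mult_vec_index[OF A _ x p j, of "1\<^sub>m n"] by simp
  also have "\<dots> = (\<Sum>q<c. A $$ (p, q) * x $ (q * n + j))"
  proof (rule sum.cong[OF refl])
    fix q
    have "(\<Sum>i<n. A $$ (p, q) * 1\<^sub>m n $$ (j, i) * x $ (q * n + i))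
        = (\<Sum>i<n. if i = j then A $$ (p, q) * x $ (q * n + i) else 0)"
      using j by (intro sum.cong) auto
    then show "(\<Sum>i<n. A $$ (p, q) * 1\<^sub>m n $$ (j, i) * x $ (q * n + i)) = A $$ (p, q) * x $ (q * n + j)"
      using j by simp
  qed
  also have "\<dots> = (A *\<^sub>v slice n j x) $ p"
    using A p slice_carrier[OF j x] slice_index[OF x j] by (simp add: scalar_prod_def atLeast0LessThan)
  finally show "slice n j ((A \<otimes>\<^sub>K 1\<^sub>m n) *\<^sub>v x) $ p = (A *\<^sub>v slice n j x) $ p" .
qed

lemma quadratic_form_sum:
  fixes R :: "real mat"
  assumes "R \<in> carrier_mat n n" "x \<in> carrier_vec n" "y \<in> carrier_vec n"
  shows "x \<bullet> (R *\<^sub>v y) = (\<Sum>j<n. \<Sum>k<n. R $$ (j, k) * (x $ j * y $ k))"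
  using assms by (simp add: scalar_prod_def atLeast0LessThan sum_distrib_left mult.left_commute)

lemma kron_one_quadratic_form:
  fixes R :: "real mat"
  assumes R: "R \<in> carrier_mat n n" and x: "x \<in> carrier_vec (k * n)"
  shows "x \<bullet> ((1\<^sub>m k \<otimes>\<^sub>K R) *\<^sub>v x) = (\<Sum>p<k. chunk n p x \<bullet> (R *\<^sub>v chunk n p x))"
proof -
  have K: "1\<^sub>m k \<otimes>\<^sub>K R \<in> carrier_mat (k * n) (k * n)" using kron_carrier[OF _ R, of "1\<^sub>m k" k k] by simp
  have "x \<bullet> ((1\<^sub>m k \<otimes>\<^sub>K R) *\<^sub>v x) = (\<Sum>p<k. \<Sum>i<n. x $ (p * n + i) * ((1\<^sub>m k \<otimes>\<^sub>K R) *\<^sub>v x) $ (p * n + i))"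
    using K x by (simp add: scalar_prod_def atLeast0LessThan sum_lessThan_mult del: index_mult_mat_vec)
  also have "\<dots> = (\<Sum>p<k. chunk n p x \<bullet> (R *\<^sub>v chunk n p x))"
  proof (rule sum.cong[OF refl])
    fix p assume p: "p \<in> {..<k}"
    have "((1\<^sub>m k \<otimes>\<^sub>K R) *\<^sub>v x) $ (p * n + i) = (\<Sum>j<n. R $$ (i, j) * x $ (p * n + j))" if i: "i < n" for i
    proof -
      have "((1\<^sub>m k \<otimes>\<^sub>K R) *\<^sub>v x) $ (p * n + i) = (\<Sum>q<k. \<Sum>j<n. 1\<^sub>m k $$ (p, q) * R $$ (i, j) * x $ (q * n + j))"
        using kron_mult_vec_index[OF _ R x _ i, of "1\<^sub>m k" k p] p by simp
      also have "\<dots> = (\<Sum>q<k. if q = p then \<Sum>j<n. R $$ (i, j) * x $ (q * n + j) else 0)"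
        using p by (intro sum.cong) auto
      finally show ?thesis using p by simp
    qed
    then have "(\<Sum>i<n. x $ (p * n + i) * ((1\<^sub>m k \<otimes>\<^sub>K R) *\<^sub>v x) $ (p * n + i))
        = (\<Sum>i<n. x $ (p * n + i) * (\<Sum>j<n. R $$ (i, j) * x $ (p * n + j)))" by simp
    also have "\<dots> = chunk n p x \<bullet> (R *\<^sub>v chunk n p x)"
      using R by (subst quadratic_form_sum[OF R]) (auto simp: chunk_def sum_distrib_left mult_ac)
    finally show "(\<Sum>i<n. x $ (p * n + i) * ((1\<^sub>m k \<otimes>\<^sub>K R) *\<^sub>v x) $ (p * n + i)) = chunk n p x \<bullet> (R *\<^sub>v chunk n p x)" .
  qed
  finally show ?thesis .
qed

text \<open>The test vector is \<open>x\<close> in block \<open>i\<close> and zero in all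
  others.\<close>

lemma pos_def_diag_idx_block:
  assumes P: "pos_def (diag_idx S R)" and R: "\<And>i. i \<in> {1..num_delays S} \<Longrightarrow> R i \<in> sym_mats n"
    and i: "i \<in> {1..num_delays S}"
  shows "pos_def (R i)"
proof (rule pos_defI)
  show Ri: "R i \<in> carrier_mat n n" "(R i)\<^sup>\<top> = R i" using R[OF i] by (auto simp: sym_mats_def)
  fix x :: "real vec" assume x: "x \<in> carrier_vec n" "x \<noteq> 0\<^sub>v n"
  define y where "y j = (if j = i then x else 0\<^sub>v n)" for j
  let ?y = "vconcat (map y (idx S))"
  have Rc: "R j \<in> carrier_mat n n" if "j \<in> set (idx S)" for j using R that by (auto simp: sym_mats_def)
  have yc: "y j \<in> carrier_vec n" for j using x by (simp add: y_def)
  have D: "diag_idx S R \<in> carrier_mat (\<Sum>j\<leftarrow>idx S. n) (\<Sum>j\<leftarrow>idx S. n)"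
    unfolding diag_idx_def using diag_block_mat_carrier[OF Rc] .
  have Y: "?y \<in> carrier_vec (\<Sum>j\<leftarrow>idx S. n)" using vconcat_carrier[of "idx S" y "\<lambda>_. n"] yc by blast
  have "?y \<bullet> ?y = (\<Sum>j=1..num_delays S. y j \<bullet> y j)"
    using vconcat_scalar_prod[of "idx S" y "\<lambda>_. n" y] yc sum_list_idx by metis
  also have "\<dots> = (\<Sum>j=1..num_delays S. if j = i then x \<bullet> x else 0)"
    by (intro sum.cong) (auto simp: y_def)
  finally have "?y \<bullet> ?y = x \<bullet> x" using i by simp
  then have "?y \<noteq> 0\<^sub>v (\<Sum>j\<leftarrow>idx S. n)"
    using scalar_prod_self_pos[OF x] by (metis less_irrefl scalar_prod_left_zero zero_carrier_vec)
  from pos_defD(2)[OF P D Y this] have "0 < ?y \<bullet> (diag_idx S R *\<^sub>v ?y)" .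
  also have "diag_idx S R *\<^sub>v ?y = vconcat (map (\<lambda>j. R j *\<^sub>v y j) (idx S))"
    unfolding diag_idx_def using Rc yc by (intro diag_block_mat_mult_vconcat) (metis carrier_matD(2))
  also have "?y \<bullet> \<dots> = (\<Sum>j=1..num_delays S. y j \<bullet> (R j *\<^sub>v y j))"
    unfolding sum_list_idx[symmetric] using Rc yc
    by (intro vconcat_scalar_prod[of _ _ "\<lambda>_. n"]) (metis mult_mat_vec_carrier)
  also have "\<dots> = (\<Sum>j=1..num_delays S. if j = i then x \<bullet> (R i *\<^sub>v x) else 0)"
  proof (rule sum.cong[OF refl])
    fix j assume "j \<in> {1..num_delays S}"
    then have "R j \<in> carrier_mat n n" using R by (auto simp: sym_mats_def)
    then show "y j \<bullet> (R j *\<^sub>v y j) = (if j = i then x \<bullet> (R i *\<^sub>v x) else 0)"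
      using mult_mat_zero_vec[of "R j" n n] by (simp add: y_def)
  qed
  also have "\<dots> = x \<bullet> (R i *\<^sub>v x)" using i by simp
  finally show "0 < x \<bullet> (R i *\<^sub>v x)" .
qed

section \<open>Norm bounds and coercivity of matrices\<close>

lemma Cauchy_Schwarz_vec:
  fixes x y :: "real vec"
  assumes "x \<in> carrier_vec n" "y \<in> carrier_vec n"
  shows "(x \<bullet> y)\<^sup>2 \<le> (x \<bullet> x) * (y \<bullet> y)"
  using Cauchy_Schwarz_ineq_sum[of "\<lambda>i. x $ i" "\<lambda>i. y $ i" "{0..<n}"] assms
  by (simp add: scalar_prod_def power2_eq_square)

lemma mult_mat_vec_norm_le:
  fixes A :: "real mat"
  assumes A: "A \<in> carrier_mat k n"
  obtains c where "c > 0" "\<And>x. x \<in> carrier_vec n \<Longrightarrow> (A *\<^sub>v x) \<bullet> (A *\<^sub>v x) \<le> c * (x \<bullet> x)"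
proof -
  \<comment> \<open>The \<open>+ 1\<close> keeps the constant positive for the zero matrix.\<close>
  define c where "c = (\<Sum>i<k. row A i \<bullet> row A i) + 1"
  have "(A *\<^sub>v x) \<bullet> (A *\<^sub>v x) \<le> c * (x \<bullet> x)" if x: "x \<in> carrier_vec n" for x
  proof -
    have "(A *\<^sub>v x) \<bullet> (A *\<^sub>v x) = (\<Sum>i<k. (row A i \<bullet> x)\<^sup>2)"
      using A x by (simp add: scalar_prod_def[of "A *\<^sub>v x"] atLeast0LessThan power2_eq_square)
    also have "\<dots> \<le> (\<Sum>i<k. (row A i \<bullet> row A i) * (x \<bullet> x))"
      using A x by (intro sum_mono Cauchy_Schwarz_vec[of _ n]) auto
    also have "\<dots> \<le> c * (x \<bullet> x)"
      using scalar_prod_self_ge_0[of x] by (simp add: c_def sum_distrib_right[symmetric] distrib_right)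
    finally show ?thesis .
  qed
  moreover have "c > 0" unfolding c_def by (intro add_nonneg_pos sum_nonneg scalar_prod_self_ge_0) auto
  ultimately show thesis using that by blast
qed

text \<open>Expanding the nonnegative square of \<open>x - A *\<^sub>v x\<close> bounds twice the
  form by the squares of \<open>x\<close> and of its image.\<close>

lemma quadratic_form_le:
  fixes A :: "real mat"
  assumes A: "A \<in> carrier_mat n n"
  obtains c where "c > 0" "\<And>x. x \<in> carrier_vec n \<Longrightarrow> x \<bullet> (A *\<^sub>v x) \<le> c * (x \<bullet> x)"
proof -
  obtain c where c: "c > 0" "\<And>x. x \<in> carrier_vec n \<Longrightarrow> (A *\<^sub>v x) \<bullet> (A *\<^sub>v x) \<le> c * (x \<bullet> x)"
    using mult_mat_vec_norm_le[OF A] by blast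
  have "x \<bullet> (A *\<^sub>v x) \<le> (c + 1) * (x \<bullet> x)" if x: "x \<in> carrier_vec n" for x
  proof -
    let ?y = "A *\<^sub>v x"
    have y: "?y \<in> carrier_vec n" using A x by auto
    have "0 \<le> (x - ?y) \<bullet> (x - ?y)" by (rule scalar_prod_self_ge_0)
    also have "\<dots> = x \<bullet> x - 2 * (x \<bullet> ?y) + ?y \<bullet> ?y"
      using x y by (simp add: minus_scalar_prod_distrib[of _ n] scalar_prod_minus_distrib[of _ n] comm_scalar_prod[of ?y n x])
    finally have "2 * (x \<bullet> ?y) \<le> x \<bullet> x + c * (x \<bullet> x)" using c(2)[OF x] by linarith
    moreover have "0 \<le> (c + 1) * (x \<bullet> x)" using c(1) scalar_prod_self_ge_0[of x] by simp
    ultimately show ?thesis by (simp add: distrib_right)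
  qed
  then show thesis using that[of "c + 1"] c(1) by auto
qed

text \<open>The form at \<open>x\<close> is the squared norm of
  \<open>mat_sqrt A *\<^sub>v x\<close>, and \<open>x\<close> is recovered from that vector by the
  bounded inverse of the root; this replaces eigenvalue or compactness arguments.\<close>

lemma pos_def_coercive:
  assumes P: "pos_def A" and A: "A \<in> carrier_mat n n"
  obtains c where "c > 0" "\<And>x. x \<in> carrier_vec n \<Longrightarrow> c * (x \<bullet> x) \<le> x \<bullet> (A *\<^sub>v x)"
proof -
  note Y = mat_sqrt_props[OF P A]
  note K = pos_def_mat_inv[OF Y(2,1)]
  obtain c where c: "c > 0" "\<And>x. x \<in> carrier_vec n \<Longrightarrow>
      (mat_inv (mat_sqrt A) *\<^sub>v x) \<bullet> (mat_inv (mat_sqrt A) *\<^sub>v x) \<le> c * (x \<bullet> x)"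
    using mult_mat_vec_norm_le[OF K(1)] by blast
  have "1 / c * (x \<bullet> x) \<le> x \<bullet> (A *\<^sub>v x)" if x: "x \<in> carrier_vec n" for x
  proof -
    let ?y = "mat_sqrt A *\<^sub>v x"
    have y: "?y \<in> carrier_vec n" using Y x by auto
    have "mat_inv (mat_sqrt A) *\<^sub>v ?y = x"
      using K Y x by (simp add: assoc_mult_mat_vec[symmetric, of _ n n _ n])
    then have "x \<bullet> x \<le> c * (?y \<bullet> ?y)" using c(2)[OF y] by simp
    also have "?y \<bullet> ?y = x \<bullet> (mat_sqrt A *\<^sub>v ?y)"
      by (rule sym_scalar_prod[OF Y(1) pos_defD(1)[OF Y(2,1)] x y])
    also have "mat_sqrt A *\<^sub>v ?y = A *\<^sub>v x"
      using Y x by (simp add: assoc_mult_mat_vec[symmetric, of _ n n _ n])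
    finally show ?thesis using c(1) by (simp add: field_simps)
  qed
  then show thesis using that[of "1 / c"] c(1) by auto
qed

lemma neg_def_coercive:
  assumes P: "neg_def A" and A: "A \<in> carrier_mat n n"
  obtains c where "c > 0" "\<And>x. x \<in> carrier_vec n \<Longrightarrow> x \<bullet> (A *\<^sub>v x) \<le> - c * (x \<bullet> x)"
proof -
  have neg: "x \<bullet> ((- A) *\<^sub>v x) = - (x \<bullet> (A *\<^sub>v x))" if "x \<in> carrier_vec n" for x
    using A that by (simp add: quadratic_form_sum[of _ n] sum_negf)
  have "A\<^sup>\<top> = A" using P A by (auto simp: neg_def_def sym_mats_def)
  then have "pos_def (- A)" using P A neg
    by (intro pos_defI[of _ n]) (auto simp: neg_def_def transpose_uminus)
  then obtain c where "c > 0" "\<And>x. x \<in> carrier_vec n \<Longrightarrow> c * (x \<bullet> x) \<le> x \<bullet> ((- A) *\<^sub>v x)"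
    using pos_def_coercive[of "- A" n] A by auto
  then show thesis using that[of c] neg by fastforce
qed

subsection \<open>Gram matrices and the Bessel inequality\<close>

definition square_integrable :: "real set \<Rightarrow> (real \<Rightarrow> real) \<Rightarrow> bool"
  where "square_integrable X f \<longleftrightarrow> f \<in> borel_measurable (lebesgue_on X) \<and> integrable (lebesgue_on X) (\<lambda>t. (f t)\<^sup>2)"

lemma square_integrable_mult:
  assumes "square_integrable X f" "square_integrable X g"
  shows "integrable (lebesgue_on X) (\<lambda>t. f t * g t)"
proof (rule Bochner_Integration.integrable_bound[of _ "\<lambda>t. (f t)\<^sup>2 + (g t)\<^sup>2"])
  show "integrable (lebesgue_on X) (\<lambda>t. (f t)\<^sup>2 + (g t)\<^sup>2)"
    "(\<lambda>t. f t * g t) \<in> borel_measurable (lebesgue_on X)"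
    using assms by (auto simp: square_integrable_def)
  have "\<bar>x * y\<bar> \<le> x\<^sup>2 + y\<^sup>2" for x y :: real
  proof -
    have "2 * \<bar>x * y\<bar> \<le> x\<^sup>2 + y\<^sup>2" using sum_squares_bound[of "\<bar>x\<bar>" "\<bar>y\<bar>"] by (simp add: abs_mult)
    then show ?thesis by (smt (verit) abs_ge_zero)
  qed
  then show "AE t in lebesgue_on X. norm (f t * g t) \<le> norm ((f t)\<^sup>2 + (g t)\<^sup>2)" by simp
qed

lemma square_integrable_add:
  assumes "square_integrable X f" "square_integrable X g"
  shows "square_integrable X (\<lambda>t. f t + g t)"
  unfolding square_integrable_def power2_sum
  using assms square_integrable_mult[OF assms] by (auto simp: square_integrable_def mult.assoc)

lemma square_integrable_cmult:
  assumes "square_integrable X f" shows "square_integrable X (\<lambda>t. c * f t)"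
  using assms by (auto simp: square_integrable_def power_mult_distrib)

lemma square_integrable_diff:
  assumes "square_integrable X f" "square_integrable X g"
  shows "square_integrable X (\<lambda>t. f t - g t)"
  using square_integrable_add[OF assms(1) square_integrable_cmult[OF assms(2), of "-1"]] by simp

lemma square_integrable_sum:
  assumes "finite I" "\<And>i. i \<in> I \<Longrightarrow> square_integrable X (f i)"
  shows "square_integrable X (\<lambda>t. \<Sum>i\<in>I. f i t)"
  using assms
proof (induction I rule: finite_induct)
  case empty
  show ?case by (simp add: square_integrable_def)
next
  case (insert i I)
  then show ?case using square_integrable_add[of X "f i" "\<lambda>t. \<Sum>i\<in>I. f i t"] by simp
qed

lemma square_integrable_continuous:
  assumes "continuous_on {a..b} f" shows "square_integrable {a..b} f"
  using assms unfolding square_integrable_def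
  by (auto intro!: integrable_continuous_lebesgue_on continuous_intros continuous_imp_measurable_on_sets_lebesgue)

lemma square_integrable_imp_integrable:
  assumes "square_integrable {a..b} f" shows "integrable (lebesgue_on {a..b}) f"
  using square_integrable_mult[OF assms square_integrable_continuous[of a b "\<lambda>_. 1"]] by simp

lemma square_integrable_cong:
  assumes "square_integrable X f" "\<And>t. t \<in> X \<Longrightarrow> f t = g t"
  shows "square_integrable X g"
proof -
  have "g \<in> borel_measurable (lebesgue_on X) \<longleftrightarrow> f \<in> borel_measurable (lebesgue_on X)"
    by (rule measurable_cong) (simp add: assms(2))
  moreover have "integrable (lebesgue_on X) (\<lambda>t. (g t)\<^sup>2) \<longleftrightarrow> integrable (lebesgue_on X) (\<lambda>t. (f t)\<^sup>2)"
    by (rule Bochner_Integration.integrable_cong) (simp_all add: assms(2))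
  ultimately show ?thesis using assms(1) by (simp add: square_integrable_def)
qed

lemma L2_on_carrier: "L2_on X k u \<Longrightarrow> t \<in> X \<Longrightarrow> u t \<in> carrier_vec k"
  by (simp add: L2_on_def)

lemma L2_on_component: "L2_on X k u \<Longrightarrow> j < k \<Longrightarrow> square_integrable X (\<lambda>t. u t $ j)"
  by (simp add: L2_on_def square_integrable_def)

lemma L2_onI:
  assumes "\<And>t. t \<in> X \<Longrightarrow> u t \<in> carrier_vec k" "\<And>j. j < k \<Longrightarrow> square_integrable X (\<lambda>t. u t $ j)"
  shows "L2_on X k u"
  using assms by (simp add: L2_on_def square_integrable_def)

lemma L2_on_scalar_prod:
  assumes "L2_on X k u" "x \<in> carrier_vec k"
  shows "square_integrable X (\<lambda>t. x \<bullet> u t)"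
proof (rule square_integrable_cong)
  show "square_integrable X (\<lambda>t. \<Sum>j<k. x $ j * u t $ j)"
    using assms by (intro square_integrable_sum square_integrable_cmult) (auto simp: L2_on_component)
  fix t assume "t \<in> X"
  then show "(\<Sum>j<k. x $ j * u t $ j) = x \<bullet> u t"
    using L2_on_carrier[OF assms(1), of t] by (simp add: scalar_prod_def atLeast0LessThan)
qed

lemma L2_on_mult_mat_vec:
  assumes u: "L2_on X k u" and B: "B \<in> carrier_mat l k"
  shows "L2_on X l (\<lambda>t. B *\<^sub>v u t)"
proof (rule L2_onI)
  show "B *\<^sub>v u t \<in> carrier_vec l" if "t \<in> X" for t using L2_on_carrier[OF u that] B by auto
  fix j assume j: "j < l"
  have "square_integrable X (\<lambda>t. row B j \<bullet> u t)" using B j by (intro L2_on_scalar_prod[OF u]) auto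
  then show "square_integrable X (\<lambda>t. (B *\<^sub>v u t) $ j)"
    by (rule square_integrable_cong) (use B j in auto)
qed

lemma L2_on_append:
  assumes u: "L2_on X a u" and w: "L2_on X b w"
  shows "L2_on X (a + b) (\<lambda>t. u t @\<^sub>v w t)"
proof (rule L2_onI)
  show "u t @\<^sub>v w t \<in> carrier_vec (a + b)" if "t \<in> X" for t using L2_on_carrier[OF u that] L2_on_carrier[OF w that] by auto
  fix j assume j: "j < a + b"
  show "square_integrable X (\<lambda>t. (u t @\<^sub>v w t) $ j)"
  proof (cases "j < a")
    case True
    from L2_on_component[OF u True] show ?thesis
    proof (rule square_integrable_cong)
      fix t assume t: "t \<in> X"
      show "u t $ j = (u t @\<^sub>v w t) $ j"
        using True L2_on_carrier[OF u t] L2_on_carrier[OF w t] by auto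
    qed
  next
    case False
    then have "j - a < b" using j by auto
    from L2_on_component[OF w this] show ?thesis
    proof (rule square_integrable_cong)
      fix t assume t: "t \<in> X"
      show "w t $ (j - a) = (u t @\<^sub>v w t) $ j"
        using False j L2_on_carrier[OF u t] L2_on_carrier[OF w t] by auto
    qed
  qed
qed

lemma L2_on_minus:
  assumes u: "L2_on X k u" and w: "L2_on X k w"
  shows "L2_on X k (\<lambda>t. u t - w t)"
proof (rule L2_onI)
  show "u t - w t \<in> carrier_vec k" if "t \<in> X" for t
    using L2_on_carrier[OF u that] L2_on_carrier[OF w that] by simp
  fix j assume j: "j < k"
  from square_integrable_diff[OF L2_on_component[OF u j] L2_on_component[OF w j]]
  show "square_integrable X (\<lambda>t. (u t - w t) $ j)"
  proof (rule square_integrable_cong)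
    fix t assume t: "t \<in> X"
    show "u t $ j - w t $ j = (u t - w t) $ j" using j L2_on_carrier[OF w t] by auto
  qed
qed

lemma lebesgue_integral_double_sum:
  fixes f :: "'i \<Rightarrow> 'j \<Rightarrow> 'a \<Rightarrow> real"
  assumes "\<And>i j. i \<in> A \<Longrightarrow> j \<in> B \<Longrightarrow> integrable M (f i j)"
  shows "(LINT t|M. (\<Sum>i\<in>A. \<Sum>j\<in>B. f i j t)) = (\<Sum>i\<in>A. \<Sum>j\<in>B. LINT t|M. f i j t)"
  using assms by (simp add: Bochner_Integration.integral_sum Bochner_Integration.integrable_sum)

text \<open>The common shape of the matrices \<open>matG\<close>, \<open>matF\<close>,
  \<open>matH\<close>, \<open>matGamma\<close> and \<open>matE\<close>, so that bilinearity,
  congruence and positivity are treated once.\<close>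

definition gram :: "real set \<Rightarrow> nat \<Rightarrow> nat \<Rightarrow> (real \<Rightarrow> real vec) \<Rightarrow> (real \<Rightarrow> real vec) \<Rightarrow> real mat"
  where "gram X k l u w = mat_integral X k l (\<lambda>\<tau>. col_mat (u \<tau>) * (col_mat (w \<tau>))\<^sup>\<top>)"

lemma gram_carrier [simp]: "gram X k l u w \<in> carrier_mat k l"
  by (simp add: gram_def mat_integral_def)

lemma gram_dim [simp]: "dim_row (gram X k l u w) = k" "dim_col (gram X k l u w) = l"
  by (simp_all add: gram_def mat_integral_def)

lemma gram_index:
  assumes u: "L2_on X k u" and w: "L2_on X l w" and ij: "i < k" "j < l"
  shows "gram X k l u w $$ (i, j) = (LINT \<tau>|lebesgue_on X. u \<tau> $ i * w \<tau> $ j)"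
proof -
  have "(col_mat (u \<tau>) * (col_mat (w \<tau>))\<^sup>\<top>) $$ (i, j) = u \<tau> $ i * w \<tau> $ j" if "\<tau> \<in> X" for \<tau>
    using L2_on_carrier[OF u that] L2_on_carrier[OF w that] ij by (simp add: scalar_prod_def mat_of_cols_index)
  then show ?thesis using ij unfolding gram_def mat_integral_def
    by (auto intro!: Bochner_Integration.integral_cong)
qed

lemma gram_bilinear:
  assumes u: "L2_on X k u" and w: "L2_on X l w" and x: "x \<in> carrier_vec k" and y: "y \<in> carrier_vec l"
  shows "x \<bullet> (gram X k l u w *\<^sub>v y) = (LINT \<tau>|lebesgue_on X. (x \<bullet> u \<tau>) * (y \<bullet> w \<tau>))"
proof -
  have i: "integrable (lebesgue_on X) (\<lambda>\<tau>. u \<tau> $ i * w \<tau> $ j)" if "i < k" "j < l" for i j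
    using square_integrable_mult[OF L2_on_component[OF u] L2_on_component[OF w]] that by blast
  have "x \<bullet> (gram X k l u w *\<^sub>v y) = (\<Sum>i<k. \<Sum>j<l. (x $ i * y $ j) * gram X k l u w $$ (i, j))"
    using x y gram_carrier[of X k l u w]
    by (simp add: scalar_prod_def atLeast0LessThan sum_distrib_left mult_ac)
  also have "\<dots> = (\<Sum>i<k. \<Sum>j<l. LINT \<tau>|lebesgue_on X. (x $ i * y $ j) * (u \<tau> $ i * w \<tau> $ j))"
    by (intro sum.cong refl) (simp add: gram_index[OF u w])
  also have "\<dots> = (LINT \<tau>|lebesgue_on X. (\<Sum>i<k. \<Sum>j<l. (x $ i * y $ j) * (u \<tau> $ i * w \<tau> $ j)))"
    using i by (subst lebesgue_integral_double_sum) auto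
  also have "\<dots> = (LINT \<tau>|lebesgue_on X. (x \<bullet> u \<tau>) * (y \<bullet> w \<tau>))"
  proof (rule Bochner_Integration.integral_cong[OF refl])
    fix \<tau> assume "\<tau> \<in> space (lebesgue_on X)"
    then have c: "u \<tau> \<in> carrier_vec k" "w \<tau> \<in> carrier_vec l" using L2_on_carrier u w by auto
    show "(\<Sum>i<k. \<Sum>j<l. (x $ i * y $ j) * (u \<tau> $ i * w \<tau> $ j)) = (x \<bullet> u \<tau>) * (y \<bullet> w \<tau>)"
      using c by (simp add: scalar_prod_def atLeast0LessThan sum_product mult_ac)
  qed
  finally show ?thesis .
qed

lemma gram_mult:
  assumes u: "L2_on X k u" and w: "L2_on X l w" and B: "B \<in> carrier_mat k' k" and C: "C \<in> carrier_mat l' l"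
  shows "gram X k' l' (\<lambda>\<tau>. B *\<^sub>v u \<tau>) (\<lambda>\<tau>. C *\<^sub>v w \<tau>) = B * gram X k l u w * C\<^sup>\<top>"
proof (rule eq_mat_bilinearI[of _ k' l'])
  fix x y :: "real vec" assume x: "x \<in> carrier_vec k'" and y: "y \<in> carrier_vec l'"
  have G: "gram X k l u w \<in> carrier_mat k l" by simp
  have Bx: "B\<^sup>\<top> *\<^sub>v x \<in> carrier_vec k" and Cy: "C\<^sup>\<top> *\<^sub>v y \<in> carrier_vec l" using B C x y by auto
  have "x \<bullet> (gram X k' l' (\<lambda>\<tau>. B *\<^sub>v u \<tau>) (\<lambda>\<tau>. C *\<^sub>v w \<tau>) *\<^sub>v y)
      = (LINT \<tau>|lebesgue_on X. (x \<bullet> (B *\<^sub>v u \<tau>)) * (y \<bullet> (C *\<^sub>v w \<tau>)))"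
    by (rule gram_bilinear[OF L2_on_mult_mat_vec[OF u B] L2_on_mult_mat_vec[OF w C] x y])
  also have "\<dots> = (LINT \<tau>|lebesgue_on X. ((B\<^sup>\<top> *\<^sub>v x) \<bullet> u \<tau>) * ((C\<^sup>\<top> *\<^sub>v y) \<bullet> w \<tau>))"
    using L2_on_carrier[OF u] L2_on_carrier[OF w]
    by (intro Bochner_Integration.integral_cong refl)
      (simp add: transpose_scalar_prod[OF B x] transpose_scalar_prod[OF C y])
  also have "\<dots> = (B\<^sup>\<top> *\<^sub>v x) \<bullet> (gram X k l u w *\<^sub>v (C\<^sup>\<top> *\<^sub>v y))"
    by (rule gram_bilinear[OF u w Bx Cy, symmetric])
  also have "\<dots> = x \<bullet> (B *\<^sub>v (gram X k l u w *\<^sub>v (C\<^sup>\<top> *\<^sub>v y)))"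
    using mult_mat_vec_carrier[OF G Cy] by (rule transpose_scalar_prod[OF B x])
  also have "B *\<^sub>v (gram X k l u w *\<^sub>v (C\<^sup>\<top> *\<^sub>v y)) = (B * gram X k l u w * C\<^sup>\<top>) *\<^sub>v y"
    using B C G y Cy by (simp add: assoc_mult_mat_vec[of _ k' l _ l'] assoc_mult_mat_vec[of _ k' k _ l])
  finally show "x \<bullet> (gram X k' l' (\<lambda>\<tau>. B *\<^sub>v u \<tau>) (\<lambda>\<tau>. C *\<^sub>v w \<tau>) *\<^sub>v y) = x \<bullet> ((B * gram X k l u w * C\<^sup>\<top>) *\<^sub>v y)" .
qed (use B C in auto)

lemma gram_minus_left:
  assumes u: "L2_on X k u" and v: "L2_on X k v" and w: "L2_on X l w"
  shows "gram X k l (\<lambda>\<tau>. u \<tau> - v \<tau>) w = gram X k l u w - gram X k l v w"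
proof (rule eq_matI)
  fix i j assume "i < dim_row (gram X k l u w - gram X k l v w)" "j < dim_col (gram X k l u w - gram X k l v w)"
  then have ij: "i < k" "j < l" using gram_carrier by (metis carrier_matD index_minus_mat(2,3))+
  have "(LINT \<tau>|lebesgue_on X. (u \<tau> - v \<tau>) $ i * w \<tau> $ j) = (LINT \<tau>|lebesgue_on X. u \<tau> $ i * w \<tau> $ j - v \<tau> $ i * w \<tau> $ j)"
  proof (rule Bochner_Integration.integral_cong[OF refl])
    fix \<tau> assume "\<tau> \<in> space (lebesgue_on X)"
    then have "v \<tau> \<in> carrier_vec k" using L2_on_carrier[OF v] by simp
    then show "(u \<tau> - v \<tau>) $ i * w \<tau> $ j = u \<tau> $ i * w \<tau> $ j - v \<tau> $ i * w \<tau> $ j"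
      using ij by (simp add: left_diff_distrib)
  qed
  also have "\<dots> = (LINT \<tau>|lebesgue_on X. u \<tau> $ i * w \<tau> $ j) - (LINT \<tau>|lebesgue_on X. v \<tau> $ i * w \<tau> $ j)"
    using ij u v w by (intro Bochner_Integration.integral_diff square_integrable_mult L2_on_component)
  finally show "gram X k l (\<lambda>\<tau>. u \<tau> - v \<tau>) w $$ (i, j) = (gram X k l u w - gram X k l v w) $$ (i, j)"
    using ij gram_carrier[of X k l v w]
    by (simp add: gram_index[OF L2_on_minus[OF u v] w] gram_index[OF u w] gram_index[OF v w])
qed (use gram_carrier in \<open>metis carrier_matD index_minus_mat(2,3)\<close>)+

lemma gram_self_transpose:
  assumes u: "L2_on X k u" shows "(gram X k k u u)\<^sup>\<top> = gram X k k u u"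
proof (rule eq_matI)
  fix i j assume "i < dim_row (gram X k k u u)" "j < dim_col (gram X k k u u)"
  then have "i < k" "j < k" using gram_carrier by (metis carrier_matD)+
  then show "(gram X k k u u)\<^sup>\<top> $$ (i, j) = gram X k k u u $$ (i, j)"
    using gram_carrier[of X k k u u] by (simp add: gram_index[OF u u] mult.commute)
qed (use gram_carrier in \<open>metis carrier_matD index_transpose_mat(2,3)\<close>)+

text \<open>Both quadratic forms integrate the same square. In this way positivity passes from
  \<open>g\<close> to \<open>h\<close> and to \<open>\<epsilon>\<close>, and from \<open>h\<close>
  to \<open>f\<close>.\<close>

lemma pos_def_gram_combination:
  assumes P: "pos_def (gram X l l w w)" and w: "L2_on X l w" and u: "L2_on X k u"
    and comb: "\<And>x. x \<in> carrier_vec k \<Longrightarrow> x \<noteq> 0\<^sub>v k \<Longrightarrow>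
      \<exists>y\<in>carrier_vec l. y \<noteq> 0\<^sub>v l \<and> (\<forall>\<tau>\<in>X. x \<bullet> u \<tau> = y \<bullet> w \<tau>)"
  shows "pos_def (gram X k k u u)"
proof (rule pos_defI[OF gram_carrier gram_self_transpose[OF u]])
  fix x :: "real vec" assume x: "x \<in> carrier_vec k" "x \<noteq> 0\<^sub>v k"
  from comb[OF this] obtain y where y: "y \<in> carrier_vec l" "y \<noteq> 0\<^sub>v l" "\<And>\<tau>. \<tau> \<in> X \<Longrightarrow> x \<bullet> u \<tau> = y \<bullet> w \<tau>" by blast
  have "x \<bullet> (gram X k k u u *\<^sub>v x) = (LINT \<tau>|lebesgue_on X. (x \<bullet> u \<tau>) * (x \<bullet> u \<tau>))"
    by (rule gram_bilinear[OF u u x(1) x(1)])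
  also have "\<dots> = (LINT \<tau>|lebesgue_on X. (y \<bullet> w \<tau>) * (y \<bullet> w \<tau>))"
    by (intro Bochner_Integration.integral_cong refl) (simp add: y(3))
  also have "\<dots> = y \<bullet> (gram X l l w w *\<^sub>v y)" by (rule gram_bilinear[OF w w y(1) y(1), symmetric])
  also have "\<dots> > 0" using pos_defD(2)[OF P gram_carrier y(1,2)] .
  finally show "x \<bullet> (gram X k k u u *\<^sub>v x) > 0" .
qed

text \<open>With \<open>Y\<close> the root of the Gram matrix and \<open>K\<close> its inverse, the
  Gram matrix of the normalised functions is \<open>K * (Y * Y) * K\<close>, the identity.\<close>

lemma gram_normalize:
  assumes u: "L2_on X k u" and P: "pos_def (gram X k k u u)"
    and pq: "p < k" "q < k"
  defines "K \<equiv> mat_sqrt (mat_inv (gram X k k u u))"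
  shows "(LINT \<tau>|lebesgue_on X. (K *\<^sub>v u \<tau>) $ p * (K *\<^sub>v u \<tau>) $ q) = (if p = q then 1 else 0)"
proof -
  define A where "A = gram X k k u u"
  define Y where "Y = mat_sqrt A"
  have A: "A \<in> carrier_mat k k" "pos_def A" using P by (auto simp: A_def)
  note I = pos_def_mat_inv[OF A(2,1)]
  have K: "K \<in> carrier_mat k k" "pos_def K"
    using mat_sqrt_props[OF I(4,1)] by (auto simp: K_def A_def)
  have Y: "Y \<in> carrier_mat k k" "Y * Y = A" using mat_sqrt_props[OF A(2,1)] by (auto simp: Y_def)
  have KY: "K * Y = 1\<^sub>m k" "Y * K = 1\<^sub>m k" using mat_sqrt_inv[OF A(2,1)] by (auto simp: K_def Y_def A_def)
  have "gram X k k (\<lambda>\<tau>. K *\<^sub>v u \<tau>) (\<lambda>\<tau>. K *\<^sub>v u \<tau>) = K * A * K\<^sup>\<top>"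
    unfolding A_def by (rule gram_mult[OF u u K(1) K(1)])
  also have "\<dots> = K * (Y * Y) * K" using pos_defD(1)[OF K(2,1)] Y by simp
  also have "\<dots> = (K * Y) * (Y * K)" using K(1) Y(1) by (simp add: assoc_mult_mat[of _ k k _ k _ k])
  also have "\<dots> = 1\<^sub>m k" using KY by simp
  finally have "gram X k k (\<lambda>\<tau>. K *\<^sub>v u \<tau>) (\<lambda>\<tau>. K *\<^sub>v u \<tau>) $$ (p, q) = 1\<^sub>m k $$ (p, q)" by simp
  then show ?thesis
    using gram_index[OF L2_on_mult_mat_vec[OF u K(1)] L2_on_mult_mat_vec[OF u K(1)] pq] pq by simp
qed

text \<open>The remainder \<open>z\<close> of \<open>e\<close> after subtracting its projection
  \<open>s\<close> has nonnegative \<open>R\<close>-energy. By orthonormality the cross terms of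
  \<open>e\<close> and \<open>s\<close> integrate to the same sums as those of \<open>s\<close> with
  itself, so expanding that energy leaves the difference of the two sides. The index type is
  arbitrary so that two families can be joined.\<close>

lemma Bessel_inequality_quadratic:
  fixes g :: "'i \<Rightarrow> real \<Rightarrow> real" and e :: "real \<Rightarrow> real vec"
  assumes I: "finite I" and g: "\<And>i. i \<in> I \<Longrightarrow> square_integrable X (g i)"
    and orth: "\<And>i k. i \<in> I \<Longrightarrow> k \<in> I \<Longrightarrow> (LINT \<tau>|lebesgue_on X. g i \<tau> * g k \<tau>) = (if i = k then 1 else 0)"
    and e: "L2_on X n e" and R: "R \<in> carrier_mat n n"
    and psd: "\<And>x. x \<in> carrier_vec n \<Longrightarrow> 0 \<le> x \<bullet> (R *\<^sub>v x)"
  defines "c \<equiv> \<lambda>i. vec n (\<lambda>j. LINT \<tau>|lebesgue_on X. g i \<tau> * e \<tau> $ j)"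
  shows "(\<Sum>i\<in>I. c i \<bullet> (R *\<^sub>v c i)) \<le> (LINT \<tau>|lebesgue_on X. e \<tau> \<bullet> (R *\<^sub>v e \<tau>))"
proof -
  let ?M = "lebesgue_on X"
  have quad: "(LINT \<tau>|?M. u \<tau> \<bullet> (R *\<^sub>v u \<tau>)) = (\<Sum>j<n. \<Sum>k<n. R $$ (j, k) * (LINT \<tau>|?M. u \<tau> $ j * u \<tau> $ k))"
    if u: "L2_on X n u" for u
  proof -
    have i: "integrable ?M (\<lambda>\<tau>. u \<tau> $ j * u \<tau> $ k)" if "j < n" "k < n" for j k
      using square_integrable_mult[OF L2_on_component[OF u] L2_on_component[OF u]] that by blast
    have "(LINT \<tau>|?M. u \<tau> \<bullet> (R *\<^sub>v u \<tau>)) = (LINT \<tau>|?M. (\<Sum>j<n. \<Sum>k<n. R $$ (j, k) * (u \<tau> $ j * u \<tau> $ k)))"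
      using L2_on_carrier[OF u] by (intro Bochner_Integration.integral_cong refl quadratic_form_sum[OF R]) auto
    also have "\<dots> = (\<Sum>j<n. \<Sum>k<n. R $$ (j, k) * (LINT \<tau>|?M. u \<tau> $ j * u \<tau> $ k))"
      using i by (subst lebesgue_integral_double_sum) auto
    finally show ?thesis .
  qed
  define s where "s j \<tau> = (\<Sum>i\<in>I. c i $ j * g i \<tau>)" for j \<tau>
  define z where "z \<tau> = vec n (\<lambda>j. e \<tau> $ j - s j \<tau>)" for \<tau>
  have s: "square_integrable X (s j)" for j unfolding s_def
    using g by (intro square_integrable_sum[OF I] square_integrable_cmult)
  have z: "L2_on X n z"
  proof (rule L2_onI)
    fix j assume j: "j < n"
    from square_integrable_diff[OF L2_on_component[OF e j] s[of j]] show "square_integrable X (\<lambda>t. z t $ j)"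
      using j by (simp add: z_def)
  qed (simp add: z_def)
  have ge: "(LINT \<tau>|?M. g i \<tau> * e \<tau> $ j) = c i $ j" if "j < n" for i j using that by (simp add: c_def)
  have es: "(LINT \<tau>|?M. e \<tau> $ k * s j \<tau>) = (\<Sum>i\<in>I. c i $ j * c i $ k)" if jk: "j < n" "k < n" for j k
  proof -
    have i: "integrable ?M (\<lambda>\<tau>. g i \<tau> * e \<tau> $ k)" if "i \<in> I" for i
      using square_integrable_mult[OF g[OF that] L2_on_component[OF e jk(2)]] .
    have "(LINT \<tau>|?M. e \<tau> $ k * s j \<tau>) = (LINT \<tau>|?M. (\<Sum>i\<in>I. c i $ j * (g i \<tau> * e \<tau> $ k)))"
      by (simp add: s_def sum_distrib_left mult_ac)
    also have "\<dots> = (\<Sum>i\<in>I. c i $ j * c i $ k)"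
      using i by (subst Bochner_Integration.integral_sum) (auto simp: ge jk)
    finally show ?thesis .
  qed
  have ss: "(LINT \<tau>|?M. s j \<tau> * s k \<tau>) = (\<Sum>i\<in>I. c i $ j * c i $ k)" for j k
  proof -
    have i: "integrable ?M (\<lambda>\<tau>. g i \<tau> * g l \<tau>)" if "i \<in> I" "l \<in> I" for i l
      using square_integrable_mult[OF g[OF that(1)] g[OF that(2)]] .
    have "(LINT \<tau>|?M. s j \<tau> * s k \<tau>) = (LINT \<tau>|?M. (\<Sum>i\<in>I. \<Sum>l\<in>I. (c i $ j * c l $ k) * (g i \<tau> * g l \<tau>)))"
      by (simp add: s_def sum_product mult_ac)
    also have "\<dots> = (\<Sum>i\<in>I. \<Sum>l\<in>I. (c i $ j * c l $ k) * (LINT \<tau>|?M. g i \<tau> * g l \<tau>))"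
      using i by (subst lebesgue_integral_double_sum) auto
    also have "\<dots> = (\<Sum>i\<in>I. \<Sum>l\<in>I. if l = i then c i $ j * c l $ k else 0)"
      by (intro sum.cong refl) (auto simp: orth)
    also have "\<dots> = (\<Sum>i\<in>I. c i $ j * c i $ k)" using I by (intro sum.cong refl) simp
    finally show ?thesis .
  qed
  have zz: "(LINT \<tau>|?M. z \<tau> $ j * z \<tau> $ k) = (LINT \<tau>|?M. e \<tau> $ j * e \<tau> $ k) - (\<Sum>i\<in>I. c i $ j * c i $ k)"
    if jk: "j < n" "k < n" for j k
  proof -
    note ej = L2_on_component[OF e jk(1)] and ek = L2_on_component[OF e jk(2)]
    note ii = square_integrable_mult[OF ej ek] square_integrable_mult[OF ej s[of k]]
      square_integrable_mult[OF ek s[of j]] square_integrable_mult[OF s[of j] s[of k]]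
    have "(LINT \<tau>|?M. z \<tau> $ j * z \<tau> $ k)
        = (LINT \<tau>|?M. (e \<tau> $ j * e \<tau> $ k - e \<tau> $ j * s k \<tau>) - (e \<tau> $ k * s j \<tau> - s j \<tau> * s k \<tau>))"
      using jk by (simp add: z_def algebra_simps)
    also have "\<dots> = ((LINT \<tau>|?M. e \<tau> $ j * e \<tau> $ k) - (LINT \<tau>|?M. e \<tau> $ j * s k \<tau>))
        - ((LINT \<tau>|?M. e \<tau> $ k * s j \<tau>) - (LINT \<tau>|?M. s j \<tau> * s k \<tau>))"
      using ii by simp
    also have "\<dots> = (LINT \<tau>|?M. e \<tau> $ j * e \<tau> $ k) - (\<Sum>i\<in>I. c i $ j * c i $ k)"
      using es[OF jk(2,1)] es[OF jk] ss[of j k] by (simp add: mult.commute)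
    finally show ?thesis .
  qed
  have cc: "c i \<in> carrier_vec n" for i by (simp add: c_def)
  have "0 \<le> (LINT \<tau>|?M. z \<tau> \<bullet> (R *\<^sub>v z \<tau>))"
    using psd L2_on_carrier[OF z] by (intro Bochner_Integration.integral_nonneg) (simp add: z_def)
  also have "\<dots> = (\<Sum>j<n. \<Sum>k<n. R $$ (j, k) * ((LINT \<tau>|?M. e \<tau> $ j * e \<tau> $ k) - (\<Sum>i\<in>I. c i $ j * c i $ k)))"
    unfolding quad[OF z] by (intro sum.cong refl) (simp add: zz)
  also have "\<dots> = (\<Sum>j<n. \<Sum>k<n. R $$ (j, k) * (LINT \<tau>|?M. e \<tau> $ j * e \<tau> $ k))
      - (\<Sum>j<n. \<Sum>k<n. \<Sum>i\<in>I. R $$ (j, k) * (c i $ j * c i $ k))"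
    by (simp add: right_diff_distrib sum_subtractf sum_distrib_left)
  also have "(\<Sum>j<n. \<Sum>k<n. \<Sum>i\<in>I. R $$ (j, k) * (c i $ j * c i $ k))
      = (\<Sum>i\<in>I. \<Sum>j<n. \<Sum>k<n. R $$ (j, k) * (c i $ j * c i $ k))"
    by (subst sum.swap[of _ _ "{..<n}"], subst sum.swap, rule refl)
  also have "\<dots> = (\<Sum>i\<in>I. c i \<bullet> (R *\<^sub>v c i))"
    by (intro sum.cong refl quadratic_form_sum[OF R, symmetric] cc)
  finally show ?thesis unfolding quad[OF e] by simp
qed

subsection \<open>Moments of the history\<close>

definition normalized :: "real mat \<Rightarrow> (real \<Rightarrow> real vec) \<Rightarrow> real \<Rightarrow> real vec"
  where "normalized A u \<tau> = mat_sqrt (mat_inv A) *\<^sub>v u \<tau>"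

definition moment_block :: "plant \<Rightarrow> nat \<Rightarrow> (real \<Rightarrow> real vec) \<Rightarrow> (real \<Rightarrow> real vec) \<Rightarrow> real \<Rightarrow> nat \<Rightarrow> real vec"
  where "moment_block S N g e t i = vec_integral (Iint S i) (N * dim_n S)
    (\<lambda>\<tau>. (col_mat (g \<tau>) \<otimes>\<^sub>K 1\<^sub>m (dim_n S)) *\<^sub>v e (t + \<tau>))"

definition moments :: "plant \<Rightarrow> (nat \<Rightarrow> nat) \<Rightarrow> (nat \<Rightarrow> real \<Rightarrow> real vec) \<Rightarrow> (real \<Rightarrow> real vec) \<Rightarrow> real \<Rightarrow> real vec"
  where "moments S N g e t = vconcat (map (\<lambda>i. moment_block S (N i) (g i) e t i) (idx S))"

text \<open>One predicate serves both a trajectory seen at time \<open>t\<close> and an element of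
  \<open>C_space S\<close>, the latter with \<open>t = 0\<close>.\<close>

definition history :: "plant \<Rightarrow> (real \<Rightarrow> real vec) \<Rightarrow> real \<Rightarrow> bool"
  where "history S e t \<longleftrightarrow> (\<forall>\<tau>\<in>Jint S. e (t + \<tau>) \<in> carrier_vec (dim_n S)) \<and>
    (\<forall>j<dim_n S. continuous_on (Jint S) (\<lambda>\<tau>. e (t + \<tau>) $ j))"

lemma append_vec_neq_zero:
  fixes x y :: "real vec"
  assumes "x \<in> carrier_vec a" "y \<in> carrier_vec b" "x \<noteq> 0\<^sub>v a \<or> y \<noteq> 0\<^sub>v b"
  shows "x @\<^sub>v y \<noteq> 0\<^sub>v (a + b)"
proof
  assume "x @\<^sub>v y = 0\<^sub>v (a + b)"
  then have "(x @\<^sub>v y) \<bullet> (x @\<^sub>v y) = 0" by simp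
  then have "x \<bullet> x + y \<bullet> y = 0" using assms by (simp add: scalar_prod_append[of _ a _ b])
  then have "x \<bullet> x = 0" "y \<bullet> y = 0" using scalar_prod_self_ge_0[of x] scalar_prod_self_ge_0[of y] by linarith+
  then show False using scalar_prod_self_eq_0[OF assms(1)] scalar_prod_self_eq_0[OF assms(2)] assms(3) by simp
qed

section \<open>Gram matrices and orthonormal kernels of the delay system\<close>

locale delay_system =
  fixes S :: plant
  assumes admissible: "admissible_plant S"
begin

abbreviation "n \<equiv> dim_n S"
abbreviation "\<nu> \<equiv> num_delays S"

lemma delay_0: "delay S 0 = 0" and delay_less: "i \<in> {1..\<nu>} \<Longrightarrow> delay S (i - 1) < delay S i"
  and nu_ge_1: "\<nu> \<ge> 1"
  using admissible by (auto simp: admissible_plant_def)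

lemma delay_le: "i \<le> j \<Longrightarrow> j \<le> \<nu> \<Longrightarrow> delay S i \<le> delay S j"
proof (induction j rule: dec_induct)
  case (step j)
  then show ?case using delay_less[of "Suc j"] by auto
qed simp

lemma delay_nonneg: "i \<le> \<nu> \<Longrightarrow> 0 \<le> delay S i"
  using delay_le[of 0 i] delay_0 by simp

lemma delay_le_r_max: "i \<le> \<nu> \<Longrightarrow> delay S i \<le> r_max S"
  using delay_le[of i \<nu>] by (simp add: r_max_def)

lemma r_max_nonneg: "0 \<le> r_max S"
  using delay_nonneg[of \<nu>] by (simp add: r_max_def)

lemma Iint_subset_Jint: "i \<in> {1..\<nu>} \<Longrightarrow> Iint S i \<subseteq> Jint S"
  using delay_le_r_max[of i] delay_nonneg[of "i - 1"] by (auto simp: Iint_def Jint_def)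

lemma neg_delay_in_Jint: "i \<le> \<nu> \<Longrightarrow> - delay S i \<in> Jint S"
  using delay_le_r_max[of i] delay_nonneg[of i] by (auto simp: Jint_def)

context
  fixes i assumes i: "i \<in> {1..\<nu>}"
begin

lemma f_L2: "L2_on (Iint S i) (d_of S i) (fun_f S i)"
  and varphi_L2: "L2_on (Iint S i) (del_of S i) (fun_varphi S i)"
  and phi_L2: "L2_on (Iint S i) (mu_of S i) (fun_phi S i)"
  and f_continuous: "p < d_of S i \<Longrightarrow> continuous_on (Iint S i) (\<lambda>\<tau>. fun_f S i \<tau> $ p)"
  and f_weak_deriv: "weak_deriv_on (Iint S i) (d_of S i) (fun_f S i) (\<lambda>\<tau>. pM S i *\<^sub>v fun_h S i \<tau>)"
  and M_carrier: "pM S i \<in> carrier_mat (d_of S i) (varkap_of S i)"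
  and pos_def_matG: "pos_def (matG S i)"
  using admissible i unfolding admissible_plant_def H1_on_def by auto

lemma h_L2: "L2_on (Iint S i) (varkap_of S i) (fun_h S i)"
  using L2_on_append[OF varphi_L2 f_L2] by (simp add: varkap_of_def fun_h_def[abs_def] add.commute)

lemma g_L2: "L2_on (Iint S i) (kap_of S i) (fun_g S i)"
  using L2_on_append[OF phi_L2 h_L2] by (simp add: kap_of_def varkap_of_def fun_g_def[abs_def] add_ac)

lemma matrices_gram:
  "matG S i = gram (Iint S i) (kap_of S i) (kap_of S i) (fun_g S i) (fun_g S i)"
  "matF S i = gram (Iint S i) (d_of S i) (d_of S i) (fun_f S i) (fun_f S i)"
  "matH S i = gram (Iint S i) (varkap_of S i) (varkap_of S i) (fun_h S i) (fun_h S i)"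
  "matGamma S i = gram (Iint S i) (mu_of S i) (varkap_of S i) (fun_phi S i) (fun_h S i)"
  "matE S i = gram (Iint S i) (mu_of S i) (mu_of S i) (fun_eps S i) (fun_eps S i)"
  by (simp_all add: gram_def matG_def matF_def matH_def matGamma_def matE_def)

lemma pos_def_matH: "pos_def (matH S i)"
  unfolding matrices_gram
proof (rule pos_def_gram_combination[OF pos_def_matG[unfolded matrices_gram] g_L2 h_L2])
  fix x :: "real vec" assume x: "x \<in> carrier_vec (varkap_of S i)" "x \<noteq> 0\<^sub>v (varkap_of S i)"
  have k: "kap_of S i = mu_of S i + varkap_of S i" by (simp add: kap_of_def varkap_of_def)
  show "\<exists>y\<in>carrier_vec (kap_of S i). y \<noteq> 0\<^sub>v (kap_of S i) \<and> (\<forall>\<tau>\<in>Iint S i. x \<bullet> fun_h S i \<tau> = y \<bullet> fun_g S i \<tau>)"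
    unfolding k
  proof (intro bexI[of _ "0\<^sub>v (mu_of S i) @\<^sub>v x"] conjI ballI)
    fix \<tau> assume "\<tau> \<in> Iint S i"
    then show "x \<bullet> fun_h S i \<tau> = (0\<^sub>v (mu_of S i) @\<^sub>v x) \<bullet> fun_g S i \<tau>"
      using L2_on_carrier[OF phi_L2] L2_on_carrier[OF h_L2] x
      by (simp add: fun_g_def scalar_prod_append[of _ "mu_of S i" _ "varkap_of S i"])
  qed (use x append_vec_neq_zero in auto)
qed

lemma pos_def_matF: "pos_def (matF S i)"
  unfolding matrices_gram
proof (rule pos_def_gram_combination[OF pos_def_matH[unfolded matrices_gram] h_L2 f_L2])
  fix x :: "real vec" assume x: "x \<in> carrier_vec (d_of S i)" "x \<noteq> 0\<^sub>v (d_of S i)"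
  have k: "varkap_of S i = del_of S i + d_of S i" by (simp add: varkap_of_def)
  show "\<exists>y\<in>carrier_vec (varkap_of S i). y \<noteq> 0\<^sub>v (varkap_of S i) \<and> (\<forall>\<tau>\<in>Iint S i. x \<bullet> fun_f S i \<tau> = y \<bullet> fun_h S i \<tau>)"
    unfolding k
  proof (intro bexI[of _ "0\<^sub>v (del_of S i) @\<^sub>v x"] conjI ballI)
    fix \<tau> assume "\<tau> \<in> Iint S i"
    then show "x \<bullet> fun_f S i \<tau> = (0\<^sub>v (del_of S i) @\<^sub>v x) \<bullet> fun_h S i \<tau>"
      using L2_on_carrier[OF varphi_L2] L2_on_carrier[OF f_L2] x
      by (simp add: fun_h_def scalar_prod_append[of _ "del_of S i" _ "d_of S i"])
  qed (use x append_vec_neq_zero in auto)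
qed

lemma matrix_carriers [simp]:
  "matF S i \<in> carrier_mat (d_of S i) (d_of S i)" "matH S i \<in> carrier_mat (varkap_of S i) (varkap_of S i)"
  "matGamma S i \<in> carrier_mat (mu_of S i) (varkap_of S i)" "matE S i \<in> carrier_mat (mu_of S i) (mu_of S i)"
  unfolding matrices_gram by auto

lemma Gamma_H_carrier: "matGamma S i * mat_inv (matH S i) \<in> carrier_mat (mu_of S i) (varkap_of S i)"
  by (rule mult_carrier_mat[OF matrix_carriers(3) pos_def_mat_inv(1)[OF pos_def_matH matrix_carriers(2)]])

lemma eps_L2: "L2_on (Iint S i) (mu_of S i) (fun_eps S i)"
  unfolding fun_eps_def[abs_def] by (intro L2_on_minus phi_L2 L2_on_mult_mat_vec[OF h_L2] Gamma_H_carrier)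

text \<open>A combination of \<open>\<epsilon>\<close> with coefficients \<open>x\<close> is the
  combination of \<open>g\<close> with coefficients \<open>x\<close> on \<open>\<phi>\<close> and
  \<open>?y\<close> on \<open>h\<close>; it is nontrivial because its first part is
  \<open>x\<close>.\<close>

lemma pos_def_matE: "pos_def (matE S i)"
  unfolding matrices_gram
proof (rule pos_def_gram_combination[OF pos_def_matG[unfolded matrices_gram] g_L2 eps_L2])
  fix x :: "real vec" assume x: "x \<in> carrier_vec (mu_of S i)" "x \<noteq> 0\<^sub>v (mu_of S i)"
  have k: "kap_of S i = mu_of S i + varkap_of S i" by (simp add: kap_of_def varkap_of_def)
  let ?B = "matGamma S i * mat_inv (matH S i)"
  let ?y = "- (?B\<^sup>\<top> *\<^sub>v x)"
  have y: "?y \<in> carrier_vec (varkap_of S i)" using Gamma_H_carrier x by auto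
  show "\<exists>y\<in>carrier_vec (kap_of S i). y \<noteq> 0\<^sub>v (kap_of S i) \<and> (\<forall>\<tau>\<in>Iint S i. x \<bullet> fun_eps S i \<tau> = y \<bullet> fun_g S i \<tau>)"
    unfolding k
  proof (intro bexI[of _ "x @\<^sub>v ?y"] conjI ballI)
    fix \<tau> assume "\<tau> \<in> Iint S i"
    then have c: "fun_phi S i \<tau> \<in> carrier_vec (mu_of S i)" "fun_h S i \<tau> \<in> carrier_vec (varkap_of S i)"
      using L2_on_carrier[OF phi_L2] L2_on_carrier[OF h_L2] by auto
    have "(x @\<^sub>v ?y) \<bullet> fun_g S i \<tau> = x \<bullet> fun_phi S i \<tau> - (?B\<^sup>\<top> *\<^sub>v x) \<bullet> fun_h S i \<tau>"
      using c x y Gamma_H_carrier unfolding fun_g_def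
      by (subst scalar_prod_append[of _ "mu_of S i" _ "varkap_of S i"]) (auto simp: scalar_prod_uminus_left)
    also have "(?B\<^sup>\<top> *\<^sub>v x) \<bullet> fun_h S i \<tau> = x \<bullet> (?B *\<^sub>v fun_h S i \<tau>)"
      by (rule transpose_scalar_prod[OF Gamma_H_carrier x(1) c(2)])
    finally show "x \<bullet> fun_eps S i \<tau> = (x @\<^sub>v ?y) \<bullet> fun_g S i \<tau>"
      unfolding fun_eps_def using c x Gamma_H_carrier
      by (subst scalar_prod_minus_distrib[of _ "mu_of S i"]) auto
  qed (use x y append_vec_neq_zero in auto)
qed

text \<open>\<open>\<epsilon>\<close> is \<open>\<phi>\<close> minus its projection onto the span of
  \<open>h\<close>: the Gram matrix is \<open>\<Gamma> - \<Gamma> H^{-1} H = 0\<close>.\<close>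

lemma eps_h_orthogonal: "gram (Iint S i) (mu_of S i) (varkap_of S i) (fun_eps S i) (fun_h S i) = 0\<^sub>m (mu_of S i) (varkap_of S i)"
proof -
  let ?B = "matGamma S i * mat_inv (matH S i)"
  note I = pos_def_mat_inv[OF pos_def_matH matrix_carriers(2)]
  have "gram (Iint S i) (mu_of S i) (varkap_of S i) (fun_eps S i) (fun_h S i)
      = matGamma S i - gram (Iint S i) (mu_of S i) (varkap_of S i) (\<lambda>\<tau>. ?B *\<^sub>v fun_h S i \<tau>) (fun_h S i)"
    unfolding fun_eps_def[abs_def]
    by (subst gram_minus_left[OF phi_L2 L2_on_mult_mat_vec[OF h_L2 Gamma_H_carrier] h_L2]) (simp add: matrices_gram)
  \<comment> \<open>An identity matrix is inserted in the second argument so that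
    \<open>gram_mult\<close> applies to both.\<close>
  also have "gram (Iint S i) (mu_of S i) (varkap_of S i) (\<lambda>\<tau>. ?B *\<^sub>v fun_h S i \<tau>) (fun_h S i)
     = gram (Iint S i) (mu_of S i) (varkap_of S i) (\<lambda>\<tau>. ?B *\<^sub>v fun_h S i \<tau>) (\<lambda>\<tau>. 1\<^sub>m (varkap_of S i) *\<^sub>v fun_h S i \<tau>)"
  proof (rule eq_matI)
    fix a b assume "a < dim_row (gram (Iint S i) (mu_of S i) (varkap_of S i) (\<lambda>\<tau>. ?B *\<^sub>v fun_h S i \<tau>) (\<lambda>\<tau>. 1\<^sub>m (varkap_of S i) *\<^sub>v fun_h S i \<tau>))"
      "b < dim_col (gram (Iint S i) (mu_of S i) (varkap_of S i) (\<lambda>\<tau>. ?B *\<^sub>v fun_h S i \<tau>) (\<lambda>\<tau>. 1\<^sub>m (varkap_of S i) *\<^sub>v fun_h S i \<tau>))"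
    then have ab: "a < mu_of S i" "b < varkap_of S i" by auto
    have "(LINT \<tau>|lebesgue_on (Iint S i). (?B *\<^sub>v fun_h S i \<tau>) $ a * fun_h S i \<tau> $ b)
      = (LINT \<tau>|lebesgue_on (Iint S i). (?B *\<^sub>v fun_h S i \<tau>) $ a * (1\<^sub>m (varkap_of S i) *\<^sub>v fun_h S i \<tau>) $ b)"
      using L2_on_carrier[OF h_L2] by (intro Bochner_Integration.integral_cong) (auto simp: one_mult_mat_vec)
    then show "gram (Iint S i) (mu_of S i) (varkap_of S i) (\<lambda>\<tau>. ?B *\<^sub>v fun_h S i \<tau>) (fun_h S i) $$ (a, b)
      = gram (Iint S i) (mu_of S i) (varkap_of S i) (\<lambda>\<tau>. ?B *\<^sub>v fun_h S i \<tau>) (\<lambda>\<tau>. 1\<^sub>m (varkap_of S i) *\<^sub>v fun_h S i \<tau>) $$ (a, b)"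
      using ab by (simp only: gram_index[OF L2_on_mult_mat_vec[OF h_L2 Gamma_H_carrier] h_L2 ab]
        gram_index[OF L2_on_mult_mat_vec[OF h_L2 Gamma_H_carrier] L2_on_mult_mat_vec[OF h_L2 one_carrier_mat] ab])
  qed auto
  also have "\<dots> = ?B * matH S i * (1\<^sub>m (varkap_of S i))\<^sup>\<top>"
    by (rule gram_mult[OF h_L2 h_L2 Gamma_H_carrier one_carrier_mat, folded matrices_gram(3)])
  also have "\<dots> = matGamma S i"
    using I matrix_carriers by (simp add: right_mult_one_mat[OF matrix_carriers(3)] assoc_mult_mat[of _ "mu_of S i" "varkap_of S i" _ "varkap_of S i" _ "varkap_of S i"])
  finally show ?thesis using minus_r_inv_mat[OF matrix_carriers(3)] by simp
qed

abbreviation "nf \<equiv> normalized (matF S i) (fun_f S i)"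
abbreviation "nh \<equiv> normalized (matH S i) (fun_h S i)"
abbreviation "ne \<equiv> normalized (matE S i) (fun_eps S i)"

lemma sqrt_carriers:
  "mat_sqrt (mat_inv (matF S i)) \<in> carrier_mat (d_of S i) (d_of S i)"
  "mat_sqrt (mat_inv (matH S i)) \<in> carrier_mat (varkap_of S i) (varkap_of S i)"
  "mat_sqrt (mat_inv (matE S i)) \<in> carrier_mat (mu_of S i) (mu_of S i)"
  "mat_sqrt (matH S i) \<in> carrier_mat (varkap_of S i) (varkap_of S i)"
  "mat_sqrt (matE S i) \<in> carrier_mat (mu_of S i) (mu_of S i)"
  using mat_sqrt_props(1)[OF pos_def_mat_inv(4,1)] pos_def_matF pos_def_matH pos_def_matE matrix_carriers
    mat_sqrt_props(1) by metis+

lemma normalized_L2: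
  "L2_on (Iint S i) (d_of S i) nf" "L2_on (Iint S i) (varkap_of S i) nh" "L2_on (Iint S i) (mu_of S i) ne"
  unfolding normalized_def[abs_def]
  by (intro L2_on_mult_mat_vec[OF f_L2] L2_on_mult_mat_vec[OF h_L2] L2_on_mult_mat_vec[OF eps_L2] sqrt_carriers)+

lemma nf_orthonormal:
  "p < d_of S i \<Longrightarrow> q < d_of S i \<Longrightarrow> (LINT \<tau>|lebesgue_on (Iint S i). nf \<tau> $ p * nf \<tau> $ q) = (if p = q then 1 else 0)"
  using gram_normalize[OF f_L2 pos_def_matF[unfolded matrices_gram]] by (simp add: normalized_def matrices_gram)

lemma nh_orthonormal:
  "p < varkap_of S i \<Longrightarrow> q < varkap_of S i \<Longrightarrow> (LINT \<tau>|lebesgue_on (Iint S i). nh \<tau> $ p * nh \<tau> $ q) = (if p = q then 1 else 0)"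
  using gram_normalize[OF h_L2 pos_def_matH[unfolded matrices_gram]] by (simp add: normalized_def matrices_gram)

lemma ne_orthonormal:
  "p < mu_of S i \<Longrightarrow> q < mu_of S i \<Longrightarrow> (LINT \<tau>|lebesgue_on (Iint S i). ne \<tau> $ p * ne \<tau> $ q) = (if p = q then 1 else 0)"
  using gram_normalize[OF eps_L2 pos_def_matE[unfolded matrices_gram]] by (simp add: normalized_def matrices_gram)

lemma ne_nh_orthogonal:
  assumes pq: "p < mu_of S i" "q < varkap_of S i"
  shows "(LINT \<tau>|lebesgue_on (Iint S i). ne \<tau> $ p * nh \<tau> $ q) = 0"
proof -
  note K = sqrt_carriers(3,2)
  have "gram (Iint S i) (mu_of S i) (varkap_of S i) ne nh = mat_sqrt (mat_inv (matE S i)) * 0\<^sub>m (mu_of S i) (varkap_of S i) * (mat_sqrt (mat_inv (matH S i)))\<^sup>\<top>"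
    unfolding normalized_def[abs_def] eps_h_orthogonal[symmetric] by (rule gram_mult[OF eps_L2 h_L2 K])
  also have "\<dots> = 0\<^sub>m (mu_of S i) (varkap_of S i)" using K by simp
  finally have "gram (Iint S i) (mu_of S i) (varkap_of S i) ne nh $$ (p, q) = 0" using pq by simp
  then show ?thesis by (simp only: gram_index[OF normalized_L2(3,2) pq])
qed

text \<open>\<open>mat_sqrt (matH S i)\<close> undoes the normalisation of \<open>h\<close>, and the
  selector with a zero and an identity block picks the lower part \<open>f\<close>. From these
  blocks \<open>boldI\<close> is built.\<close>

lemma nf_of_nh:
  assumes "\<tau> \<in> Iint S i"
  shows "(mat_sqrt (mat_inv (matF S i)) * (0\<^sub>m (d_of S i) (del_of S i) @\<^sub>c 1\<^sub>m (d_of S i)) * mat_sqrt (matH S i)) *\<^sub>v nh \<tau> = nf \<tau>"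
proof -
  let ?k = "varkap_of S i" and ?d = "d_of S i"
  let ?E = "0\<^sub>m ?d (del_of S i) @\<^sub>c 1\<^sub>m ?d"
  have E: "?E \<in> carrier_mat ?d ?k"
    using append_cols_carrier[of "0\<^sub>m ?d (del_of S i)" ?d "del_of S i" "1\<^sub>m ?d" ?d] by (simp add: varkap_of_def add.commute)
  have h: "fun_h S i \<tau> \<in> carrier_vec ?k" using L2_on_carrier[OF h_L2 assms] .
  have nh: "nh \<tau> \<in> carrier_vec ?k" using L2_on_carrier[OF normalized_L2(2) assms] .
  have "mat_sqrt (matH S i) *\<^sub>v nh \<tau> = (mat_sqrt (matH S i) * mat_sqrt (mat_inv (matH S i))) *\<^sub>v fun_h S i \<tau>"
    unfolding normalized_def using sqrt_carriers h by (simp add: assoc_mult_mat_vec[of _ ?k ?k _ ?k])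
  also have "\<dots> = fun_h S i \<tau>" using mat_sqrt_inv(2)[OF pos_def_matH matrix_carriers(2)] h by simp
  finally have *: "mat_sqrt (matH S i) *\<^sub>v nh \<tau> = fun_h S i \<tau>" .
  have "?E *\<^sub>v fun_h S i \<tau> = 0\<^sub>m ?d (del_of S i) *\<^sub>v fun_varphi S i \<tau> + 1\<^sub>m ?d *\<^sub>v fun_f S i \<tau>"
    unfolding fun_h_def using L2_on_carrier[OF varphi_L2 assms] L2_on_carrier[OF f_L2 assms]
    by (intro append_cols_mult_vec) auto
  also have "\<dots> = fun_f S i \<tau>" using L2_on_carrier[OF varphi_L2 assms] L2_on_carrier[OF f_L2 assms]
    by (intro eq_vecI) auto
  finally have "?E *\<^sub>v (mat_sqrt (matH S i) *\<^sub>v nh \<tau>) = fun_f S i \<tau>" using * by simp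
  then show ?thesis using sqrt_carriers(1,4) E nh
    by (simp add: assoc_mult_mat_vec[of _ ?d ?k _ ?k] assoc_mult_mat_vec[of _ ?d ?d _ ?k] normalized_def[of "matF S i"])
qed

text \<open>The derivative of the orthonormalised \<open>f\<close>, written through the
  orthonormalised \<open>h\<close> because \<theta> contains moments against the latter.\<close>

abbreviation "Dnf \<tau> \<equiv> (mat_sqrt (mat_inv (matF S i)) * pM S i * mat_sqrt (matH S i)) *\<^sub>v nh \<tau>"

lemma Dnf_carrier: "mat_sqrt (mat_inv (matF S i)) * pM S i * mat_sqrt (matH S i) \<in> carrier_mat (d_of S i) (varkap_of S i)"
  using sqrt_carriers M_carrier by auto

lemma Dnf_eq: 
  assumes "\<tau> \<in> Iint S i"
  shows "Dnf \<tau> = mat_sqrt (mat_inv (matF S i)) *\<^sub>v (pM S i *\<^sub>v fun_h S i \<tau>)"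
proof -
  let ?k = "varkap_of S i" and ?d = "d_of S i"
  have h: "fun_h S i \<tau> \<in> carrier_vec ?k" using L2_on_carrier[OF h_L2 assms] .
  have nh: "nh \<tau> \<in> carrier_vec ?k" using L2_on_carrier[OF normalized_L2(2) assms] .
  have "mat_sqrt (matH S i) *\<^sub>v nh \<tau> = (mat_sqrt (matH S i) * mat_sqrt (mat_inv (matH S i))) *\<^sub>v fun_h S i \<tau>"
    unfolding normalized_def using sqrt_carriers h by (simp add: assoc_mult_mat_vec[of _ ?k ?k _ ?k])
  also have "\<dots> = fun_h S i \<tau>" using mat_sqrt_inv(2)[OF pos_def_matH matrix_carriers(2)] h by simp
  finally have *: "mat_sqrt (matH S i) *\<^sub>v nh \<tau> = fun_h S i \<tau>" .
  show ?thesis using sqrt_carriers(1,4) M_carrier nh *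
    by (simp add: assoc_mult_mat_vec[of _ ?d ?k _ ?k] assoc_mult_mat_vec[of _ ?d ?d _ ?k])
qed

lemma Dnf_L2: "L2_on (Iint S i) (d_of S i) (\<lambda>\<tau>. Dnf \<tau>)"
  by (rule L2_on_mult_mat_vec[OF normalized_L2(2) Dnf_carrier])

text \<open>Componentwise, the weak derivative makes \<open>f\<close> a primitive of
  \<open>M h\<close>, and the constant matrix \<open>?K\<close> commutes with the integral.\<close>

lemma nf_primitive:
  assumes p: "p < d_of S i" and x: "x \<in> Iint S i"
  shows "nf x $ p = nf (- delay S i) $ p + integral {- delay S i..x} (\<lambda>\<tau>. Dnf \<tau> $ p)"
proof -
  let ?K = "mat_sqrt (mat_inv (matF S i))" and ?d = "d_of S i"
  define a b where "a = - delay S i" and "b = - delay S (i - 1)"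
  have ab: "a < b" using delay_less[OF i] by (simp add: a_def b_def)
  have X: "Iint S i = {a..b}" by (simp add: Iint_def a_def b_def)
  have aX: "a \<in> Iint S i" using ab X by auto
  have Mh: "L2_on (Iint S i) ?d (\<lambda>\<tau>. pM S i *\<^sub>v fun_h S i \<tau>)"
    by (rule L2_on_mult_mat_vec[OF h_L2 M_carrier])
  have int: "integrable (lebesgue_on {a..b}) (\<lambda>\<tau>. (pM S i *\<^sub>v fun_h S i \<tau>) $ q)" if "q < ?d" for q
    using square_integrable_imp_integrable L2_on_component[OF Mh that] X by auto
  have f: "fun_f S i y $ q = fun_f S i a $ q + integral {a..y} (\<lambda>\<tau>. (pM S i *\<^sub>v fun_h S i \<tau>) $ q)"
    if "q < ?d" "y \<in> {a..b}" for q y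
  proof (rule weak_derivative_primitive[OF ab _ int[OF that(1)] _ that(2)])
    show "continuous_on {a..b} (\<lambda>\<tau>. fun_f S i \<tau> $ q)" using f_continuous[OF that(1)] X by simp
    show "(LINT t|lebesgue_on {a..b}. fun_f S i t $ q * deriv \<eta> t) = - (LINT t|lebesgue_on {a..b}. (pM S i *\<^sub>v fun_h S i t) $ q * \<eta> t)"
      if "test_fun {a..b} \<eta>" for \<eta>
      using f_weak_deriv that \<open>q < ?d\<close> unfolding weak_deriv_on_def X by blast
  qed
  have K: "?K \<in> carrier_mat ?d ?d" by (rule sqrt_carriers)
  have comp: "(?K *\<^sub>v v) $ p = (\<Sum>q<?d. ?K $$ (p, q) * v $ q)" if "v \<in> carrier_vec ?d" for v
    using K p that by (simp add: scalar_prod_def atLeast0LessThan)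
  have xX: "x \<in> {a..b}" using x X by simp
  have io: "(\<lambda>\<tau>. (pM S i *\<^sub>v fun_h S i \<tau>) $ q) integrable_on {a..x}" if "q < ?d" for q
  proof -
    have "(\<lambda>\<tau>. (pM S i *\<^sub>v fun_h S i \<tau>) $ q) integrable_on {a..b}"
      using int[OF that] by (simp add: integrable_on_lebesgue_on)
    then show ?thesis by (rule integrable_on_subinterval) (use xX in auto)
  qed
  have "nf x $ p = (\<Sum>q<?d. ?K $$ (p, q) * (fun_f S i a $ q + integral {a..x} (\<lambda>\<tau>. (pM S i *\<^sub>v fun_h S i \<tau>) $ q)))"
    unfolding normalized_def comp[OF L2_on_carrier[OF f_L2 x]]
    by (intro sum.cong refl arg_cong2[of _ _ _ _ "(*)"] f xX) auto
  also have "\<dots> = nf a $ p + (\<Sum>q<?d. integral {a..x} (\<lambda>\<tau>. ?K $$ (p, q) * (pM S i *\<^sub>v fun_h S i \<tau>) $ q))"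
    unfolding normalized_def comp[OF L2_on_carrier[OF f_L2 aX]] by (simp add: distrib_left sum.distrib)
  also have "(\<Sum>q<?d. integral {a..x} (\<lambda>\<tau>. ?K $$ (p, q) * (pM S i *\<^sub>v fun_h S i \<tau>) $ q))
      = integral {a..x} (\<lambda>\<tau>. \<Sum>q<?d. ?K $$ (p, q) * (pM S i *\<^sub>v fun_h S i \<tau>) $ q)"
    by (rule Henstock_Kurzweil_Integration.integral_sum[symmetric]) (auto intro!: integrable_on_mult_right io)
  also have "\<dots> = integral {a..x} (\<lambda>\<tau>. Dnf \<tau> $ p)"
  proof (rule Henstock_Kurzweil_Integration.integral_cong)
    fix \<tau> assume "\<tau> \<in> {a..x}"
    then have t: "\<tau> \<in> Iint S i" using xX X by auto
    show "(\<Sum>q<?d. ?K $$ (p, q) * (pM S i *\<^sub>v fun_h S i \<tau>) $ q) = Dnf \<tau> $ p"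
      unfolding Dnf_eq[OF t] by (rule comp[symmetric, OF L2_on_carrier[OF Mh t]])
  qed
  finally show ?thesis by (simp add: a_def)
qed

lemma history_component_continuous:
  assumes "history S e t" "j < n"
  shows "continuous_on (Iint S i) (\<lambda>\<tau>. e (t + \<tau>) $ j)"
  using assms continuous_on_subset[OF _ Iint_subset_Jint[OF i]] unfolding history_def by blast

lemma history_L2:
  assumes "history S e t" shows "L2_on (Iint S i) n (\<lambda>\<tau>. e (t + \<tau>))"
proof (rule L2_onI)
  fix \<tau> assume "\<tau> \<in> Iint S i"
  then show "e (t + \<tau>) \<in> carrier_vec n" using assms Iint_subset_Jint[OF i] by (auto simp: history_def)
next
  fix j assume "j < n"
  then show "square_integrable (Iint S i) (\<lambda>\<tau>. e (t + \<tau>) $ j)"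
    using history_component_continuous[OF assms] square_integrable_continuous by (simp add: Iint_def)
qed

lemma moment_block_carrier [simp]: "moment_block S N g e t i \<in> carrier_vec (N * n)"
  by (simp add: moment_block_def vec_integral_def)

lemma moment_block_index:
  assumes g: "L2_on (Iint S i) N g" and e: "history S e t" and p: "p < N" and j: "j < n"
  shows "moment_block S N g e t i $ (p * n + j) = (LINT \<tau>|lebesgue_on (Iint S i). g \<tau> $ p * e (t + \<tau>) $ j)"
proof -
  have "((col_mat (g \<tau>) \<otimes>\<^sub>K 1\<^sub>m n) *\<^sub>v e (t + \<tau>)) $ (p * n + j) = g \<tau> $ p * e (t + \<tau>) $ j" if t: "\<tau> \<in> Iint S i" for \<tau>
  proof -
    have c: "g \<tau> \<in> carrier_vec N" "e (t + \<tau>) \<in> carrier_vec (1 * n)"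
      using L2_on_carrier[OF g t] L2_on_carrier[OF history_L2[OF e] t] by auto
    have A: "col_mat (g \<tau>) \<in> carrier_mat N 1" using c(1) mat_of_cols_carrier(1)[of N "[g \<tau>]"] by simp
    have "((col_mat (g \<tau>) \<otimes>\<^sub>K 1\<^sub>m n) *\<^sub>v e (t + \<tau>)) $ (p * n + j)
        = (\<Sum>q<1. \<Sum>l<n. col_mat (g \<tau>) $$ (p, q) * 1\<^sub>m n $$ (j, l) * e (t + \<tau>) $ (q * n + l))"
      by (rule kron_mult_vec_index[OF A one_carrier_mat c(2) p j])
    also have "\<dots> = (\<Sum>l<n. g \<tau> $ p * 1\<^sub>m n $$ (j, l) * e (t + \<tau>) $ l)"
      using p c by (simp add: mat_of_cols_index)
    also have "\<dots> = (\<Sum>l<n. if l = j then g \<tau> $ p * e (t + \<tau>) $ l else 0)"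
      using j by (intro sum.cong) auto
    finally show ?thesis using j by simp
  qed
  then show ?thesis unfolding moment_block_def vec_integral_def using block_index_less[OF p j]
    by (auto intro!: Bochner_Integration.integral_cong)
qed

lemma slice_moment_block:
  assumes g: "L2_on (Iint S i) N g" and e: "history S e t" and j: "j < n"
  shows "slice n j (moment_block S N g e t i) = vec N (\<lambda>p. LINT \<tau>|lebesgue_on (Iint S i). g \<tau> $ p * e (t + \<tau>) $ j)"
proof (rule eq_vecI)
  fix p assume "p < dim_vec (vec N (\<lambda>p. LINT \<tau>|lebesgue_on (Iint S i). g \<tau> $ p * e (t + \<tau>) $ j))"
  then have p: "p < N" by simp
  show "slice n j (moment_block S N g e t i) $ p = vec N (\<lambda>p. LINT \<tau>|lebesgue_on (Iint S i). g \<tau> $ p * e (t + \<tau>) $ j) $ p"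
    using p by (simp only: slice_index[OF moment_block_carrier j p] moment_block_index[OF g e p j] index_vec)
qed (use carrier_vecD[OF slice_carrier[OF j moment_block_carrier[of N g e t]]] in simp)

lemma mult_slice_moment_block:
  assumes g: "L2_on (Iint S i) N g" and e: "history S e t" and j: "j < n" and A: "A \<in> carrier_mat k N"
  shows "A *\<^sub>v slice n j (moment_block S N g e t i) = slice n j (moment_block S k (\<lambda>\<tau>. A *\<^sub>v g \<tau>) e t i)"
  unfolding slice_moment_block[OF g e j] slice_moment_block[OF L2_on_mult_mat_vec[OF g A] e j]
proof (rule eq_vecI)
  fix p assume "p < dim_vec (vec k (\<lambda>p. LINT \<tau>|lebesgue_on (Iint S i). (A *\<^sub>v g \<tau>) $ p * e (t + \<tau>) $ j))"
  then have p: "p < k" by simp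
  have int: "integrable (lebesgue_on (Iint S i)) (\<lambda>\<tau>. g \<tau> $ q * e (t + \<tau>) $ j)" if "q < N" for q
    by (rule square_integrable_mult[OF L2_on_component[OF g that] L2_on_component[OF history_L2[OF e] j]])
  have "(A *\<^sub>v vec N (\<lambda>p. LINT \<tau>|lebesgue_on (Iint S i). g \<tau> $ p * e (t + \<tau>) $ j)) $ p
      = (\<Sum>q<N. A $$ (p, q) * (LINT \<tau>|lebesgue_on (Iint S i). g \<tau> $ q * e (t + \<tau>) $ j))"
    using A p by (simp add: scalar_prod_def atLeast0LessThan)
  also have "\<dots> = (LINT \<tau>|lebesgue_on (Iint S i). (\<Sum>q<N. A $$ (p, q) * (g \<tau> $ q * e (t + \<tau>) $ j)))"
    using int by (subst Bochner_Integration.integral_sum) auto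
  also have "\<dots> = (LINT \<tau>|lebesgue_on (Iint S i). (A *\<^sub>v g \<tau>) $ p * e (t + \<tau>) $ j)"
  proof (rule Bochner_Integration.integral_cong[OF refl])
    fix \<tau> assume "\<tau> \<in> space (lebesgue_on (Iint S i))"
    then have "g \<tau> \<in> carrier_vec N" using L2_on_carrier[OF g] by simp
    then show "(\<Sum>q<N. A $$ (p, q) * (g \<tau> $ q * e (t + \<tau>) $ j)) = (A *\<^sub>v g \<tau>) $ p * e (t + \<tau>) $ j"
      using A p by (simp add: scalar_prod_def atLeast0LessThan sum_distrib_right mult.assoc)
  qed
  finally show "(A *\<^sub>v vec N (\<lambda>p. LINT \<tau>|lebesgue_on (Iint S i). g \<tau> $ p * e (t + \<tau>) $ j)) $ p
      = vec k (\<lambda>p. LINT \<tau>|lebesgue_on (Iint S i). (A *\<^sub>v g \<tau>) $ p * e (t + \<tau>) $ j) $ p" using p by simp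
qed (use A in auto)

end

end

subsection \<open>Quadratic functionals on the history space\<close>

context delay_system
begin

lemma C_space_iff_history:
  "\<psi> \<in> C_space S \<longleftrightarrow> history S \<psi> 0 \<and> \<psi> \<in> extensional (Jint S)"
  by (auto simp: C_space_def history_def PiE_def Pi_def)

lemma C_space_history: "\<psi> \<in> C_space S \<Longrightarrow> history S \<psi> 0"
  by (simp add: C_space_iff_history)

lemma C_space_carrier: "\<psi> \<in> C_space S \<Longrightarrow> \<tau> \<in> Jint S \<Longrightarrow> \<psi> \<tau> \<in> carrier_vec n"
  by (auto simp: C_space_def)

lemma C_plus_index: "\<psi> \<in> C_space S \<Longrightarrow> \<eta> \<in> C_space S \<Longrightarrow> \<tau> \<in> Jint S \<Longrightarrow> j < n \<Longrightarrow>
    C_plus S \<psi> \<eta> \<tau> $ j = \<psi> \<tau> $ j + \<eta> \<tau> $ j"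
  using C_space_carrier[of \<eta> \<tau>] by (auto simp: C_plus_def)

lemma C_scale_index: "\<eta> \<in> C_space S \<Longrightarrow> \<tau> \<in> Jint S \<Longrightarrow> j < n \<Longrightarrow> C_scale S c \<eta> \<tau> $ j = c * \<eta> \<tau> $ j"
  using C_space_carrier[of \<eta> \<tau>] by (auto simp: C_scale_def)

lemma C_spaceI:
  assumes "\<And>\<tau>. \<tau> \<in> Jint S \<Longrightarrow> \<psi> \<tau> \<in> carrier_vec n" "\<psi> \<in> extensional (Jint S)"
    and "\<And>j. j < n \<Longrightarrow> continuous_on (Jint S) (\<lambda>\<tau>. \<psi> \<tau> $ j)"
  shows "\<psi> \<in> C_space S"
  using assms by (simp add: C_space_def PiE_def Pi_def)

lemma C_space_continuous: "\<psi> \<in> C_space S \<Longrightarrow> j < n \<Longrightarrow> continuous_on (Jint S) (\<lambda>\<tau>. \<psi> \<tau> $ j)"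
  by (simp add: C_space_def)

lemma C_plus_in:
  assumes "\<psi> \<in> C_space S" "\<eta> \<in> C_space S" shows "C_plus S \<psi> \<eta> \<in> C_space S"
proof (rule C_spaceI)
  fix j assume j: "j < n"
  have "continuous_on (Jint S) (\<lambda>\<tau>. \<psi> \<tau> $ j + \<eta> \<tau> $ j)"
    using assms j by (intro continuous_on_add C_space_continuous)
  then show "continuous_on (Jint S) (\<lambda>\<tau>. C_plus S \<psi> \<eta> \<tau> $ j)"
    by (rule continuous_on_eq) (simp add: C_plus_index[OF assms _ j])
qed (use C_space_carrier assms in \<open>auto simp: C_plus_def\<close>)

lemma C_scale_in:
  assumes "\<eta> \<in> C_space S" shows "C_scale S c \<eta> \<in> C_space S"
proof (rule C_spaceI)
  fix j assume j: "j < n"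
  have "continuous_on (Jint S) (\<lambda>\<tau>. c * \<eta> \<tau> $ j)"
    using assms j by (intro continuous_on_mult_left C_space_continuous)
  then show "continuous_on (Jint S) (\<lambda>\<tau>. C_scale S c \<eta> \<tau> $ j)"
    by (rule continuous_on_eq) (simp add: C_scale_index[OF assms _ j])
qed (use C_space_carrier assms in \<open>auto simp: C_scale_def\<close>)

lemma zero_in_Jint: "0 \<in> Jint S"
  using neg_delay_in_Jint[of 0] delay_0 by simp

lemma vnorm_le_C_norm:
  assumes \<psi>: "\<psi> \<in> C_space S" and \<tau>: "\<tau> \<in> Jint S"
  shows "vnorm (\<psi> \<tau>) \<le> C_norm S \<psi>"
  unfolding C_norm_def
proof (rule cSUP_upper[OF \<tau>])
  have "continuous_on (Jint S) (\<lambda>\<theta>. sqrt (\<Sum>j<n. \<psi> \<theta> $ j * \<psi> \<theta> $ j))"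
    using \<psi> by (auto simp: C_space_def intro!: continuous_intros)
  then have "continuous_on (Jint S) (\<lambda>\<theta>. vnorm (\<psi> \<theta>))"
  proof (rule continuous_on_eq)
    fix \<theta> assume "\<theta> \<in> Jint S"
    then show "sqrt (\<Sum>j<n. \<psi> \<theta> $ j * \<psi> \<theta> $ j) = vnorm (\<psi> \<theta>)"
      using C_space_carrier[OF \<psi>, of \<theta>] by (simp add: vnorm_def scalar_prod_def atLeast0LessThan)
  qed
  then have "compact ((\<lambda>\<theta>. vnorm (\<psi> \<theta>)) ` Jint S)" by (intro compact_continuous_image) (auto simp: Jint_def)
  then show "bdd_above ((\<lambda>\<theta>. vnorm (\<psi> \<theta>)) ` Jint S)" by (intro bounded_imp_bdd_above compact_imp_bounded)
qed

lemma component_le_C_norm: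
  assumes \<psi>: "\<psi> \<in> C_space S" and \<tau>: "\<tau> \<in> Jint S" and j: "j < n"
  shows "\<bar>\<psi> \<tau> $ j\<bar> \<le> C_norm S \<psi>"
proof -
  have c: "\<psi> \<tau> \<in> carrier_vec n" using C_space_carrier[OF \<psi> \<tau>] .
  have "(\<psi> \<tau> $ j)\<^sup>2 \<le> (\<Sum>k<n. (\<psi> \<tau> $ k)\<^sup>2)" using j by (intro member_le_sum) auto
  also have "\<dots> = \<psi> \<tau> \<bullet> \<psi> \<tau>" using c by (simp add: scalar_prod_def atLeast0LessThan power2_eq_square)
  finally have "\<bar>\<psi> \<tau> $ j\<bar> \<le> vnorm (\<psi> \<tau>)" by (simp add: vnorm_def real_le_rsqrt)
  then show ?thesis using vnorm_le_C_norm[OF \<psi> \<tau>] by linarith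
qed

lemma C_norm_nonneg: "\<psi> \<in> C_space S \<Longrightarrow> 0 \<le> C_norm S \<psi>"
  using vnorm_le_C_norm[OF _ zero_in_Jint] scalar_prod_self_ge_0[of "\<psi> 0"]
  by (metis order_trans real_sqrt_ge_zero vnorm_def)

definition linear_form :: "((real \<Rightarrow> real vec) \<Rightarrow> real) \<Rightarrow> bool"
  where "linear_form l \<longleftrightarrow> (\<forall>\<eta>\<in>C_space S. \<forall>\<chi>\<in>C_space S. l (C_plus S \<eta> \<chi>) = l \<eta> + l \<chi>) \<and>
    (\<forall>c. \<forall>\<eta>\<in>C_space S. l (C_scale S c \<eta>) = c * l \<eta>)"

definition bounded_linear_form :: "((real \<Rightarrow> real vec) \<Rightarrow> real) \<Rightarrow> bool"
  where "bounded_linear_form l \<longleftrightarrow> linear_form l \<and> (\<exists>B\<ge>0. \<forall>\<eta>\<in>C_space S. \<bar>l \<eta>\<bar> \<le> B * C_norm S \<eta>)"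

text \<open>A bounded bilinear form on the diagonal. Products of bounded linear forms and weighted
  integrals of products of components are of this kind, and so are their finite sums; the storage
  functional is put together from these.\<close>

definition quadratic_functional :: "((real \<Rightarrow> real vec) \<Rightarrow> real) \<Rightarrow> bool"
  where "quadratic_functional v \<longleftrightarrow> (\<exists>B K. (\<forall>\<psi>\<in>C_space S. v \<psi> = B \<psi> \<psi>) \<and>
    (\<forall>\<chi>\<in>C_space S. linear_form (\<lambda>\<psi>. B \<psi> \<chi>) \<and> linear_form (B \<chi>)) \<and> K \<ge> 0 \<and>
    (\<forall>\<psi>\<in>C_space S. \<forall>\<chi>\<in>C_space S. \<bar>B \<psi> \<chi>\<bar> \<le> K * (C_norm S \<psi> * C_norm S \<chi>)))"

lemma quadratic_functional_cong:
  "quadratic_functional v \<Longrightarrow> (\<And>\<psi>. \<psi> \<in> C_space S \<Longrightarrow> v \<psi> = v' \<psi>) \<Longrightarrow> quadratic_functional v'"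
  unfolding quadratic_functional_def by metis

lemma quadratic_functional_mult:
  assumes "bounded_linear_form l" "bounded_linear_form l'"
  shows "quadratic_functional (\<lambda>\<psi>. c * (l \<psi> * l' \<psi>))"
proof -
  obtain B where B: "B \<ge> 0" "\<And>\<eta>. \<eta> \<in> C_space S \<Longrightarrow> \<bar>l \<eta>\<bar> \<le> B * C_norm S \<eta>"
    using assms(1) by (auto simp: bounded_linear_form_def)
  obtain B' where B': "B' \<ge> 0" "\<And>\<eta>. \<eta> \<in> C_space S \<Longrightarrow> \<bar>l' \<eta>\<bar> \<le> B' * C_norm S \<eta>"
    using assms(2) by (auto simp: bounded_linear_form_def)
  have lin: "linear_form l" "linear_form l'" using assms by (auto simp: bounded_linear_form_def)
  show ?thesis unfolding quadratic_functional_def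
  proof (intro exI[of _ "\<lambda>\<psi> \<chi>. c * (l \<psi> * l' \<chi>)"] exI[of _ "\<bar>c\<bar> * (B * B')"] conjI ballI)
    fix \<psi> \<chi> assume c: "\<psi> \<in> C_space S" "\<chi> \<in> C_space S"
    have "\<bar>l \<psi>\<bar> * \<bar>l' \<chi>\<bar> \<le> (B * C_norm S \<psi>) * (B' * C_norm S \<chi>)"
      using B(2)[OF c(1)] B'(2)[OF c(2)] by (intro mult_mono) auto
    from mult_left_mono[OF this, of "\<bar>c\<bar>"] show "\<bar>c * (l \<psi> * l' \<chi>)\<bar> \<le> \<bar>c\<bar> * (B * B') * (C_norm S \<psi> * C_norm S \<chi>)"
      by (simp add: abs_mult mult_ac)
  qed (use lin B B' in \<open>auto simp: linear_form_def algebra_simps\<close>)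
qed

lemma quadratic_functional_zero: "quadratic_functional (\<lambda>_. 0)"
  unfolding quadratic_functional_def by (intro exI[of _ "\<lambda>_ _. 0"] exI[of _ 0]) (auto simp: linear_form_def)

lemma quadratic_functional_add:
  assumes "quadratic_functional v" "quadratic_functional w"
  shows "quadratic_functional (\<lambda>\<psi>. v \<psi> + w \<psi>)"
proof -
  obtain B K where B: "\<And>\<psi>. \<psi> \<in> C_space S \<Longrightarrow> v \<psi> = B \<psi> \<psi>"
    "\<And>\<chi>. \<chi> \<in> C_space S \<Longrightarrow> linear_form (\<lambda>\<psi>. B \<psi> \<chi>) \<and> linear_form (B \<chi>)" "K \<ge> 0"
    "\<And>\<psi> \<chi>. \<psi> \<in> C_space S \<Longrightarrow> \<chi> \<in> C_space S \<Longrightarrow> \<bar>B \<psi> \<chi>\<bar> \<le> K * (C_norm S \<psi> * C_norm S \<chi>)"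
    using assms(1) unfolding quadratic_functional_def by blast
  obtain B' K' where B': "\<And>\<psi>. \<psi> \<in> C_space S \<Longrightarrow> w \<psi> = B' \<psi> \<psi>"
    "\<And>\<chi>. \<chi> \<in> C_space S \<Longrightarrow> linear_form (\<lambda>\<psi>. B' \<psi> \<chi>) \<and> linear_form (B' \<chi>)" "K' \<ge> 0"
    "\<And>\<psi> \<chi>. \<psi> \<in> C_space S \<Longrightarrow> \<chi> \<in> C_space S \<Longrightarrow> \<bar>B' \<psi> \<chi>\<bar> \<le> K' * (C_norm S \<psi> * C_norm S \<chi>)"
    using assms(2) unfolding quadratic_functional_def by blast
  show ?thesis unfolding quadratic_functional_def
  proof (intro exI[of _ "\<lambda>\<psi> \<chi>. B \<psi> \<chi> + B' \<psi> \<chi>"] exI[of _ "K + K'"] conjI ballI)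
    fix \<psi> \<chi> assume c: "\<psi> \<in> C_space S" "\<chi> \<in> C_space S"
    show "\<bar>B \<psi> \<chi> + B' \<psi> \<chi>\<bar> \<le> (K + K') * (C_norm S \<psi> * C_norm S \<chi>)"
      using B(4)[OF c] B'(4)[OF c] by (simp add: distrib_right)
  next
    fix \<chi> assume c: "\<chi> \<in> C_space S"
    show "linear_form (\<lambda>\<psi>. B \<psi> \<chi> + B' \<psi> \<chi>)" "linear_form (\<lambda>\<psi>. B \<chi> \<psi> + B' \<chi> \<psi>)"
      using B(2)[OF c] B'(2)[OF c] by (auto simp: linear_form_def algebra_simps)
  qed (use B B' in auto)
qed

lemma quadratic_functional_sum:
  "(\<And>i. i \<in> A \<Longrightarrow> quadratic_functional (v i)) \<Longrightarrow> quadratic_functional (\<lambda>\<psi>. \<Sum>i\<in>A. v i \<psi>)"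
  by (induction A rule: infinite_finite_induct) (auto simp: quadratic_functional_zero quadratic_functional_add)

text \<open>The derivative at \<open>\<psi>\<close> sends \<open>\<eta>\<close> to
  \<open>B \<psi> \<eta> + B \<eta> \<psi>\<close>, and the remainder is exactly
  \<open>B \<eta> \<eta>\<close>, at most \<open>K\<close> times the squared norm;
  \<open>\<epsilon> / (K + 1)\<close> then serves as \<open>\<delta>\<close>.\<close>

lemma quadratic_functional_differentiable:
  assumes "quadratic_functional v" shows "differentiable_functional S v"
  unfolding differentiable_functional_def
proof
  fix \<psi> assume \<psi>: "\<psi> \<in> C_space S"
  obtain B K where B: "\<And>\<psi>. \<psi> \<in> C_space S \<Longrightarrow> v \<psi> = B \<psi> \<psi>"
    "\<And>\<chi>. \<chi> \<in> C_space S \<Longrightarrow> linear_form (\<lambda>\<psi>. B \<psi> \<chi>) \<and> linear_form (B \<chi>)" "K \<ge> 0"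
    "\<And>\<psi> \<chi>. \<psi> \<in> C_space S \<Longrightarrow> \<chi> \<in> C_space S \<Longrightarrow> \<bar>B \<psi> \<chi>\<bar> \<le> K * (C_norm S \<psi> * C_norm S \<chi>)"
    using assms unfolding quadratic_functional_def by blast
  define D where "D \<eta> = B \<psi> \<eta> + B \<eta> \<psi>" for \<eta>
  have lin: "linear_form (\<lambda>\<eta>. B \<eta> \<psi>)" "linear_form (B \<psi>)" using B(2)[OF \<psi>] by auto
  have bound: "\<bar>D \<eta>\<bar> \<le> (2 * K * C_norm S \<psi>) * C_norm S \<eta>" if \<eta>: "\<eta> \<in> C_space S" for \<eta>
    using B(4)[OF \<psi> \<eta>] B(4)[OF \<eta> \<psi>] by (simp add: D_def mult_ac)
  have err: "v (C_plus S \<psi> \<eta>) - v \<psi> - D \<eta> = B \<eta> \<eta>" if \<eta>: "\<eta> \<in> C_space S" for \<eta>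
  proof -
    have p: "C_plus S \<psi> \<eta> \<in> C_space S" by (rule C_plus_in[OF \<psi> \<eta>])
    have "v (C_plus S \<psi> \<eta>) = B \<psi> (C_plus S \<psi> \<eta>) + B \<eta> (C_plus S \<psi> \<eta>)"
      using B(1)[OF p] B(2)[OF p] \<psi> \<eta> by (auto simp: linear_form_def)
    also have "\<dots> = B \<psi> \<psi> + B \<psi> \<eta> + (B \<eta> \<psi> + B \<eta> \<eta>)"
      using B(2)[OF \<psi>] B(2)[OF \<eta>] \<psi> \<eta> by (auto simp: linear_form_def)
    finally show ?thesis using B(1)[OF \<psi>] by (simp add: D_def)
  qed
  show "\<exists>D. (\<forall>\<eta>\<in>C_space S. \<forall>\<chi>\<in>C_space S. D (C_plus S \<eta> \<chi>) = D \<eta> + D \<chi>) \<and>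
    (\<forall>c. \<forall>\<eta>\<in>C_space S. D (C_scale S c \<eta>) = c * D \<eta>) \<and>
    (\<exists>B. \<forall>\<eta>\<in>C_space S. \<bar>D \<eta>\<bar> \<le> B * C_norm S \<eta>) \<and>
    (\<forall>\<epsilon>>0. \<exists>\<delta>>0. \<forall>\<eta>\<in>C_space S. C_norm S \<eta> < \<delta> \<longrightarrow>
       \<bar>v (C_plus S \<psi> \<eta>) - v \<psi> - D \<eta>\<bar> \<le> \<epsilon> * C_norm S \<eta>)"
  proof (intro exI[of _ D] conjI allI impI)
    show "\<forall>\<eta>\<in>C_space S. \<forall>\<chi>\<in>C_space S. D (C_plus S \<eta> \<chi>) = D \<eta> + D \<chi>"
      "\<forall>\<eta>\<in>C_space S. D (C_scale S c \<eta>) = c * D \<eta>" for c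
      using lin by (auto simp: D_def linear_form_def algebra_simps)
    show "\<exists>B. \<forall>\<eta>\<in>C_space S. \<bar>D \<eta>\<bar> \<le> B * C_norm S \<eta>" using bound by blast
    fix \<epsilon> :: real assume \<epsilon>: "\<epsilon> > 0"
    show "\<exists>\<delta>>0. \<forall>\<eta>\<in>C_space S. C_norm S \<eta> < \<delta> \<longrightarrow> \<bar>v (C_plus S \<psi> \<eta>) - v \<psi> - D \<eta>\<bar> \<le> \<epsilon> * C_norm S \<eta>"
    proof (intro exI[of _ "\<epsilon> / (K + 1)"] conjI ballI impI)
      show "\<epsilon> / (K + 1) > 0" using \<epsilon> B(3) by simp
      fix \<eta> assume \<eta>: "\<eta> \<in> C_space S" "C_norm S \<eta> < \<epsilon> / (K + 1)"
      have N: "0 \<le> C_norm S \<eta>" by (rule C_norm_nonneg[OF \<eta>(1)])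
      have "C_norm S \<eta> * (K + 1) < \<epsilon>" using \<eta>(2) B(3) by (simp add: field_simps)
      then have "K * C_norm S \<eta> \<le> \<epsilon>" using N B(3) by (simp add: distrib_left mult.commute)
      from mult_right_mono[OF this N] show "\<bar>v (C_plus S \<psi> \<eta>) - v \<psi> - D \<eta>\<bar> \<le> \<epsilon> * C_norm S \<eta>"
        using B(4)[OF \<eta>(1) \<eta>(1)] err[OF \<eta>(1)] by (simp add: mult_ac)
    qed
  qed
qed

lemma bounded_linear_form_cong:
  assumes "bounded_linear_form l" "\<And>\<psi>. \<psi> \<in> C_space S \<Longrightarrow> l \<psi> = l' \<psi>"
  shows "bounded_linear_form l'"
  using assms C_plus_in C_scale_in unfolding bounded_linear_form_def linear_form_def by (metis (no_types, lifting))

lemma bounded_linear_form_eval: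
  assumes \<tau>: "\<tau> \<in> Jint S" and j: "j < n"
  shows "bounded_linear_form (\<lambda>\<psi>. \<psi> \<tau> $ j)"
  unfolding bounded_linear_form_def linear_form_def
  using C_plus_index[OF _ _ \<tau> j] C_scale_index[OF _ \<tau> j] component_le_C_norm[OF _ \<tau> j]
  by (auto intro!: exI[of _ 1])

text \<open>The argument \<open>0 + \<tau>\<close> is the form in which a moment taken at time 0
  presents itself after unfolding.\<close>

lemma bounded_linear_form_moment:
  assumes i: "i \<in> {1..\<nu>}" and g: "integrable (lebesgue_on (Iint S i)) g" and j: "j < n"
  shows "bounded_linear_form (\<lambda>\<psi>. LINT \<tau>|lebesgue_on (Iint S i). g \<tau> * \<psi> (0 + \<tau>) $ j)"
proof -
  let ?M = "lebesgue_on (Iint S i)"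
  have J: "\<tau> \<in> Jint S" if "\<tau> \<in> space ?M" for \<tau> using that Iint_subset_Jint[OF i] by auto
  have int: "integrable ?M (\<lambda>\<tau>. g \<tau> * \<psi> \<tau> $ j)" if "\<psi> \<in> C_space S" for \<psi>
    using history_component_continuous[OF i C_space_history[OF that] j] g
    unfolding Iint_def by (intro integrable_mult_continuous) auto
  have "(LINT \<tau>|?M. g \<tau> * C_plus S \<eta> \<chi> \<tau> $ j) = (LINT \<tau>|?M. g \<tau> * \<eta> \<tau> $ j) + (LINT \<tau>|?M. g \<tau> * \<chi> \<tau> $ j)"
    if c: "\<eta> \<in> C_space S" "\<chi> \<in> C_space S" for \<eta> \<chi>
  proof -
    have "(LINT \<tau>|?M. g \<tau> * C_plus S \<eta> \<chi> \<tau> $ j) = (LINT \<tau>|?M. g \<tau> * \<eta> \<tau> $ j + g \<tau> * \<chi> \<tau> $ j)"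
      by (intro Bochner_Integration.integral_cong refl) (simp only: C_plus_index[OF c J j] distrib_left)
    then show ?thesis using Bochner_Integration.integral_add[OF int[OF c(1)] int[OF c(2)]] by simp
  qed
  moreover have "(LINT \<tau>|?M. g \<tau> * C_scale S c \<eta> \<tau> $ j) = c * (LINT \<tau>|?M. g \<tau> * \<eta> \<tau> $ j)"
    if \<eta>: "\<eta> \<in> C_space S" for \<eta> c
  proof -
    have "(LINT \<tau>|?M. g \<tau> * C_scale S c \<eta> \<tau> $ j) = (LINT \<tau>|?M. c * (g \<tau> * \<eta> \<tau> $ j))"
      by (intro Bochner_Integration.integral_cong refl) (simp only: C_scale_index[OF \<eta> J j] mult.left_commute)
    then show ?thesis by simp
  qed
  moreover have "\<bar>LINT \<tau>|?M. g \<tau> * \<eta> \<tau> $ j\<bar> \<le> (LINT \<tau>|?M. \<bar>g \<tau>\<bar>) * C_norm S \<eta>" if "\<eta> \<in> C_space S" for \<eta>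
    using lint_abs_le[OF g int[OF that]] component_le_C_norm[OF that J j] by (simp add: mult.commute)
  moreover have "0 \<le> (LINT \<tau>|?M. \<bar>g \<tau>\<bar>)" by simp
  ultimately show ?thesis unfolding bounded_linear_form_def linear_form_def
    by (intro conjI exI[of _ "LINT \<tau>|?M. \<bar>g \<tau>\<bar>"]) auto
qed

text \<open>With one argument fixed, the integral is a moment whose kernel is \<open>w\<close> times
  a component, so linearity in the other argument comes from
  \<open>bounded_linear_form_moment\<close>.\<close>

lemma quadratic_functional_integral:
  assumes i: "i \<in> {1..\<nu>}" and w: "continuous_on (Iint S i) w" and jk: "j < n" "k < n"
  shows "quadratic_functional (\<lambda>\<psi>. LINT \<tau>|lebesgue_on (Iint S i). w \<tau> * (\<psi> (0 + \<tau>) $ j * \<psi> (0 + \<tau>) $ k))"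
proof -
  let ?M = "lebesgue_on (Iint S i)"
  have J: "\<tau> \<in> Jint S" if "\<tau> \<in> space ?M" for \<tau> using that Iint_subset_Jint[OF i] by auto
  have comp: "continuous_on (Iint S i) (\<lambda>\<tau>. \<psi> \<tau> $ l)" if "\<psi> \<in> C_space S" "l < n" for \<psi> l
    using history_component_continuous[OF i C_space_history[OF that(1)] that(2)] by simp
  have wi: "integrable ?M w" using w unfolding Iint_def by (rule integrable_continuous_lebesgue_on)
  have g1: "integrable ?M (\<lambda>\<tau>. w \<tau> * \<chi> \<tau> $ l)" if "\<chi> \<in> C_space S" "l < n" for \<chi> l
    using w comp[OF that] unfolding Iint_def by (intro integrable_continuous_lebesgue_on continuous_on_mult)
  have lin1: "linear_form (\<lambda>\<psi>. LINT \<tau>|?M. w \<tau> * (\<psi> \<tau> $ j * \<chi> \<tau> $ k))" if "\<chi> \<in> C_space S" for \<chi>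
    using bounded_linear_form_moment[OF i g1[OF that jk(2)] jk(1)]
    unfolding bounded_linear_form_def by (simp add: mult_ac)
  have lin2: "linear_form (\<lambda>\<psi>. LINT \<tau>|?M. w \<tau> * (\<chi> \<tau> $ j * \<psi> \<tau> $ k))" if "\<chi> \<in> C_space S" for \<chi>
    using bounded_linear_form_moment[OF i g1[OF that jk(1)] jk(2)]
    unfolding bounded_linear_form_def by (simp add: mult_ac)
  have bd: "\<bar>LINT \<tau>|?M. w \<tau> * (\<psi> \<tau> $ j * \<chi> \<tau> $ k)\<bar> \<le> (LINT \<tau>|?M. \<bar>w \<tau>\<bar>) * (C_norm S \<psi> * C_norm S \<chi>)"
    if "\<psi> \<in> C_space S" "\<chi> \<in> C_space S" for \<psi> \<chi>
  proof -
    have "\<bar>LINT \<tau>|?M. w \<tau> * (\<psi> \<tau> $ j * \<chi> \<tau> $ k)\<bar> \<le> (C_norm S \<psi> * C_norm S \<chi>) * (LINT \<tau>|?M. \<bar>w \<tau>\<bar>)"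
    proof (rule lint_abs_le[OF wi])
      show "integrable ?M (\<lambda>\<tau>. w \<tau> * (\<psi> \<tau> $ j * \<chi> \<tau> $ k))"
        using w comp[OF that(1) jk(1)] comp[OF that(2) jk(2)] unfolding Iint_def
        by (intro integrable_continuous_lebesgue_on continuous_on_mult)
      fix \<tau> assume "\<tau> \<in> space ?M"
      then show "\<bar>\<psi> \<tau> $ j * \<chi> \<tau> $ k\<bar> \<le> C_norm S \<psi> * C_norm S \<chi>"
        unfolding abs_mult using J component_le_C_norm that jk C_norm_nonneg
        by (intro mult_mono) auto
    qed
    then show ?thesis by (simp add: mult.commute)
  qed
  show ?thesis unfolding quadratic_functional_def
  proof (intro exI[of _ "\<lambda>\<psi> \<chi>. LINT \<tau>|?M. w \<tau> * (\<psi> \<tau> $ j * \<chi> \<tau> $ k)"]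
      exI[of _ "LINT \<tau>|?M. \<bar>w \<tau>\<bar>"] conjI ballI)
    fix \<chi> assume "\<chi> \<in> C_space S"
    then show "linear_form (\<lambda>\<psi>. LINT \<tau>|?M. w \<tau> * (\<psi> \<tau> $ j * \<chi> \<tau> $ k))"
      "linear_form (\<lambda>\<psi>. LINT \<tau>|?M. w \<tau> * (\<chi> \<tau> $ j * \<psi> \<tau> $ k))" by (rule lin1, rule lin2)
  qed (simp_all add: bd)
qed

end

subsection \<open>The Krasovskii functional\<close>

text \<open>\<open>\<Phi>\<close> is arbitrary so that one induction over the blocks transports
  differentiability in time as well as bounded linearity in the history.\<close>

lemma vconcat_component:
  assumes "\<And>i s. i \<in> set l \<Longrightarrow> x i s \<in> carrier_vec (k i)" "\<And>i. i \<in> set l \<Longrightarrow> y i \<in> carrier_vec (k i)"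
    and "\<And>i a. i \<in> set l \<Longrightarrow> a < k i \<Longrightarrow> \<Phi> (\<lambda>s. x i s $ a) (y i $ a)"
    and "a < (\<Sum>i\<leftarrow>l. k i)"
  shows "\<Phi> (\<lambda>s. vconcat (map (\<lambda>i. x i s) l) $ a) (vconcat (map y l) $ a)"
  using assms
proof (induction l arbitrary: a)
  case (Cons i l)
  have c: "x i s \<in> carrier_vec (k i)" "y i \<in> carrier_vec (k i)" for s using Cons.prems by auto
  have v: "vconcat (map (\<lambda>i. x i s) l) \<in> carrier_vec (\<Sum>i\<leftarrow>l. k i)" "vconcat (map y l) \<in> carrier_vec (\<Sum>i\<leftarrow>l. k i)" for s
    using Cons.prems by (auto intro!: vconcat_carrier)
  show ?case
  proof (cases "a < k i")
    case True
    then have "(x i s @\<^sub>v vconcat (map (\<lambda>i. x i s) l)) $ a = x i s $ a"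
      "(y i @\<^sub>v vconcat (map y l)) $ a = y i $ a" for s
      using c(1)[of s] c(2) v(1)[of s] v(2) by auto
    then show ?thesis using Cons.prems(3)[of i a] True by simp
  next
    case False
    then have "a - k i < (\<Sum>i\<leftarrow>l. k i)" using Cons.prems(4) by auto
    then have "\<Phi> (\<lambda>s. vconcat (map (\<lambda>i. x i s) l) $ (a - k i)) (vconcat (map y l) $ (a - k i))"
      using Cons by simp
    moreover have "vconcat (map (\<lambda>i. x i s) (i # l)) $ a = vconcat (map (\<lambda>i. x i s) l) $ (a - k i)" for s
      using False c(1)[of s] v(1)[of s] Cons.prems(4) by simp
    moreover have "vconcat (map y (i # l)) $ a = vconcat (map y l) $ (a - k i)"
      using False c(2) v(2) Cons.prems(4) by simp
    ultimately show ?thesis by simp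
  qed
qed simp

definition vec_deriv :: "nat \<Rightarrow> (real \<Rightarrow> real vec) \<Rightarrow> real vec \<Rightarrow> real \<Rightarrow> bool"
  where "vec_deriv N u u' t \<longleftrightarrow> u' \<in> carrier_vec N \<and> (\<forall>a<N. ((\<lambda>s. u s $ a) has_real_derivative u' $ a) (at t))"

text \<open>The hypotheses on the dimensions differ because \<open>u\<close> will be the signal,
  whose values are constrained near \<open>t\<close> but not in the remote past, whereas
  \<open>w\<close> will be a moment vector, of the same dimension at all times.\<close>

lemma vec_deriv_append:
  assumes u: "vec_deriv a u u' t" "eventually (\<lambda>s. u s \<in> carrier_vec a) (nhds t)"
    and w: "vec_deriv b w w' t" "\<And>s. w s \<in> carrier_vec b"
  shows "vec_deriv (a + b) (\<lambda>s. u s @\<^sub>v w s) (u' @\<^sub>v w') t"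
  unfolding vec_deriv_def
proof (intro conjI allI impI)
  have c: "u' \<in> carrier_vec a" "w' \<in> carrier_vec b" using u w by (auto simp: vec_deriv_def)
  then show "u' @\<^sub>v w' \<in> carrier_vec (a + b)" by simp
  fix p assume p: "p < a + b"
  show "((\<lambda>s. (u s @\<^sub>v w s) $ p) has_real_derivative (u' @\<^sub>v w') $ p) (at t)"
  proof (cases "p < a")
    case True
    have ev: "eventually (\<lambda>s. u s $ p = (u s @\<^sub>v w s) $ p) (nhds t)"
      using u(2) by eventually_elim (use True w(2) in auto)
    have "((\<lambda>s. u s $ p) has_real_derivative (u' @\<^sub>v w') $ p) (at t)"
      using u(1) True c by (auto simp: vec_deriv_def)
    then show ?thesis by (simp only: DERIV_cong_ev[OF refl ev refl])
  next
    case False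
    then have pb: "p - a < b" using p by auto
    have ev: "eventually (\<lambda>s. w s $ (p - a) = (u s @\<^sub>v w s) $ p) (nhds t)"
      using u(2)
    proof eventually_elim
      case (elim s)
      then show ?case using False p w(2)[of s] by auto
    qed
    have "((\<lambda>s. w s $ (p - a)) has_real_derivative (u' @\<^sub>v w') $ p) (at t)"
      using w(1) False pb p c by (auto simp: vec_deriv_def)
    then show ?thesis by (simp only: DERIV_cong_ev[OF refl ev refl])
  qed
qed

lemma quadratic_form_has_derivative:
  assumes P: "P \<in> carrier_mat N N" and sym: "P\<^sup>\<top> = P"
    and u: "vec_deriv N u u' t" "eventually (\<lambda>s. u s \<in> carrier_vec N) (nhds t)"
  shows "((\<lambda>s. u s \<bullet> (P *\<^sub>v u s)) has_real_derivative 2 * (u t \<bullet> (P *\<^sub>v u'))) (at t)"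
proof -
  have u': "u' \<in> carrier_vec N" and d: "\<And>a. a < N \<Longrightarrow> ((\<lambda>s. u s $ a) has_real_derivative u' $ a) (at t)"
    using u(1) by (auto simp: vec_deriv_def)
  have ut: "u t \<in> carrier_vec N" using u(2) by (rule eventually_nhds_x_imp_x)
  have ev: "eventually (\<lambda>s. (\<Sum>j<N. \<Sum>k<N. P $$ (j, k) * (u s $ j * u s $ k)) = u s \<bullet> (P *\<^sub>v u s)) (nhds t)"
    using u(2) by eventually_elim (simp only: quadratic_form_sum[OF P])
  have "((\<lambda>s. \<Sum>j<N. \<Sum>k<N. P $$ (j, k) * (u s $ j * u s $ k)) has_real_derivative
      (\<Sum>j<N. \<Sum>k<N. P $$ (j, k) * (u' $ j * u t $ k + u' $ k * u t $ j))) (at t)"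
    by (intro DERIV_sum DERIV_cmult DERIV_mult d) auto
  also have "(\<Sum>j<N. \<Sum>k<N. P $$ (j, k) * (u' $ j * u t $ k + u' $ k * u t $ j))
      = (\<Sum>j<N. \<Sum>k<N. P $$ (j, k) * (u' $ j * u t $ k)) + (\<Sum>j<N. \<Sum>k<N. P $$ (j, k) * (u t $ j * u' $ k))"
    by (simp add: distrib_left sum.distrib mult.commute)
  also have "\<dots> = u' \<bullet> (P *\<^sub>v u t) + u t \<bullet> (P *\<^sub>v u')"
    by (simp only: quadratic_form_sum[OF P u' ut] quadratic_form_sum[OF P ut u'])
  also have "u' \<bullet> (P *\<^sub>v u t) = u t \<bullet> (P *\<^sub>v u')"
    using sym_scalar_prod[OF P sym ut u'] comm_scalar_prod[of "P *\<^sub>v u t" N u'] P ut u' by auto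
  finally show ?thesis by (simp add: DERIV_cong_ev[OF refl ev refl])
qed

section \<open>Derivatives of moments and Bessel bounds along a signal\<close>

context delay_system
begin

text \<open>The regularity of a solution that the derivatives of moments and weighted energies rest
  on: continuity from \<open>t0 - r_max S\<close> onwards.\<close>

definition signal :: "(real \<Rightarrow> real vec) \<Rightarrow> real \<Rightarrow> bool"
  where "signal e t0 \<longleftrightarrow> (\<forall>s\<ge>t0 - r_max S. e s \<in> carrier_vec n) \<and>
    (\<forall>j<n. continuous_on {t0 - r_max S..} (\<lambda>s. e s $ j))"

lemma signal_carrier: "signal e t0 \<Longrightarrow> s \<ge> t0 - r_max S \<Longrightarrow> e s \<in> carrier_vec n"
  by (simp add: signal_def)

lemma signal_history:
  assumes "signal e t0" "t \<ge> t0" shows "history S e t"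
  unfolding history_def
proof (intro conjI ballI allI impI)
  fix j assume "j < n"
  then have c: "continuous_on {t0 - r_max S..} (\<lambda>s. e s $ j)" using assms by (simp add: signal_def)
  show "continuous_on (Jint S) (\<lambda>\<tau>. e (t + \<tau>) $ j)"
    by (rule continuous_on_compose2[OF c]) (use assms(2) in \<open>auto simp: Jint_def intro!: continuous_intros\<close>)
qed (use assms in \<open>auto simp: signal_def Jint_def\<close>)

lemma history_carrier: "history S e t \<Longrightarrow> i \<le> \<nu> \<Longrightarrow> e (t - delay S i) \<in> carrier_vec n"
  using neg_delay_in_Jint[of i] unfolding history_def by (metis diff_conv_add_uminus)

lemma history_carrier_0: "history S e t \<Longrightarrow> e t \<in> carrier_vec n"
  using history_carrier[of e t 0] delay_0 by simp

lemma moments_carrier: "moments S N g e t \<in> carrier_vec ((\<Sum>i=1..\<nu>. N i) * n)"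
proof -
  have "moments S N g e t \<in> carrier_vec (\<Sum>i\<leftarrow>idx S. N i * n)"
    unfolding moments_def by (rule vconcat_carrier) (simp add: moment_block_def vec_integral_def)
  then show ?thesis by (simp only: sum_list_idx sum_distrib_right)
qed

definition lyap_state :: "(real \<Rightarrow> real vec) \<Rightarrow> real \<Rightarrow> real vec"
  where "lyap_state e t = e t @\<^sub>v moments S (d_of S) nf e t"

lemma lyap_state_carrier: "history S e t \<Longrightarrow> lyap_state e t \<in> carrier_vec (n + d_tot S * n)"
  using moments_carrier[of "d_of S"] history_carrier_0 by (auto simp: lyap_state_def d_tot_def)

text \<open>The result of integrating by parts over the moving window, at position
  \<open>a = p * n + j\<close>: kernel times signal at the newer end, minus the same at the older
  end, minus the moment of the kernel's derivative.\<close>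

definition moment_rate :: "(real \<Rightarrow> real vec) \<Rightarrow> real \<Rightarrow> nat \<Rightarrow> real vec"
  where "moment_rate e t i = vec (d_of S i * n) (\<lambda>a.
    nf i (- delay S (i - 1)) $ (a div n) * e (t - delay S (i - 1)) $ (a mod n)
    - nf i (- delay S i) $ (a div n) * e (t - delay S i) $ (a mod n)
    - (LINT \<tau>|lebesgue_on (Iint S i). Dnf i \<tau> $ (a div n) * e (t + \<tau>) $ (a mod n)))"

lemma Iint_endpoints:
  assumes "i \<in> {1..\<nu>}" shows "- delay S i \<in> Iint S i" "- delay S (i - 1) \<in> Iint S i"
  using delay_less[OF assms] by (auto simp: Iint_def)

text \<open>Room on both sides of every window, as a two-sided derivative at \<open>t\<close>
  demands: on the left it comes from \<open>t > t0\<close>, on the right \<open>t + 1\<close> is an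
  arbitrary margin.\<close>

lemma signal_delay_bounds:
  assumes "t > t0" "i \<in> {1..\<nu>}"
  shows "t0 - r_max S < t + - delay S i" "t + - delay S (i - 1) < t + 1"
proof -
  have "i \<le> \<nu>" "i - 1 \<le> \<nu>" using assms by auto
  from delay_le_r_max[OF this(1)] delay_nonneg[OF this(2)] assms(1)
  show "t0 - r_max S < t + - delay S i" "t + - delay S (i - 1) < t + 1" by linarith+
qed

lemma moment_block_has_derivative:
  assumes e: "signal e t0" and t: "t > t0" and i: "i \<in> {1..\<nu>}"
  shows "vec_deriv (d_of S i * n) (\<lambda>s. moment_block S (d_of S i) (nf i) e s i) (moment_rate e t i) t"
  unfolding vec_deriv_def
proof (intro conjI allI impI)
  show "moment_rate e t i \<in> carrier_vec (d_of S i * n)" by (simp add: moment_rate_def)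
  fix a assume a: "a < d_of S i * n"
  define p j where "p = a div n" and "j = a mod n"
  have pj: "p < d_of S i" "j < n" "a = p * n + j"
    using a by (auto simp: p_def j_def less_mult_imp_div_less intro!: mod_less_divisor gr0I)
  define b c where "b = - delay S i" and "c = - delay S (i - 1)"
  have X: "Iint S i = {b..c}" by (simp add: Iint_def b_def c_def)
  have cont: "continuous_on {t0 - r_max S..t + 1} (\<lambda>s. e s $ j)"
    using e pj(2) by (auto simp: signal_def intro: continuous_on_subset)
  have int: "integrable (lebesgue_on {b..c}) (\<lambda>\<tau>. Dnf i \<tau> $ p)"
    using square_integrable_imp_integrable L2_on_component[OF Dnf_L2[OF i] pj(1)] X by auto
  have "((\<lambda>s. LINT \<tau>|lebesgue_on {b..c}. nf i \<tau> $ p * e (s + \<tau>) $ j) has_real_derivative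
      (nf i c $ p * e (t + c) $ j - nf i b $ p * e (t + b) $ j - (LINT \<tau>|lebesgue_on {b..c}. Dnf i \<tau> $ p * e (t + \<tau>) $ j))) (at t)"
  proof (rule delay_integral_has_derivative[OF _ int _ cont])
    show "b \<le> c" using delay_less[OF i] by (simp add: b_def c_def)
    show "nf i x $ p = nf i b $ p + integral {b..x} (\<lambda>\<tau>. Dnf i \<tau> $ p)" if "x \<in> {b..c}" for x
      using nf_primitive[OF i pj(1), of x] that X unfolding b_def by blast
    show "t0 - r_max S < t + b" "t + c < t + 1"
      using signal_delay_bounds[OF t i] by (simp_all add: b_def c_def)
  qed
  also have "nf i c $ p * e (t + c) $ j - nf i b $ p * e (t + b) $ j - (LINT \<tau>|lebesgue_on {b..c}. Dnf i \<tau> $ p * e (t + \<tau>) $ j)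
      = moment_rate e t i $ a"
    using a by (simp add: moment_rate_def p_def j_def b_def c_def Iint_def)
  finally have d: "((\<lambda>s. LINT \<tau>|lebesgue_on {b..c}. nf i \<tau> $ p * e (s + \<tau>) $ j) has_real_derivative moment_rate e t i $ a) (at t)" .
  show "((\<lambda>s. moment_block S (d_of S i) (nf i) e s i $ a) has_real_derivative moment_rate e t i $ a) (at t)"
  proof (rule has_field_derivative_transform_within_open[OF d, of "{t0<..}"])
    fix s assume "s \<in> {t0<..}"
    then have "history S e s" using signal_history[OF e] by simp
    then show "(LINT \<tau>|lebesgue_on {b..c}. nf i \<tau> $ p * e (s + \<tau>) $ j) = moment_block S (d_of S i) (nf i) e s i $ a"
      using moment_block_index[OF i normalized_L2(1)[OF i] _ pj(1,2)] X pj(3) by simp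
  qed (use t in auto)
qed

definition lyap_state_rate :: "(real \<Rightarrow> real vec) \<Rightarrow> real vec \<Rightarrow> real \<Rightarrow> real vec"
  where "lyap_state_rate e e' t = e' @\<^sub>v vconcat (map (moment_rate e t) (idx S))"

lemma lyap_state_has_derivative:
  assumes e: "signal e t0" and t: "t > t0" and e': "vec_deriv n e e' t"
  shows "vec_deriv (n + d_tot S * n) (lyap_state e) (lyap_state_rate e e' t) t"
  unfolding lyap_state_def[abs_def] lyap_state_rate_def
proof (rule vec_deriv_append[OF e'])
  have "eventually (\<lambda>s. s \<in> {t0<..}) (nhds t)" using t by (intro eventually_nhds_in_open) auto
  then show "eventually (\<lambda>s. e s \<in> carrier_vec n) (nhds t)"
    by eventually_elim (use r_max_nonneg in \<open>auto intro!: signal_carrier[OF e]\<close>)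
  have len: "d_tot S * n = (\<Sum>i\<leftarrow>idx S. d_of S i * n)"
    by (simp only: sum_list_idx d_tot_def sum_distrib_right)
  show "vec_deriv (d_tot S * n) (moments S (d_of S) nf e) (vconcat (map (moment_rate e t) (idx S))) t"
    unfolding vec_deriv_def
  proof (intro conjI allI impI)
    show "vconcat (map (moment_rate e t) (idx S)) \<in> carrier_vec (d_tot S * n)"
      unfolding len by (rule vconcat_carrier) (simp add: moment_rate_def)
    fix a assume a: "a < d_tot S * n"
    show "((\<lambda>s. moments S (d_of S) nf e s $ a) has_real_derivative vconcat (map (moment_rate e t) (idx S)) $ a) (at t)"
      unfolding moments_def
    proof (rule vconcat_component[where k = "\<lambda>i. d_of S i * n" and \<Phi> = "\<lambda>f f'. (f has_real_derivative f') (at t)"])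
      fix i b assume "i \<in> set (idx S)" "b < d_of S i * n"
      then show "((\<lambda>s. moment_block S (d_of S i) (nf i) e s i $ b) has_real_derivative moment_rate e t i $ b) (at t)"
        using moment_block_has_derivative[OF e t, of i] by (auto simp: vec_deriv_def)
    qed (use a[unfolded len] in \<open>auto simp: moment_rate_def moment_block_def vec_integral_def\<close>)
  qed
qed (use moments_carrier[of "d_of S"] in \<open>auto simp: d_tot_def\<close>)

lemma integral_quadratic_form:
  assumes i: "i \<in> {1..\<nu>}" and e: "history S e t" and M: "\<And>\<tau>. M \<tau> \<in> carrier_mat n n"
    and cont: "\<And>j k. j < n \<Longrightarrow> k < n \<Longrightarrow> continuous_on (Iint S i) (\<lambda>\<tau>. M \<tau> $$ (j, k))"
  shows "(LINT \<tau>|lebesgue_on (Iint S i). e (t + \<tau>) \<bullet> (M \<tau> *\<^sub>v e (t + \<tau>)))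
    = (\<Sum>j<n. \<Sum>k<n. LINT \<tau>|lebesgue_on (Iint S i). M \<tau> $$ (j, k) * (e (t + \<tau>) $ j * e (t + \<tau>) $ k))"
    and "integrable (lebesgue_on (Iint S i)) (\<lambda>\<tau>. e (t + \<tau>) \<bullet> (M \<tau> *\<^sub>v e (t + \<tau>)))"
proof -
  let ?X = "lebesgue_on (Iint S i)"
  have int: "integrable ?X (\<lambda>\<tau>. M \<tau> $$ (j, k) * (e (t + \<tau>) $ j * e (t + \<tau>) $ k))" if "j < n" "k < n" for j k
    using cont[OF that] history_component_continuous[OF i e] that unfolding Iint_def
    by (intro integrable_continuous_lebesgue_on continuous_on_mult)
  have eq: "e (t + \<tau>) \<bullet> (M \<tau> *\<^sub>v e (t + \<tau>)) = (\<Sum>j<n. \<Sum>k<n. M \<tau> $$ (j, k) * (e (t + \<tau>) $ j * e (t + \<tau>) $ k))"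
    if "\<tau> \<in> space ?X" for \<tau>
    using L2_on_carrier[OF history_L2[OF i e]] that M by (intro quadratic_form_sum) auto
  have "(LINT \<tau>|?X. e (t + \<tau>) \<bullet> (M \<tau> *\<^sub>v e (t + \<tau>)))
      = (LINT \<tau>|?X. (\<Sum>j<n. \<Sum>k<n. M \<tau> $$ (j, k) * (e (t + \<tau>) $ j * e (t + \<tau>) $ k)))"
    by (intro Bochner_Integration.integral_cong refl eq)
  also have "\<dots> = (\<Sum>j<n. \<Sum>k<n. LINT \<tau>|?X. M \<tau> $$ (j, k) * (e (t + \<tau>) $ j * e (t + \<tau>) $ k))"
    by (rule lebesgue_integral_double_sum) (use int in auto)
  finally show "(LINT \<tau>|?X. e (t + \<tau>) \<bullet> (M \<tau> *\<^sub>v e (t + \<tau>)))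
    = (\<Sum>j<n. \<Sum>k<n. LINT \<tau>|?X. M \<tau> $$ (j, k) * (e (t + \<tau>) $ j * e (t + \<tau>) $ k))" .
  have "integrable ?X (\<lambda>\<tau>. \<Sum>j<n. \<Sum>k<n. M \<tau> $$ (j, k) * (e (t + \<tau>) $ j * e (t + \<tau>) $ k))"
    using int by (intro Bochner_Integration.integrable_sum) auto
  then show "integrable ?X (\<lambda>\<tau>. e (t + \<tau>) \<bullet> (M \<tau> *\<^sub>v e (t + \<tau>)))"
    by (subst Bochner_Integration.integrable_cong[OF refl eq])
qed

definition energy :: "(real \<Rightarrow> real vec) \<Rightarrow> real \<Rightarrow> real mat \<Rightarrow> nat \<Rightarrow> real"
  where "energy e t M i = (LINT \<tau>|lebesgue_on (Iint S i). e (t + \<tau>) \<bullet> (M *\<^sub>v e (t + \<tau>)))"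

lemma energy_integrable:
  "i \<in> {1..\<nu>} \<Longrightarrow> history S e t \<Longrightarrow> M \<in> carrier_mat n n \<Longrightarrow>
    integrable (lebesgue_on (Iint S i)) (\<lambda>\<tau>. e (t + \<tau>) \<bullet> (M *\<^sub>v e (t + \<tau>)))"
  by (rule integral_quadratic_form(2)) auto

text \<open>The chunks of a moment block are the vector-valued Fourier coefficients of the history
  against an orthonormal family, so the Kronecker form is the coefficient sum of the weighted Bessel
  inequality.\<close>

lemma moment_chunk_Bessel:
  assumes i: "i \<in> {1..\<nu>}" and e: "history S e t" and M: "M \<in> carrier_mat n n"
    and psd: "\<And>x. x \<in> carrier_vec n \<Longrightarrow> 0 \<le> x \<bullet> (M *\<^sub>v x)"
  shows "moment_block S (d_of S i) (nf i) e t i \<bullet> ((1\<^sub>m (d_of S i) \<otimes>\<^sub>K M) *\<^sub>v moment_block S (d_of S i) (nf i) e t i)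
      \<le> energy e t M i"
    and "moment_block S (varkap_of S i) (nh i) e t i \<bullet> ((1\<^sub>m (varkap_of S i) \<otimes>\<^sub>K M) *\<^sub>v moment_block S (varkap_of S i) (nh i) e t i)
      + moment_block S (mu_of S i) (ne i) e t i \<bullet> ((1\<^sub>m (mu_of S i) \<otimes>\<^sub>K M) *\<^sub>v moment_block S (mu_of S i) (ne i) e t i)
      \<le> energy e t M i"
proof -
  have form: "moment_block S N g e t i \<bullet> ((1\<^sub>m N \<otimes>\<^sub>K M) *\<^sub>v moment_block S N g e t i)
    = (\<Sum>p<N. vec n (\<lambda>j. LINT \<tau>|lebesgue_on (Iint S i). g \<tau> $ p * e (t + \<tau>) $ j)
        \<bullet> (M *\<^sub>v vec n (\<lambda>j. LINT \<tau>|lebesgue_on (Iint S i). g \<tau> $ p * e (t + \<tau>) $ j)))"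
    if g: "L2_on (Iint S i) N g" for N g
  proof -
    have "chunk n p (moment_block S N g e t i) = vec n (\<lambda>j. LINT \<tau>|lebesgue_on (Iint S i). g \<tau> $ p * e (t + \<tau>) $ j)"
      if "p < N" for p
      unfolding chunk_def by (rule eq_vecI) (simp_all add: moment_block_index[OF i g e that])
    then show ?thesis by (subst kron_one_quadratic_form[OF M moment_block_carrier[OF i]]) (auto intro!: sum.cong)
  qed
  note eL = history_L2[OF i e]
  show "moment_block S (d_of S i) (nf i) e t i \<bullet> ((1\<^sub>m (d_of S i) \<otimes>\<^sub>K M) *\<^sub>v moment_block S (d_of S i) (nf i) e t i)
      \<le> energy e t M i"
    unfolding form[OF normalized_L2(1)[OF i]] energy_def
    by (rule Bessel_inequality_quadratic[where g = "\<lambda>p \<tau>. nf i \<tau> $ p", OF _ _ _ eL M psd])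
      (auto simp: nf_orthonormal[OF i] intro: L2_on_component[OF normalized_L2(1)[OF i]])
  \<comment> \<open>The families from \<open>h\<close> and \<open>\<epsilon>\<close> are orthonormal
    and orthogonal to one another; over a disjoint sum of index sets they form a single orthonormal
    family.\<close>
  define G where "G = case_sum (\<lambda>p \<tau>. nh i \<tau> $ p) (\<lambda>p \<tau>. ne i \<tau> $ p)"
  let ?I = "{..<varkap_of S i} <+> {..<mu_of S i}"
  have "(\<Sum>p\<in>?I. vec n (\<lambda>j. LINT \<tau>|lebesgue_on (Iint S i). G p \<tau> * e (t + \<tau>) $ j)
        \<bullet> (M *\<^sub>v vec n (\<lambda>j. LINT \<tau>|lebesgue_on (Iint S i). G p \<tau> * e (t + \<tau>) $ j))) \<le> energy e t M i"
    unfolding energy_def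
  proof (rule Bessel_inequality_quadratic[OF _ _ _ eL M psd])
    show "square_integrable (Iint S i) (G p)" if "p \<in> ?I" for p
      using that L2_on_component[OF normalized_L2(2)[OF i]] L2_on_component[OF normalized_L2(3)[OF i]]
      by (auto simp: G_def)
    show "(LINT \<tau>|lebesgue_on (Iint S i). G p \<tau> * G q \<tau>) = (if p = q then 1 else 0)" if "p \<in> ?I" "q \<in> ?I" for p q
      using that nh_orthonormal[OF i] ne_orthonormal[OF i] ne_nh_orthogonal[OF i]
      by (auto simp: G_def mult.commute[of "nh i _ $ _" "ne i _ $ _"] split: if_splits)
  qed auto
  then show "moment_block S (varkap_of S i) (nh i) e t i \<bullet> ((1\<^sub>m (varkap_of S i) \<otimes>\<^sub>K M) *\<^sub>v moment_block S (varkap_of S i) (nh i) e t i)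
      + moment_block S (mu_of S i) (ne i) e t i \<bullet> ((1\<^sub>m (mu_of S i) \<otimes>\<^sub>K M) *\<^sub>v moment_block S (mu_of S i) (ne i) e t i)
      \<le> energy e t M i"
    unfolding form[OF normalized_L2(2)[OF i]] form[OF normalized_L2(3)[OF i]]
    by (simp add: sum.Plus G_def comp_def)
qed

end

section \<open>The storage functional, its derivative and its bounds\<close>

locale lyapunov = delay_system +
  fixes Q R :: "nat \<Rightarrow> real mat" and P1 P2 P3 :: "real mat"
  assumes Q_sym: "\<And>i. i \<in> {1..num_delays S} \<Longrightarrow> Q i \<in> sym_mats (dim_n S)"
    and R_sym: "\<And>i. i \<in> {1..num_delays S} \<Longrightarrow> R i \<in> sym_mats (dim_n S)"
    and P1_sym: "P1 \<in> sym_mats (dim_n S)"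
    and P2_carrier: "P2 \<in> carrier_mat (dim_n S) (d_tot S * dim_n S)"
    and P3_sym: "P3 \<in> sym_mats (d_tot S * dim_n S)"
    and pos_P: "pos_def (four_block_mat P1 P2 (P2\<^sup>\<top>) (P3 + diag_idx S (\<lambda>i. 1\<^sub>m (d_of S i) \<otimes>\<^sub>K Q i)))"
    and pos_Q: "pos_def (diag_idx S Q)"
    and pos_R: "pos_def (diag_idx S R)"
begin

abbreviation "dn \<equiv> d_tot S * n"

definition Pm :: "real mat" where "Pm = four_block_mat P1 P2 (P2\<^sup>\<top>) P3"

lemma P1_carrier: "P1 \<in> carrier_mat n n" and P1_transpose: "P1\<^sup>\<top> = P1"
  and P3_carrier: "P3 \<in> carrier_mat dn dn" and P3_transpose: "P3\<^sup>\<top> = P3"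
  using P1_sym P3_sym by (auto simp: sym_mats_def)

lemma P2t_carrier: "P2\<^sup>\<top> \<in> carrier_mat dn n"
  using P2_carrier by simp

lemma Pm_carrier: "Pm \<in> carrier_mat (n + dn) (n + dn)"
  using P1_carrier P3_carrier by (auto simp: Pm_def)

lemma Pm_transpose: "Pm\<^sup>\<top> = Pm"
  unfolding Pm_def
  by (subst transpose_four_block_mat[OF P1_carrier P2_carrier P2t_carrier P3_carrier])
    (simp add: P1_transpose P3_transpose)

lemma QR_carrier: "i \<in> {1..\<nu>} \<Longrightarrow> Q i \<in> carrier_mat n n" "i \<in> {1..\<nu>} \<Longrightarrow> R i \<in> carrier_mat n n"
  using Q_sym R_sym by (auto simp: sym_mats_def)

lemma QR_pos_def: "i \<in> {1..\<nu>} \<Longrightarrow> pos_def (Q i)" "i \<in> {1..\<nu>} \<Longrightarrow> pos_def (R i)"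
  using pos_def_diag_idx_block[OF pos_Q Q_sym] pos_def_diag_idx_block[OF pos_R R_sym] by auto

lemma QR_psd: "i \<in> {1..\<nu>} \<Longrightarrow> x \<in> carrier_vec n \<Longrightarrow> 0 \<le> x \<bullet> (Q i *\<^sub>v x)"
    "i \<in> {1..\<nu>} \<Longrightarrow> x \<in> carrier_vec n \<Longrightarrow> 0 \<le> x \<bullet> (R i *\<^sub>v x)"
  using pos_defD(3)[OF QR_pos_def(1) QR_carrier(1)] pos_defD(3)[OF QR_pos_def(2) QR_carrier(2)] by auto

text \<open>Affine in \<open>\<tau>\<close> with slope \<open>R i\<close>: it equals
  \<open>Q i\<close> at the older end of the window and \<open>Q i + (r_i - r_{i-1}) R i\<close> at
  the newer one. These values are the origin of the blocks \<open>Q\<close> and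
  \<open>Q + R \<Lambda>\<close> in \<open>Xi\<close>.\<close>

definition weight :: "nat \<Rightarrow> real \<Rightarrow> real mat"
  where "weight i \<tau> = Q i + (\<tau> + delay S i) \<cdot>\<^sub>m R i"

lemma weight_carrier: "i \<in> {1..\<nu>} \<Longrightarrow> weight i \<tau> \<in> carrier_mat n n"
  using QR_carrier by (auto simp: weight_def)

lemma weight_index: "i \<in> {1..\<nu>} \<Longrightarrow> j < n \<Longrightarrow> k < n \<Longrightarrow> weight i \<tau> $$ (j, k) = Q i $$ (j, k) + (\<tau> + delay S i) * R i $$ (j, k)"
  using QR_carrier[of i] by (auto simp: weight_def)

lemma weight_quadratic_form:
  assumes i: "i \<in> {1..\<nu>}" and x: "x \<in> carrier_vec n"
  shows "x \<bullet> (weight i \<tau> *\<^sub>v x) = x \<bullet> (Q i *\<^sub>v x) + (\<tau> + delay S i) * (x \<bullet> (R i *\<^sub>v x))"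
  unfolding quadratic_form_sum[OF weight_carrier[OF i] x x] quadratic_form_sum[OF QR_carrier(1)[OF i] x x]
    quadratic_form_sum[OF QR_carrier(2)[OF i] x x]
  by (simp add: weight_index[OF i] distrib_right sum.distrib sum_distrib_left mult.assoc)

lemma weight_continuous: "i \<in> {1..\<nu>} \<Longrightarrow> j < n \<Longrightarrow> k < n \<Longrightarrow> continuous_on X (\<lambda>\<tau>. weight i \<tau> $$ (j, k))"
  by (simp add: weight_index continuous_intros)

definition weighted_energy :: "(real \<Rightarrow> real vec) \<Rightarrow> real \<Rightarrow> nat \<Rightarrow> real"
  where "weighted_energy e t i = (LINT \<tau>|lebesgue_on (Iint S i). e (t + \<tau>) \<bullet> (weight i \<tau> *\<^sub>v e (t + \<tau>)))"

definition lyap :: "(real \<Rightarrow> real vec) \<Rightarrow> real \<Rightarrow> real"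
  where "lyap e t = lyap_state e t \<bullet> (Pm *\<^sub>v lyap_state e t) + (\<Sum>i=1..\<nu>. weighted_energy e t i)"

definition boundary_rate :: "(real \<Rightarrow> real vec) \<Rightarrow> real \<Rightarrow> nat \<Rightarrow> real"
  where "boundary_rate e t i =
    e (t - delay S (i - 1)) \<bullet> ((Q i + (delay S i - delay S (i - 1)) \<cdot>\<^sub>m R i) *\<^sub>v e (t - delay S (i - 1)))
    - e (t - delay S i) \<bullet> (Q i *\<^sub>v e (t - delay S i)) - energy e t (R i) i"

text \<open>Entrywise, each product of two components of \<open>e\<close> is again a continuous
  scalar signal and the weight is a primitive of an entry of \<open>R i\<close>, so the rule for
  moments over a moving window applies to it.\<close>

lemma weighted_energy_has_derivative:
  assumes e: "signal e t0" and t: "t > t0" and i: "i \<in> {1..\<nu>}"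
  shows "((\<lambda>s. weighted_energy e s i) has_real_derivative boundary_rate e t i) (at t)"
proof -
  define b c where "b = - delay S i" and "c = - delay S (i - 1)"
  have X: "Iint S i = {b..c}" by (simp add: Iint_def b_def c_def)
  let ?M = "lebesgue_on {b..c}"
  have cont: "continuous_on {t0 - r_max S..t + 1} (\<lambda>s. e s $ j * e s $ k)" if "j < n" "k < n" for j k
    using e that by (auto simp: signal_def intro!: continuous_intros intro: continuous_on_subset)
  have hist: "history S e s" if "s > t0" for s using signal_history[OF e, of s] that by simp
  have d: "((\<lambda>s. LINT \<tau>|?M. weight i \<tau> $$ (j, k) * (e (s + \<tau>) $ j * e (s + \<tau>) $ k)) has_real_derivative
      (weight i c $$ (j, k) * (e (t + c) $ j * e (t + c) $ k) - weight i b $$ (j, k) * (e (t + b) $ j * e (t + b) $ k)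
       - (LINT \<tau>|?M. R i $$ (j, k) * (e (t + \<tau>) $ j * e (t + \<tau>) $ k)))) (at t)"
    if jk: "j < n" "k < n" for j k
  proof (rule delay_integral_has_derivative[OF _ _ _ cont[OF jk]])
    show "b \<le> c" using delay_less[OF i] by (simp add: b_def c_def)
    show "integrable ?M (\<lambda>\<tau>. R i $$ (j, k))" by (rule integrable_continuous_lebesgue_on) simp
    show "weight i x $$ (j, k) = weight i b $$ (j, k) + integral {b..x} (\<lambda>\<tau>. R i $$ (j, k))" if "x \<in> {b..c}" for x
      using that by (simp add: weight_index[OF i jk] algebra_simps b_def)
    show "t0 - r_max S < t + b" "t + c < t + 1"
      using signal_delay_bounds[OF t i] by (simp_all add: b_def c_def)
  qed
  have eb: "e (t + b) \<in> carrier_vec n" "e (t + c) \<in> carrier_vec n"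
    using history_carrier[OF hist[OF t], of i] history_carrier[OF hist[OF t], of "i - 1"] i
    by (auto simp: b_def c_def)
  have "((\<lambda>s. \<Sum>j<n. \<Sum>k<n. LINT \<tau>|?M. weight i \<tau> $$ (j, k) * (e (s + \<tau>) $ j * e (s + \<tau>) $ k)) has_real_derivative
    (\<Sum>j<n. \<Sum>k<n. weight i c $$ (j, k) * (e (t + c) $ j * e (t + c) $ k) - weight i b $$ (j, k) * (e (t + b) $ j * e (t + b) $ k)
       - (LINT \<tau>|?M. R i $$ (j, k) * (e (t + \<tau>) $ j * e (t + \<tau>) $ k)))) (at t)"
    by (intro DERIV_sum d) auto
  also have "(\<Sum>j<n. \<Sum>k<n. weight i c $$ (j, k) * (e (t + c) $ j * e (t + c) $ k) - weight i b $$ (j, k) * (e (t + b) $ j * e (t + b) $ k)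
       - (LINT \<tau>|?M. R i $$ (j, k) * (e (t + \<tau>) $ j * e (t + \<tau>) $ k)))
    = e (t + c) \<bullet> (weight i c *\<^sub>v e (t + c)) - e (t + b) \<bullet> (weight i b *\<^sub>v e (t + b)) - energy e t (R i) i"
    unfolding energy_def integral_quadratic_form(1)[OF i hist[OF t] QR_carrier(2)[OF i] continuous_on_const]
    unfolding X
      quadratic_form_sum[OF weight_carrier[OF i] eb(1) eb(1)] quadratic_form_sum[OF weight_carrier[OF i] eb(2) eb(2)]
    by (simp only: sum_subtractf)
  also have "\<dots> = boundary_rate e t i"
  proof -
    have "weight i b = Q i" using QR_carrier[OF i] by (intro eq_matI) (auto simp: weight_def b_def)
    moreover have "weight i c = Q i + (delay S i - delay S (i - 1)) \<cdot>\<^sub>m R i" by (simp add: weight_def c_def)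
    ultimately show ?thesis by (simp add: boundary_rate_def b_def c_def)
  qed
  finally have D: "((\<lambda>s. \<Sum>j<n. \<Sum>k<n. LINT \<tau>|?M. weight i \<tau> $$ (j, k) * (e (s + \<tau>) $ j * e (s + \<tau>) $ k))
    has_real_derivative boundary_rate e t i) (at t)" .
  show ?thesis
  proof (rule has_field_derivative_transform_within_open[OF D, of "{t0<..}"])
    fix s assume "s \<in> {t0<..}"
    then have "history S e s" using hist by simp
    then show "(\<Sum>j<n. \<Sum>k<n. LINT \<tau>|?M. weight i \<tau> $$ (j, k) * (e (s + \<tau>) $ j * e (s + \<tau>) $ k)) = weighted_energy e s i"
      unfolding weighted_energy_def
      using integral_quadratic_form(1)[OF i _ weight_carrier[OF i] weight_continuous[OF i]] X by simp
  qed (use t in auto)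
qed

lemma lyap_has_derivative:
  assumes e: "signal e t0" and t: "t > t0" and e': "vec_deriv n e e' t"
  shows "(lyap e has_real_derivative 2 * (lyap_state e t \<bullet> (Pm *\<^sub>v lyap_state_rate e e' t))
    + (\<Sum>i=1..\<nu>. boundary_rate e t i)) (at t)"
  unfolding lyap_def[abs_def]
proof (intro DERIV_add DERIV_sum weighted_energy_has_derivative[OF e t]
    quadratic_form_has_derivative[OF Pm_carrier Pm_transpose lyap_state_has_derivative[OF e t e']])
  have "eventually (\<lambda>s. s \<in> {t0<..}) (nhds t)" using t by (intro eventually_nhds_in_open) auto
  then show "eventually (\<lambda>s. lyap_state e s \<in> carrier_vec (n + dn)) (nhds t)"
    by eventually_elim (auto intro!: lyap_state_carrier signal_history[OF e])
qed auto

lemma moment_block_cong: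
  assumes "\<And>\<tau>. \<tau> \<in> Iint S i \<Longrightarrow> e (t + \<tau>) = e' (t' + \<tau>)"
  shows "moment_block S N g e t i = moment_block S N g e' t' i"
  unfolding moment_block_def vec_integral_def
  by (intro eq_vecI) (auto intro!: Bochner_Integration.integral_cong simp: assms)

text \<open>All ingredients of \<open>lyap\<close> read \<open>e\<close> on the window
  \<open>Jint S\<close> only, where the segment agrees with it. Hence \<open>lyap\<close> along a
  solution is a functional of the segment, as dissipativity demands.\<close>

lemma lyap_segment: "lyap (segment S e t) 0 = lyap e t"
proof -
  have seg: "segment S e t (0 + \<tau>) = e (t + \<tau>)" if "\<tau> \<in> Jint S" for \<tau>
    using that by (simp add: segment_def)
  have segI: "segment S e t (0 + \<tau>) = e (t + \<tau>)" if "\<tau> \<in> Iint S i" "i \<in> {1..\<nu>}" for \<tau> i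
    using seg that Iint_subset_Jint by blast
  have "moments S (d_of S) nf (segment S e t) 0 = moments S (d_of S) nf e t"
    unfolding moments_def
    by (intro arg_cong[of _ _ vconcat] map_cong refl moment_block_cong segI) auto
  moreover have "segment S e t 0 = e t" using seg[OF zero_in_Jint] by simp
  ultimately have "lyap_state (segment S e t) 0 = lyap_state e t" by (simp add: lyap_state_def)
  moreover have "weighted_energy (segment S e t) 0 i = weighted_energy e t i" if "i \<in> {1..\<nu>}" for i
    unfolding weighted_energy_def using segI[OF _ that] by (intro Bochner_Integration.integral_cong refl) simp
  ultimately show ?thesis by (simp add: lyap_def)
qed

lemma bounded_linear_form_lyap_state:
  assumes a: "a < n + dn"
  shows "bounded_linear_form (\<lambda>\<psi>. lyap_state \<psi> 0 $ a)"
proof (cases "a < n")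
  case True
  from bounded_linear_form_eval[OF zero_in_Jint True] show ?thesis
  proof (rule bounded_linear_form_cong)
    fix \<psi> assume "\<psi> \<in> C_space S"
    then have "\<psi> 0 \<in> carrier_vec n" using C_space_carrier zero_in_Jint by blast
    then show "\<psi> 0 $ a = lyap_state \<psi> 0 $ a" using True by (simp add: lyap_state_def)
  qed
next
  case False
  have len: "d_tot S * n = (\<Sum>i\<leftarrow>idx S. d_of S i * n)"
    by (simp only: sum_list_idx d_tot_def sum_distrib_right)
  have an: "a - n < (\<Sum>i\<leftarrow>idx S. d_of S i * n)" using False a len by linarith
  have "bounded_linear_form (\<lambda>\<psi>. moments S (d_of S) nf \<psi> 0 $ (a - n))"
    unfolding moments_def
  \<comment> \<open>\<open>y\<close> is a dummy, since this instance of \<open>\<Phi>\<close>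
    ignores its second argument.\<close>
  proof (rule vconcat_component[where k = "\<lambda>i. d_of S i * n" and \<Phi> = "\<lambda>f _. bounded_linear_form f" and y = "\<lambda>i. 0\<^sub>v (d_of S i * n)"])
    fix i b assume i: "i \<in> set (idx S)" and b: "b < d_of S i * n"
    have i': "i \<in> {1..\<nu>}" using i by (simp only: set_idx)
    define p j where "p = b div n" and "j = b mod n"
    have pj: "p < d_of S i" "j < n" "b = p * n + j"
      using b by (auto simp: p_def j_def less_mult_imp_div_less intro!: mod_less_divisor gr0I)
    have "integrable (lebesgue_on (Iint S i)) (\<lambda>\<tau>. nf i \<tau> $ p)"
      using L2_on_component[OF normalized_L2(1)[OF i'] pj(1)] square_integrable_imp_integrable unfolding Iint_def by blast
    from bounded_linear_form_moment[OF i' this pj(2)]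
    show "bounded_linear_form (\<lambda>\<psi>. moment_block S (d_of S i) (nf i) \<psi> 0 i $ b)"
      by (rule bounded_linear_form_cong)
        (simp add: moment_block_index[OF i' normalized_L2(1)[OF i'] C_space_history pj(1,2), folded pj(3)])
  qed (use an in \<open>auto simp: moment_block_def vec_integral_def\<close>)
  then show ?thesis
  proof (rule bounded_linear_form_cong)
    fix \<psi> assume "\<psi> \<in> C_space S"
    then have "\<psi> 0 \<in> carrier_vec n" using C_space_carrier zero_in_Jint by blast
    then show "moments S (d_of S) nf \<psi> 0 $ (a - n) = lyap_state \<psi> 0 $ a"
      using False a moments_carrier[of "d_of S" nf \<psi> 0] by (auto simp: lyap_state_def d_tot_def)
  qed
qed

lemma lyap_quadratic_functional: "quadratic_functional (\<lambda>\<psi>. lyap \<psi> 0)"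
proof -
  have "quadratic_functional (\<lambda>\<psi>. (\<Sum>a<n + dn. \<Sum>b<n + dn. Pm $$ (a, b) * (lyap_state \<psi> 0 $ a * lyap_state \<psi> 0 $ b))
    + (\<Sum>i=1..\<nu>. \<Sum>j<n. \<Sum>k<n. LINT \<tau>|lebesgue_on (Iint S i). weight i \<tau> $$ (j, k) * (\<psi> (0 + \<tau>) $ j * \<psi> (0 + \<tau>) $ k)))"
    by (intro quadratic_functional_add quadratic_functional_sum quadratic_functional_mult
        bounded_linear_form_lyap_state quadratic_functional_integral weight_continuous) auto
  then show ?thesis
  proof (rule quadratic_functional_cong)
    fix \<psi> assume "\<psi> \<in> C_space S"
    then have h: "history S \<psi> 0" by (rule C_space_history)
    have "weighted_energy \<psi> 0 i = (\<Sum>j<n. \<Sum>k<n. LINT \<tau>|lebesgue_on (Iint S i). weight i \<tau> $$ (j, k) * (\<psi> (0 + \<tau>) $ j * \<psi> (0 + \<tau>) $ k))"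
      if "i \<in> {1..\<nu>}" for i
      unfolding weighted_energy_def by (rule integral_quadratic_form(1)[OF that h weight_carrier[OF that] weight_continuous[OF that]])
    then show "(\<Sum>a<n + dn. \<Sum>b<n + dn. Pm $$ (a, b) * (lyap_state \<psi> 0 $ a * lyap_state \<psi> 0 $ b))
      + (\<Sum>i=1..\<nu>. \<Sum>j<n. \<Sum>k<n. LINT \<tau>|lebesgue_on (Iint S i). weight i \<tau> $$ (j, k) * (\<psi> (0 + \<tau>) $ j * \<psi> (0 + \<tau>) $ k)) = lyap \<psi> 0"
      unfolding lyap_def quadratic_form_sum[OF Pm_carrier lyap_state_carrier[OF h] lyap_state_carrier[OF h]] by simp
  qed
qed

lemma lyap_initial_bound: "\<exists>K\<ge>0. \<forall>\<psi>\<in>C_space S. lyap \<psi> 0 \<le> K * (C_norm S \<psi>)\<^sup>2"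
proof -
  obtain B K where B: "\<And>\<psi>. \<psi> \<in> C_space S \<Longrightarrow> lyap \<psi> 0 = B \<psi> \<psi>" "K \<ge> 0"
    "\<And>\<psi> \<chi>. \<psi> \<in> C_space S \<Longrightarrow> \<chi> \<in> C_space S \<Longrightarrow> \<bar>B \<psi> \<chi>\<bar> \<le> K * (C_norm S \<psi> * C_norm S \<chi>)"
    using lyap_quadratic_functional unfolding quadratic_functional_def by blast
  have "lyap \<psi> 0 \<le> K * (C_norm S \<psi>)\<^sup>2" if "\<psi> \<in> C_space S" for \<psi>
    using B(1)[OF that] B(3)[OF that that] by (simp add: power2_eq_square)
  then show ?thesis using B(2) by blast
qed

lemma diag_moments:
  assumes M: "\<And>i. i \<in> {1..\<nu>} \<Longrightarrow> M i \<in> carrier_mat n n"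
  shows "moments S N g e t \<bullet> (diag_idx S (\<lambda>i. 1\<^sub>m (N i) \<otimes>\<^sub>K M i) *\<^sub>v moments S N g e t)
    = (\<Sum>i=1..\<nu>. moment_block S (N i) (g i) e t i \<bullet> ((1\<^sub>m (N i) \<otimes>\<^sub>K M i) *\<^sub>v moment_block S (N i) (g i) e t i))"
proof -
  have K: "1\<^sub>m (N i) \<otimes>\<^sub>K M i \<in> carrier_mat (N i * n) (N i * n)" if "i \<in> set (idx S)" for i
    using kron_carrier[OF one_carrier_mat M] that by (simp only: set_idx)
  have m: "moment_block S (N i) (g i) e t i \<in> carrier_vec (N i * n)" for i
    by (simp add: moment_block_def vec_integral_def)
  have "diag_idx S (\<lambda>i. 1\<^sub>m (N i) \<otimes>\<^sub>K M i) *\<^sub>v moments S N g e t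
      = vconcat (map (\<lambda>i. (1\<^sub>m (N i) \<otimes>\<^sub>K M i) *\<^sub>v moment_block S (N i) (g i) e t i) (idx S))"
    unfolding diag_idx_def moments_def by (rule diag_block_mat_mult_vconcat) (metis K m carrier_matD(2))
  also have "moments S N g e t \<bullet> \<dots> = (\<Sum>i\<leftarrow>idx S. moment_block S (N i) (g i) e t i \<bullet> ((1\<^sub>m (N i) \<otimes>\<^sub>K M i) *\<^sub>v moment_block S (N i) (g i) e t i))"
    unfolding moments_def by (rule vconcat_scalar_prod[of _ _ "\<lambda>i. N i * n"]) (metis K m mult_mat_vec_carrier)
  finally show ?thesis by (simp only: sum_list_idx)
qed

lemma lyap_lower_bound: "\<exists>c>0. \<forall>e t. history S e t \<longrightarrow> c * (e t \<bullet> e t) \<le> lyap e t"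
proof -
  let ?D = "diag_idx S (\<lambda>i. 1\<^sub>m (d_of S i) \<otimes>\<^sub>K Q i)"
  let ?F = "four_block_mat P1 P2 (P2\<^sup>\<top>) (P3 + ?D)"
  have K: "1\<^sub>m (d_of S i) \<otimes>\<^sub>K Q i \<in> carrier_mat (d_of S i * n) (d_of S i * n)" if "i \<in> set (idx S)" for i
    using kron_carrier[OF one_carrier_mat QR_carrier(1)] that by (simp only: set_idx)
  have D: "?D \<in> carrier_mat dn dn"
    using diag_block_mat_carrier[OF K, of "idx S"] unfolding diag_idx_def
    by (simp only: sum_list_idx d_tot_def sum_distrib_right)
  have F: "?F \<in> carrier_mat (n + dn) (n + dn)" using P1_carrier P3_carrier D by auto
  obtain c where c: "c > 0" "\<And>x. x \<in> carrier_vec (n + dn) \<Longrightarrow> c * (x \<bullet> x) \<le> x \<bullet> (?F *\<^sub>v x)"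
    using pos_def_coercive[OF pos_P F] by blast
  have "c * (e t \<bullet> e t) \<le> lyap e t" if h: "history S e t" for e t
  proof -
    define y where "y = moments S (d_of S) nf e t"
    have y: "y \<in> carrier_vec dn" using moments_carrier[of "d_of S"] by (simp add: y_def d_tot_def)
    have x: "e t \<in> carrier_vec n" by (rule history_carrier_0[OF h])
    have st: "lyap_state e t = e t @\<^sub>v y" by (simp add: lyap_state_def y_def)
    have "y \<bullet> (?D *\<^sub>v y) = (\<Sum>i=1..\<nu>. moment_block S (d_of S i) (nf i) e t i \<bullet> ((1\<^sub>m (d_of S i) \<otimes>\<^sub>K Q i) *\<^sub>v moment_block S (d_of S i) (nf i) e t i))"
      unfolding y_def by (rule diag_moments[OF QR_carrier(1)])
    also have "\<dots> \<le> (\<Sum>i=1..\<nu>. energy e t (Q i) i)"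
      by (intro sum_mono moment_chunk_Bessel(1) h QR_carrier(1) QR_psd)
    \<comment> \<open>On its window the factor \<open>\<tau> + delay S i\<close> is nonnegative, so
      the \<open>R\<close>-part of the weight can only increase the energy.\<close>
    also have "\<dots> \<le> (\<Sum>i=1..\<nu>. weighted_energy e t i)"
    proof (rule sum_mono)
      fix i assume i: "i \<in> {1..\<nu>}"
      show "energy e t (Q i) i \<le> weighted_energy e t i" unfolding energy_def weighted_energy_def
      proof (rule integral_mono)
        show "integrable (lebesgue_on (Iint S i)) (\<lambda>\<tau>. e (t + \<tau>) \<bullet> (Q i *\<^sub>v e (t + \<tau>)))"
          by (rule energy_integrable[OF i h QR_carrier(1)[OF i]])
        show "integrable (lebesgue_on (Iint S i)) (\<lambda>\<tau>. e (t + \<tau>) \<bullet> (weight i \<tau> *\<^sub>v e (t + \<tau>)))"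
          by (rule integral_quadratic_form(2)[OF i h weight_carrier[OF i] weight_continuous[OF i]])
        fix \<tau> assume "\<tau> \<in> space (lebesgue_on (Iint S i))"
        then have \<tau>: "\<tau> \<in> Iint S i" by simp
        then have "0 \<le> \<tau> + delay S i" by (auto simp: Iint_def)
        moreover have et: "e (t + \<tau>) \<in> carrier_vec n" using L2_on_carrier[OF history_L2[OF i h] \<tau>] .
        ultimately have "0 \<le> (\<tau> + delay S i) * (e (t + \<tau>) \<bullet> (R i *\<^sub>v e (t + \<tau>)))"
          using QR_psd(2)[OF i et] by simp
        then show "e (t + \<tau>) \<bullet> (Q i *\<^sub>v e (t + \<tau>)) \<le> e (t + \<tau>) \<bullet> (weight i \<tau> *\<^sub>v e (t + \<tau>))"
          by (simp add: weight_quadratic_form[OF i et])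
      qed
    qed
    finally have le: "y \<bullet> (?D *\<^sub>v y) \<le> (\<Sum>i=1..\<nu>. weighted_energy e t i)" .
    have Dy: "?D *\<^sub>v y \<in> carrier_vec dn" using D y by (rule mult_mat_vec_carrier)
    have "(e t @\<^sub>v y) \<bullet> (?F *\<^sub>v (e t @\<^sub>v y)) = (e t @\<^sub>v y) \<bullet> (Pm *\<^sub>v (e t @\<^sub>v y)) + y \<bullet> (?D *\<^sub>v y)"
    proof -
      have "?F *\<^sub>v (e t @\<^sub>v y) = (P1 *\<^sub>v e t + P2 *\<^sub>v y) @\<^sub>v (P2\<^sup>\<top> *\<^sub>v e t + (P3 + ?D) *\<^sub>v y)"
        by (rule four_block_mat_mult_vec[OF P1_carrier P2_carrier P2t_carrier _ x y]) (use P3_carrier D in auto)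
      moreover have "Pm *\<^sub>v (e t @\<^sub>v y) = (P1 *\<^sub>v e t + P2 *\<^sub>v y) @\<^sub>v (P2\<^sup>\<top> *\<^sub>v e t + P3 *\<^sub>v y)"
        unfolding Pm_def by (rule four_block_mat_mult_vec[OF P1_carrier P2_carrier P2t_carrier P3_carrier x y])
      moreover have "(P3 + ?D) *\<^sub>v y = P3 *\<^sub>v y + ?D *\<^sub>v y"
        by (rule add_mult_distrib_mat_vec[OF P3_carrier D y])
      moreover have c1: "P1 *\<^sub>v e t + P2 *\<^sub>v y \<in> carrier_vec n" "P2\<^sup>\<top> *\<^sub>v e t \<in> carrier_vec dn" "P3 *\<^sub>v y \<in> carrier_vec dn"
        using P1_carrier P2_carrier P2t_carrier P3_carrier x y by (auto intro!: add_carrier_vec mult_mat_vec_carrier)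
      ultimately show ?thesis using x y Dy
        by (simp add: scalar_prod_append[of _ n _ dn] scalar_prod_add_distrib[of _ dn])
    qed
    moreover have "c * (e t \<bullet> e t) \<le> c * ((e t @\<^sub>v y) \<bullet> (e t @\<^sub>v y))"
      using c(1) x y scalar_prod_self_ge_0[of y] by (simp add: scalar_prod_append[of _ n _ dn])
    ultimately show ?thesis using c(2)[of "e t @\<^sub>v y"] x y le by (simp add: lyap_def st)
  qed
  then show ?thesis using c(1) by blast
qed

lemma energy_one: "i \<in> {1..\<nu>} \<Longrightarrow> history S e t \<Longrightarrow>
    energy e t (1\<^sub>m n) i = (LINT \<tau>|lebesgue_on (Iint S i). e (t + \<tau>) \<bullet> e (t + \<tau>))"
  unfolding energy_def using L2_on_carrier[OF history_L2]
  by (intro Bochner_Integration.integral_cong refl) simp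

lemma energy_one_nonneg: "i \<in> {1..\<nu>} \<Longrightarrow> history S e t \<Longrightarrow> 0 \<le> energy e t (1\<^sub>m n) i"
  unfolding energy_one by (intro Bochner_Integration.integral_nonneg scalar_prod_self_ge_0)

lemma energy_compare:
  assumes i: "i \<in> {1..\<nu>}" and h: "history S e t" and A: "A \<in> carrier_mat n n" and B: "B \<in> carrier_mat n n"
    and le: "\<And>x. x \<in> carrier_vec n \<Longrightarrow> a * (x \<bullet> (A *\<^sub>v x)) \<le> x \<bullet> (B *\<^sub>v x)"
  shows "a * energy e t A i \<le> energy e t B i"
  unfolding energy_def integral_mult_right_zero[symmetric]
  using energy_integrable[OF i h A] energy_integrable[OF i h B] le L2_on_carrier[OF history_L2[OF i h]]
  by (intro integral_mono) auto

text \<open>The full energy of the history stands on the right because finitely many moments do not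
  bound the weighted energies from above; the moments are in turn bounded by it through Bessel's
  inequality with weight \<open>1\<^sub>m n\<close>.\<close>

lemma lyap_upper_bound: "\<exists>c>0. \<forall>e t. history S e t \<longrightarrow> lyap e t \<le> c * (e t \<bullet> e t + (\<Sum>i=1..\<nu>. energy e t (1\<^sub>m n) i))"
proof -
  obtain p where p: "p > 0" "\<And>x. x \<in> carrier_vec (n + dn) \<Longrightarrow> x \<bullet> (Pm *\<^sub>v x) \<le> p * (x \<bullet> x)"
    using quadratic_form_le[OF Pm_carrier] by blast
  have bound: "\<exists>c. \<forall>i\<in>{1..\<nu>}. c i > 0 \<and> (\<forall>x\<in>carrier_vec n. x \<bullet> (A i *\<^sub>v x) \<le> c i * (x \<bullet> x))"
    if A: "\<And>i. i \<in> {1..\<nu>} \<Longrightarrow> A i \<in> carrier_mat n n" for A :: "nat \<Rightarrow> real mat"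
  proof (rule bchoice, rule ballI)
    fix i assume "i \<in> {1..\<nu>}"
    from quadratic_form_le[OF A[OF this]] obtain c where "c > 0" "\<And>x. x \<in> carrier_vec n \<Longrightarrow> x \<bullet> (A i *\<^sub>v x) \<le> c * (x \<bullet> x)"
      by blast
    then show "\<exists>c>0. \<forall>x\<in>carrier_vec n. x \<bullet> (A i *\<^sub>v x) \<le> c * (x \<bullet> x)" by blast
  qed
  obtain cq where cq: "\<And>i x. i \<in> {1..\<nu>} \<Longrightarrow> x \<in> carrier_vec n \<Longrightarrow> x \<bullet> (Q i *\<^sub>v x) \<le> cq i * (x \<bullet> x)"
      "\<And>i. i \<in> {1..\<nu>} \<Longrightarrow> cq i > 0" using bound[of Q] QR_carrier(1) by blast
  obtain cr where cr: "\<And>i x. i \<in> {1..\<nu>} \<Longrightarrow> x \<in> carrier_vec n \<Longrightarrow> x \<bullet> (R i *\<^sub>v x) \<le> cr i * (x \<bullet> x)"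
      "\<And>i. i \<in> {1..\<nu>} \<Longrightarrow> cr i > 0" using bound[of R] QR_carrier(2) by blast
  have Ci: "0 \<le> cq i + r_max S * cr i" if "i \<in> {1..\<nu>}" for i
    using cq(2)[OF that] cr(2)[OF that] r_max_nonneg by (intro add_nonneg_nonneg mult_nonneg_nonneg) auto
  \<comment> \<open>The sum of the nonnegative constants of all windows bounds each of them;
    \<open>r_max S\<close> bounds the factor \<open>\<tau> + delay S i\<close>.\<close>
  define C where "C = (\<Sum>i=1..\<nu>. cq i + r_max S * cr i)"
  have C: "cq i + r_max S * cr i \<le> C" if "i \<in> {1..\<nu>}" for i
    unfolding C_def using that Ci by (intro member_le_sum) auto
  have C0: "C \<ge> 0" unfolding C_def using Ci by (intro sum_nonneg)
  have "lyap e t \<le> (p + C) * (e t \<bullet> e t + (\<Sum>i=1..\<nu>. energy e t (1\<^sub>m n) i))" if h: "history S e t" for e t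
  proof -
    let ?E = "\<Sum>i=1..\<nu>. energy e t (1\<^sub>m n) i"
    have x: "e t \<in> carrier_vec n" by (rule history_carrier_0[OF h])
    have y: "moments S (d_of S) nf e t \<in> carrier_vec dn" using moments_carrier[of "d_of S"] by (simp add: d_tot_def)
    have "moments S (d_of S) nf e t \<bullet> moments S (d_of S) nf e t
        = (\<Sum>i=1..\<nu>. moment_block S (d_of S i) (nf i) e t i \<bullet> moment_block S (d_of S i) (nf i) e t i)"
      unfolding moments_def
      by (subst vconcat_scalar_prod[of _ _ "\<lambda>i. d_of S i * n"])
        (simp_all only: sum_list_idx, simp add: moment_block_def vec_integral_def)
    also have "\<dots> \<le> ?E"
    proof (rule sum_mono)
      fix i assume i: "i \<in> {1..\<nu>}"
      \<comment> \<open>Turns the weighted Bessel inequality into a bound on the plain squared norm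
        of the moments.\<close>
      have one: "1\<^sub>m (d_of S i) \<otimes>\<^sub>K 1\<^sub>m n = (1\<^sub>m (d_of S i * n) :: real mat)"
      proof (rule eq_matI)
        fix a b assume "a < dim_row (1\<^sub>m (d_of S i * n) :: real mat)" "b < dim_col (1\<^sub>m (d_of S i * n) :: real mat)"
        then have ab: "a < d_of S i * n" "b < d_of S i * n" by auto
        then have "n > 0" by (cases n) auto
        then have "a div n < d_of S i" "b div n < d_of S i" "a mod n < n" "b mod n < n"
          using ab by (auto simp: less_mult_imp_div_less)
        moreover have "a = b \<longleftrightarrow> a div n = b div n \<and> a mod n = b mod n" by (metis div_mult_mod_eq)
        ultimately show "(1\<^sub>m (d_of S i) \<otimes>\<^sub>K 1\<^sub>m n) $$ (a, b) = (1\<^sub>m (d_of S i * n) :: real mat) $$ (a, b)"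
          using ab by (auto simp: kron_def)
      qed (auto simp: kron_def)
      have "moment_block S (d_of S i) (nf i) e t i \<bullet> ((1\<^sub>m (d_of S i) \<otimes>\<^sub>K 1\<^sub>m n) *\<^sub>v moment_block S (d_of S i) (nf i) e t i) \<le> energy e t (1\<^sub>m n) i"
        by (rule moment_chunk_Bessel(1)[OF i h]) (auto simp: scalar_prod_self_ge_0)
      then show "moment_block S (d_of S i) (nf i) e t i \<bullet> moment_block S (d_of S i) (nf i) e t i \<le> energy e t (1\<^sub>m n) i"
        unfolding one using moment_block_carrier[OF i, of "d_of S i" "nf i" e t] by simp
    qed
    finally have "lyap_state e t \<bullet> lyap_state e t \<le> e t \<bullet> e t + ?E"
      using x y by (simp add: lyap_state_def scalar_prod_append[of _ n _ dn])
    then have 1: "lyap_state e t \<bullet> (Pm *\<^sub>v lyap_state e t) \<le> p * (e t \<bullet> e t + ?E)"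
      using p(2)[OF lyap_state_carrier[OF h]] p(1) by (meson less_eq_real_def mult_left_mono order_trans)
    have "weighted_energy e t i \<le> C * energy e t (1\<^sub>m n) i" if i: "i \<in> {1..\<nu>}" for i
      unfolding weighted_energy_def energy_def integral_mult_right_zero[symmetric]
    proof (rule integral_mono)
      show "integrable (lebesgue_on (Iint S i)) (\<lambda>\<tau>. e (t + \<tau>) \<bullet> (weight i \<tau> *\<^sub>v e (t + \<tau>)))"
        by (rule integral_quadratic_form(2)[OF i h weight_carrier[OF i] weight_continuous[OF i]])
      show "integrable (lebesgue_on (Iint S i)) (\<lambda>\<tau>. C * (e (t + \<tau>) \<bullet> (1\<^sub>m n *\<^sub>v e (t + \<tau>))))"
        using energy_integrable[OF i h one_carrier_mat] by (rule integrable_mult_right)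
      fix \<tau> assume "\<tau> \<in> space (lebesgue_on (Iint S i))"
      then have \<tau>: "\<tau> \<in> Iint S i" by simp
      have i': "i \<le> \<nu>" "i - 1 \<le> \<nu>" using i by auto
      have "0 \<le> \<tau> + delay S i" "\<tau> + delay S i \<le> r_max S"
        using \<tau> delay_le_r_max[OF i'(1)] delay_nonneg[OF i'(2)] by (auto simp: Iint_def)
      moreover have et: "e (t + \<tau>) \<in> carrier_vec n" using L2_on_carrier[OF history_L2[OF i h] \<tau>] .
      ultimately have "(\<tau> + delay S i) * (e (t + \<tau>) \<bullet> (R i *\<^sub>v e (t + \<tau>))) \<le> r_max S * (cr i * (e (t + \<tau>) \<bullet> e (t + \<tau>)))"
        using QR_psd(2)[OF i et] cr(1)[OF i et] r_max_nonneg by (intro mult_mono) auto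
      then have "e (t + \<tau>) \<bullet> (weight i \<tau> *\<^sub>v e (t + \<tau>)) \<le> (cq i + r_max S * cr i) * (e (t + \<tau>) \<bullet> e (t + \<tau>))"
        unfolding weight_quadratic_form[OF i et] using cq(1)[OF i et] by (simp add: distrib_right mult.assoc)
      also have "\<dots> \<le> C * (e (t + \<tau>) \<bullet> e (t + \<tau>))" by (intro mult_right_mono C[OF i] scalar_prod_self_ge_0)
      finally show "e (t + \<tau>) \<bullet> (weight i \<tau> *\<^sub>v e (t + \<tau>)) \<le> C * (e (t + \<tau>) \<bullet> (1\<^sub>m n *\<^sub>v e (t + \<tau>)))"
        using et by simp
    qed
    then have "(\<Sum>i=1..\<nu>. weighted_energy e t i) \<le> C * ?E" unfolding sum_distrib_left by (rule sum_mono)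
    moreover have "0 \<le> C * (e t \<bullet> e t)" using C0 scalar_prod_self_ge_0 by simp
    ultimately show ?thesis using 1 by (simp add: lyap_def algebra_simps)
  qed
  then show ?thesis using p(1) C0 by (intro exI[of _ "p + C"]) auto
qed

end

subsection \<open>The matrix inequality\<close>

lemma append_vec_assoc: "(x @\<^sub>v y) @\<^sub>v z = x @\<^sub>v y @\<^sub>v z"
  by (intro eq_vecI) (auto simp: less_diff_conv2)

lemma zero_mat_mult_vec: "x \<in> carrier_vec b \<Longrightarrow> 0\<^sub>m a b *\<^sub>v x = 0\<^sub>v a" for x :: "real vec"
  by (intro eq_vecI) auto

lemma hconcat_carrier:
  assumes "\<And>i. i \<in> set l \<Longrightarrow> X i \<in> carrier_mat nr (c i)"
  shows "hconcat nr (map X l) \<in> carrier_mat nr (\<Sum>i\<leftarrow>l. c i)"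
  using assms by (induction l) (auto simp: hconcat_def intro!: append_cols_carrier)

lemma vconcat_add:
  assumes "\<And>i. i \<in> set l \<Longrightarrow> x i \<in> carrier_vec (k i) \<and> y i \<in> carrier_vec (k i)"
  shows "vconcat (map x l) + vconcat (map y l) = vconcat (map (\<lambda>i. x i + y i) l)"
  using assms
proof (induction l)
  case Nil
  show ?case by (intro eq_vecI) auto
next
  case (Cons i l)
  have "vconcat (map x l) \<in> carrier_vec (\<Sum>i\<leftarrow>l. k i)" "vconcat (map y l) \<in> carrier_vec (\<Sum>i\<leftarrow>l. k i)"
    using Cons.prems by (auto intro!: vconcat_carrier)
  then show ?case using Cons by (simp add: append_vec_add[of _ "k i" _ _ "\<Sum>i\<leftarrow>l. k i"])
qed

lemma vconcat_minus:
  assumes "\<And>i. i \<in> set l \<Longrightarrow> x i \<in> carrier_vec (k i) \<and> y i \<in> carrier_vec (k i)"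
  shows "vconcat (map x l) - vconcat (map y l) = vconcat (map (\<lambda>i. x i - y i) l)"
  using assms
proof (induction l)
  case Nil
  show ?case by (intro eq_vecI) auto
next
  case (Cons i l)
  have v: "vconcat (map x l) \<in> carrier_vec (\<Sum>i\<leftarrow>l. k i)" "vconcat (map y l) \<in> carrier_vec (\<Sum>i\<leftarrow>l. k i)"
    using Cons.prems by (auto intro!: vconcat_carrier)
  have "(x i @\<^sub>v vconcat (map x l)) - (y i @\<^sub>v vconcat (map y l)) = (x i - y i) @\<^sub>v (vconcat (map x l) - vconcat (map y l))"
    using v Cons.prems[of i] by (intro eq_vecI) auto
  then show ?case using Cons by simp
qed

text \<open>Kept bilinear, since matrices are compared below through pairs of vectors.\<close>

lemma Sy_scalar_prod:
  assumes X: "X \<in> carrier_mat N N" and u: "u \<in> carrier_vec N" and x: "x \<in> carrier_vec N"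
  shows "u \<bullet> (Sy X *\<^sub>v x) = u \<bullet> (X *\<^sub>v x) + x \<bullet> (X *\<^sub>v u)"
proof -
  have Xt: "X\<^sup>\<top> \<in> carrier_mat N N" using X by simp
  have "Sy X *\<^sub>v x = X *\<^sub>v x + X\<^sup>\<top> *\<^sub>v x" unfolding Sy_def by (rule add_mult_distrib_mat_vec[OF X Xt x])
  then have "u \<bullet> (Sy X *\<^sub>v x) = u \<bullet> (X *\<^sub>v x) + u \<bullet> (X\<^sup>\<top> *\<^sub>v x)"
    using scalar_prod_add_distrib[OF u mult_mat_vec_carrier[OF X x] mult_mat_vec_carrier[OF Xt x]] by simp
  also have "u \<bullet> (X\<^sup>\<top> *\<^sub>v x) = (X\<^sup>\<top> *\<^sub>v x) \<bullet> u"
    by (rule comm_scalar_prod[OF u mult_mat_vec_carrier[OF Xt x]])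
  also have "\<dots> = x \<bullet> (X *\<^sub>v u)" by (rule transpose_scalar_prod[OF X x u])
  finally show ?thesis .
qed

lemma Sy_carrier: "X \<in> carrier_mat N N \<Longrightarrow> Sy X \<in> carrier_mat N N"
  by (simp add: Sy_def)

lemma col_mat_mult_vec: "v \<in> carrier_vec N \<Longrightarrow> x \<in> carrier_vec 1 \<Longrightarrow> col_mat v *\<^sub>v x = x $ 0 \<cdot>\<^sub>v v"
  by (intro eq_vecI) (auto simp: scalar_prod_def mat_of_cols_index)

lemma col_mat_carrier: "v \<in> carrier_vec N \<Longrightarrow> col_mat v \<in> carrier_mat N 1"
  using mat_of_cols_carrier(1)[of N "[v]"] by auto

section \<open>Moments and their rates as linear images of \<theta>\<close>

context delay_system
begin

text \<open>The sizes of the blocks of \<open>\<theta>\<close> and, as \<open>ND\<close>, of \<open>\<theta>\<close> itself; sums associate to the right, like the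
  iterated \<open>@\<^sub>v\<close> in the definition of \<open>\<theta>\<close>.\<close>

abbreviation "D2 \<equiv> num_delays S * dim_n S"
abbreviation "D3 \<equiv> varkap_tot S * dim_n S"
abbreviation "D4 \<equiv> mu_tot S * dim_n S"
abbreviation "ND \<equiv> dim_n S + (num_delays S * dim_n S + (varkap_tot S * dim_n S + (mu_tot S * dim_n S + dim_q S)))"

lemma kap_tot_split: "kap_tot S = varkap_tot S + mu_tot S"
  by (simp add: kap_tot_def varkap_tot_def mu_tot_def kap_of_def varkap_of_def sum.distrib)

lemma beta_n: "beta S * k = k + (\<nu> * k + (varkap_tot S * k + mu_tot S * k))"
  by (simp add: beta_def kap_tot_split algebra_simps)

lemma diag_idx_carrier:
  assumes "\<And>i. i \<in> {1..\<nu>} \<Longrightarrow> A i \<in> carrier_mat (r i) (c i)"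
  shows "diag_idx S A \<in> carrier_mat (\<Sum>i=1..\<nu>. r i) (\<Sum>i=1..\<nu>. c i)"
  using diag_block_mat_carrier[of "idx S" A r c] assms unfolding diag_idx_def sum_list_idx by (simp only: set_idx)

lemma diag_idx_mult_vconcat:
  assumes "\<And>i. i \<in> {1..\<nu>} \<Longrightarrow> A i \<in> carrier_mat (r i) (c i)" "\<And>i. i \<in> {1..\<nu>} \<Longrightarrow> x i \<in> carrier_vec (c i)"
  shows "diag_idx S A *\<^sub>v vconcat (map x (idx S)) = vconcat (map (\<lambda>i. A i *\<^sub>v x i) (idx S))"
  unfolding diag_idx_def
proof (rule diag_block_mat_mult_vconcat)
  fix i assume "i \<in> set (idx S)"
  then have "i \<in> {1..\<nu>}" by (simp only: set_idx)
  then show "x i \<in> carrier_vec (dim_col (A i))" using assms by (metis carrier_matD(2))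
qed

lemma vconcat_idx_carrier:
  assumes "\<And>i. i \<in> {1..\<nu>} \<Longrightarrow> x i \<in> carrier_vec (k i)"
  shows "vconcat (map x (idx S)) \<in> carrier_vec (\<Sum>i=1..\<nu>. k i)"
  using vconcat_carrier[of "idx S" x k] assms unfolding sum_list_idx by (simp only: set_idx)

lemma vconcat_idx_carrier_const:
  assumes "\<And>i. i \<in> {1..\<nu>} \<Longrightarrow> x i \<in> carrier_vec c"
  shows "vconcat (map x (idx S)) \<in> carrier_vec (\<nu> * c)"
  using vconcat_idx_carrier[of x "\<lambda>_. c"] assms by (simp del: upt_Suc)

lemma vconcat_idx_scalar_prod:
  assumes "\<And>i. i \<in> {1..\<nu>} \<Longrightarrow> x i \<in> carrier_vec (k i)" "\<And>i. i \<in> {1..\<nu>} \<Longrightarrow> y i \<in> carrier_vec (k i)"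
  shows "vconcat (map x (idx S)) \<bullet> vconcat (map y (idx S)) = (\<Sum>i=1..\<nu>. x i \<bullet> y i)"
  unfolding sum_list_idx[symmetric] by (rule vconcat_scalar_prod[where k = k]) (use assms in \<open>simp only: set_idx\<close>)

lemma vconcat_idx_cong:
  assumes "\<And>i. i \<in> {1..\<nu>} \<Longrightarrow> x i = y i"
  shows "vconcat (map x (idx S)) = vconcat (map y (idx S))"
proof -
  have "map x (idx S) = map y (idx S)" by (rule map_cong[OF refl]) (use assms in \<open>simp only: set_idx\<close>)
  then show ?thesis by (simp only:)
qed

lemma slice_moments:
  assumes j: "j < n"
  shows "slice n j (moments S N g e t) = vconcat (map (\<lambda>i. slice n j (moment_block S (N i) (g i) e t i)) (idx S))"
  unfolding moments_def by (rule slice_vconcat[OF _ j, where k = N]) (simp add: moment_block_def vec_integral_def)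

lemma slice_block_carrier: "j < n \<Longrightarrow> slice n j (moment_block S N g e t i) \<in> carrier_vec N"
  by (rule slice_carrier) (simp_all add: moment_block_def vec_integral_def)

abbreviation "Ihat i \<equiv> mat_sqrt (mat_inv (matF S i)) * (0\<^sub>m (d_of S i) (del_of S i) @\<^sub>c 1\<^sub>m (d_of S i)) * mat_sqrt (matH S i)"
abbreviation "Mhat i \<equiv> mat_sqrt (mat_inv (matF S i)) * pM S i * mat_sqrt (matH S i)"

lemma Ihat_carrier: assumes i: "i \<in> {1..\<nu>}" shows "Ihat i \<in> carrier_mat (d_of S i) (varkap_of S i)"
proof -
  have "0\<^sub>m (d_of S i) (del_of S i) @\<^sub>c 1\<^sub>m (d_of S i) \<in> carrier_mat (d_of S i) (varkap_of S i)"
    using append_cols_carrier[of "0\<^sub>m (d_of S i) (del_of S i)" "d_of S i" "del_of S i" "1\<^sub>m (d_of S i)" "d_of S i"]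
    by (simp add: varkap_of_def add.commute)
  then show ?thesis using sqrt_carriers[OF i] by (intro mult_carrier_mat) auto
qed

lemma boldI_carrier: "boldI S \<in> carrier_mat (d_tot S * n) D3"
  unfolding boldI_def using kron_carrier[OF diag_idx_carrier[OF Ihat_carrier] one_carrier_mat[of n]]
  by (simp only: d_tot_def varkap_tot_def)

lemma moment_block_cong_kernel:
  assumes "\<And>\<tau>. \<tau> \<in> Iint S i \<Longrightarrow> g \<tau> = g' \<tau>"
  shows "moment_block S N g e t i = moment_block S N g' e t i"
  unfolding moment_block_def vec_integral_def
  by (intro eq_vecI) (auto intro!: Bochner_Integration.integral_cong simp: assms)

text \<open>Slicing by component removes the factor \<open>\<otimes>\<^sub>K 1\<^sub>m n\<close>,
  and blockwise \<open>nf_of_nh\<close> exchanges the kernels. Thus the \<open>f\<close>-moments in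
  the storage functional are a linear function of the \<open>h\<close>-moments contained in
  \<theta>.\<close>

lemma boldI_moments:
  assumes h: "history S e t"
  shows "boldI S *\<^sub>v moments S (varkap_of S) nh e t = moments S (d_of S) nf e t"
proof (rule eq_slicesI)
  have m: "moments S (varkap_of S) nh e t \<in> carrier_vec D3" using moments_carrier[of "varkap_of S"] by (simp add: varkap_tot_def)
  show "boldI S *\<^sub>v moments S (varkap_of S) nh e t \<in> carrier_vec (d_tot S * n)"
    using boldI_carrier m by (rule mult_mat_vec_carrier)
  show "moments S (d_of S) nf e t \<in> carrier_vec (d_tot S * n)" using moments_carrier[of "d_of S"] by (simp add: d_tot_def)
  fix j assume j: "j < n"
  have D: "diag_idx S Ihat \<in> carrier_mat (d_tot S) (varkap_tot S)"
    using diag_idx_carrier[OF Ihat_carrier] by (simp only: d_tot_def varkap_tot_def)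
  have "slice n j (boldI S *\<^sub>v moments S (varkap_of S) nh e t) = diag_idx S Ihat *\<^sub>v slice n j (moments S (varkap_of S) nh e t)"
    unfolding boldI_def by (rule slice_kron_mult_vec[OF D m j])
  also have "\<dots> = vconcat (map (\<lambda>i. Ihat i *\<^sub>v slice n j (moment_block S (varkap_of S i) (nh i) e t i)) (idx S))"
    unfolding slice_moments[OF j]
    by (rule diag_idx_mult_vconcat[where r = "d_of S" and c = "varkap_of S"]) (simp_all add: Ihat_carrier slice_block_carrier[OF j])
  also have "\<dots> = vconcat (map (\<lambda>i. slice n j (moment_block S (d_of S i) (nf i) e t i)) (idx S))"
  proof (rule vconcat_idx_cong)
    fix i assume i: "i \<in> {1..\<nu>}"
    have "moment_block S (d_of S i) (\<lambda>\<tau>. Ihat i *\<^sub>v nh i \<tau>) e t i = moment_block S (d_of S i) (nf i) e t i"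
      by (rule moment_block_cong_kernel) (rule nf_of_nh[OF i])
    then show "Ihat i *\<^sub>v slice n j (moment_block S (varkap_of S i) (nh i) e t i) = slice n j (moment_block S (d_of S i) (nf i) e t i)"
      by (simp only: mult_slice_moment_block[OF i normalized_L2(2)[OF i] h j Ihat_carrier[OF i]])
  qed
  also have "\<dots> = slice n j (moments S (d_of S) nf e t)" by (rule slice_moments[OF j, symmetric])
  finally show "slice n j (boldI S *\<^sub>v moments S (varkap_of S) nh e t) = slice n j (moments S (d_of S) nf e t)" .
qed

abbreviation "nf_right \<equiv> diag_idx S (\<lambda>i. col_mat (mat_sqrt (mat_inv (matF S i)) *\<^sub>v fun_f S i (- delay S (i - 1))))"
abbreviation "nf_left \<equiv> diag_idx S (\<lambda>i. col_mat (mat_sqrt (mat_inv (matF S i)) *\<^sub>v fun_f S i (- delay S i)))"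

lemma nf_endpoint_carrier:
  assumes i: "i \<in> {1..\<nu>}"
  shows "nf i (- delay S (i - 1)) \<in> carrier_vec (d_of S i)" "nf i (- delay S i) \<in> carrier_vec (d_of S i)"
  using L2_on_carrier[OF normalized_L2(1)[OF i]] Iint_endpoints[OF i] by auto

lemma nf_mats_carrier: "nf_right \<in> carrier_mat (d_tot S) \<nu>" "nf_left \<in> carrier_mat (d_tot S) \<nu>"
  "diag_idx S Mhat \<in> carrier_mat (d_tot S) (varkap_tot S)"
proof -
  have "nf_right \<in> carrier_mat (\<Sum>i=1..\<nu>. d_of S i) (\<Sum>i=1..\<nu>. 1)"
    by (rule diag_idx_carrier, rule col_mat_carrier) (use nf_endpoint_carrier in \<open>simp add: normalized_def\<close>)
  then show "nf_right \<in> carrier_mat (d_tot S) \<nu>" by (simp add: d_tot_def)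
  have "nf_left \<in> carrier_mat (\<Sum>i=1..\<nu>. d_of S i) (\<Sum>i=1..\<nu>. 1)"
    by (rule diag_idx_carrier, rule col_mat_carrier) (use nf_endpoint_carrier in \<open>simp add: normalized_def\<close>)
  then show "nf_left \<in> carrier_mat (d_tot S) \<nu>" by (simp add: d_tot_def)
  show "diag_idx S Mhat \<in> carrier_mat (d_tot S) (varkap_tot S)"
    using diag_idx_carrier[OF Dnf_carrier] by (simp only: d_tot_def varkap_tot_def)
qed

lemma boldM_parts_carrier:
  "nf_right @\<^sub>c 0\<^sub>m (d_tot S) 1 @\<^sub>c 0\<^sub>m (d_tot S) (varkap_tot S) \<in> carrier_mat (d_tot S) (\<nu> + (1 + varkap_tot S))"
  "0\<^sub>m (d_tot S) 1 @\<^sub>c nf_left @\<^sub>c diag_idx S Mhat \<in> carrier_mat (d_tot S) (1 + (\<nu> + varkap_tot S))"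
  by (intro append_cols_carrier nf_mats_carrier zero_carrier_mat)+

lemma boldM_carrier: "boldM S \<in> carrier_mat (d_tot S) (1 + \<nu> + varkap_tot S)"
  unfolding boldM_def using boldM_parts_carrier(2) by (simp add: add_ac minus_carrier_mat)

text \<open>In each slice the columns of \<open>boldM\<close> pair off with the terms of the
  integration by parts: one group with the newer window ends, one with the older ends, and one with
  the moments of the derivative of the kernel.\<close>

lemma boldM_rate:
  assumes h: "history S e t"
  shows "(boldM S \<otimes>\<^sub>K 1\<^sub>m n) *\<^sub>v (e t @\<^sub>v vconcat (map (\<lambda>i. e (t - delay S i)) (idx S)) @\<^sub>v moments S (varkap_of S) nh e t)
    = vconcat (map (moment_rate e t) (idx S))"
proof (rule eq_slicesI)
  let ?m = "moments S (varkap_of S) nh e t"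
  let ?E = "vconcat (map (\<lambda>i. e (t - delay S i)) (idx S))"
  have ec: "e (t - delay S i) \<in> carrier_vec n" if "i \<le> \<nu>" for i by (rule history_carrier[OF h that])
  have m: "?m \<in> carrier_vec D3" using moments_carrier[of "varkap_of S"] by (simp add: varkap_tot_def)
  have E: "?E \<in> carrier_vec D2"
    using vconcat_idx_carrier_const[of "\<lambda>i. e (t - delay S i)" n] ec by (simp only: atLeastAtMost_iff)
  have e0: "e t \<in> carrier_vec (1 * n)" using history_carrier_0[OF h] by simp
  have Em: "?E @\<^sub>v ?m \<in> carrier_vec ((\<nu> + varkap_tot S) * n)" using E m by (simp add: add_mult_distrib)
  have v: "e t @\<^sub>v ?E @\<^sub>v ?m \<in> carrier_vec ((1 + \<nu> + varkap_tot S) * n)"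
    using append_carrier_vec[OF e0 Em] by (simp add: add_mult_distrib add_ac)
  show "(boldM S \<otimes>\<^sub>K 1\<^sub>m n) *\<^sub>v (e t @\<^sub>v ?E @\<^sub>v ?m) \<in> carrier_vec (d_tot S * n)"
    by (rule mult_mat_vec_carrier[OF kron_carrier[OF boldM_carrier one_carrier_mat] v])
  show "vconcat (map (moment_rate e t) (idx S)) \<in> carrier_vec (d_tot S * n)"
    using vconcat_idx_carrier[of "moment_rate e t" "\<lambda>i. d_of S i * n"] by (simp add: moment_rate_def d_tot_def sum_distrib_right)
  fix j assume j: "j < n"
  define s where "s i = slice n j (e (t - delay S i))" for i
  define \<xi> where "\<xi> i = slice n j (moment_block S (varkap_of S i) (nh i) e t i)" for i
  have sc: "s i \<in> carrier_vec 1" if "i \<le> \<nu>" for i unfolding s_def by (rule slice_carrier[OF j]) (simp add: ec that)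
  have s0: "s i $ 0 = e (t - delay S i) $ j" if "i \<le> \<nu>" for i
    unfolding s_def using slice_index[of "e (t - delay S i)" 1 n j 0] ec[OF that] j by simp
  have \<xi>c: "\<xi> i \<in> carrier_vec (varkap_of S i)" for i unfolding \<xi>_def by (rule slice_block_carrier[OF j])
  have V\<xi>: "vconcat (map \<xi> (idx S)) \<in> carrier_vec (varkap_tot S)"
    using vconcat_idx_carrier[of \<xi> "varkap_of S"] \<xi>c by (simp only: varkap_tot_def)
  have Vs: "vconcat (map s (idx S)) \<in> carrier_vec \<nu>" "vconcat (map (\<lambda>i. s (i - 1)) (idx S)) \<in> carrier_vec \<nu>"
    using vconcat_idx_carrier_const[of s 1] vconcat_idx_carrier_const[of "\<lambda>i. s (i - 1)" 1] sc
    by (simp_all only: atLeastAtMost_iff mult_1_right) (metis diff_le_self le_trans)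
  have "slice n j (e t @\<^sub>v ?E @\<^sub>v ?m) = s 0 @\<^sub>v vconcat (map s (idx S)) @\<^sub>v vconcat (map \<xi> (idx S))"
  proof -
    have "slice n j (e t @\<^sub>v ?E @\<^sub>v ?m) = slice n j (e t) @\<^sub>v slice n j (?E @\<^sub>v ?m)" by (rule slice_append[OF e0 Em j])
    also have "slice n j (?E @\<^sub>v ?m) = slice n j ?E @\<^sub>v slice n j ?m" by (rule slice_append[OF E m j])
    also have "slice n j ?E = vconcat (map s (idx S))" unfolding s_def
      by (rule slice_vconcat[OF _ j, of _ _ "\<lambda>_. 1"]) (use ec in \<open>simp only: set_idx atLeastAtMost_iff mult_1\<close>)
    also have "slice n j ?m = vconcat (map \<xi> (idx S))" unfolding \<xi>_def by (rule slice_moments[OF j])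
    also have "slice n j (e t) = s 0" by (simp add: s_def delay_0)
    finally show ?thesis .
  qed
  then have sl: "slice n j ((boldM S \<otimes>\<^sub>K 1\<^sub>m n) *\<^sub>v (e t @\<^sub>v ?E @\<^sub>v ?m))
      = boldM S *\<^sub>v (s 0 @\<^sub>v vconcat (map s (idx S)) @\<^sub>v vconcat (map \<xi> (idx S)))"
    by (simp only: slice_kron_mult_vec[OF boldM_carrier v j])
  \<comment> \<open>The first part of \<open>boldM\<close> has its zero column after the
    \<open>\<nu>\<close> delay columns, the second part before them; the same stacked vector is
    therefore also grouped as all samples but the last, followed by the last.\<close>
  have shift: "s 0 @\<^sub>v vconcat (map s (idx S)) @\<^sub>v vconcat (map \<xi> (idx S))
      = vconcat (map (\<lambda>i. s (i - 1)) (idx S)) @\<^sub>v s \<nu> @\<^sub>v vconcat (map \<xi> (idx S))"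
    using vconcat_shift[of \<nu> s 1] sc by (simp only: append_vec_assoc[symmetric])
  \<comment> \<open>The contribution of window \<open>i\<close> is \<open>a i - (b i + c i)\<close>:
    newer end, older end, distributed part.\<close>
  define a where "a i = s (i - 1) $ 0 \<cdot>\<^sub>v nf i (- delay S (i - 1))" for i
  define b where "b i = s i $ 0 \<cdot>\<^sub>v nf i (- delay S i)" for i
  define c where "c i = Mhat i *\<^sub>v \<xi> i" for i
  have abc: "a i \<in> carrier_vec (d_of S i)" "b i \<in> carrier_vec (d_of S i)" "c i \<in> carrier_vec (d_of S i)" if i: "i \<in> {1..\<nu>}" for i
    using nf_endpoint_carrier[OF i] mult_mat_vec_carrier[OF Dnf_carrier[OF i] \<xi>c] by (auto simp: a_def b_def c_def)
  have Vabc: "vconcat (map a (idx S)) \<in> carrier_vec (d_tot S)" "vconcat (map b (idx S)) \<in> carrier_vec (d_tot S)"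
    "vconcat (map c (idx S)) \<in> carrier_vec (d_tot S)"
    unfolding d_tot_def by (intro vconcat_idx_carrier abc; assumption)+
  have R1: "nf_right *\<^sub>v vconcat (map (\<lambda>i. s (i - 1)) (idx S)) = vconcat (map a (idx S))"
  proof (subst diag_idx_mult_vconcat[where r = "d_of S" and c = "\<lambda>_. 1"])
    fix i assume i: "i \<in> {1..\<nu>}"
    show "col_mat (mat_sqrt (mat_inv (matF S i)) *\<^sub>v fun_f S i (- delay S (i - 1))) \<in> carrier_mat (d_of S i) 1"
      using col_mat_carrier[OF nf_endpoint_carrier(1)[OF i]] by (simp add: normalized_def)
    show "s (i - 1) \<in> carrier_vec 1" using sc[of "i - 1"] i by auto
  next
    show "vconcat (map (\<lambda>i. col_mat (mat_sqrt (mat_inv (matF S i)) *\<^sub>v fun_f S i (- delay S (i - 1))) *\<^sub>v s (i - 1)) (idx S)) = vconcat (map a (idx S))"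
    proof (rule vconcat_idx_cong)
      fix i assume i: "i \<in> {1..\<nu>}"
      then have "s (i - 1) \<in> carrier_vec 1" using sc[of "i - 1"] by auto
      from col_mat_mult_vec[OF nf_endpoint_carrier(1)[OF i] this]
      show "col_mat (mat_sqrt (mat_inv (matF S i)) *\<^sub>v fun_f S i (- delay S (i - 1))) *\<^sub>v s (i - 1) = a i"
        by (simp add: a_def normalized_def)
    qed
  qed
  have R2: "nf_left *\<^sub>v vconcat (map s (idx S)) = vconcat (map b (idx S))"
  proof (subst diag_idx_mult_vconcat[where r = "d_of S" and c = "\<lambda>_. 1"])
    fix i assume i: "i \<in> {1..\<nu>}"
    show "col_mat (mat_sqrt (mat_inv (matF S i)) *\<^sub>v fun_f S i (- delay S i)) \<in> carrier_mat (d_of S i) 1"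
      using col_mat_carrier[OF nf_endpoint_carrier(2)[OF i]] by (simp add: normalized_def)
    show "s i \<in> carrier_vec 1" using sc i by simp
  next
    show "vconcat (map (\<lambda>i. col_mat (mat_sqrt (mat_inv (matF S i)) *\<^sub>v fun_f S i (- delay S i)) *\<^sub>v s i) (idx S)) = vconcat (map b (idx S))"
    proof (rule vconcat_idx_cong)
      fix i assume i: "i \<in> {1..\<nu>}"
      then have "s i \<in> carrier_vec 1" using sc by simp
      from col_mat_mult_vec[OF nf_endpoint_carrier(2)[OF i] this]
      show "col_mat (mat_sqrt (mat_inv (matF S i)) *\<^sub>v fun_f S i (- delay S i)) *\<^sub>v s i = b i"
        by (simp add: b_def normalized_def)
    qed
  qed
  have R3: "diag_idx S Mhat *\<^sub>v vconcat (map \<xi> (idx S)) = vconcat (map c (idx S))"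
    unfolding c_def by (rule diag_idx_mult_vconcat[where r = "d_of S" and c = "varkap_of S"]) (simp_all add: Dnf_carrier \<xi>c)
  have z: "0\<^sub>m (d_tot S) 1 *\<^sub>v s i = 0\<^sub>v (d_tot S)" if "i \<le> \<nu>" for i by (rule zero_mat_mult_vec[OF sc[OF that]])
  have z': "0\<^sub>m (d_tot S) (varkap_tot S) *\<^sub>v vconcat (map \<xi> (idx S)) = 0\<^sub>v (d_tot S)" by (rule zero_mat_mult_vec[OF V\<xi>])
  have A: "(nf_right @\<^sub>c 0\<^sub>m (d_tot S) 1 @\<^sub>c 0\<^sub>m (d_tot S) (varkap_tot S)) *\<^sub>v (vconcat (map (\<lambda>i. s (i - 1)) (idx S)) @\<^sub>v s \<nu> @\<^sub>v vconcat (map \<xi> (idx S)))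
    = vconcat (map a (idx S))"
    using Vabc(1) by (subst append_cols_mult_vec[OF nf_mats_carrier(1) append_cols_carrier[OF zero_carrier_mat zero_carrier_mat] Vs(2) append_carrier_vec[OF sc V\<xi>]];
        simp only: append_cols_mult_vec[OF zero_carrier_mat zero_carrier_mat sc V\<xi>] R1 z z' order_refl right_zero_vec zero_carrier_vec)
  have B: "(0\<^sub>m (d_tot S) 1 @\<^sub>c nf_left @\<^sub>c diag_idx S Mhat) *\<^sub>v (s 0 @\<^sub>v vconcat (map s (idx S)) @\<^sub>v vconcat (map \<xi> (idx S)))
    = vconcat (map b (idx S)) + vconcat (map c (idx S))"
    using Vabc by (subst append_cols_mult_vec[OF zero_carrier_mat append_cols_carrier[OF nf_mats_carrier(2,3)] sc append_carrier_vec[OF Vs(1) V\<xi>]];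
        simp only: append_cols_mult_vec[OF nf_mats_carrier(2,3) Vs(1) V\<xi>] R2 R3 z le0 left_zero_vec add_carrier_vec)
  have dims: "s 0 @\<^sub>v vconcat (map s (idx S)) @\<^sub>v vconcat (map \<xi> (idx S)) \<in> carrier_vec (1 + (\<nu> + varkap_tot S))"
    by (intro append_carrier_vec sc Vs V\<xi>) simp
  have parts: "nf_right @\<^sub>c 0\<^sub>m (d_tot S) 1 @\<^sub>c 0\<^sub>m (d_tot S) (varkap_tot S) \<in> carrier_mat (d_tot S) (1 + (\<nu> + varkap_tot S))"
    using boldM_parts_carrier(1) by (simp add: add_ac)
  have "boldM S *\<^sub>v (s 0 @\<^sub>v vconcat (map s (idx S)) @\<^sub>v vconcat (map \<xi> (idx S)))
      = vconcat (map a (idx S)) - (vconcat (map b (idx S)) + vconcat (map c (idx S)))"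
    unfolding boldM_def minus_mult_distrib_mat_vec[OF parts boldM_parts_carrier(2) dims] B
    by (simp only: shift A)
  also have "\<dots> = vconcat (map (\<lambda>i. a i - (b i + c i)) (idx S))"
    by (subst vconcat_add[where k = "d_of S"], use abc set_idx in metis, rule vconcat_minus[where k = "d_of S"])
      (use abc add_carrier_vec set_idx in metis)
  also have "\<dots> = vconcat (map (\<lambda>i. slice n j (moment_rate e t i)) (idx S))"
  proof (rule vconcat_idx_cong)
    fix i assume i: "i \<in> {1..\<nu>}"
    have i': "i \<le> \<nu>" "i - 1 \<le> \<nu>" using i by auto
    have mr: "moment_rate e t i \<in> carrier_vec (d_of S i * n)" by (simp add: moment_rate_def)
    have ci: "c i = vec (d_of S i) (\<lambda>p. LINT \<tau>|lebesgue_on (Iint S i). Dnf i \<tau> $ p * e (t + \<tau>) $ j)"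
      unfolding c_def \<xi>_def mult_slice_moment_block[OF i normalized_L2(2)[OF i] h j Dnf_carrier[OF i]]
      by (rule slice_moment_block[OF i Dnf_L2[OF i] h j])
    show "a i - (b i + c i) = slice n j (moment_rate e t i)"
    proof (rule eq_vecI)
      show "dim_vec (a i - (b i + c i)) = dim_vec (slice n j (moment_rate e t i))"
        using abc[OF i] slice_carrier[OF j mr] by simp
      fix p assume "p < dim_vec (slice n j (moment_rate e t i))"
      then have p: "p < d_of S i" using slice_carrier[OF j mr] by simp
      have "slice n j (moment_rate e t i) $ p = moment_rate e t i $ (p * n + j)" by (rule slice_index[OF mr j p])
      also have "\<dots> = nf i (- delay S (i - 1)) $ p * e (t - delay S (i - 1)) $ j - nf i (- delay S i) $ p * e (t - delay S i) $ j - c i $ p"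
        using block_index_less[OF p j] j p by (simp add: moment_rate_def ci)
      also have "\<dots> = (a i - (b i + c i)) $ p"
        using abc[OF i] p nf_endpoint_carrier[OF i] s0[OF i'(1)] s0[OF i'(2)]
        by (simp add: a_def b_def mult.commute)
      finally show "(a i - (b i + c i)) $ p = slice n j (moment_rate e t i) $ p" by simp
    qed
  qed
  also have "\<dots> = slice n j (vconcat (map (moment_rate e t) (idx S)))"
    by (rule slice_vconcat[OF _ j, symmetric, where k = "d_of S"]) (simp add: moment_rate_def)
  finally show "slice n j ((boldM S \<otimes>\<^sub>K 1\<^sub>m n) *\<^sub>v (e t @\<^sub>v ?E @\<^sub>v ?m)) = slice n j (vconcat (map (moment_rate e t) (idx S)))"
    by (simp only: sl)
qed

end

lemma row5_mult_vec:
  assumes "A1 \<in> carrier_mat r k1" "A2 \<in> carrier_mat r k2" "A3 \<in> carrier_mat r k3" "A4 \<in> carrier_mat r k4" "A5 \<in> carrier_mat r k5"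
    and "x1 \<in> carrier_vec k1" "x2 \<in> carrier_vec k2" "x3 \<in> carrier_vec k3" "x4 \<in> carrier_vec k4" "x5 \<in> carrier_vec k5"
  shows "(A1 @\<^sub>c A2 @\<^sub>c A3 @\<^sub>c A4 @\<^sub>c A5) *\<^sub>v (x1 @\<^sub>v x2 @\<^sub>v x3 @\<^sub>v x4 @\<^sub>v x5)
    = A1 *\<^sub>v x1 + (A2 *\<^sub>v x2 + (A3 *\<^sub>v x3 + (A4 *\<^sub>v x4 + A5 *\<^sub>v x5)))"
proof -
  note c = append_cols_carrier append_carrier_vec
  show ?thesis
    by (simp only: append_cols_mult_vec[OF assms(1) c(1)[OF assms(2) c(1)[OF assms(3) c(1)[OF assms(4,5)]]] assms(6) c(2)[OF assms(7) c(2)[OF assms(8) c(2)[OF assms(9,10)]]]]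
      append_cols_mult_vec[OF assms(2) c(1)[OF assms(3) c(1)[OF assms(4,5)]] assms(7) c(2)[OF assms(8) c(2)[OF assms(9,10)]]]
      append_cols_mult_vec[OF assms(3) c(1)[OF assms(4,5)] assms(8) c(2)[OF assms(9,10)]]
      append_cols_mult_vec[OF assms(4,5,9,10)])
qed

lemma diag_block_mat_Cons_form:
  assumes A: "A \<in> carrier_mat a a" and D: "diag_block_mat As \<in> carrier_mat b b"
    and x: "x \<in> carrier_vec a" and y: "y \<in> carrier_vec b"
  shows "(x @\<^sub>v y) \<bullet> (diag_block_mat (A # As) *\<^sub>v (x @\<^sub>v y)) = x \<bullet> (A *\<^sub>v x) + y \<bullet> (diag_block_mat As *\<^sub>v y)"
    and "diag_block_mat (A # As) \<in> carrier_mat (a + b) (a + b)"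
proof -
  show "diag_block_mat (A # As) \<in> carrier_mat (a + b) (a + b)"
    using A D by (auto simp: Let_def)
  have "diag_block_mat (A # As) *\<^sub>v (x @\<^sub>v y) = (A *\<^sub>v x) @\<^sub>v (diag_block_mat As *\<^sub>v y)"
    by (rule diag_block_mat_Cons_mult_vec) (use A D x y in auto)
  then show "(x @\<^sub>v y) \<bullet> (diag_block_mat (A # As) *\<^sub>v (x @\<^sub>v y)) = x \<bullet> (A *\<^sub>v x) + y \<bullet> (diag_block_mat As *\<^sub>v y)"
    by (simp only: scalar_prod_append[OF x y mult_mat_vec_carrier[OF A x] mult_mat_vec_carrier[OF D y]])
qed

lemma diag_block_mat_Cons_carrier:
  assumes "A \<in> carrier_mat a a" "diag_block_mat As \<in> carrier_mat b b"
  shows "diag_block_mat (A # As) \<in> carrier_mat (a + b) (a + b)"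
  using assms by (auto simp: Let_def)

context delay_system
begin

lemma ND_eq: "beta S * n + dim_q S = ND"
  by (simp add: beta_n)

lemma matT_carrier:
  assumes i: "i \<in> {1..\<nu>}"
  shows "matT S i \<in> carrier_mat (kap_of S i) (varkap_of S i)" "matTt S i \<in> carrier_mat (kap_of S i) (mu_of S i)"
proof -
  have k: "kap_of S i = mu_of S i + varkap_of S i" by (simp add: kap_of_def varkap_of_def)
  show "matT S i \<in> carrier_mat (kap_of S i) (varkap_of S i)" unfolding matT_def k
    by (intro carrier_append_rows mult_carrier_mat[OF matrix_carriers(3)[OF i]] sqrt_carriers[OF i])
  show "matTt S i \<in> carrier_mat (kap_of S i) (mu_of S i)" unfolding matTt_def k
    by (intro carrier_append_rows zero_carrier_mat sqrt_carriers[OF i])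
qed

lemma hconcat_idx_carrier:
  assumes "\<And>i. i \<in> {1..\<nu>} \<Longrightarrow> X i \<in> carrier_mat r (c i)"
  shows "hconcat r (map X (idx S)) \<in> carrier_mat r (\<Sum>i=1..\<nu>. c i)"
  using hconcat_carrier[of "idx S" X r c] assms unfolding sum_list_idx by (simp only: set_idx)

lemma coeff_row_carrier:
  assumes X: "\<And>i. i \<in> {0..\<nu>} \<Longrightarrow> X i \<in> carrier_mat r k" and Xh: "\<And>i. i \<in> {1..\<nu>} \<Longrightarrow> Xh i \<in> carrier_mat r (kap_of S i * k)"
    and D: "D \<in> carrier_mat r (dim_q S)"
  shows "coeff_row S r k X Xh D \<in> carrier_mat r (k + (\<nu> * k + (varkap_tot S * k + (mu_tot S * k + dim_q S))))"
proof -
  have 1: "hconcat r (map X (idx S)) \<in> carrier_mat r (\<nu> * k)"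
    using hconcat_idx_carrier[of X r "\<lambda>_. k"] X by (simp del: upt_Suc)
  have 2: "hconcat r (map (\<lambda>i. Xh i * (matT S i \<otimes>\<^sub>K 1\<^sub>m k)) (idx S)) \<in> carrier_mat r (varkap_tot S * k)"
    unfolding varkap_tot_def sum_distrib_right
    by (intro hconcat_idx_carrier mult_carrier_mat[OF Xh] kron_carrier matT_carrier one_carrier_mat)
  have 3: "hconcat r (map (\<lambda>i. Xh i * (matTt S i \<otimes>\<^sub>K 1\<^sub>m k)) (idx S)) \<in> carrier_mat r (mu_tot S * k)"
    unfolding mu_tot_def sum_distrib_right
    by (intro hconcat_idx_carrier mult_carrier_mat[OF Xh] kron_carrier matT_carrier one_carrier_mat)
  show ?thesis unfolding coeff_row_def by (intro append_cols_carrier 1 2 3 D X) simp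
qed

lemma obs_map_carrier: "obs_map S \<in> carrier_mat (beta S * dim_l S + dim_q S) ND"
proof -
  have "pObs S \<in> carrier_mat (dim_l S) n" using admissible by (simp add: admissible_plant_def)
  from kron_carrier[OF one_carrier_mat this, of "beta S"] show ?thesis
    unfolding obs_map_def ND_eq[symmetric] by (auto simp: Let_def)
qed

lemma selS_carrier: "selS S \<in> carrier_mat (n + d_tot S * n) ND"
  unfolding selS_def Let_def
  by (intro carrier_append_rows append_cols_carrier boldI_carrier one_carrier_mat zero_carrier_mat)

lemma selS_mult_vec:
  assumes x: "x1 \<in> carrier_vec n" "x2 \<in> carrier_vec D2" "x3 \<in> carrier_vec D3" "x4 \<in> carrier_vec D4" "x5 \<in> carrier_vec (dim_q S)"
  shows "selS S *\<^sub>v (x1 @\<^sub>v x2 @\<^sub>v x3 @\<^sub>v x4 @\<^sub>v x5) = x1 @\<^sub>v (boldI S *\<^sub>v x3)"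
proof -
  let ?dn = "d_tot S * n"
  have I: "boldI S *\<^sub>v x3 \<in> carrier_vec ?dn" by (rule mult_mat_vec_carrier[OF boldI_carrier x(3)])
  have X: "x1 @\<^sub>v x2 @\<^sub>v x3 @\<^sub>v x4 @\<^sub>v x5 \<in> carrier_vec ND" by (intro append_carrier_vec x)
  note row = row5_mult_vec[OF _ _ _ _ _ x]
  have c: "1\<^sub>m n @\<^sub>c 0\<^sub>m n D2 @\<^sub>c 0\<^sub>m n D3 @\<^sub>c 0\<^sub>m n D4 @\<^sub>c 0\<^sub>m n (dim_q S) \<in> carrier_mat n ND"
    "0\<^sub>m ?dn n @\<^sub>c 0\<^sub>m ?dn D2 @\<^sub>c boldI S @\<^sub>c 0\<^sub>m ?dn D4 @\<^sub>c 0\<^sub>m ?dn (dim_q S) \<in> carrier_mat ?dn ND"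
    by (intro append_cols_carrier boldI_carrier one_carrier_mat zero_carrier_mat)+
  have "selS S *\<^sub>v (x1 @\<^sub>v x2 @\<^sub>v x3 @\<^sub>v x4 @\<^sub>v x5)
    = (1\<^sub>m n *\<^sub>v x1 + (0\<^sub>m n D2 *\<^sub>v x2 + (0\<^sub>m n D3 *\<^sub>v x3 + (0\<^sub>m n D4 *\<^sub>v x4 + 0\<^sub>m n (dim_q S) *\<^sub>v x5))))
      @\<^sub>v (0\<^sub>m ?dn n *\<^sub>v x1 + (0\<^sub>m ?dn D2 *\<^sub>v x2 + (boldI S *\<^sub>v x3 + (0\<^sub>m ?dn D4 *\<^sub>v x4 + 0\<^sub>m ?dn (dim_q S) *\<^sub>v x5))))"
    unfolding selS_def Let_def
    by (simp only: mat_mult_append[OF c X] row[OF one_carrier_mat zero_carrier_mat zero_carrier_mat zero_carrier_mat zero_carrier_mat]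
        row[OF zero_carrier_mat zero_carrier_mat boldI_carrier zero_carrier_mat zero_carrier_mat])
  also have "\<dots> = x1 @\<^sub>v (boldI S *\<^sub>v x3)"
    using x I by (simp add: zero_mat_mult_vec[OF x(1)] zero_mat_mult_vec[OF x(2)] zero_mat_mult_vec[OF x(3)]
        zero_mat_mult_vec[OF x(4)] zero_mat_mult_vec[OF x(5)])
  finally show ?thesis .
qed

text \<open>The lower block row in \<open>Psi\<close>: applied to \<theta> it yields the rates of
  the \<open>f\<close>-moments.\<close>

definition Nmat :: "real mat"
  where "Nmat = (boldM S \<otimes>\<^sub>K 1\<^sub>m n) @\<^sub>c 0\<^sub>m (d_tot S * n) (mu_tot S * n + dim_q S)"

lemma boldM_kron_carrier: "boldM S \<otimes>\<^sub>K 1\<^sub>m n \<in> carrier_mat (d_tot S * n) (n + (D2 + D3))"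
  using kron_carrier[OF boldM_carrier one_carrier_mat[of n]] by (simp add: algebra_simps)

lemma Nmat_carrier: "Nmat \<in> carrier_mat (d_tot S * n) ND"
proof -
  have "n + (D2 + D3) + (D4 + dim_q S) = ND" by simp
  then show ?thesis unfolding Nmat_def
    using append_cols_carrier[OF boldM_kron_carrier zero_carrier_mat[of "d_tot S * n" "D4 + dim_q S"]] by (simp only:)
qed

lemma Nmat_mult_vec:
  assumes x: "x1 \<in> carrier_vec n" "x2 \<in> carrier_vec D2" "x3 \<in> carrier_vec D3" "x4 \<in> carrier_vec D4" "x5 \<in> carrier_vec (dim_q S)"
  shows "Nmat *\<^sub>v (x1 @\<^sub>v x2 @\<^sub>v x3 @\<^sub>v x4 @\<^sub>v x5) = (boldM S \<otimes>\<^sub>K 1\<^sub>m n) *\<^sub>v (x1 @\<^sub>v x2 @\<^sub>v x3)"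
proof -
  have c: "x1 @\<^sub>v x2 @\<^sub>v x3 \<in> carrier_vec (n + (D2 + D3))" "x4 @\<^sub>v x5 \<in> carrier_vec (D4 + dim_q S)"
    by (intro append_carrier_vec x)+
  have "x1 @\<^sub>v x2 @\<^sub>v x3 @\<^sub>v x4 @\<^sub>v x5 = (x1 @\<^sub>v x2 @\<^sub>v x3) @\<^sub>v (x4 @\<^sub>v x5)" by (simp only: append_vec_assoc)
  then have "Nmat *\<^sub>v (x1 @\<^sub>v x2 @\<^sub>v x3 @\<^sub>v x4 @\<^sub>v x5)
      = (boldM S \<otimes>\<^sub>K 1\<^sub>m n) *\<^sub>v (x1 @\<^sub>v x2 @\<^sub>v x3) + 0\<^sub>m (d_tot S * n) (D4 + dim_q S) *\<^sub>v (x4 @\<^sub>v x5)"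
    unfolding Nmat_def by (simp only: append_cols_mult_vec[OF boldM_kron_carrier zero_carrier_mat c])
  then show ?thesis
    using mult_mat_vec_carrier[OF boldM_kron_carrier c(1)] by (simp add: zero_mat_mult_vec[OF c(2)])
qed

end

section \<open>Bilinear forms of the matrices in the inequality\<close>

locale lmi_data = lyapunov +
  fixes G :: gains and J :: supply_rate
  assumes gains: "admissible_gains S G" and rate: "admissible_supply S J"
begin

abbreviation "m \<equiv> dim_m S"
abbreviation "q \<equiv> dim_q S"

lemma Omega_carrier: "Omega S G \<in> carrier_mat n ND" and Sigma_carrier: "Sigma_mat S G \<in> carrier_mat m ND"
proof -
  have l: "dim_l S + (\<nu> * dim_l S + (varkap_tot S * dim_l S + (mu_tot S * dim_l S + q))) = beta S * dim_l S + q"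
    by (simp add: beta_n)
  have A: "boldA S \<in> carrier_mat n ND" "boldC S \<in> carrier_mat m ND"
    unfolding boldA_def boldC_def
    by (intro coeff_row_carrier minus_carrier_mat; use admissible in \<open>simp add: admissible_plant_def\<close>)+
  have "boldL1 S G \<in> carrier_mat n (beta S * dim_l S + q)" "boldL2 S G \<in> carrier_mat m (beta S * dim_l S + q)"
    unfolding boldL1_def boldL2_def l[symmetric]
    by (intro coeff_row_carrier zero_carrier_mat; use gains in \<open>simp add: admissible_gains_def\<close>)+
  then show "Omega S G \<in> carrier_mat n ND" "Sigma_mat S G \<in> carrier_mat m ND"
    unfolding Omega_def Sigma_mat_def using A obs_map_carrier by (auto intro!: add_carrier_mat mult_carrier_mat)
qed

lemma J_carriers:
  "sJ1 J \<in> carrier_mat m m" "(sJ1 J)\<^sup>\<top> = sJ1 J" "sJt J \<in> carrier_mat m m" "sJ2 J \<in> carrier_mat m q"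
  "sJ3 J \<in> carrier_mat q q" "(sJ2 J)\<^sup>\<top> \<in> carrier_mat q m"
  using rate by (auto simp: admissible_supply_def sym_mats_def)

text \<open>\<open>mat_inv\<close> takes \<open>the\<close> of an option, so
  \<open>invertible_mat\<close> is first turned into a unit of the matrix ring, for which
  \<open>mat_inverse\<close> succeeds.\<close>

lemma J1_inv: "mat_inv (sJ1 J) \<in> carrier_mat m m" "sJ1 J * mat_inv (sJ1 J) = 1\<^sub>m m" "(mat_inv (sJ1 J))\<^sup>\<top> = mat_inv (sJ1 J)"
proof -
  have "invertible_mat (sJ1 J)" "neg_def (mat_inv (sJ1 J))" using rate by (auto simp: admissible_supply_def)
  then obtain B where "inverts_mat (sJ1 J) B" "inverts_mat B (sJ1 J)" by (auto simp: invertible_mat_def)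
  then have B: "sJ1 J * B = 1\<^sub>m m" "B * sJ1 J = 1\<^sub>m (dim_row B)" using J_carriers(1) by (auto simp: inverts_mat_def)
  have "dim_row B = m" using arg_cong[OF B(2), of dim_col] J_carriers(1) by simp
  moreover have "dim_col B = m" using arg_cong[OF B(1), of dim_col] by simp
  ultimately have "B \<in> carrier_mat m m" "B * sJ1 J = 1\<^sub>m m" using B(2) by auto
  then have "sJ1 J \<in> Units (ring_mat TYPE(real) m ())"
    using B(1) J_carriers(1) by (auto simp: Units_def ring_mat_simps)
  then obtain C where C: "mat_inverse (sJ1 J) = Some C" using mat_inverse(1)[OF J_carriers(1), where b = "()"]
    by (cases "mat_inverse (sJ1 J)") auto
  from mat_inverse(2)[OF J_carriers(1) C] show "mat_inv (sJ1 J) \<in> carrier_mat m m" "sJ1 J * mat_inv (sJ1 J) = 1\<^sub>m m"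
    using C by auto
  show "(mat_inv (sJ1 J))\<^sup>\<top> = mat_inv (sJ1 J)"
    using \<open>neg_def (mat_inv (sJ1 J))\<close> by (auto simp: neg_def_def sym_mats_def)
qed

lemma Xi_parts_carrier:
  "diag_block_mat [diag_idx S Q + diag_idx S R * Lambda S, 0\<^sub>m n n, 0\<^sub>m (kap_tot S * n) (kap_tot S * n), 0\<^sub>m q q] \<in> carrier_mat ND ND"
  "diag_block_mat [0\<^sub>m n n, diag_idx S Q, diag_idx S (\<lambda>i. 1\<^sub>m (varkap_of S i) \<otimes>\<^sub>K R i),
        diag_idx S (\<lambda>i. 1\<^sub>m (mu_of S i) \<otimes>\<^sub>K R i), sJ3 J] \<in> carrier_mat ND ND"
  "diag_idx S Q + diag_idx S R * Lambda S \<in> carrier_mat D2 D2" "diag_idx S Q \<in> carrier_mat D2 D2"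
  "diag_idx S (\<lambda>i. 1\<^sub>m (varkap_of S i) \<otimes>\<^sub>K R i) \<in> carrier_mat D3 D3" "diag_idx S (\<lambda>i. 1\<^sub>m (mu_of S i) \<otimes>\<^sub>K R i) \<in> carrier_mat D4 D4"
  "diag_idx S R \<in> carrier_mat D2 D2" "Lambda S \<in> carrier_mat D2 D2"
proof -
  have c: "diag_idx S M \<in> carrier_mat D2 D2" if "\<And>i. i \<in> {1..\<nu>} \<Longrightarrow> M i \<in> carrier_mat n n" for M
    using diag_idx_carrier[of M "\<lambda>_. n" "\<lambda>_. n"] that by simp
  show Qc: "diag_idx S Q \<in> carrier_mat D2 D2" and Rc: "diag_idx S R \<in> carrier_mat D2 D2"
    by (rule c, rule QR_carrier, assumption)+
  show Lc: "Lambda S \<in> carrier_mat D2 D2" unfolding Lambda_def by (rule c) simp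
  then show QR: "diag_idx S Q + diag_idx S R * Lambda S \<in> carrier_mat D2 D2" using Qc Rc by simp
  show R3: "diag_idx S (\<lambda>i. 1\<^sub>m (varkap_of S i) \<otimes>\<^sub>K R i) \<in> carrier_mat D3 D3"
    unfolding varkap_tot_def sum_distrib_right by (intro diag_idx_carrier kron_carrier one_carrier_mat QR_carrier)
  show R4: "diag_idx S (\<lambda>i. 1\<^sub>m (mu_of S i) \<otimes>\<^sub>K R i) \<in> carrier_mat D4 D4"
    unfolding mu_tot_def sum_distrib_right by (intro diag_idx_carrier kron_carrier one_carrier_mat QR_carrier)
  have dims: "ND = D2 + (n + (kap_tot S * n + q))" by (simp add: kap_tot_split algebra_simps)
  show "diag_block_mat [diag_idx S Q + diag_idx S R * Lambda S, 0\<^sub>m n n, 0\<^sub>m (kap_tot S * n) (kap_tot S * n), 0\<^sub>m q q] \<in> carrier_mat ND ND"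
    unfolding dims
    by (rule diag_block_mat_Cons_carrier[OF QR diag_block_mat_Cons_carrier[OF zero_carrier_mat
      diag_block_mat_Cons_carrier[OF zero_carrier_mat]]]) (simp only: diag_block_mat_singleton zero_carrier_mat)
  show "diag_block_mat [0\<^sub>m n n, diag_idx S Q, diag_idx S (\<lambda>i. 1\<^sub>m (varkap_of S i) \<otimes>\<^sub>K R i),
        diag_idx S (\<lambda>i. 1\<^sub>m (mu_of S i) \<otimes>\<^sub>K R i), sJ3 J] \<in> carrier_mat ND ND"
    by (rule diag_block_mat_Cons_carrier[OF zero_carrier_mat diag_block_mat_Cons_carrier[OF Qc
      diag_block_mat_Cons_carrier[OF R3 diag_block_mat_Cons_carrier[OF R4]]]])
      (simp only: diag_block_mat_singleton J_carriers)
qed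

lemma Xi_carrier: "Xi S J Q R \<in> carrier_mat ND ND"
  unfolding Xi_def Let_def using Xi_parts_carrier(2) by (rule minus_carrier_mat)

text \<open>The bilinear form that appears, symmetrised, on both sides of the matrix identity.\<close>

definition half_form :: "real vec \<Rightarrow> real vec \<Rightarrow> real vec \<Rightarrow> real vec \<Rightarrow> real"
  where "half_form u1 u3 u5 x = (u1 @\<^sub>v (boldI S *\<^sub>v u3)) \<bullet> (Pm *\<^sub>v ((Omega S G *\<^sub>v x) @\<^sub>v (Nmat *\<^sub>v x)))
    - u5 \<bullet> ((sJ2 J)\<^sup>\<top> *\<^sub>v (Sigma_mat S G *\<^sub>v x))"

abbreviation "Ymat \<equiv> Omega S G @\<^sub>r Nmat"
abbreviation "Zmat \<equiv> 0\<^sub>m (beta S * n) m @\<^sub>r (sJ2 J)\<^sup>\<top>"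
abbreviation "Xmat \<equiv> (selS S)\<^sup>\<top> * Pm * Ymat - Zmat * Sigma_mat S G"

lemma XYZ_carrier: "Ymat \<in> carrier_mat (n + dn) ND" "Zmat \<in> carrier_mat ND m" "Xmat \<in> carrier_mat ND ND"
  "(selS S)\<^sup>\<top> * Pm * Ymat \<in> carrier_mat ND ND" "Zmat * Sigma_mat S G \<in> carrier_mat ND ND"
proof -
  show Y: "Ymat \<in> carrier_mat (n + dn) ND" by (intro carrier_append_rows Omega_carrier Nmat_carrier)
  show Z: "Zmat \<in> carrier_mat ND m" unfolding ND_eq[symmetric] by (intro carrier_append_rows zero_carrier_mat J_carriers)
  have "(selS S)\<^sup>\<top> \<in> carrier_mat ND (n + dn)" using selS_carrier by simp
  then show SP: "(selS S)\<^sup>\<top> * Pm * Ymat \<in> carrier_mat ND ND" using Pm_carrier Y by (intro mult_carrier_mat)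
  show ZS: "Zmat * Sigma_mat S G \<in> carrier_mat ND ND" using Z Sigma_carrier by (rule mult_carrier_mat)
  then show "Xmat \<in> carrier_mat ND ND" by (rule minus_carrier_mat)
qed

lemma Psi_eq: "Psi S G J Q R P1 P2 P3 = Sy Xmat + Xi S J Q R"
  unfolding Psi_def Let_def Pm_def Nmat_def by (rule refl)

lemma Psi_carrier: "Psi S G J Q R P1 P2 P3 \<in> carrier_mat ND ND"
  unfolding Psi_eq by (intro add_carrier_mat Xi_carrier Sy_carrier XYZ_carrier)

lemma Xmat_form:
  assumes u: "u1 \<in> carrier_vec n" "u2 \<in> carrier_vec D2" "u3 \<in> carrier_vec D3" "u4 \<in> carrier_vec D4" "u5 \<in> carrier_vec q"
    and x: "x \<in> carrier_vec ND"
  shows "(u1 @\<^sub>v u2 @\<^sub>v u3 @\<^sub>v u4 @\<^sub>v u5) \<bullet> (Xmat *\<^sub>v x) = half_form u1 u3 u5 x"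
proof -
  let ?u = "u1 @\<^sub>v u2 @\<^sub>v u3 @\<^sub>v u4 @\<^sub>v u5"
  have U: "?u \<in> carrier_vec ND" by (intro append_carrier_vec u)
  have Ox: "Omega S G *\<^sub>v x \<in> carrier_vec n" "Nmat *\<^sub>v x \<in> carrier_vec dn" "Sigma_mat S G *\<^sub>v x \<in> carrier_vec m"
    using mult_mat_vec_carrier[OF Omega_carrier x] mult_mat_vec_carrier[OF Nmat_carrier x] mult_mat_vec_carrier[OF Sigma_carrier x] .
  have Yx: "Ymat *\<^sub>v x = (Omega S G *\<^sub>v x) @\<^sub>v (Nmat *\<^sub>v x)"
    by (rule mat_mult_append[OF Omega_carrier Nmat_carrier x])
  have Yxc: "Ymat *\<^sub>v x \<in> carrier_vec (n + dn)" by (rule mult_mat_vec_carrier[OF XYZ_carrier(1) x])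
  have St: "(selS S)\<^sup>\<top> \<in> carrier_mat ND (n + dn)" using selS_carrier by simp
  have PY: "Pm *\<^sub>v (Ymat *\<^sub>v x) \<in> carrier_vec (n + dn)" by (rule mult_mat_vec_carrier[OF Pm_carrier Yxc])
  have 1: "?u \<bullet> (((selS S)\<^sup>\<top> * Pm * Ymat) *\<^sub>v x) = (selS S *\<^sub>v ?u) \<bullet> (Pm *\<^sub>v (Ymat *\<^sub>v x))"
  proof -
    have "((selS S)\<^sup>\<top> * Pm * Ymat) *\<^sub>v x = (selS S)\<^sup>\<top> *\<^sub>v (Pm *\<^sub>v (Ymat *\<^sub>v x))"
      by (simp only: assoc_mult_mat_vec[OF mult_carrier_mat[OF St Pm_carrier] XYZ_carrier(1) x]
          assoc_mult_mat_vec[OF St Pm_carrier Yxc])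
    moreover have "?u \<bullet> ((selS S)\<^sup>\<top> *\<^sub>v (Pm *\<^sub>v (Ymat *\<^sub>v x))) = (((selS S)\<^sup>\<top>)\<^sup>\<top> *\<^sub>v ?u) \<bullet> (Pm *\<^sub>v (Ymat *\<^sub>v x))"
      by (rule transpose_scalar_prod[OF St U PY, symmetric])
    ultimately show ?thesis by simp
  qed
  have b: "u1 @\<^sub>v u2 @\<^sub>v u3 @\<^sub>v u4 \<in> carrier_vec (beta S * n)" unfolding beta_n by (intro append_carrier_vec u)
  have "(Zmat * Sigma_mat S G) *\<^sub>v x = 0\<^sub>v (beta S * n) @\<^sub>v ((sJ2 J)\<^sup>\<top> *\<^sub>v (Sigma_mat S G *\<^sub>v x))"
    by (simp only: assoc_mult_mat_vec[OF XYZ_carrier(2) Sigma_carrier x]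
        mat_mult_append[OF zero_carrier_mat J_carriers(6) Ox(3)] zero_mat_mult_vec[OF Ox(3)])
  moreover have "?u = (u1 @\<^sub>v u2 @\<^sub>v u3 @\<^sub>v u4) @\<^sub>v u5" by (simp only: append_vec_assoc)
  ultimately have 2: "?u \<bullet> ((Zmat * Sigma_mat S G) *\<^sub>v x) = u5 \<bullet> ((sJ2 J)\<^sup>\<top> *\<^sub>v (Sigma_mat S G *\<^sub>v x))"
    using b by (simp add: scalar_prod_append[OF b u(5) zero_carrier_vec mult_mat_vec_carrier[OF J_carriers(6) Ox(3)]] del: append_vec_assoc)
  have "Xmat *\<^sub>v x = ((selS S)\<^sup>\<top> * Pm * Ymat) *\<^sub>v x - (Zmat * Sigma_mat S G) *\<^sub>v x"
    by (rule minus_mult_distrib_mat_vec[OF XYZ_carrier(4,5) x])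
  then have "?u \<bullet> (Xmat *\<^sub>v x) = ?u \<bullet> (((selS S)\<^sup>\<top> * Pm * Ymat) *\<^sub>v x) - ?u \<bullet> ((Zmat * Sigma_mat S G) *\<^sub>v x)"
    by (simp only: scalar_prod_minus_distrib[OF U mult_mat_vec_carrier[OF XYZ_carrier(4) x] mult_mat_vec_carrier[OF XYZ_carrier(5) x]])
  then show ?thesis unfolding half_form_def 1 2 Yx selS_mult_vec[OF u] .
qed

text \<open>Two independent vectors are kept for the comparison of matrices; along a trajectory both
  become \<theta>.\<close>

lemma Psi_form:
  assumes u: "u1 \<in> carrier_vec n" "u2 \<in> carrier_vec D2" "u3 \<in> carrier_vec D3" "u4 \<in> carrier_vec D4" "u5 \<in> carrier_vec q"
    and x: "x1 \<in> carrier_vec n" "x2 \<in> carrier_vec D2" "x3 \<in> carrier_vec D3" "x4 \<in> carrier_vec D4" "x5 \<in> carrier_vec q"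
  defines "u \<equiv> u1 @\<^sub>v u2 @\<^sub>v u3 @\<^sub>v u4 @\<^sub>v u5" and "x \<equiv> x1 @\<^sub>v x2 @\<^sub>v x3 @\<^sub>v x4 @\<^sub>v x5"
  shows "u \<bullet> (Psi S G J Q R P1 P2 P3 *\<^sub>v x) = half_form u1 u3 u5 x + half_form x1 x3 x5 u + u \<bullet> (Xi S J Q R *\<^sub>v x)"
proof -
  have U: "u \<in> carrier_vec ND" and X: "x \<in> carrier_vec ND" unfolding u_def x_def by (intro append_carrier_vec u x)+
  note Sc = Sy_carrier[OF XYZ_carrier(3)]
  have "u \<bullet> (Psi S G J Q R P1 P2 P3 *\<^sub>v x) = u \<bullet> (Sy Xmat *\<^sub>v x) + u \<bullet> (Xi S J Q R *\<^sub>v x)"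
    unfolding Psi_eq add_mult_distrib_mat_vec[OF Sc Xi_carrier X]
    by (rule scalar_prod_add_distrib[OF U mult_mat_vec_carrier[OF Sc X] mult_mat_vec_carrier[OF Xi_carrier X]])
  also have "u \<bullet> (Sy Xmat *\<^sub>v x) = u \<bullet> (Xmat *\<^sub>v x) + x \<bullet> (Xmat *\<^sub>v u)"
    by (rule Sy_scalar_prod[OF XYZ_carrier(3) U X])
  also have "u \<bullet> (Xmat *\<^sub>v x) = half_form u1 u3 u5 x" unfolding u_def by (rule Xmat_form[OF u X])
  also have "x \<bullet> (Xmat *\<^sub>v u) = half_form x1 x3 x5 u" unfolding x_def by (rule Xmat_form[OF x U])
  finally show ?thesis .
qed

end

context lmi_data
begin

abbreviation "Psi0 \<equiv> Psi S G J Q R P1 P2 P3"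
abbreviation "LMI \<equiv> four_block_mat Psi0 ((Sigma_mat S G)\<^sup>\<top> * (sJt J)\<^sup>\<top>) (sJt J * Sigma_mat S G) (sJ1 J)"

lemma LMI_blocks: "(Sigma_mat S G)\<^sup>\<top> * (sJt J)\<^sup>\<top> \<in> carrier_mat ND m" "sJt J * Sigma_mat S G \<in> carrier_mat m ND"
  using Sigma_carrier J_carriers by auto

lemma LMI_carrier: "LMI \<in> carrier_mat (ND + m) (ND + m)"
  by (rule four_block_carrier_mat[OF Psi_carrier J_carriers(1)])

lemma LMI_form:
  assumes u: "u \<in> carrier_vec ND" "u6 \<in> carrier_vec m" and x: "x \<in> carrier_vec ND" "x6 \<in> carrier_vec m"
  shows "(u @\<^sub>v u6) \<bullet> (LMI *\<^sub>v (x @\<^sub>v x6)) = u \<bullet> (Psi0 *\<^sub>v x) + x6 \<bullet> (sJt J *\<^sub>v (Sigma_mat S G *\<^sub>v u))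
    + u6 \<bullet> (sJt J *\<^sub>v (Sigma_mat S G *\<^sub>v x)) + u6 \<bullet> (sJ1 J *\<^sub>v x6)"
proof -
  let ?B = "(Sigma_mat S G)\<^sup>\<top> * (sJt J)\<^sup>\<top>" and ?C = "sJt J * Sigma_mat S G"
  note c = mult_mat_vec_carrier[OF Psi_carrier x(1)] mult_mat_vec_carrier[OF LMI_blocks(1) x(2)]
    mult_mat_vec_carrier[OF LMI_blocks(2) x(1)] mult_mat_vec_carrier[OF J_carriers(1) x(2)]
  have Bt: "?B = ?C\<^sup>\<top>" by (rule transpose_mult[OF J_carriers(3) Sigma_carrier, symmetric])
  have "u \<bullet> (?B *\<^sub>v x6) = (?C\<^sup>\<top> *\<^sub>v x6) \<bullet> u" unfolding Bt[symmetric] by (rule comm_scalar_prod[OF u(1) c(2)])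
  also have "\<dots> = x6 \<bullet> (?C *\<^sub>v u)" by (rule transpose_scalar_prod[OF LMI_blocks(2) x(2) u(1)])
  finally have B: "u \<bullet> (?B *\<^sub>v x6) = x6 \<bullet> (sJt J *\<^sub>v (Sigma_mat S G *\<^sub>v u))"
    by (simp only: assoc_mult_mat_vec[OF J_carriers(3) Sigma_carrier u(1)])
  have C: "u6 \<bullet> (?C *\<^sub>v x) = u6 \<bullet> (sJt J *\<^sub>v (Sigma_mat S G *\<^sub>v x))"
    by (rule arg_cong[OF assoc_mult_mat_vec[OF J_carriers(3) Sigma_carrier x(1)]])
  have "LMI *\<^sub>v (x @\<^sub>v x6) = (Psi0 *\<^sub>v x + ?B *\<^sub>v x6) @\<^sub>v (?C *\<^sub>v x + sJ1 J *\<^sub>v x6)"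
    by (rule four_block_mat_mult_vec[OF Psi_carrier LMI_blocks J_carriers(1) x])
  then show ?thesis
    by (simp only: scalar_prod_append[OF u add_carrier_vec[OF c(1,2)] add_carrier_vec[OF c(3,4)]]
        scalar_prod_add_distrib[OF u(1) c(1,2)] scalar_prod_add_distrib[OF u(2) c(3,4)] B C add.assoc)
qed

text \<open>The lower component is eliminated by inserting its optimal value: with
  \<open>z = sJt J *\<^sub>v (Sigma_mat S G *\<^sub>v x)\<close>, the vector
  \<open>y = - J1^{-1} z\<close> maximises twice \<open>y \<bullet> z\<close> plus the form of the
  negative definite \<open>J1\<close>. Strictness of the inequality survives as the multiple of
  \<open>x \<bullet> x\<close>.\<close>

lemma Schur_complement_bound:
  assumes "neg_def LMI"
  obtains c where "c > 0" "\<And>x. x \<in> carrier_vec ND \<Longrightarrow>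
    x \<bullet> (Psi0 *\<^sub>v x) - (sJt J *\<^sub>v (Sigma_mat S G *\<^sub>v x)) \<bullet> (mat_inv (sJ1 J) *\<^sub>v (sJt J *\<^sub>v (Sigma_mat S G *\<^sub>v x)))
    \<le> - c * (x \<bullet> x)"
proof -
  obtain c where c: "c > 0" "\<And>x. x \<in> carrier_vec (ND + m) \<Longrightarrow> x \<bullet> (LMI *\<^sub>v x) \<le> - c * (x \<bullet> x)"
    using neg_def_coercive[OF assms LMI_carrier] by blast
  have "x \<bullet> (Psi0 *\<^sub>v x) - (sJt J *\<^sub>v (Sigma_mat S G *\<^sub>v x)) \<bullet> (mat_inv (sJ1 J) *\<^sub>v (sJt J *\<^sub>v (Sigma_mat S G *\<^sub>v x)))
    \<le> - c * (x \<bullet> x)" if x: "x \<in> carrier_vec ND" for x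
  proof -
    define z where "z = sJt J *\<^sub>v (Sigma_mat S G *\<^sub>v x)"
    define k where "k = mat_inv (sJ1 J) *\<^sub>v z"
    define y where "y = (-1) \<cdot>\<^sub>v k"
    have z: "z \<in> carrier_vec m" unfolding z_def
      by (rule mult_mat_vec_carrier[OF J_carriers(3) mult_mat_vec_carrier[OF Sigma_carrier x]])
    have k: "k \<in> carrier_vec m" unfolding k_def by (rule mult_mat_vec_carrier[OF J1_inv(1) z])
    have y: "y \<in> carrier_vec m" using k by (simp add: y_def)
    have J1k: "sJ1 J *\<^sub>v k = z" unfolding k_def
      using z by (simp add: assoc_mult_mat_vec[OF J_carriers(1) J1_inv(1) z, symmetric] J1_inv(2))
    have "sJ1 J *\<^sub>v y = (-1) \<cdot>\<^sub>v z" unfolding y_def mult_mat_vec[OF J_carriers(1) k] J1k ..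
    then have "y \<bullet> (sJ1 J *\<^sub>v y) = z \<bullet> k" using z k by (simp add: y_def comm_scalar_prod[OF k z])
    moreover have "y \<bullet> z = - (z \<bullet> k)" using z k by (simp add: y_def comm_scalar_prod[OF k z])
    ultimately have "(x @\<^sub>v y) \<bullet> (LMI *\<^sub>v (x @\<^sub>v y)) = x \<bullet> (Psi0 *\<^sub>v x) - z \<bullet> k"
      unfolding LMI_form[OF x y x y] z_def[symmetric] by simp
    moreover have "(x @\<^sub>v y) \<bullet> (LMI *\<^sub>v (x @\<^sub>v y)) \<le> - c * (x \<bullet> x + y \<bullet> y)"
      using c(2)[OF append_carrier_vec[OF x y]] by (simp only: scalar_prod_append[OF x y x y])
    moreover have "0 \<le> c * (y \<bullet> y)" using c(1) scalar_prod_self_ge_0[of y] by simp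
    ultimately show ?thesis unfolding z_def[symmetric] k_def[symmetric] by (simp add: distrib_left)
  qed
  then show thesis using that c(1) by blast
qed

lemma supply_fun_form:
  assumes z: "z \<in> carrier_vec m" and w: "w \<in> carrier_vec q"
  shows "supply_fun J z w = (sJt J *\<^sub>v z) \<bullet> (mat_inv (sJ1 J) *\<^sub>v (sJt J *\<^sub>v z)) + 2 * (w \<bullet> ((sJ2 J)\<^sup>\<top> *\<^sub>v z)) + w \<bullet> (sJ3 J *\<^sub>v w)"
proof -
  let ?A = "(sJt J)\<^sup>\<top> * mat_inv (sJ1 J) * sJt J"
  have Jtt: "(sJt J)\<^sup>\<top> \<in> carrier_mat m m" using J_carriers by simp
  have A: "?A \<in> carrier_mat m m" using Jtt J1_inv J_carriers by auto
  have Jz: "sJt J *\<^sub>v z \<in> carrier_vec m" by (rule mult_mat_vec_carrier[OF J_carriers(3) z])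
  have KJz: "mat_inv (sJ1 J) *\<^sub>v (sJt J *\<^sub>v z) \<in> carrier_vec m" by (rule mult_mat_vec_carrier[OF J1_inv(1) Jz])
  have "?A *\<^sub>v z = (sJt J)\<^sup>\<top> *\<^sub>v (mat_inv (sJ1 J) *\<^sub>v (sJt J *\<^sub>v z))"
    by (simp only: assoc_mult_mat_vec[OF mult_carrier_mat[OF Jtt J1_inv(1)] J_carriers(3) z] assoc_mult_mat_vec[OF Jtt J1_inv(1) Jz])
  then have Az: "z \<bullet> (?A *\<^sub>v z) = (sJt J *\<^sub>v z) \<bullet> (mat_inv (sJ1 J) *\<^sub>v (sJt J *\<^sub>v z))"
    using transpose_scalar_prod[OF Jtt z KJz] by simp
  note c = mult_mat_vec_carrier[OF A z] mult_mat_vec_carrier[OF J_carriers(4) w]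
    mult_mat_vec_carrier[OF J_carriers(6) z] mult_mat_vec_carrier[OF J_carriers(5) w]
  have "z \<bullet> (sJ2 J *\<^sub>v w) = ((sJ2 J)\<^sup>\<top> *\<^sub>v z) \<bullet> w" by (rule transpose_scalar_prod[OF J_carriers(4) z w, symmetric])
  then have zw: "z \<bullet> (sJ2 J *\<^sub>v w) = w \<bullet> ((sJ2 J)\<^sup>\<top> *\<^sub>v z)" using comm_scalar_prod[OF c(3) w] by simp
  have "supply_fun J z w = (z @\<^sub>v w) \<bullet> ((?A *\<^sub>v z + sJ2 J *\<^sub>v w) @\<^sub>v ((sJ2 J)\<^sup>\<top> *\<^sub>v z + sJ3 J *\<^sub>v w))"
    unfolding supply_fun_def by (subst four_block_mat_mult_vec[OF A J_carriers(4,6,5) z w]) (rule refl)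
  also have "\<dots> = z \<bullet> (?A *\<^sub>v z) + z \<bullet> (sJ2 J *\<^sub>v w) + (w \<bullet> ((sJ2 J)\<^sup>\<top> *\<^sub>v z) + w \<bullet> (sJ3 J *\<^sub>v w))"
    by (simp only: scalar_prod_append[OF z w add_carrier_vec[OF c(1,2)] add_carrier_vec[OF c(3,4)]]
        scalar_prod_add_distrib[OF z c(1,2)] scalar_prod_add_distrib[OF w c(3,4)])
  finally show ?thesis using Az zw by simp
qed

text \<open>With \<open>w = 0\<close> only the negative semidefinite output block of the supply rate
  remains, so that dissipation turns into decay.\<close>

lemma supply_nonpos:
  assumes z: "z \<in> carrier_vec m"
  shows "supply_fun J z (0\<^sub>v q) \<le> 0"
proof -
  have "neg_semidef ((sJt J)\<^sup>\<top> * mat_inv (sJ1 J) * sJt J)" using rate by (simp add: admissible_supply_def)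
  then have neg: "z \<bullet> (((sJt J)\<^sup>\<top> * mat_inv (sJ1 J) * sJt J) *\<^sub>v z) \<le> 0"
    using z J_carriers by (auto simp: neg_semidef_def)
  have Jtt: "(sJt J)\<^sup>\<top> \<in> carrier_mat m m" using J_carriers by simp
  have A: "(sJt J)\<^sup>\<top> * mat_inv (sJ1 J) * sJt J \<in> carrier_mat m m" using Jtt J1_inv J_carriers by auto
  have "supply_fun J z (0\<^sub>v q) = (z @\<^sub>v 0\<^sub>v q) \<bullet> ((((sJt J)\<^sup>\<top> * mat_inv (sJ1 J) * sJt J) *\<^sub>v z + sJ2 J *\<^sub>v 0\<^sub>v q) @\<^sub>v ((sJ2 J)\<^sup>\<top> *\<^sub>v z + sJ3 J *\<^sub>v 0\<^sub>v q))"
    unfolding supply_fun_def by (subst four_block_mat_mult_vec[OF A J_carriers(4,6,5) z zero_carrier_vec]) (rule refl)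
  also have "\<dots> = z \<bullet> (((sJt J)\<^sup>\<top> * mat_inv (sJ1 J) * sJt J) *\<^sub>v z)"
    using z mult_mat_vec_carrier[OF A z] mult_mat_vec_carrier[OF J_carriers(6) z]
    by (simp add: mult_mat_zero_vec[OF J_carriers(4)] mult_mat_zero_vec[OF J_carriers(5)] scalar_prod_append[of _ m _ q])
  finally show ?thesis using neg by simp
qed

abbreviation "form_h e t i \<equiv> moment_block S (varkap_of S i) (nh i) e t i \<bullet> ((1\<^sub>m (varkap_of S i) \<otimes>\<^sub>K R i) *\<^sub>v moment_block S (varkap_of S i) (nh i) e t i)"
abbreviation "form_eps e t i \<equiv> moment_block S (mu_of S i) (ne i) e t i \<bullet> ((1\<^sub>m (mu_of S i) \<otimes>\<^sub>K R i) *\<^sub>v moment_block S (mu_of S i) (ne i) e t i)"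

lemma diag_R_moments:
  "moments S N g e t \<bullet> (diag_idx S (\<lambda>i. 1\<^sub>m (N i) \<otimes>\<^sub>K R i) *\<^sub>v moments S N g e t)
    = (\<Sum>i=1..\<nu>. moment_block S (N i) (g i) e t i \<bullet> ((1\<^sub>m (N i) \<otimes>\<^sub>K R i) *\<^sub>v moment_block S (N i) (g i) e t i))"
  by (rule diag_moments) (rule QR_carrier(2))

text \<open>The two block diagonal parts of \<open>Xi\<close> are partitioned differently: the first
  meets the samples at the newer window ends, the second those at the older ends, so \<theta> is
  read in two groupings. The energy is added back because \<open>boundary_rate\<close> already
  subtracts it.\<close>

lemma Xi_form_moments:
  assumes h: "history S e t" and w: "w \<in> carrier_vec q"
  defines "\<theta> \<equiv> e t @\<^sub>v vconcat (map (\<lambda>i. e (t - delay S i)) (idx S)) @\<^sub>v moments S (varkap_of S) nh e t @\<^sub>v moments S (mu_of S) ne e t @\<^sub>v w"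
  shows "\<theta> \<bullet> (Xi S J Q R *\<^sub>v \<theta>) = (\<Sum>i=1..\<nu>. boundary_rate e t i + energy e t (R i) i
      - (form_h e t i + form_eps e t i))
      - w \<bullet> (sJ3 J *\<^sub>v w)"
    and "\<theta> \<in> carrier_vec ND"
proof -
  define E where "E = vconcat (map (\<lambda>i. e (t - delay S i)) (idx S))"
  define E' where "E' = vconcat (map (\<lambda>i. e (t - delay S (i - 1))) (idx S))"
  define \<xi> where "\<xi> = moments S (varkap_of S) nh e t"
  define a where "a = moments S (mu_of S) ne e t"
  have ec: "e (t - delay S i) \<in> carrier_vec n" if "i \<le> \<nu>" for i by (rule history_carrier[OF h that])
  have ec1: "e (t - delay S (i - 1)) \<in> carrier_vec n" if "i \<in> {1..\<nu>}" for i using ec[of "i - 1"] that by auto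
  have ec2: "e (t - delay S i) \<in> carrier_vec n" if "i \<in> {1..\<nu>}" for i using ec[of i] that by auto
  have e0: "e t \<in> carrier_vec n" by (rule history_carrier_0[OF h])
  have E: "E \<in> carrier_vec D2" unfolding E_def by (rule vconcat_idx_carrier_const[OF ec2])
  have E': "E' \<in> carrier_vec D2" unfolding E'_def by (rule vconcat_idx_carrier_const[OF ec1])
  have \<xi>: "\<xi> \<in> carrier_vec D3" unfolding \<xi>_def using moments_carrier[of "varkap_of S"] by (simp add: varkap_tot_def)
  have a: "a \<in> carrier_vec D4" unfolding a_def using moments_carrier[of "mu_of S"] by (simp add: mu_tot_def)
  have \<theta>: "\<theta> = e t @\<^sub>v E @\<^sub>v \<xi> @\<^sub>v a @\<^sub>v w" by (simp only: \<theta>_def E_def \<xi>_def a_def)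
  show \<theta>c: "\<theta> \<in> carrier_vec ND" unfolding \<theta> by (intro append_carrier_vec e0 E \<xi> a w)
  have "e t @\<^sub>v E = E' @\<^sub>v e (t - delay S \<nu>)"
    using vconcat_shift[of \<nu> "\<lambda>i. e (t - delay S i)" n] ec delay_0 unfolding E_def E'_def by (simp only: diff_0_right)
  \<comment> \<open>For the first part of \<open>Xi\<close> the blocks \<open>\<xi>\<close> and
    \<open>a\<close> are merged, matching its single zero block of size
    \<open>kap_tot S * n\<close>.\<close>
  then have \<theta>': "\<theta> = E' @\<^sub>v e (t - delay S \<nu>) @\<^sub>v (\<xi> @\<^sub>v a) @\<^sub>v w"
    unfolding \<theta> by (simp only: append_vec_assoc[symmetric])
  have en: "e (t - delay S \<nu>) \<in> carrier_vec n" by (rule ec) simp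
  have \<xi>a: "\<xi> @\<^sub>v a \<in> carrier_vec (kap_tot S * n)"
    unfolding kap_tot_split add_mult_distrib by (rule append_carrier_vec[OF \<xi> a])
  let ?QR = "diag_idx S Q + diag_idx S R * Lambda S"
  let ?B1 = "diag_block_mat [?QR, 0\<^sub>m n n, 0\<^sub>m (kap_tot S * n) (kap_tot S * n), 0\<^sub>m q q]"
  let ?B2 = "diag_block_mat [0\<^sub>m n n, diag_idx S Q, diag_idx S (\<lambda>i. 1\<^sub>m (varkap_of S i) \<otimes>\<^sub>K R i),
        diag_idx S (\<lambda>i. 1\<^sub>m (mu_of S i) \<otimes>\<^sub>K R i), sJ3 J]"
  note XC = Xi_parts_carrier
  have q1: "diag_block_mat [0\<^sub>m q q] \<in> carrier_mat q q" "diag_block_mat [sJ3 J] \<in> carrier_mat q q"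
    by (simp_all only: diag_block_mat_singleton zero_carrier_mat J_carriers)
  have zf: "x \<bullet> (0\<^sub>m k k *\<^sub>v x) = 0" if "x \<in> carrier_vec k" for x :: "real vec" and k
    using that by (simp add: zero_mat_mult_vec[OF that])
  have f1: "\<theta> \<bullet> (?B1 *\<^sub>v \<theta>) = E' \<bullet> (?QR *\<^sub>v E')"
    unfolding \<theta>' diag_block_mat_Cons_form(1)[OF XC(3) diag_block_mat_Cons_carrier[OF zero_carrier_mat diag_block_mat_Cons_carrier[OF zero_carrier_mat q1(1)]]
        E' append_carrier_vec[OF en append_carrier_vec[OF \<xi>a w]]]
      diag_block_mat_Cons_form(1)[OF zero_carrier_mat diag_block_mat_Cons_carrier[OF zero_carrier_mat q1(1)] en append_carrier_vec[OF \<xi>a w]]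
      diag_block_mat_Cons_form(1)[OF zero_carrier_mat q1(1) \<xi>a w] diag_block_mat_singleton zf[OF en] zf[OF \<xi>a] zf[OF w] by simp
  have f2: "\<theta> \<bullet> (?B2 *\<^sub>v \<theta>) = E \<bullet> (diag_idx S Q *\<^sub>v E) + (\<xi> \<bullet> (diag_idx S (\<lambda>i. 1\<^sub>m (varkap_of S i) \<otimes>\<^sub>K R i) *\<^sub>v \<xi>)
      + (a \<bullet> (diag_idx S (\<lambda>i. 1\<^sub>m (mu_of S i) \<otimes>\<^sub>K R i) *\<^sub>v a) + w \<bullet> (sJ3 J *\<^sub>v w)))"
    unfolding \<theta> diag_block_mat_Cons_form(1)[OF zero_carrier_mat diag_block_mat_Cons_carrier[OF XC(4) diag_block_mat_Cons_carrier[OF XC(5)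
        diag_block_mat_Cons_carrier[OF XC(6) q1(2)]]] e0 append_carrier_vec[OF E append_carrier_vec[OF \<xi> append_carrier_vec[OF a w]]]]
      diag_block_mat_Cons_form(1)[OF XC(4) diag_block_mat_Cons_carrier[OF XC(5) diag_block_mat_Cons_carrier[OF XC(6) q1(2)]] E append_carrier_vec[OF \<xi> append_carrier_vec[OF a w]]]
      diag_block_mat_Cons_form(1)[OF XC(5) diag_block_mat_Cons_carrier[OF XC(6) q1(2)] \<xi> append_carrier_vec[OF a w]]
      diag_block_mat_Cons_form(1)[OF XC(6) q1(2) a w] diag_block_mat_singleton zf[OF e0] by simp
  have QRE: "?QR *\<^sub>v E' = vconcat (map (\<lambda>i. (Q i + (delay S i - delay S (i - 1)) \<cdot>\<^sub>m R i) *\<^sub>v e (t - delay S (i - 1))) (idx S))"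
  proof -
    have sc: "c \<cdot>\<^sub>v e (t - delay S (i - 1)) \<in> carrier_vec n" if "i \<in> {1..\<nu>}" for i c using ec1[OF that] by simp
    have "Lambda S *\<^sub>v E' = vconcat (map (\<lambda>i. ((delay S i - delay S (i - 1)) \<cdot>\<^sub>m 1\<^sub>m n) *\<^sub>v e (t - delay S (i - 1))) (idx S))"
      unfolding Lambda_def E'_def by (rule diag_idx_mult_vconcat[where r = "\<lambda>_. n" and c = "\<lambda>_. n"]) (simp, rule ec1)
    also have "\<dots> = vconcat (map (\<lambda>i. (delay S i - delay S (i - 1)) \<cdot>\<^sub>v e (t - delay S (i - 1))) (idx S))"
    proof (rule vconcat_idx_cong)
      fix i assume "i \<in> {1..\<nu>}"
      note c = ec1[OF this]
      have "(b \<cdot>\<^sub>m 1\<^sub>m n) *\<^sub>v x = b \<cdot>\<^sub>v x" if "x \<in> carrier_vec n" for b and x :: "real vec"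
      proof (rule eq_vecI)
        fix k assume "k < dim_vec (b \<cdot>\<^sub>v x)"
        then have k: "k < n" using that by simp
        have "((b \<cdot>\<^sub>m 1\<^sub>m n) *\<^sub>v x) $ k = (\<Sum>j=0..<n. b * (if j = k then 1 else 0) * x $ j)"
          using that k by (simp add: scalar_prod_def)
        also have "\<dots> = (\<Sum>j=0..<n. if j = k then b * x $ j else 0)" by (rule sum.cong) auto
        finally show "((b \<cdot>\<^sub>m 1\<^sub>m n) *\<^sub>v x) $ k = (b \<cdot>\<^sub>v x) $ k" using that k by simp
      qed (use that in simp)
      from this[OF c] show "((delay S i - delay S (i - 1)) \<cdot>\<^sub>m 1\<^sub>m n) *\<^sub>v e (t - delay S (i - 1))
        = (delay S i - delay S (i - 1)) \<cdot>\<^sub>v e (t - delay S (i - 1))" .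
    qed
    finally have L: "Lambda S *\<^sub>v E' = vconcat (map (\<lambda>i. (delay S i - delay S (i - 1)) \<cdot>\<^sub>v e (t - delay S (i - 1))) (idx S))" .
    have RL: "(diag_idx S R * Lambda S) *\<^sub>v E' = vconcat (map (\<lambda>i. R i *\<^sub>v ((delay S i - delay S (i - 1)) \<cdot>\<^sub>v e (t - delay S (i - 1)))) (idx S))"
      unfolding assoc_mult_mat_vec[OF XC(7,8) E'] L
      by (rule diag_idx_mult_vconcat[where r = "\<lambda>_. n" and c = "\<lambda>_. n"]) (rule QR_carrier, assumption, rule sc)
    have QE: "diag_idx S Q *\<^sub>v E' = vconcat (map (\<lambda>i. Q i *\<^sub>v e (t - delay S (i - 1))) (idx S))"
      unfolding E'_def by (rule diag_idx_mult_vconcat[where r = "\<lambda>_. n" and c = "\<lambda>_. n"]) (rule QR_carrier, assumption, rule ec1)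
    have "?QR *\<^sub>v E' = diag_idx S Q *\<^sub>v E' + (diag_idx S R * Lambda S) *\<^sub>v E'"
      by (rule add_mult_distrib_mat_vec[OF XC(4) mult_carrier_mat[OF XC(7,8)] E'])
    also have "\<dots> = vconcat (map (\<lambda>i. Q i *\<^sub>v e (t - delay S (i - 1)) + R i *\<^sub>v ((delay S i - delay S (i - 1)) \<cdot>\<^sub>v e (t - delay S (i - 1)))) (idx S))"
      unfolding QE RL
    proof (rule vconcat_add[where k = "\<lambda>_. n"])
      fix i assume "i \<in> set (idx S)"
      then have i: "i \<in> {1..\<nu>}" by (simp only: set_idx)
      show "Q i *\<^sub>v e (t - delay S (i - 1)) \<in> carrier_vec n \<and> R i *\<^sub>v ((delay S i - delay S (i - 1)) \<cdot>\<^sub>v e (t - delay S (i - 1))) \<in> carrier_vec n"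
        using mult_mat_vec_carrier[OF QR_carrier(1)[OF i] ec1[OF i]] mult_mat_vec_carrier[OF QR_carrier(2)[OF i] sc[OF i]] by blast
    qed
    also have "\<dots> = vconcat (map (\<lambda>i. (Q i + (delay S i - delay S (i - 1)) \<cdot>\<^sub>m R i) *\<^sub>v e (t - delay S (i - 1))) (idx S))"
    proof (rule vconcat_idx_cong)
      fix i assume i: "i \<in> {1..\<nu>}"
      note c = QR_carrier[OF i] ec1[OF i]
      have "(Q i + (delay S i - delay S (i - 1)) \<cdot>\<^sub>m R i) *\<^sub>v e (t - delay S (i - 1))
        = Q i *\<^sub>v e (t - delay S (i - 1)) + ((delay S i - delay S (i - 1)) \<cdot>\<^sub>m R i) *\<^sub>v e (t - delay S (i - 1))"
        by (rule add_mult_distrib_mat_vec[OF c(1) _ c(3)]) (use c(2) in simp)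
      also have "((delay S i - delay S (i - 1)) \<cdot>\<^sub>m R i) *\<^sub>v e (t - delay S (i - 1)) = R i *\<^sub>v ((delay S i - delay S (i - 1)) \<cdot>\<^sub>v e (t - delay S (i - 1)))"
        unfolding mult_mat_vec[OF c(2,3)] using c by (intro eq_vecI) (auto simp: scalar_prod_def sum_distrib_left mult.assoc)
      finally show "Q i *\<^sub>v e (t - delay S (i - 1)) + R i *\<^sub>v ((delay S i - delay S (i - 1)) \<cdot>\<^sub>v e (t - delay S (i - 1)))
        = (Q i + (delay S i - delay S (i - 1)) \<cdot>\<^sub>m R i) *\<^sub>v e (t - delay S (i - 1))" by simp
    qed
    finally show ?thesis .
  qed
  have g1: "E' \<bullet> (?QR *\<^sub>v E') = (\<Sum>i=1..\<nu>. e (t - delay S (i - 1)) \<bullet> ((Q i + (delay S i - delay S (i - 1)) \<cdot>\<^sub>m R i) *\<^sub>v e (t - delay S (i - 1))))"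
    unfolding QRE unfolding E'_def
  proof (rule vconcat_idx_scalar_prod[where k = "\<lambda>_. n", OF ec1])
    fix i assume i: "i \<in> {1..\<nu>}"
    show "(Q i + (delay S i - delay S (i - 1)) \<cdot>\<^sub>m R i) *\<^sub>v e (t - delay S (i - 1)) \<in> carrier_vec n"
      by (rule mult_mat_vec_carrier[OF _ ec1[OF i]]) (use QR_carrier[OF i] in simp)
  qed
  have g2: "E \<bullet> (diag_idx S Q *\<^sub>v E) = (\<Sum>i=1..\<nu>. e (t - delay S i) \<bullet> (Q i *\<^sub>v e (t - delay S i)))"
  proof -
    have QE: "diag_idx S Q *\<^sub>v E = vconcat (map (\<lambda>i. Q i *\<^sub>v e (t - delay S i)) (idx S))"
      unfolding E_def by (rule diag_idx_mult_vconcat[where r = "\<lambda>_. n" and c = "\<lambda>_. n"]) (rule QR_carrier, assumption, rule ec2)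
    show ?thesis unfolding QE unfolding E_def
    proof (rule vconcat_idx_scalar_prod[where k = "\<lambda>_. n", OF ec2])
      fix i assume i: "i \<in> {1..\<nu>}"
      show "Q i *\<^sub>v e (t - delay S i) \<in> carrier_vec n" by (rule mult_mat_vec_carrier[OF QR_carrier(1)[OF i] ec2[OF i]])
    qed
  qed
  have "\<theta> \<bullet> (Xi S J Q R *\<^sub>v \<theta>) = \<theta> \<bullet> (?B1 *\<^sub>v \<theta>) - \<theta> \<bullet> (?B2 *\<^sub>v \<theta>)"
    unfolding Xi_def Let_def minus_mult_distrib_mat_vec[OF XC(1,2) \<theta>c]
    by (rule scalar_prod_minus_distrib[OF \<theta>c mult_mat_vec_carrier[OF XC(1) \<theta>c] mult_mat_vec_carrier[OF XC(2) \<theta>c]])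
  also have "\<dots> = (\<Sum>i=1..\<nu>. boundary_rate e t i + energy e t (R i) i
      - (form_h e t i + form_eps e t i))
      - w \<bullet> (sJ3 J *\<^sub>v w)"
    unfolding f1 f2 g1 g2 \<xi>_def a_def diag_R_moments boundary_rate_def by (simp only: sum_subtractf sum.distrib)
  finally show "\<theta> \<bullet> (Xi S J Q R *\<^sub>v \<theta>) = \<dots>" .
qed

text \<open>The terms of \<open>half_form\<close> are distributed over two matrices: those in which
  \<open>Pm\<close> meets \<open>Omega\<close> come from \<open>boldP\<close> and
  \<open>boldPi\<close>, those in which it meets the moment rates from \<open>C * Nm\<close>, and
  the supply terms from \<open>Z * \<Sigma>m\<close>. Hence the sum is evaluated as a whole.\<close>

lemma boldPhi_form:
  assumes u: "u1 \<in> carrier_vec n" "u2 \<in> carrier_vec D2" "u3 \<in> carrier_vec D3" "u4 \<in> carrier_vec D4" "u5 \<in> carrier_vec q" "u6 \<in> carrier_vec m"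
    and x: "x \<in> carrier_vec ND" "x6 \<in> carrier_vec m"
  defines "C \<equiv> P2 @\<^sub>r 0\<^sub>m (\<nu> * n) (d_tot S * n) @\<^sub>r ((boldI S)\<^sup>\<top> * P3) @\<^sub>r 0\<^sub>m (mu_tot S * n + q + m) (d_tot S * n)"
    and "Nm \<equiv> (boldM S \<otimes>\<^sub>K 1\<^sub>m n) @\<^sub>c 0\<^sub>m (d_tot S * n) (mu_tot S * n + q + m)"
    and "Z \<equiv> 0\<^sub>m (beta S * n) m @\<^sub>r (- ((sJ2 J)\<^sup>\<top>)) @\<^sub>r sJt J"
    and "\<Sigma>m \<equiv> Sigma_mat S G @\<^sub>c 0\<^sub>m m m"
  shows "((u1 @\<^sub>v u2 @\<^sub>v u3 @\<^sub>v u4 @\<^sub>v u5) @\<^sub>v u6) \<bullet> ((C * Nm + Z * \<Sigma>m) *\<^sub>v (x @\<^sub>v x6))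
      + ((u1 @\<^sub>v u2 @\<^sub>v u3 @\<^sub>v u4 @\<^sub>v u5) @\<^sub>v u6) \<bullet> (((boldP S P1 P2)\<^sup>\<top> * boldPi S G) *\<^sub>v (x @\<^sub>v x6))
    = half_form u1 u3 u5 x + u6 \<bullet> (sJt J *\<^sub>v (Sigma_mat S G *\<^sub>v x))"
    and "C * Nm + Z * \<Sigma>m \<in> carrier_mat (ND + m) (ND + m)"
    and "(boldP S P1 P2)\<^sup>\<top> * boldPi S G \<in> carrier_mat (ND + m) (ND + m)"
proof -
  let ?u = "(u1 @\<^sub>v u2 @\<^sub>v u3 @\<^sub>v u4 @\<^sub>v u5) @\<^sub>v u6" and ?x = "x @\<^sub>v x6"
  have X: "?x \<in> carrier_vec (ND + m)" by (rule append_carrier_vec[OF x])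
  have U: "?u \<in> carrier_vec (ND + m)" by (intro append_carrier_vec u)
  have It: "(boldI S)\<^sup>\<top> * P3 \<in> carrier_mat D3 dn" using boldI_carrier P3_carrier by auto
  have dimN: "n + (D2 + D3) + (D4 + q + m) = ND + m" by simp
  have dimC: "n + (D2 + (D3 + (D4 + q + m))) = ND + m" by simp
  have dimZ: "beta S * n + (q + m) = ND + m" unfolding ND_eq[symmetric] by simp
  have C: "C \<in> carrier_mat (ND + m) dn" unfolding C_def dimC[symmetric]
    by (intro carrier_append_rows P2_carrier It zero_carrier_mat)
  have Nm: "Nm \<in> carrier_mat dn (ND + m)" unfolding Nm_def dimN[symmetric]
    by (intro append_cols_carrier boldM_kron_carrier zero_carrier_mat)
  have mJ2: "- ((sJ2 J)\<^sup>\<top>) \<in> carrier_mat q m" using J_carriers by simp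
  have Z: "Z \<in> carrier_mat (ND + m) m" unfolding Z_def dimZ[symmetric]
    by (intro carrier_append_rows J_carriers mJ2 zero_carrier_mat)
  have \<Sigma>m: "\<Sigma>m \<in> carrier_mat m (ND + m)" unfolding \<Sigma>m_def
    by (intro append_cols_carrier Sigma_carrier zero_carrier_mat)
  have CN: "C * Nm \<in> carrier_mat (ND + m) (ND + m)" and ZS: "Z * \<Sigma>m \<in> carrier_mat (ND + m) (ND + m)"
    using mult_carrier_mat[OF C Nm] mult_carrier_mat[OF Z \<Sigma>m] .
  then show "C * Nm + Z * \<Sigma>m \<in> carrier_mat (ND + m) (ND + m)" by simp
  have PI: "P2 * boldI S \<in> carrier_mat n D3" by (rule mult_carrier_mat[OF P2_carrier boldI_carrier])
  have bP: "boldP S P1 P2 \<in> carrier_mat n (ND + m)" unfolding boldP_def Let_def dimC[symmetric]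
    by (intro append_cols_carrier P1_carrier PI zero_carrier_mat)
  have bPi: "boldPi S G \<in> carrier_mat n (ND + m)" unfolding boldPi_def
    by (intro append_cols_carrier Omega_carrier zero_carrier_mat)
  have bPt: "(boldP S P1 P2)\<^sup>\<top> \<in> carrier_mat (ND + m) n" using bP by simp
  show "(boldP S P1 P2)\<^sup>\<top> * boldPi S G \<in> carrier_mat (ND + m) (ND + m)" by (rule mult_carrier_mat[OF bPt bPi])
  define Ox Nx Sx Iu where "Ox = Omega S G *\<^sub>v x" and "Nx = Nmat *\<^sub>v x" and "Sx = Sigma_mat S G *\<^sub>v x" and "Iu = boldI S *\<^sub>v u3"
  have Ox: "Ox \<in> carrier_vec n" and Nx: "Nx \<in> carrier_vec dn" and Sx: "Sx \<in> carrier_vec m" and Iu: "Iu \<in> carrier_vec dn"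
    unfolding Ox_def Nx_def Sx_def Iu_def
    using mult_mat_vec_carrier[OF Omega_carrier x(1)] mult_mat_vec_carrier[OF Nmat_carrier x(1)] mult_mat_vec_carrier[OF Sigma_carrier x(1)]
      mult_mat_vec_carrier[OF boldI_carrier u(3)] .
  \<comment> \<open>\<open>Nm\<close> widens the trailing zero block of \<open>Nmat\<close> by
    \<open>m\<close> columns, so \<open>x\<close> is cut after its third block and the rest is
    absorbed together with \<open>x6\<close>.\<close>
  have Nmx: "Nm *\<^sub>v ?x = Nx"
  proof -
    have "x \<in> carrier_vec (n + (D2 + D3) + (D4 + q))" using x(1) by (simp add: add.assoc)
    then obtain y z where yz: "y \<in> carrier_vec (n + (D2 + D3))" "z \<in> carrier_vec (D4 + q)" "x = y @\<^sub>v z"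
      using split_append_vec by blast
    have zx: "z @\<^sub>v x6 \<in> carrier_vec (D4 + q + m)" by (rule append_carrier_vec[OF yz(2) x(2)])
    have "Nm *\<^sub>v ?x = (boldM S \<otimes>\<^sub>K 1\<^sub>m n) *\<^sub>v y + 0\<^sub>m dn (D4 + q + m) *\<^sub>v (z @\<^sub>v x6)"
      unfolding Nm_def yz(3) append_vec_assoc by (rule append_cols_mult_vec[OF boldM_kron_carrier zero_carrier_mat yz(1) zx])
    moreover have "Nx = (boldM S \<otimes>\<^sub>K 1\<^sub>m n) *\<^sub>v y + 0\<^sub>m dn (D4 + q) *\<^sub>v z"
      unfolding Nx_def Nmat_def yz(3) by (rule append_cols_mult_vec[OF boldM_kron_carrier zero_carrier_mat yz(1,2)])
    ultimately show ?thesis by (simp only: zero_mat_mult_vec[OF zx] zero_mat_mult_vec[OF yz(2)])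
  qed
  have Smx: "\<Sigma>m *\<^sub>v ?x = Sx"
    unfolding \<Sigma>m_def append_cols_mult_vec[OF Sigma_carrier zero_carrier_mat x] zero_mat_mult_vec[OF x(2)] Sx_def[symmetric]
    using Sx by simp
  have Pix: "boldPi S G *\<^sub>v ?x = Ox"
    unfolding boldPi_def append_cols_mult_vec[OF Omega_carrier zero_carrier_mat x] zero_mat_mult_vec[OF x(2)] Ox_def[symmetric]
    using Ox by simp
  have tail: "u4 @\<^sub>v u5 @\<^sub>v u6 \<in> carrier_vec (D4 + q + m)" using append_carrier_vec[OF u(4) append_carrier_vec[OF u(5,6)]] by (simp only: add.assoc)
  have uC: "?u = u1 @\<^sub>v u2 @\<^sub>v u3 @\<^sub>v (u4 @\<^sub>v u5 @\<^sub>v u6)" by (simp only: append_vec_assoc)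
  have CNx: "?u \<bullet> ((C * Nm) *\<^sub>v ?x) = u1 \<bullet> (P2 *\<^sub>v Nx) + Iu \<bullet> (P3 *\<^sub>v Nx)"
  proof -
    have P3N: "P3 *\<^sub>v Nx \<in> carrier_vec dn" by (rule mult_mat_vec_carrier[OF P3_carrier Nx])
    have "C *\<^sub>v Nx = (P2 *\<^sub>v Nx) @\<^sub>v 0\<^sub>v D2 @\<^sub>v (((boldI S)\<^sup>\<top> * P3) *\<^sub>v Nx) @\<^sub>v 0\<^sub>v (D4 + q + m)"
      unfolding C_def
      by (simp only: mat_mult_append[OF P2_carrier carrier_append_rows[OF zero_carrier_mat carrier_append_rows[OF It zero_carrier_mat]] Nx]
        mat_mult_append[OF zero_carrier_mat carrier_append_rows[OF It zero_carrier_mat] Nx] mat_mult_append[OF It zero_carrier_mat Nx]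
        zero_mat_mult_vec[OF Nx])
    then have "?u \<bullet> (C *\<^sub>v Nx) = u1 \<bullet> (P2 *\<^sub>v Nx) + u3 \<bullet> (((boldI S)\<^sup>\<top> * P3) *\<^sub>v Nx)"
      unfolding uC using mult_mat_vec_carrier[OF P2_carrier Nx] mult_mat_vec_carrier[OF It Nx] u tail
      by (simp add: scalar_prod_append[of _ n _ "D2 + (D3 + (D4 + q + m))"] scalar_prod_append[of _ D2 _ "D3 + (D4 + q + m)"]
          scalar_prod_append[of _ D3 _ "D4 + q + m"] del: assoc_mult_mat_vec)
    also have "((boldI S)\<^sup>\<top> * P3) *\<^sub>v Nx = (boldI S)\<^sup>\<top> *\<^sub>v (P3 *\<^sub>v Nx)"
      by (rule assoc_mult_mat_vec[OF _ P3_carrier Nx]) (use boldI_carrier in simp)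
    also have "u3 \<bullet> ((boldI S)\<^sup>\<top> *\<^sub>v (P3 *\<^sub>v Nx)) = Iu \<bullet> (P3 *\<^sub>v Nx)"
      using transpose_scalar_prod[of "(boldI S)\<^sup>\<top>" D3 dn u3 "P3 *\<^sub>v Nx"] boldI_carrier u(3) P3N by (simp add: Iu_def)
    finally show ?thesis by (simp only: assoc_mult_mat_vec[OF C Nm X] Nmx)
  qed
  have ZSx: "?u \<bullet> ((Z * \<Sigma>m) *\<^sub>v ?x) = - (u5 \<bullet> ((sJ2 J)\<^sup>\<top> *\<^sub>v Sx)) + u6 \<bullet> (sJt J *\<^sub>v Sx)"
  proof -
    have b: "u1 @\<^sub>v u2 @\<^sub>v u3 @\<^sub>v u4 \<in> carrier_vec (beta S * n)" unfolding beta_n by (intro append_carrier_vec u)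
    have uZ: "?u = (u1 @\<^sub>v u2 @\<^sub>v u3 @\<^sub>v u4) @\<^sub>v u5 @\<^sub>v u6" by (simp only: append_vec_assoc)
    note cJ = mult_mat_vec_carrier[OF mJ2 Sx] mult_mat_vec_carrier[OF J_carriers(3) Sx]
    have "Z *\<^sub>v Sx = 0\<^sub>v (beta S * n) @\<^sub>v ((- ((sJ2 J)\<^sup>\<top>)) *\<^sub>v Sx) @\<^sub>v (sJt J *\<^sub>v Sx)"
      unfolding Z_def
      by (simp only: mat_mult_append[OF zero_carrier_mat carrier_append_rows[OF mJ2 J_carriers(3)] Sx] mat_mult_append[OF mJ2 J_carriers(3) Sx]
        zero_mat_mult_vec[OF Sx])
    then have "?u \<bullet> (Z *\<^sub>v Sx) = u5 \<bullet> ((- ((sJ2 J)\<^sup>\<top>)) *\<^sub>v Sx) + u6 \<bullet> (sJt J *\<^sub>v Sx)"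
      unfolding uZ using b
      by (simp only: scalar_prod_append[OF b append_carrier_vec[OF u(5,6)] zero_carrier_vec append_carrier_vec[OF cJ]]
          scalar_prod_append[OF u(5,6) cJ] scalar_prod_right_zero add_0_left)
    also have "(- ((sJ2 J)\<^sup>\<top>)) *\<^sub>v Sx = - ((sJ2 J)\<^sup>\<top> *\<^sub>v Sx)"
      using J_carriers(6) Sx by (intro eq_vecI) (auto simp: scalar_prod_def sum_negf)
    also have "u5 \<bullet> (- ((sJ2 J)\<^sup>\<top> *\<^sub>v Sx)) = - (u5 \<bullet> ((sJ2 J)\<^sup>\<top> *\<^sub>v Sx))"
      using u(5) carrier_vecD[OF mult_mat_vec_carrier[OF J_carriers(6) Sx]] unfolding scalar_prod_def by (simp add: sum_negf)
    finally show ?thesis by (simp only: assoc_mult_mat_vec[OF Z \<Sigma>m X] Smx)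
  qed
  have PPx: "?u \<bullet> (((boldP S P1 P2)\<^sup>\<top> * boldPi S G) *\<^sub>v ?x) = u1 \<bullet> (P1 *\<^sub>v Ox) + Iu \<bullet> (P2\<^sup>\<top> *\<^sub>v Ox)"
  proof -
    have Pu: "boldP S P1 P2 *\<^sub>v ?u = P1 *\<^sub>v u1 + P2 *\<^sub>v Iu"
    proof -
      note c1 = append_cols_carrier[OF PI zero_carrier_mat] and c2 = append_carrier_vec[OF u(3) tail]
      have "boldP S P1 P2 *\<^sub>v ?u = P1 *\<^sub>v u1 + (0\<^sub>v n + ((P2 * boldI S) *\<^sub>v u3 + 0\<^sub>v n))"
        unfolding boldP_def Let_def uC
        by (simp only: append_cols_mult_vec[OF P1_carrier append_cols_carrier[OF zero_carrier_mat c1] u(1) append_carrier_vec[OF u(2) c2]]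
            append_cols_mult_vec[OF zero_carrier_mat c1 u(2) c2] append_cols_mult_vec[OF PI zero_carrier_mat u(3) tail]
            zero_mat_mult_vec[OF u(2)] zero_mat_mult_vec[OF tail])
      also have "(P2 * boldI S) *\<^sub>v u3 = P2 *\<^sub>v Iu" unfolding Iu_def by (rule assoc_mult_mat_vec[OF P2_carrier boldI_carrier u(3)])
      finally show ?thesis using mult_mat_vec_carrier[OF P2_carrier Iu] by simp
    qed
    have "?u \<bullet> (((boldP S P1 P2)\<^sup>\<top> * boldPi S G) *\<^sub>v ?x) = ?u \<bullet> ((boldP S P1 P2)\<^sup>\<top> *\<^sub>v Ox)"
      by (simp only: assoc_mult_mat_vec[OF bPt bPi X] Pix)
    also have "\<dots> = (boldP S P1 P2 *\<^sub>v ?u) \<bullet> Ox"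
      using transpose_scalar_prod[OF bPt U Ox] by simp
    also have "\<dots> = (P1 *\<^sub>v u1) \<bullet> Ox + (P2 *\<^sub>v Iu) \<bullet> Ox"
      unfolding Pu by (rule add_scalar_prod_distrib[OF mult_mat_vec_carrier[OF P1_carrier u(1)] mult_mat_vec_carrier[OF P2_carrier Iu] Ox])
    also have "(P1 *\<^sub>v u1) \<bullet> Ox = u1 \<bullet> (P1 *\<^sub>v Ox)" by (rule sym_scalar_prod[OF P1_carrier P1_transpose u(1) Ox])
    also have "(P2 *\<^sub>v Iu) \<bullet> Ox = Iu \<bullet> (P2\<^sup>\<top> *\<^sub>v Ox)"
      using transpose_scalar_prod[OF P2t_carrier Iu Ox] by simp
    finally show ?thesis .
  qed
  have hf: "half_form u1 u3 u5 x = u1 \<bullet> (P1 *\<^sub>v Ox) + u1 \<bullet> (P2 *\<^sub>v Nx) + (Iu \<bullet> (P2\<^sup>\<top> *\<^sub>v Ox) + Iu \<bullet> (P3 *\<^sub>v Nx)) - u5 \<bullet> ((sJ2 J)\<^sup>\<top> *\<^sub>v Sx)"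
  proof -
    note c = mult_mat_vec_carrier[OF P1_carrier Ox] mult_mat_vec_carrier[OF P2_carrier Nx]
      mult_mat_vec_carrier[OF P2t_carrier Ox] mult_mat_vec_carrier[OF P3_carrier Nx]
    have "Pm *\<^sub>v (Ox @\<^sub>v Nx) = (P1 *\<^sub>v Ox + P2 *\<^sub>v Nx) @\<^sub>v (P2\<^sup>\<top> *\<^sub>v Ox + P3 *\<^sub>v Nx)"
      unfolding Pm_def by (rule four_block_mat_mult_vec[OF P1_carrier P2_carrier P2t_carrier P3_carrier Ox Nx])
    then show ?thesis unfolding half_form_def Ox_def[symmetric] Nx_def[symmetric] Sx_def[symmetric] Iu_def[symmetric]
      by (simp only: scalar_prod_append[OF u(1) Iu add_carrier_vec[OF c(1,2)] add_carrier_vec[OF c(3,4)]]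
          scalar_prod_add_distrib[OF u(1) c(1,2)] scalar_prod_add_distrib[OF Iu c(3,4)])
  qed
  have "?u \<bullet> ((C * Nm + Z * \<Sigma>m) *\<^sub>v ?x) = ?u \<bullet> ((C * Nm) *\<^sub>v ?x) + ?u \<bullet> ((Z * \<Sigma>m) *\<^sub>v ?x)"
    unfolding add_mult_distrib_mat_vec[OF CN ZS X]
    by (rule scalar_prod_add_distrib[OF U mult_mat_vec_carrier[OF CN X] mult_mat_vec_carrier[OF ZS X]])
  then show "?u \<bullet> ((C * Nm + Z * \<Sigma>m) *\<^sub>v ?x) + ?u \<bullet> (((boldP S P1 P2)\<^sup>\<top> * boldPi S G) *\<^sub>v ?x)
    = half_form u1 u3 u5 x + u6 \<bullet> (sJt J *\<^sub>v (Sigma_mat S G *\<^sub>v x))"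
    unfolding CNx ZSx PPx hf Sx_def[symmetric] by simp
qed

lemma split_ND:
  assumes "u \<in> carrier_vec (ND + m)"
  obtains u1 u2 u3 u4 u5 u6 where "u1 \<in> carrier_vec n" "u2 \<in> carrier_vec D2" "u3 \<in> carrier_vec D3" "u4 \<in> carrier_vec D4"
    "u5 \<in> carrier_vec q" "u6 \<in> carrier_vec m" "u = (u1 @\<^sub>v u2 @\<^sub>v u3 @\<^sub>v u4 @\<^sub>v u5) @\<^sub>v u6"
proof -
  obtain v u6 where 0: "v \<in> carrier_vec ND" "u6 \<in> carrier_vec m" "u = v @\<^sub>v u6" using split_append_vec[OF assms] by blast
  obtain u1 v1 where 1: "u1 \<in> carrier_vec n" "v1 \<in> carrier_vec (D2 + (D3 + (D4 + q)))" "v = u1 @\<^sub>v v1" using split_append_vec[OF 0(1)] by blast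
  obtain u2 v2 where 2: "u2 \<in> carrier_vec D2" "v2 \<in> carrier_vec (D3 + (D4 + q))" "v1 = u2 @\<^sub>v v2" using split_append_vec[OF 1(2)] by blast
  obtain u3 v3 where 3: "u3 \<in> carrier_vec D3" "v3 \<in> carrier_vec (D4 + q)" "v2 = u3 @\<^sub>v v3" using split_append_vec[OF 2(2)] by blast
  obtain u4 u5 where 4: "u4 \<in> carrier_vec D4" "u5 \<in> carrier_vec q" "v3 = u4 @\<^sub>v u5" using split_append_vec[OF 3(2)] by blast
  show thesis by (rule that[OF 1(1) 2(1) 3(1) 4(1,2) 0(2)]) (simp only: 0 1 2 3 4)
qed

text \<open>Both sides have the same bilinear form: \<open>half_form\<close> in the two orders of
  the arguments, the two mixed terms with \<open>sJt J\<close>, and the forms of \<open>Xi\<close>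
  and \<open>sJ1 J\<close>.\<close>

lemma LMI_eq: "LMI = Sy ((boldP S P1 P2)\<^sup>\<top> * boldPi S G) + boldPhi S G J Q R P2 P3"
proof (rule eq_mat_bilinearI[OF LMI_carrier])
  define C where "C = P2 @\<^sub>r 0\<^sub>m (\<nu> * n) (d_tot S * n) @\<^sub>r ((boldI S)\<^sup>\<top> * P3) @\<^sub>r 0\<^sub>m (mu_tot S * n + q + m) (d_tot S * n)"
  define Nm where "Nm = (boldM S \<otimes>\<^sub>K 1\<^sub>m n) @\<^sub>c 0\<^sub>m (d_tot S * n) (mu_tot S * n + q + m)"
  define Z where "Z = 0\<^sub>m (beta S * n) m @\<^sub>r (- ((sJ2 J)\<^sup>\<top>)) @\<^sub>r sJt J"
  define \<Sigma>m where "\<Sigma>m = Sigma_mat S G @\<^sub>c 0\<^sub>m m m"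
  let ?PP = "(boldP S P1 P2)\<^sup>\<top> * boldPi S G" and ?CZ = "C * Nm + Z * \<Sigma>m" and ?D = "diag_block_mat [Xi S J Q R, sJ1 J]"
  note form = boldPhi_form[folded C_def Nm_def Z_def \<Sigma>m_def]
  \<comment> \<open>The dimension facts in \<open>form\<close> inherit the vector hypotheses of
    \<open>boldPhi_form\<close>; zero vectors discharge them.\<close>
  have zc: "(0\<^sub>v k :: real vec) \<in> carrier_vec k" for k by simp
  have CZ: "?CZ \<in> carrier_mat (ND + m) (ND + m)" and PP: "?PP \<in> carrier_mat (ND + m) (ND + m)"
    by (rule form(2)[OF zc zc zc zc zc zc zc zc], rule form(3)[OF zc zc zc zc zc zc zc zc])
  have J1b: "diag_block_mat [sJ1 J] \<in> carrier_mat m m" by (simp only: diag_block_mat_singleton J_carriers)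
  have D: "?D \<in> carrier_mat (ND + m) (ND + m)" by (rule diag_block_mat_Cons_carrier[OF Xi_carrier J1b])
  have Phi: "boldPhi S G J Q R P2 P3 = Sy ?CZ + ?D"
    unfolding boldPhi_def Let_def C_def Nm_def Z_def \<Sigma>m_def by (rule refl)
  have PhiC: "Sy ?CZ + ?D \<in> carrier_mat (ND + m) (ND + m)" using D by simp
  show "Sy ?PP + boldPhi S G J Q R P2 P3 \<in> carrier_mat (ND + m) (ND + m)" unfolding Phi using PhiC by simp
  fix u x :: "real vec" assume u: "u \<in> carrier_vec (ND + m)" and x: "x \<in> carrier_vec (ND + m)"
  obtain u1 u2 u3 u4 u5 u6 where us: "u1 \<in> carrier_vec n" "u2 \<in> carrier_vec D2" "u3 \<in> carrier_vec D3" "u4 \<in> carrier_vec D4"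
    "u5 \<in> carrier_vec q" "u6 \<in> carrier_vec m" "u = (u1 @\<^sub>v u2 @\<^sub>v u3 @\<^sub>v u4 @\<^sub>v u5) @\<^sub>v u6" using split_ND[OF u] by blast
  obtain x1 x2 x3 x4 x5 x6 where xs: "x1 \<in> carrier_vec n" "x2 \<in> carrier_vec D2" "x3 \<in> carrier_vec D3" "x4 \<in> carrier_vec D4"
    "x5 \<in> carrier_vec q" "x6 \<in> carrier_vec m" "x = (x1 @\<^sub>v x2 @\<^sub>v x3 @\<^sub>v x4 @\<^sub>v x5) @\<^sub>v x6" using split_ND[OF x] by blast
  define ua where "ua = u1 @\<^sub>v u2 @\<^sub>v u3 @\<^sub>v u4 @\<^sub>v u5"
  define xa where "xa = x1 @\<^sub>v x2 @\<^sub>v x3 @\<^sub>v x4 @\<^sub>v x5"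
  have ua: "ua \<in> carrier_vec ND" and xa: "xa \<in> carrier_vec ND" unfolding ua_def xa_def by (intro append_carrier_vec us xs)+
  have uE: "u = ua @\<^sub>v u6" and xE: "x = xa @\<^sub>v x6" using us xs by (simp_all only: ua_def xa_def)
  have Du: "u \<bullet> (?D *\<^sub>v x) = ua \<bullet> (Xi S J Q R *\<^sub>v xa) + u6 \<bullet> (sJ1 J *\<^sub>v x6)"
  proof -
    have "?D *\<^sub>v x = (Xi S J Q R *\<^sub>v xa) @\<^sub>v (diag_block_mat [sJ1 J] *\<^sub>v x6)"
      unfolding xE by (rule diag_block_mat_Cons_mult_vec) (use carrier_matD[OF Xi_carrier] carrier_matD[OF J1b] xa xs(6) in \<open>simp_all only:\<close>)
    then show ?thesis unfolding uE diag_block_mat_singleton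
      by (simp only: scalar_prod_append[OF ua us(6) mult_mat_vec_carrier[OF Xi_carrier xa] mult_mat_vec_carrier[OF J_carriers(1) xs(6)]])
  qed
  note c = mult_mat_vec_carrier[OF Sy_carrier[OF PP] x] mult_mat_vec_carrier[OF Sy_carrier[OF CZ] x] mult_mat_vec_carrier[OF D x]
  have "u \<bullet> ((Sy ?PP + boldPhi S G J Q R P2 P3) *\<^sub>v x) = u \<bullet> (Sy ?PP *\<^sub>v x) + (u \<bullet> (Sy ?CZ *\<^sub>v x) + u \<bullet> (?D *\<^sub>v x))"
    unfolding Phi add_mult_distrib_mat_vec[OF Sy_carrier[OF PP] PhiC x] add_mult_distrib_mat_vec[OF Sy_carrier[OF CZ] D x]
    by (simp only: scalar_prod_add_distrib[OF u c(1) add_carrier_vec[OF c(2,3)]] scalar_prod_add_distrib[OF u c(2,3)])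
  also have "\<dots> = (u \<bullet> (?CZ *\<^sub>v x) + u \<bullet> (?PP *\<^sub>v x)) + (x \<bullet> (?CZ *\<^sub>v u) + x \<bullet> (?PP *\<^sub>v u)) + u \<bullet> (?D *\<^sub>v x)"
    unfolding Sy_scalar_prod[OF PP u x] Sy_scalar_prod[OF CZ u x] by simp
  also have "u \<bullet> (?CZ *\<^sub>v x) + u \<bullet> (?PP *\<^sub>v x) = half_form u1 u3 u5 xa + u6 \<bullet> (sJt J *\<^sub>v (Sigma_mat S G *\<^sub>v xa))"
    unfolding us(7) xE by (rule form(1)[OF us(1-6) xa xs(6)])
  also have "x \<bullet> (?CZ *\<^sub>v u) + x \<bullet> (?PP *\<^sub>v u) = half_form x1 x3 x5 ua + x6 \<bullet> (sJt J *\<^sub>v (Sigma_mat S G *\<^sub>v ua))"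
    unfolding xs(7) uE by (rule form(1)[OF xs(1-6) ua us(6)])
  finally have rhs: "u \<bullet> ((Sy ?PP + boldPhi S G J Q R P2 P3) *\<^sub>v x)
    = half_form u1 u3 u5 xa + u6 \<bullet> (sJt J *\<^sub>v (Sigma_mat S G *\<^sub>v xa)) + (half_form x1 x3 x5 ua + x6 \<bullet> (sJt J *\<^sub>v (Sigma_mat S G *\<^sub>v ua)))
      + (ua \<bullet> (Xi S J Q R *\<^sub>v xa) + u6 \<bullet> (sJ1 J *\<^sub>v x6))" unfolding Du .
  have psi: "ua \<bullet> (Psi0 *\<^sub>v xa) = half_form u1 u3 u5 xa + half_form x1 x3 x5 ua + ua \<bullet> (Xi S J Q R *\<^sub>v xa)"
    unfolding ua_def xa_def by (rule Psi_form[OF us(1-5) xs(1-5)])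
  show "u \<bullet> (LMI *\<^sub>v x) = u \<bullet> ((Sy ?PP + boldPhi S G J Q R P2 P3) *\<^sub>v x)"
    unfolding rhs unfolding uE xE LMI_form[OF ua us(6) xa xs(6)] psi by simp
qed

end

subsection \<open>The number of unknowns\<close>

lemma card_upper_triangle: "2 * card {(a, b). a \<le> b \<and> b < (N :: nat)} = N * (N + 1)"
proof -
  have "{(a, b). a \<le> b \<and> b < N} = (\<lambda>(b, a). (a, b)) ` (SIGMA b:{..<N}. {..b})" by auto
  moreover have "inj_on (\<lambda>(b, a). (a, b)) (SIGMA b:{..<N}. {..b})" by (auto simp: inj_on_def)
  ultimately have "card {(a, b). a \<le> b \<and> b < N} = (\<Sum>b<N. Suc b)" by (simp add: card_image)
  moreover have "2 * (\<Sum>b<N. Suc b) = N * (N + 1)" by (induction N) auto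
  ultimately show ?thesis by simp
qed

lemma finite_block_entries: "finite (block_entries S X)"
proof (cases X)
  case (Blk_Q i)
  show ?thesis unfolding Blk_Q block_entries.simps by (rule finite_subset[of _ "{..dim_n S} \<times> {..dim_n S}"]) auto
next
  case (Blk_R i)
  show ?thesis unfolding Blk_R block_entries.simps by (rule finite_subset[of _ "{..dim_n S} \<times> {..dim_n S}"]) auto
next
  case Blk_P1
  show ?thesis unfolding Blk_P1 block_entries.simps by (rule finite_subset[of _ "{..dim_n S} \<times> {..dim_n S}"]) auto
next
  case Blk_P3
  show ?thesis unfolding Blk_P3 block_entries.simps by (rule finite_subset[of _ "{..d_tot S * dim_n S} \<times> {..d_tot S * dim_n S}"]) auto
qed auto

lemma num_unknowns_sum:
  "num_unknowns S = (num_delays S + 1) * (dim_n S * dim_l S) + (num_delays S + 1) * (dim_m S * dim_l S)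
    + dim_n S * (kap_tot S * dim_l S) + dim_m S * (kap_tot S * dim_l S)
    + (2 * num_delays S + 1) * card {(a, b). a \<le> b \<and> b < dim_n S}
    + dim_n S * (d_tot S * dim_n S) + card {(a, b). a \<le> b \<and> b < d_tot S * dim_n S}"
proof -
  let ?c = "\<lambda>X. card (block_entries S X)" and ?\<nu> = "num_delays S"
  have im: "sum ?c (B ` A) = (\<Sum>i\<in>A. ?c (B i))" if "inj B" for B :: "nat \<Rightarrow> unknown_block" and A
    using that by (subst sum.reindex) (auto intro: inj_on_subset)
  have inj: "inj Blk_L" "inj Blk_K" "inj Blk_Lhat" "inj Blk_Khat" "inj Blk_Q" "inj Blk_R"
    by (auto simp: inj_def)
  have "num_unknowns S = sum ?c (unknown_blocks S)"
    unfolding num_unknowns_def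
    by (rule card_SigmaI) (auto simp: unknown_blocks_def finite_block_entries simp del: block_entries.simps)
  also have "\<dots> = (\<Sum>i\<in>{0..?\<nu>}. ?c (Blk_L i)) + (\<Sum>i\<in>{0..?\<nu>}. ?c (Blk_K i))
     + (\<Sum>i\<in>{1..?\<nu>}. ?c (Blk_Lhat i)) + (\<Sum>i\<in>{1..?\<nu>}. ?c (Blk_Khat i))
     + (\<Sum>i\<in>{1..?\<nu>}. ?c (Blk_Q i)) + (\<Sum>i\<in>{1..?\<nu>}. ?c (Blk_R i)) + (?c Blk_P1 + ?c Blk_P2 + ?c Blk_P3)"
    unfolding unknown_blocks_def
    by (subst sum.union_disjoint, simp, simp, fastforce)+
      (simp only: im[OF inj(1)] im[OF inj(2)] im[OF inj(3)] im[OF inj(4)] im[OF inj(5)] im[OF inj(6)], simp del: block_entries.simps)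
  also have "(\<Sum>i\<in>{1..?\<nu>}. ?c (Blk_Lhat i)) = dim_n S * (kap_tot S * dim_l S)"
    by (simp add: kap_tot_def sum_distrib_left sum_distrib_right)
  also have "(\<Sum>i\<in>{1..?\<nu>}. ?c (Blk_Khat i)) = dim_m S * (kap_tot S * dim_l S)"
    by (simp add: kap_tot_def sum_distrib_left sum_distrib_right)
  finally show ?thesis by (simp add: algebra_simps)
qed

text \<open>\<open>P1\<close> and the \<open>2 \<nu>\<close> blocks \<open>Q\<close>,
  \<open>R\<close> contribute \<open>n (n + 1) / 2\<close> each, \<open>P2\<close> contributes
  \<open>d n^2\<close>, \<open>P3\<close> contributes \<open>d n (d n + 1) / 2\<close>, and the
  gains together \<open>\<beta> l (n + m)\<close>. These add up to the coefficients
  \<open>0.5 d^2 + d + \<nu> + 0.5\<close> and \<open>0.5 d + 0.5 + \<nu> + \<beta> l\<close>, which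
  differ from the \<open>0.5 d^2 + 0.5 d + \<nu> + 1\<close> and
  \<open>0.5 d + 1 + \<beta> l\<close> of the informal statement; the order of growth is the
  same.\<close>

lemma num_unknowns_formula:
  "real (num_unknowns S) =
           (0.5 * real (d_tot S)^2 + real (d_tot S) + real (num_delays S) + 0.5) * real (dim_n S)^2
         + (0.5 * real (d_tot S) + 0.5 + real (num_delays S) + real (beta S) * real (dim_l S)) * real (dim_n S)
         + real (beta S) * real (dim_l S) * real (dim_m S)"
proof -
  have tri: "real (card {(a, b). a \<le> b \<and> b < N}) = real N * (real N + 1) / 2" for N :: nat
    using arg_cong[OF card_upper_triangle[of N], of real] by (simp add: distrib_left mult.commute)
  show ?thesis
    unfolding num_unknowns_sum of_nat_add of_nat_mult tri
    by (simp add: beta_def algebra_simps power2_eq_square add_divide_distrib)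
qed

text \<open>Here \<open>d\<close> and \<open>n\<close> grow together while \<open>\<nu>\<close>,
  \<open>l\<close>, \<open>m\<close> and \<open>c\<close>, which stands for the sum of all
  \<open>\<delta>_i + \<mu>_i\<close>, stay fixed; \<open>\<beta>\<close> then grows linearly in
  \<open>d\<close>, so the gain terms are of lower order.\<close>

lemma unknowns_bigo:
  fixes \<nu> l m c :: real
  assumes nn: "\<nu> \<ge> 0" "l \<ge> 0" "m \<ge> 0" "c \<ge> 0"
  shows "(\<lambda>(d, n). (let \<beta> = 1 + \<nu> + real d + c in
             (0.5 * real d^2 + real d + \<nu> + 0.5) * real n^2
           + (0.5 * real d + 0.5 + \<nu> + \<beta> * l) * real n
           + \<beta> * l * m))
         \<in> O[at_top \<times>\<^sub>F at_top](\<lambda>(d, n). real d^2 * real n^2)"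
\<comment> \<open>One summand for each term of the count, valid for \<open>d\<close> and
  \<open>n\<close> at least 1, where \<open>\<beta>\<close> is at most
  \<open>(2 + \<nu> + c) * d\<close>.\<close>
proof (rule bigoI[where c = "(2 + \<nu>) + (1 + \<nu> + (2 + \<nu> + c) * l) + (2 + \<nu> + c) * l * m"])
  have "eventually (\<lambda>x. 1 \<le> fst x \<and> 1 \<le> snd x) (at_top \<times>\<^sub>F at_top :: (nat \<times> nat) filter)"
    by (rule eventually_prodI) (rule eventually_ge_at_top)+
  then show "eventually (\<lambda>x. norm (case x of (d, n) \<Rightarrow> let \<beta> = 1 + \<nu> + real d + c in
             (0.5 * real d^2 + real d + \<nu> + 0.5) * real n^2
           + (0.5 * real d + 0.5 + \<nu> + \<beta> * l) * real n
           + \<beta> * l * m) \<le> ((2 + \<nu>) + (1 + \<nu> + (2 + \<nu> + c) * l) + (2 + \<nu> + c) * l * m) *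
      norm (case x of (d, n) \<Rightarrow> real d^2 * real n^2)) (at_top \<times>\<^sub>F at_top)"
  proof eventually_elim
    case (elim x)
    obtain d n where x: "x = (d, n)" by (cases x)
    define D N where "D = real d" and "N = real n"
    have DN: "1 \<le> D" "1 \<le> N" using elim by (simp_all add: x D_def N_def)
    define W where "W = D^2 * N^2"
    have D1: "1 \<le> D^2" "D \<le> D^2" and N1: "1 \<le> N^2" "N \<le> N^2"
      using DN one_le_power[of D 2] one_le_power[of N 2] self_le_power[of D 2] self_le_power[of N 2] by auto
    have le: "a * b \<le> W" if "0 \<le> a" "a \<le> D^2" "0 \<le> b" "b \<le> N^2" for a b
      unfolding W_def using that by (intro mult_mono) auto
    have B: "1 + \<nu> + D + c \<le> (2 + \<nu> + c) * D"
    proof -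
      have "(1 + \<nu> + c) * 1 \<le> (1 + \<nu> + c) * D" using DN nn by (intro mult_left_mono) auto
      then show ?thesis by (simp add: algebra_simps)
    qed
    have t1: "(0.5 * D^2 + D + \<nu> + 0.5) * N^2 \<le> (2 + \<nu>) * W"
    proof -
      have "\<nu> * 1 \<le> \<nu> * D^2" using D1 nn by (intro mult_left_mono) auto
      then have "0.5 * D^2 + D + \<nu> + 0.5 \<le> (2 + \<nu>) * D^2" using D1 by (simp add: distrib_right)
      from mult_right_mono[OF this, of "N^2"] show ?thesis by (simp add: W_def mult.assoc)
    qed
    have t2: "(0.5 * D + 0.5 + \<nu> + (1 + \<nu> + D + c) * l) * N \<le> (1 + \<nu> + (2 + \<nu> + c) * l) * W"
    proof -
      have "\<nu> * 1 \<le> \<nu> * D" using DN nn by (intro mult_left_mono) auto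
      moreover have "(1 + \<nu> + D + c) * l \<le> (2 + \<nu> + c) * D * l" using B nn by (intro mult_right_mono) auto
      ultimately have "0.5 * D + 0.5 + \<nu> + (1 + \<nu> + D + c) * l \<le> (1 + \<nu> + (2 + \<nu> + c) * l) * D"
        using DN by (simp add: algebra_simps)
      from mult_right_mono[OF this, of N] have "(0.5 * D + 0.5 + \<nu> + (1 + \<nu> + D + c) * l) * N \<le> (1 + \<nu> + (2 + \<nu> + c) * l) * (D * N)"
        using DN by (simp add: mult.assoc)
      also have "\<dots> \<le> (1 + \<nu> + (2 + \<nu> + c) * l) * W" using le[of D N] DN D1 N1 nn by (intro mult_left_mono) auto
      finally show ?thesis .
    qed
    have t3: "(1 + \<nu> + D + c) * l * m \<le> (2 + \<nu> + c) * l * m * W"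
    proof -
      have "(1 + \<nu> + D + c) * (l * m) \<le> (2 + \<nu> + c) * D * (l * m)" using B nn by (intro mult_right_mono) auto
      also have "\<dots> = (2 + \<nu> + c) * (l * m) * (D * 1)" by simp
      also have "\<dots> \<le> (2 + \<nu> + c) * (l * m) * W" using le[of D 1] DN D1 N1 nn by (intro mult_left_mono) auto
      finally show ?thesis by (simp add: mult.assoc)
    qed
    have "0 \<le> (0.5 * D^2 + D + \<nu> + 0.5) * N^2 + (0.5 * D + 0.5 + \<nu> + (1 + \<nu> + D + c) * l) * N + (1 + \<nu> + D + c) * l * m"
      using DN nn by (intro add_nonneg_nonneg mult_nonneg_nonneg) auto
    moreover have "0 \<le> W" using DN by (simp add: W_def)
    ultimately show ?case using t1 t2 t3
      unfolding x prod.case Let_def D_def[symmetric] N_def[symmetric] W_def[symmetric]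
      by (simp add: distrib_right)
  qed
qed

subsection \<open>Dissipativity and exponential stability\<close>

definition cont_vec :: "nat \<Rightarrow> real set \<Rightarrow> (real \<Rightarrow> real vec) \<Rightarrow> bool"
  where "cont_vec N X u \<longleftrightarrow> (\<forall>t\<in>X. u t \<in> carrier_vec N) \<and> (\<forall>j<N. continuous_on X (\<lambda>t. u t $ j))"

lemma cont_vec_append:
  assumes u: "cont_vec a X u" and w: "cont_vec b X w"
  shows "cont_vec (a + b) X (\<lambda>t. u t @\<^sub>v w t)"
  unfolding cont_vec_def
proof (intro conjI ballI allI impI)
  fix t assume "t \<in> X" then show "u t @\<^sub>v w t \<in> carrier_vec (a + b)" using u w by (auto simp: cont_vec_def)
next
  fix p assume p: "p < a + b"
  show "continuous_on X (\<lambda>t. (u t @\<^sub>v w t) $ p)"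
  proof (cases "p < a")
    case True
    then have "continuous_on X (\<lambda>t. u t $ p)" using u by (simp add: cont_vec_def)
    then show ?thesis
    proof (rule continuous_on_eq)
      fix t assume "t \<in> X"
      then have "u t \<in> carrier_vec a" "w t \<in> carrier_vec b" using u w by (auto simp: cont_vec_def)
      then show "u t $ p = (u t @\<^sub>v w t) $ p" using True by auto
    qed
  next
    case False
    then have "continuous_on X (\<lambda>t. w t $ (p - a))" using w p by (simp add: cont_vec_def)
    then show ?thesis
    proof (rule continuous_on_eq)
      fix t assume "t \<in> X"
      then have "u t \<in> carrier_vec a" "w t \<in> carrier_vec b" using u w by (auto simp: cont_vec_def)
      then show "w t $ (p - a) = (u t @\<^sub>v w t) $ p" using False p by auto
    qed
  qed
qed

lemma cont_vec_vconcat: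
  assumes "\<And>i. i \<in> set l \<Longrightarrow> cont_vec (k i) X (x i)"
  shows "cont_vec (\<Sum>i\<leftarrow>l. k i) X (\<lambda>t. vconcat (map (\<lambda>i. x i t) l))"
  using assms
proof (induction l)
  case (Cons i l)
  then have "cont_vec (k i + (\<Sum>i\<leftarrow>l. k i)) X (\<lambda>t. x i t @\<^sub>v vconcat (map (\<lambda>i. x i t) l))"
    by (intro cont_vec_append) auto
  then show ?case by simp
qed (simp add: cont_vec_def)

lemma cont_vec_mult_mat:
  assumes A: "A \<in> carrier_mat k N" and u: "cont_vec N X u"
  shows "cont_vec k X (\<lambda>t. A *\<^sub>v u t)"
  unfolding cont_vec_def
proof (intro conjI ballI allI impI)
  fix t assume "t \<in> X" then show "A *\<^sub>v u t \<in> carrier_vec k" using A u by (auto simp: cont_vec_def)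
next
  fix p assume p: "p < k"
  have "continuous_on X (\<lambda>t. \<Sum>j<N. A $$ (p, j) * u t $ j)"
    using u by (intro continuous_on_sum continuous_on_mult_left) (auto simp: cont_vec_def)
  then show "continuous_on X (\<lambda>t. (A *\<^sub>v u t) $ p)"
  proof (rule continuous_on_eq)
    fix t assume "t \<in> X"
    then show "(\<Sum>j<N. A $$ (p, j) * u t $ j) = (A *\<^sub>v u t) $ p"
      using A u p by (auto simp: cont_vec_def scalar_prod_def lessThan_atLeast0)
  qed
qed

lemma continuous_on_half_line:
  fixes f :: "real \<Rightarrow> real"
  assumes "\<And>T. continuous_on {a..T} f"
  shows "continuous_on {a..} f"
  unfolding continuous_on_eq_continuous_within
proof
  fix x assume x: "x \<in> {a..}"
  have "at x within {a..} = at x within {a..x + 1}" by (rule at_within_nhd[of x "{..<x + 1}"]) auto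
  moreover have "continuous (at x within {a..x + 1}) f"
    using assms[of "x + 1"] x by (auto simp: continuous_on_eq_continuous_within)
  ultimately show "continuous (at x within {a..}) f" by simp
qed

text \<open>The case of a single interval in the definition.\<close>

lemma abs_continuous_imp_continuous:
  assumes "abs_continuous_on_Icc a b u"
  shows "continuous_on {a..b} u"
  unfolding continuous_on_iff
proof (intro ballI allI impI)
  fix s \<epsilon> :: real assume s: "s \<in> {a..b}" and \<epsilon>: "\<epsilon> > 0"
  obtain \<delta> where \<delta>: "\<delta> > 0" "\<forall>(N::nat) x y. (\<forall>k<N. a \<le> x k \<and> x k \<le> y k \<and> y k \<le> b) \<and>
      disjoint_family_on (\<lambda>k. {x k<..<y k}) {..<N} \<and> (\<Sum>k<N. y k - x k) < \<delta> \<longrightarrow> (\<Sum>k<N. \<bar>u (y k) - u (x k)\<bar>) < \<epsilon>"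
    using assms[unfolded abs_continuous_on_Icc_def, THEN spec, THEN mp, OF \<epsilon>] by (elim exE conjE)
  have ord: "\<bar>u y - u x\<bar> < \<epsilon>" if "a \<le> x" "x \<le> y" "y \<le> b" "y - x < \<delta>" for x y
  proof -
    have "(\<Sum>k<1::nat. \<bar>u y - u x\<bar>) < \<epsilon>"
      by (rule \<delta>(2)[THEN spec, THEN spec, THEN spec, of 1 "\<lambda>_. x" "\<lambda>_. y", THEN mp]) (use that in \<open>simp_all add: disjoint_family_on_def\<close>)
    then show ?thesis by simp
  qed
  have "dist (u t) (u s) < \<epsilon>" if t: "t \<in> {a..b}" "dist t s < \<delta>" for t
    using ord[of t s] ord[of s t] s t by (cases "t \<le> s") (simp_all add: dist_real_def abs_minus_commute)
  then show "\<exists>d>0. \<forall>t\<in>{a..b}. dist t s < d \<longrightarrow> dist (u t) (u s) < \<epsilon>" using \<delta>(1) by blast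
qed

section \<open>Continuity of \<theta> and classical derivatives of solutions\<close>

context delay_system
begin

lemma cont_vec_delayed:
  assumes e: "signal e t0" and i: "i \<le> \<nu>"
  shows "cont_vec n {t0..T} (\<lambda>t. e (t - delay S i))"
  unfolding cont_vec_def
proof (intro conjI ballI allI impI)
  have r: "t0 - r_max S \<le> t - delay S i" if "t \<in> {t0..T}" for t
    using that delay_le_r_max[OF i] by simp
  then show "t \<in> {t0..T} \<Longrightarrow> e (t - delay S i) \<in> carrier_vec n" for t using signal_carrier[OF e] by blast
  fix j assume "j < n"
  then have c: "continuous_on {t0 - r_max S..} (\<lambda>s. e s $ j)" using e by (simp add: signal_def)
  show "continuous_on {t0..T} (\<lambda>t. e (t - delay S i) $ j)"
    by (rule continuous_on_compose2[OF c]) (use delay_le_r_max[OF i] in \<open>auto intro!: continuous_intros\<close>)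
qed

lemma cont_vec_moment_block:
  assumes e: "signal e t0" and i: "i \<in> {1..\<nu>}" and g: "L2_on (Iint S i) N g"
  shows "cont_vec (N * n) {t0..T} (\<lambda>t. moment_block S N g e t i)"
  unfolding cont_vec_def
proof (intro conjI ballI allI impI)
  fix a assume a: "a < N * n"
  define p j where "p = a div n" and "j = a mod n"
  have n: "0 < n" using a by (cases n) auto
  have pj: "p < N" "j < n" "a = p * n + j" using a n by (auto simp: p_def j_def less_mult_imp_div_less)
  have e': "continuous_on {t0 - r_max S..T} (\<lambda>s. e s $ j)"
    using continuous_on_subset[of "{t0 - r_max S..}" _ "{t0 - r_max S..T}"] e pj(2) unfolding signal_def by auto
  have g': "integrable (lebesgue_on {- delay S i..- delay S (i - 1)}) (\<lambda>\<tau>. g \<tau> $ p)"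
    using square_integrable_imp_integrable L2_on_component[OF g pj(1)] unfolding Iint_def by blast
  have "continuous_on {t0 - r_max S - - delay S i..T - - delay S (i - 1)} (\<lambda>s. LINT \<tau>|lebesgue_on (Iint S i). g \<tau> $ p * e (s + \<tau>) $ j)"
    unfolding Iint_def by (rule continuous_on_delay_integral[OF g' e'])
  then have "continuous_on {t0..T} (\<lambda>s. LINT \<tau>|lebesgue_on (Iint S i). g \<tau> $ p * e (s + \<tau>) $ j)"
    by (rule continuous_on_subset) (use delay_le_r_max[of i] delay_nonneg[of "i - 1"] i in auto)
  then show "continuous_on {t0..T} (\<lambda>t. moment_block S N g e t i $ a)"
    by (rule continuous_on_eq) (use moment_block_index[OF i g signal_history[OF e] pj(1,2)] pj(3) in auto)
qed (use moment_block_carrier[OF i] in simp)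

lemma cont_vec_moments:
  assumes e: "signal e t0" and g: "\<And>i. i \<in> {1..\<nu>} \<Longrightarrow> L2_on (Iint S i) (N i) (g i)"
  shows "cont_vec ((\<Sum>i=1..\<nu>. N i) * n) {t0..T} (moments S N g e)"
proof -
  have "cont_vec (\<Sum>i\<leftarrow>idx S. N i * n) {t0..T} (\<lambda>t. vconcat (map (\<lambda>i. moment_block S (N i) (g i) e t i) (idx S)))"
  proof (rule cont_vec_vconcat)
    fix i assume "i \<in> set (idx S)"
    then have i: "i \<in> {1..\<nu>}" by (simp only: set_idx)
    show "cont_vec (N i * n) {t0..T} (\<lambda>t. moment_block S (N i) (g i) e t i)" by (rule cont_vec_moment_block[OF e i g[OF i]])
  qed
  then show ?thesis by (simp only: sum_list_idx sum_distrib_right moments_def[abs_def])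
qed

lemma vartheta_moments:
  "vartheta S e w t = e t @\<^sub>v vconcat (map (\<lambda>i. e (t - delay S i)) (idx S)) @\<^sub>v moments S (varkap_of S) nh e t
    @\<^sub>v moments S (mu_of S) ne e t @\<^sub>v w t"
  by (simp only: vartheta_def xi_def afrak_def moments_def moment_block_def normalized_def)

lemma cont_vec_vartheta:
  assumes e: "signal e t0" and w: "cont_vec (dim_q S) {t0..T} w"
  shows "cont_vec ND {t0..T} (vartheta S e w)"
proof -
  have "cont_vec n {t0..T} e" using cont_vec_delayed[OF e, of 0] delay_0 by simp
  moreover have "cont_vec D2 {t0..T} (\<lambda>t. vconcat (map (\<lambda>i. e (t - delay S i)) (idx S)))"
  proof -
    have "cont_vec (\<Sum>i\<leftarrow>idx S. n) {t0..T} (\<lambda>t. vconcat (map (\<lambda>i. e (t - delay S i)) (idx S)))"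
    proof (rule cont_vec_vconcat)
      fix i assume "i \<in> set (idx S)"
      then have "i \<le> \<nu>" by (simp only: set_idx atLeastAtMost_iff)
      then show "cont_vec n {t0..T} (\<lambda>t. e (t - delay S i))" by (rule cont_vec_delayed[OF e])
    qed
    then show ?thesis by (simp only: sum_list_idx) simp
  qed
  moreover have "cont_vec D3 {t0..T} (moments S (varkap_of S) nh e)" "cont_vec D4 {t0..T} (moments S (mu_of S) ne e)"
    unfolding varkap_tot_def mu_tot_def
    by (rule cont_vec_moments[OF e], erule normalized_L2(2), rule cont_vec_moments[OF e], erule normalized_L2(3))
  ultimately show ?thesis unfolding vartheta_moments[abs_def] by (intro cont_vec_append w)
qed

text \<open>The initial function covers the past window and absolute continuity the future; the two
  closed pieces overlap at \<open>t0\<close>.\<close>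

lemma solution_signal:
  assumes sol: "is_solution S G t0 \<psi> w e"
  shows "signal e t0"
  unfolding signal_def
proof (intro conjI allI impI)
  have \<psi>: "\<psi> \<in> C_space S" and init: "\<And>\<theta>. \<theta> \<in> Jint S \<Longrightarrow> e (t0 + \<theta>) = \<psi> \<theta>"
    and ec: "\<And>t. t \<ge> t0 \<Longrightarrow> e t \<in> carrier_vec n"
    and ac: "\<And>k T. k < n \<Longrightarrow> T \<ge> t0 \<Longrightarrow> abs_continuous_on_Icc t0 T (\<lambda>t. e t $ k)"
    using sol by (auto simp: is_solution_def)
  have past: "s - t0 \<in> Jint S \<and> e s = \<psi> (s - t0)" if "s \<in> {t0 - r_max S..t0}" for s
    using init[of "s - t0"] that by (auto simp: Jint_def)
  show "e s \<in> carrier_vec n" if "t0 - r_max S \<le> s" for s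
    using ec[of s] past[of s] C_space_carrier[OF \<psi>] that by (cases "s \<le> t0") auto
  fix j assume j: "j < n"
  have 1: "continuous_on {t0 - r_max S..t0} (\<lambda>s. e s $ j)"
  proof (rule continuous_on_eq)
    show "continuous_on {t0 - r_max S..t0} (\<lambda>s. \<psi> (s - t0) $ j)"
      by (rule continuous_on_compose2[OF C_space_continuous[OF \<psi> j]]) (auto simp: Jint_def intro!: continuous_intros)
  qed (use past in auto)
  show "continuous_on {t0 - r_max S..} (\<lambda>s. e s $ j)"
  proof (rule continuous_on_half_line)
    fix T
    show "continuous_on {t0 - r_max S..T} (\<lambda>s. e s $ j)"
    proof (cases "T \<le> t0")
      case True then show ?thesis using continuous_on_subset[OF 1] by auto
    next
      case False
      then have "continuous_on {t0..T} (\<lambda>s. e s $ j)" by (intro abs_continuous_imp_continuous ac j) auto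
      then have "continuous_on ({t0 - r_max S..t0} \<union> {t0..T}) (\<lambda>s. e s $ j)"
        by (intro continuous_on_closed_Un 1) auto
      moreover have "{t0 - r_max S..t0} \<union> {t0..T} = {t0 - r_max S..T}" using False r_max_nonneg by auto
      ultimately show ?thesis by simp
    qed
  qed
qed

text \<open>An absolutely continuous function whose almost everywhere derivative is continuous is the
  integral of that derivative, hence differentiable at every time.\<close>

lemma solution_classical_derivative:
  assumes sol: "is_solution S G t0 \<psi> w e" and w: "\<And>T. cont_vec (dim_q S) {t0..T} w"
    and \<Omega>: "Omega S G \<in> carrier_mat n ND" and t: "t > t0"
  shows "vec_deriv n e (Omega S G *\<^sub>v vartheta S e w t) t"
  unfolding vec_deriv_def
proof (intro conjI allI impI)
  have e: "signal e t0" by (rule solution_signal[OF sol])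
  have F: "cont_vec n {t0..t + 1} (\<lambda>s. Omega S G *\<^sub>v vartheta S e w s)"
    by (rule cont_vec_mult_mat[OF \<Omega> cont_vec_vartheta[OF e w]])
  then show "Omega S G *\<^sub>v vartheta S e w t \<in> carrier_vec n" using t by (auto simp: cont_vec_def)
  fix k assume k: "k < n"
  define f where "f s = (Omega S G *\<^sub>v vartheta S e w s) $ k" for s
  have f: "continuous_on {t0..t + 1} f" using F k by (simp add: cont_vec_def f_def)
  have "AE s in lebesgue_on {t0..}. \<forall>k<n. ((\<lambda>s. e s $ k) has_real_derivative (Omega S G *\<^sub>v vartheta S e w s) $ k) (at s)"
    using sol by (simp add: is_solution_def)
  then obtain N where N: "N \<in> null_sets (lebesgue_on {t0..})"
    "{s \<in> space (lebesgue_on {t0..}). \<not> (\<forall>k<n. ((\<lambda>s. e s $ k) has_real_derivative (Omega S G *\<^sub>v vartheta S e w s) $ k) (at s))} \<subseteq> N"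
    by (auto simp: eventually_ae_filter)
  have neg: "negligible N" using N(1) by (simp add: null_sets_restrict_space negligible_iff_null_sets)
  have D: "((\<lambda>s. e s $ k) has_real_derivative f s) (at s)" if "s \<ge> t0" "s \<notin> N" for s
    using N(2) that k by (auto simp: f_def)
  have int: "(f has_integral e s $ k - e t0 $ k) {t0..s}" if s: "s \<in> {t0..t + 1}" for s
  proof (rule abs_continuous_has_integral[OF _ _ neg])
    show "abs_continuous_on_Icc t0 s (\<lambda>s. e s $ k)" using sol k s by (simp add: is_solution_def)
  qed (use s D in \<open>auto intro: has_field_derivative_at_within\<close>)
  have "((\<lambda>s. integral {t0..s} f) has_real_derivative f t) (at t within {t0..t + 1})"
    using integral_has_vector_derivative[OF f, of t] t by (simp add: has_real_derivative_iff_has_vector_derivative)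
  then have "((\<lambda>s. integral {t0..s} f) has_real_derivative f t) (at t)"
    using t by (simp add: at_within_Icc_at)
  then have int_deriv: "((\<lambda>s. e t0 $ k + integral {t0..s} f) has_real_derivative f t) (at t)"
    by (auto intro!: derivative_eq_intros)
  have ev: "eventually (\<lambda>s. e t0 $ k + integral {t0..s} f = e s $ k) (nhds t)"
  proof -
    have "eventually (\<lambda>s. s \<in> {t0<..<t + 1}) (nhds t)" using t by (intro eventually_nhds_in_open) auto
    then show ?thesis
    proof eventually_elim
      case (elim s)
      then show ?case using integral_unique[OF int[of s]] by simp
    qed
  qed
  show "((\<lambda>s. e s $ k) has_real_derivative (Omega S G *\<^sub>v vartheta S e w t) $ k) (at t)"
    unfolding f_def[symmetric] by (rule iffD1[OF DERIV_cong_ev[OF refl ev refl] int_deriv])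
qed

end

section \<open>The dissipation inequality and its consequences\<close>

context lmi_data
begin

text \<open>Written with the right-hand side of (E) in place of the derivative of \<open>e\<close>,
  so that the inequalities below make sense for any history.\<close>

definition lyap_rate :: "(real \<Rightarrow> real vec) \<Rightarrow> (real \<Rightarrow> real vec) \<Rightarrow> real \<Rightarrow> real"
  where "lyap_rate e w t = 2 * (lyap_state e t \<bullet> (Pm *\<^sub>v lyap_state_rate e (Omega S G *\<^sub>v vartheta S e w t) t))
    + (\<Sum>i=1..\<nu>. boundary_rate e t i)"

lemma vartheta_carrier: "history S e t \<Longrightarrow> w t \<in> carrier_vec q \<Longrightarrow> vartheta S e w t \<in> carrier_vec ND"
  unfolding vartheta_moments by (rule Xi_form_moments(2))

lemma vartheta_parts:
  assumes h: "history S e t"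
  shows "e t \<in> carrier_vec n" "vconcat (map (\<lambda>i. e (t - delay S i)) (idx S)) \<in> carrier_vec D2"
    "moments S (varkap_of S) nh e t \<in> carrier_vec D3" "moments S (mu_of S) ne e t \<in> carrier_vec D4"
proof -
  show "e t \<in> carrier_vec n" by (rule history_carrier_0[OF h])
  show "vconcat (map (\<lambda>i. e (t - delay S i)) (idx S)) \<in> carrier_vec D2"
    by (rule vconcat_idx_carrier_const) (rule history_carrier[OF h], simp)
  show "moments S (varkap_of S) nh e t \<in> carrier_vec D3" "moments S (mu_of S) ne e t \<in> carrier_vec D4"
    using moments_carrier by (simp_all add: varkap_tot_def mu_tot_def)
qed

text \<open>Twice \<open>half_form\<close> is the derivative of the \<open>P\<close>-part less the
  \<open>J2\<close>-part of the supply, and the form of \<open>Xi\<close> accounts for the boundary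
  rates and for \<open>J3\<close>; what remains are the Bessel gaps. All estimates are postponed, so
  this is an identity.\<close>

lemma lyap_rate_supply:
  fixes e w t
  assumes h: "history S e t" and w: "w t \<in> carrier_vec q"
  defines "\<theta> \<equiv> vartheta S e w t"
  shows "lyap_rate e w t - supply_fun J (zeta S G e w t) (w t)
    = \<theta> \<bullet> (Psi0 *\<^sub>v \<theta>) - (sJt J *\<^sub>v (Sigma_mat S G *\<^sub>v \<theta>)) \<bullet> (mat_inv (sJ1 J) *\<^sub>v (sJt J *\<^sub>v (Sigma_mat S G *\<^sub>v \<theta>)))
      - (\<Sum>i=1..\<nu>. energy e t (R i) i - (form_h e t i + form_eps e t i))"
proof -
  note p = vartheta_parts[OF h] w
  have \<theta>: "\<theta> \<in> carrier_vec ND" unfolding \<theta>_def by (rule vartheta_carrier[where w = w, OF h w])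
  have psi: "\<theta> \<bullet> (Psi0 *\<^sub>v \<theta>) = 2 * half_form (e t) (moments S (varkap_of S) nh e t) (w t) \<theta> + \<theta> \<bullet> (Xi S J Q R *\<^sub>v \<theta>)"
    unfolding \<theta>_def vartheta_moments by (subst Psi_form[OF p p]) simp
  have xi: "\<theta> \<bullet> (Xi S J Q R *\<^sub>v \<theta>) = (\<Sum>i=1..\<nu>. boundary_rate e t i + energy e t (R i) i - (form_h e t i + form_eps e t i)) - w t \<bullet> (sJ3 J *\<^sub>v w t)"
    unfolding \<theta>_def vartheta_moments by (rule Xi_form_moments(1)[OF h w])
  have N: "Nmat *\<^sub>v \<theta> = vconcat (map (moment_rate e t) (idx S))"
    unfolding \<theta>_def vartheta_moments Nmat_mult_vec[OF p] by (rule boldM_rate[OF h])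
  have half: "half_form (e t) (moments S (varkap_of S) nh e t) (w t) \<theta>
    = lyap_state e t \<bullet> (Pm *\<^sub>v lyap_state_rate e (Omega S G *\<^sub>v \<theta>) t) - w t \<bullet> ((sJ2 J)\<^sup>\<top> *\<^sub>v (Sigma_mat S G *\<^sub>v \<theta>))"
    unfolding half_form_def boldI_moments[OF h] N lyap_state_def lyap_state_rate_def by (rule refl)
  have s: "supply_fun J (zeta S G e w t) (w t)
    = (sJt J *\<^sub>v (Sigma_mat S G *\<^sub>v \<theta>)) \<bullet> (mat_inv (sJ1 J) *\<^sub>v (sJt J *\<^sub>v (Sigma_mat S G *\<^sub>v \<theta>)))
      + 2 * (w t \<bullet> ((sJ2 J)\<^sup>\<top> *\<^sub>v (Sigma_mat S G *\<^sub>v \<theta>))) + w t \<bullet> (sJ3 J *\<^sub>v w t)"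
    unfolding zeta_def \<theta>_def[symmetric] by (rule supply_fun_form[OF mult_mat_vec_carrier[OF Sigma_carrier \<theta>] w])
  show ?thesis
    unfolding lyap_rate_def s psi xi half \<theta>_def[symmetric] by (simp add: sum.distrib sum_subtractf)
qed

lemma Bessel_gap_nonneg:
  assumes h: "history S e t" and i: "i \<in> {1..\<nu>}"
  shows "0 \<le> energy e t (R i) i - (form_h e t i + form_eps e t i)"
  using moment_chunk_Bessel(2)[OF i h QR_carrier(2)[OF i] QR_psd(2)[OF i]] by simp

lemma dissipation_rate:
  assumes lmi: "neg_def LMI"
  obtains c where "c > 0" "\<And>e w t. history S e t \<Longrightarrow> w t \<in> carrier_vec q \<Longrightarrow>
    lyap_rate e w t - supply_fun J (zeta S G e w t) (w t)
      \<le> - c * (vartheta S e w t \<bullet> vartheta S e w t) - (\<Sum>i=1..\<nu>. energy e t (R i) i - (form_h e t i + form_eps e t i))"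
proof -
  obtain c where c: "c > 0" "\<And>x. x \<in> carrier_vec ND \<Longrightarrow>
    x \<bullet> (Psi0 *\<^sub>v x) - (sJt J *\<^sub>v (Sigma_mat S G *\<^sub>v x)) \<bullet> (mat_inv (sJ1 J) *\<^sub>v (sJt J *\<^sub>v (Sigma_mat S G *\<^sub>v x)))
    \<le> - c * (x \<bullet> x)"
    using Schur_complement_bound[OF lmi] by blast
  show thesis
  proof (rule that[OF c(1)])
    fix e w :: "real \<Rightarrow> real vec" and t assume h: "history S e t" and w: "w t \<in> carrier_vec q"
    show "lyap_rate e w t - supply_fun J (zeta S G e w t) (w t)
      \<le> - c * (vartheta S e w t \<bullet> vartheta S e w t) - (\<Sum>i=1..\<nu>. energy e t (R i) i - (form_h e t i + form_eps e t i))"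
      unfolding lyap_rate_supply[where w = w, OF h w] using c(2)[OF vartheta_carrier[where w = w, OF h w]] by simp
  qed
qed

lemma lyap_solution_derivative:
  assumes e: "signal e t0" and t: "t > t0" and d: "vec_deriv n e (Omega S G *\<^sub>v vartheta S e w t) t"
  shows "(lyap e has_real_derivative lyap_rate e w t) (at t)"
  unfolding lyap_rate_def by (rule lyap_has_derivative[OF e t d])

text \<open>Removes the single time \<open>t0\<close>, where the two-sided derivative of
  \<open>lyap\<close> is not established.\<close>

lemma AE_neq: "AE t in lebesgue_on X. t \<noteq> (c::real)" if "X \<in> sets lebesgue"
proof -
  have "AE t in lebesgue. t \<noteq> c" using AE_lborel_singleton[of c] by (rule AE_completion)
  then show ?thesis using that by (simp add: AE_restrict_space_iff) (erule eventually_mono, simp)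
qed

lemma dissipative_system:
  assumes lmi: "neg_def LMI"
  shows "dissipative S G (supply_fun J)"
  unfolding dissipative_def
proof (intro exI[of _ "\<lambda>\<psi>. lyap \<psi> 0"] conjI allI impI)
  show "differentiable_functional S (\<lambda>\<psi>. lyap \<psi> 0)"
    by (rule quadratic_functional_differentiable[OF lyap_quadratic_functional])
  obtain c where c: "c > 0" "\<And>e w t. history S e t \<Longrightarrow> w t \<in> carrier_vec q \<Longrightarrow>
    lyap_rate e w t - supply_fun J (zeta S G e w t) (w t)
      \<le> - c * (vartheta S e w t \<bullet> vartheta S e w t) - (\<Sum>i=1..\<nu>. energy e t (R i) i - (form_h e t i + form_eps e t i))"
    using dissipation_rate[OF lmi] by blast
  fix t0 \<psi> w e assume sol: "is_solution S G t0 \<psi> w e"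
  have e: "signal e t0" by (rule solution_signal[OF sol])
  have wc: "w t \<in> carrier_vec q" if "t \<ge> t0" for t using sol that by (auto simp: is_solution_def L2_on_def)
  have "AE t in lebesgue_on {t0..}. t \<noteq> t0" by (rule AE_neq) simp
  moreover have "AE t in lebesgue_on {t0..}. \<forall>k<n. ((\<lambda>s. e s $ k) has_real_derivative (Omega S G *\<^sub>v vartheta S e w t) $ k) (at t)"
    using sol by (simp add: is_solution_def)
  ultimately show "AE t in lebesgue_on {t0..}. \<exists>v'. ((\<lambda>\<tau>. lyap (segment S e \<tau>) 0) has_real_derivative v') (at t) \<and>
      v' - supply_fun J (zeta S G e w t) (w t) \<le> 0"
    using AE_space
  proof eventually_elim
    case (elim t)
    then have t: "t > t0" by simp
    have h: "history S e t" by (rule signal_history[OF e]) (use t in simp)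
    have wt: "w t \<in> carrier_vec q" by (rule wc) (use t in simp)
    have d: "vec_deriv n e (Omega S G *\<^sub>v vartheta S e w t) t"
      using elim(2) mult_mat_vec_carrier[OF Omega_carrier vartheta_carrier[where w = w, OF h wt]] by (simp add: vec_deriv_def)
    have "0 \<le> c * (vartheta S e w t \<bullet> vartheta S e w t)" using c(1) scalar_prod_self_ge_0 by simp
    moreover have "0 \<le> (\<Sum>i=1..\<nu>. energy e t (R i) i - (form_h e t i + form_eps e t i))"
      by (rule sum_nonneg) (rule Bessel_gap_nonneg[OF h])
    ultimately have "lyap_rate e w t - supply_fun J (zeta S G e w t) (w t) \<le> 0"
      using c(2)[where w = w, OF h wt] by simp
    then show ?case unfolding lyap_segment using lyap_solution_derivative[OF e t d] by blast
  qed
qed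

text \<open>The price of giving up part of the Bessel gap: the projected energies are quadratic in
  two blocks of \<theta>, so the margin in the square of \<theta> can pay for them.\<close>

lemma moment_forms_bound:
  obtains c where "c > 0" "\<And>e w t. history S e t \<Longrightarrow> w t \<in> carrier_vec q \<Longrightarrow>
    (\<Sum>i=1..\<nu>. form_h e t i + form_eps e t i) \<le> c * (vartheta S e w t \<bullet> vartheta S e w t)"
proof -
  let ?D = "\<lambda>N. diag_idx S (\<lambda>i. 1\<^sub>m (N i) \<otimes>\<^sub>K R i)"
  obtain c1 where c1: "c1 > 0" "\<And>x. x \<in> carrier_vec D3 \<Longrightarrow> x \<bullet> (?D (varkap_of S) *\<^sub>v x) \<le> c1 * (x \<bullet> x)"
    using quadratic_form_le[OF Xi_parts_carrier(5)] by blast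
  obtain c2 where c2: "c2 > 0" "\<And>x. x \<in> carrier_vec D4 \<Longrightarrow> x \<bullet> (?D (mu_of S) *\<^sub>v x) \<le> c2 * (x \<bullet> x)"
    using quadratic_form_le[OF Xi_parts_carrier(6)] by blast
  show thesis
  proof (rule that[of "c1 + c2"])
    fix e w :: "real \<Rightarrow> real vec" and t assume h: "history S e t" and w: "w t \<in> carrier_vec q"
    let ?x = "moments S (varkap_of S) nh e t" and ?a = "moments S (mu_of S) ne e t" and ?E = "vconcat (map (\<lambda>i. e (t - delay S i)) (idx S))"
    note p = vartheta_parts[OF h]
    have th: "vartheta S e w t \<bullet> vartheta S e w t = e t \<bullet> e t + (?E \<bullet> ?E + (?x \<bullet> ?x + (?a \<bullet> ?a + w t \<bullet> w t)))"
      unfolding vartheta_moments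
      by (simp only: scalar_prod_append[OF p(1) append_carrier_vec[OF p(2) append_carrier_vec[OF p(3) append_carrier_vec[OF p(4) w]]] p(1) append_carrier_vec[OF p(2) append_carrier_vec[OF p(3) append_carrier_vec[OF p(4) w]]]]
        scalar_prod_append[OF p(2) append_carrier_vec[OF p(3) append_carrier_vec[OF p(4) w]] p(2) append_carrier_vec[OF p(3) append_carrier_vec[OF p(4) w]]]
        scalar_prod_append[OF p(3) append_carrier_vec[OF p(4) w] p(3) append_carrier_vec[OF p(4) w]] scalar_prod_append[OF p(4) w p(4) w])
    have "(\<Sum>i=1..\<nu>. form_h e t i + form_eps e t i) = ?x \<bullet> (?D (varkap_of S) *\<^sub>v ?x) + ?a \<bullet> (?D (mu_of S) *\<^sub>v ?a)"
      unfolding diag_R_moments sum.distrib by (rule refl)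
    also have "\<dots> \<le> c1 * (?x \<bullet> ?x) + c2 * (?a \<bullet> ?a)" by (intro add_mono c1(2) c2(2) p)
    also have "\<dots> \<le> (c1 + c2) * (?x \<bullet> ?x + ?a \<bullet> ?a)"
      using c1(1) c2(1) scalar_prod_self_ge_0[of ?x] scalar_prod_self_ge_0[of ?a] by (simp add: algebra_simps)
    also have "\<dots> \<le> (c1 + c2) * (vartheta S e w t \<bullet> vartheta S e w t)"
      unfolding th using c1(1) c2(1) scalar_prod_self_ge_0[of "e t"] scalar_prod_self_ge_0[of ?E] scalar_prod_self_ge_0[of "w t"]
      by (intro mult_left_mono) auto
    finally show "(\<Sum>i=1..\<nu>. form_h e t i + form_eps e t i) \<le> (c1 + c2) * (vartheta S e w t \<bullet> vartheta S e w t)" .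
  qed (use c1(1) c2(1) in simp)
qed

lemma e_le_vartheta:
  assumes h: "history S e t" and w: "w t \<in> carrier_vec q"
  shows "e t \<bullet> e t \<le> vartheta S e w t \<bullet> vartheta S e w t"
proof -
  note p = vartheta_parts[OF h]
  have r: "vconcat (map (\<lambda>i. e (t - delay S i)) (idx S)) @\<^sub>v moments S (varkap_of S) nh e t @\<^sub>v moments S (mu_of S) ne e t @\<^sub>v w t
    \<in> carrier_vec (D2 + (D3 + (D4 + q)))" by (intro append_carrier_vec p w)
  show ?thesis unfolding vartheta_moments scalar_prod_append[OF p(1) r p(1) r] using scalar_prod_self_ge_0 by simp
qed

text \<open>Coercivity of each \<open>R i\<close>, integrated over its window; the least of the
  finitely many constants works for all.\<close>

lemma R_energy_bound:
  obtains \<rho> where "\<rho> > 0" "\<And>e t i. history S e t \<Longrightarrow> i \<in> {1..\<nu>} \<Longrightarrow> \<rho> * energy e t (1\<^sub>m n) i \<le> energy e t (R i) i"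
proof -
  have "\<exists>c>0. \<forall>x\<in>carrier_vec n. c * (x \<bullet> x) \<le> x \<bullet> (R i *\<^sub>v x)" if "i \<in> {1..\<nu>}" for i
    using pos_def_coercive[OF QR_pos_def(2)[OF that] QR_carrier(2)[OF that]] by metis
  then obtain c where c: "\<And>i. i \<in> {1..\<nu>} \<Longrightarrow> c i > 0 \<and> (\<forall>x\<in>carrier_vec n. c i * (x \<bullet> x) \<le> x \<bullet> (R i *\<^sub>v x))" by metis
  define \<rho> where "\<rho> = Min (c ` {1..\<nu>})"
  have \<rho>: "\<rho> \<le> c i" if "i \<in> {1..\<nu>}" for i unfolding \<rho>_def using that by (intro Min_le) auto
  have "\<rho> \<in> c ` {1..\<nu>}" unfolding \<rho>_def using nu_ge_1 by (intro Min_in) auto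
  then have "\<rho> > 0" using c by auto
  then show thesis
  proof (rule that)
    fix e t i assume h: "history S e t" and i: "i \<in> {1..\<nu>}"
    show "\<rho> * energy e t (1\<^sub>m n) i \<le> energy e t (R i) i"
    proof (rule energy_compare[OF i h one_carrier_mat QR_carrier(2)[OF i]])
      fix x :: "real vec" assume x: "x \<in> carrier_vec n"
      have "\<rho> * (x \<bullet> x) \<le> c i * (x \<bullet> x)" by (rule mult_right_mono[OF \<rho>[OF i] scalar_prod_self_ge_0])
      then show "\<rho> * (x \<bullet> (1\<^sub>m n *\<^sub>v x)) \<le> x \<bullet> (R i *\<^sub>v x)" using c[OF i] x by fastforce
    qed
  qed
qed

text \<open>A fraction of the gap in the Bessel inequality is given up to recover the full \<open>L\<^sup>2\<close> energy of
  the history, which the quadratic form in \<open>\<theta>\<close> alone does not control.\<close>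

lemma lyap_decay:
  assumes lmi: "neg_def LMI"
  obtains \<alpha> where "\<alpha> > 0" "\<And>e t. history S e t \<Longrightarrow> lyap_rate e (\<lambda>_. 0\<^sub>v q) t \<le> - (2 * \<alpha>) * lyap e t"
proof -
  obtain c where c: "c > 0" "\<And>e w t. history S e t \<Longrightarrow> w t \<in> carrier_vec q \<Longrightarrow>
    lyap_rate e w t - supply_fun J (zeta S G e w t) (w t)
      \<le> - c * (vartheta S e w t \<bullet> vartheta S e w t) - (\<Sum>i=1..\<nu>. energy e t (R i) i - (form_h e t i + form_eps e t i))"
    using dissipation_rate[OF lmi] by blast
  obtain b where b: "b > 0" "\<And>e w t. history S e t \<Longrightarrow> w t \<in> carrier_vec q \<Longrightarrow>
    (\<Sum>i=1..\<nu>. form_h e t i + form_eps e t i) \<le> b * (vartheta S e w t \<bullet> vartheta S e w t)"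
    using moment_forms_bound by blast
  obtain \<rho> where \<rho>: "\<rho> > 0" "\<And>e t i. history S e t \<Longrightarrow> i \<in> {1..\<nu>} \<Longrightarrow> \<rho> * energy e t (1\<^sub>m n) i \<le> energy e t (R i) i"
    using R_energy_bound by blast
  obtain u where u: "u > 0" "\<And>e t. history S e t \<Longrightarrow> lyap e t \<le> u * (e t \<bullet> e t + (\<Sum>i=1..\<nu>. energy e t (1\<^sub>m n) i))"
    using lyap_upper_bound by blast
  \<comment> \<open>\<open>\<eta> \<le> 1\<close> retains only a fraction of the nonnegative gap,
    and \<open>\<eta> * b \<le> c / 2\<close> lets half of the margin in the square of \<theta>
    absorb the projected energies.\<close>
  define \<eta> where "\<eta> = min 1 (c / (2 * b))"
  have \<eta>: "0 < \<eta>" "\<eta> \<le> 1" "\<eta> * b \<le> c / 2"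
    using c(1) b(1) by (auto simp: \<eta>_def min_def field_simps)
  \<comment> \<open>The other half of the margin controls \<open>e t \<bullet> e t\<close>; the
    retained \<open>R\<close>-energy controls the full energy with constant
    \<open>\<eta> * \<rho>\<close>.\<close>
  define k where "k = min (c / 2) (\<eta> * \<rho>)"
  have k: "0 < k" "k \<le> c / 2" "k \<le> \<eta> * \<rho>" using c(1) \<eta>(1) \<rho>(1) by (auto simp: k_def)
  show thesis
  proof (rule that[of "k / (2 * u)"])
    show "0 < k / (2 * u)" using k(1) u(1) by simp
    fix e t assume h: "history S e t"
    let ?w = "\<lambda>_::real. 0\<^sub>v q :: real vec"
    let ?\<theta> = "vartheta S e ?w t"
    define F where "F = (\<Sum>i=1..\<nu>. form_h e t i + form_eps e t i)"
    define ER where "ER = (\<Sum>i=1..\<nu>. energy e t (R i) i)"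
    define E1 where "E1 = (\<Sum>i=1..\<nu>. energy e t (1\<^sub>m n) i)"
    have w: "?w t \<in> carrier_vec q" by simp
    have \<theta>: "?\<theta> \<in> carrier_vec ND" by (rule vartheta_carrier[OF h w])
    have zeta: "zeta S G e ?w t \<in> carrier_vec m" unfolding zeta_def by (rule mult_mat_vec_carrier[OF Sigma_carrier \<theta>])
    have gap: "(\<Sum>i=1..\<nu>. energy e t (R i) i - (form_h e t i + form_eps e t i)) = ER - F"
      by (simp only: ER_def F_def sum_subtractf)
    have "0 \<le> ER - F" unfolding gap[symmetric] by (rule sum_nonneg) (rule Bessel_gap_nonneg[OF h])
    then have "\<eta> * (ER - F) \<le> 1 * (ER - F)" using \<eta>(2) by (rule mult_right_mono[rotated])
    moreover have "lyap_rate e ?w t \<le> - c * (?\<theta> \<bullet> ?\<theta>) - (ER - F)"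
      using c(2)[OF h, of ?w, OF w] supply_nonpos[OF zeta] unfolding gap by simp
    moreover have "\<eta> * F \<le> c / 2 * (?\<theta> \<bullet> ?\<theta>)"
    proof -
      have "\<eta> * F \<le> \<eta> * (b * (?\<theta> \<bullet> ?\<theta>))" using b(2)[OF h, of ?w, OF w] \<eta>(1) unfolding F_def by (intro mult_left_mono) auto
      also have "\<dots> = (\<eta> * b) * (?\<theta> \<bullet> ?\<theta>)" by simp
      also have "\<dots> \<le> c / 2 * (?\<theta> \<bullet> ?\<theta>)" by (rule mult_right_mono[OF \<eta>(3) scalar_prod_self_ge_0])
      finally show ?thesis .
    qed
    moreover have "c / 2 * (e t \<bullet> e t) \<le> c / 2 * (?\<theta> \<bullet> ?\<theta>)"
      using e_le_vartheta[OF h, of ?w, OF w] c(1) by (intro mult_left_mono) auto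
    moreover have "k * (e t \<bullet> e t) \<le> c / 2 * (e t \<bullet> e t)" by (rule mult_right_mono[OF k(2) scalar_prod_self_ge_0])
    moreover have "k * E1 \<le> \<eta> * ER"
    proof -
      have "0 \<le> E1" unfolding E1_def by (rule sum_nonneg) (rule energy_one_nonneg[OF _ h])
      then have "k * E1 \<le> \<eta> * \<rho> * E1" by (rule mult_right_mono[OF k(3)])
      also have "\<dots> = \<eta> * (\<rho> * E1)" by simp
      also have "\<rho> * E1 \<le> ER" unfolding E1_def ER_def sum_distrib_left by (rule sum_mono) (rule \<rho>(2)[OF h])
      finally show ?thesis using \<eta>(1) by simp
    qed
    ultimately have "lyap_rate e ?w t \<le> - k * (e t \<bullet> e t + E1)"
      by (simp add: algebra_simps)
    also have "\<dots> \<le> - (k / u) * lyap e t"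
    proof -
      have "k / u * lyap e t \<le> k / u * (u * (e t \<bullet> e t + E1))"
        using u k(1) h unfolding E1_def by (intro mult_left_mono) auto
      then show ?thesis using u(1) by simp
    qed
    finally show "lyap_rate e ?w t \<le> - (2 * (k / (2 * u))) * lyap e t" by simp
  qed
qed

lemma vnorm_square: "(vnorm x)\<^sup>2 = x \<bullet> x" "0 \<le> vnorm x"
  using scalar_prod_self_ge_0[of x] by (simp_all add: vnorm_def)

lemma segment_in_C_space:
  assumes "signal e t0" "s \<ge> t0" shows "segment S e s \<in> C_space S"
proof (rule C_spaceI)
  have h: "history S e s" by (rule signal_history[OF assms])
  show "segment S e s \<tau> \<in> carrier_vec n" if "\<tau> \<in> Jint S" for \<tau> using h that by (simp add: segment_def history_def)
  fix j assume "j < n"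
  then have "continuous_on (Jint S) (\<lambda>\<tau>. e (s + \<tau>) $ j)" using h by (simp add: history_def)
  then show "continuous_on (Jint S) (\<lambda>\<tau>. segment S e s \<tau> $ j)" by (rule continuous_on_eq) (simp add: segment_def)
qed (simp add: segment_def)

text \<open>The decay estimate has to start at some \<open>s > t0\<close>, where
  \<open>lyap e\<close> is differentiable; the segment at \<open>s\<close> consists of initial data
  and of values of \<open>e\<close> close to \<open>e t0\<close>, so its norm is almost that of
  \<open>\<psi>\<close>.\<close>

lemma segment_norm_near_initial:
  assumes sol: "is_solution S G t0 \<psi> w e" and \<epsilon>: "\<epsilon> > 0"
  obtains \<delta> where "\<delta> > 0" "\<And>s. t0 \<le> s \<Longrightarrow> s \<le> t0 + \<delta> \<Longrightarrow> C_norm S (segment S e s) \<le> C_norm S \<psi> + \<epsilon>"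
proof -
  have e: "signal e t0" by (rule solution_signal[OF sol])
  have \<psi>: "\<psi> \<in> C_space S" and init: "\<And>\<theta>. \<theta> \<in> Jint S \<Longrightarrow> e (t0 + \<theta>) = \<psi> \<theta>" using sol by (auto simp: is_solution_def)
  have ej: "continuous_on {t0..t0 + 1} (\<lambda>s. e s $ j)" if "j < n" for j
  proof -
    have "continuous_on {t0 - r_max S..} (\<lambda>s. e s $ j)" using e that by (simp add: signal_def)
    then show ?thesis by (rule continuous_on_subset) (use r_max_nonneg in auto)
  qed
  have "continuous_on {t0..t0 + 1} (\<lambda>s. sqrt (\<Sum>j<n. e s $ j * e s $ j))"
    by (intro continuous_on_real_sqrt continuous_on_sum continuous_on_mult ej) auto
  moreover have "sqrt (\<Sum>j<n. e s $ j * e s $ j) = vnorm (e s)" if "s \<ge> t0" for s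
    using carrier_vecD[OF signal_carrier[OF e, of s]] that r_max_nonneg by (simp add: vnorm_def scalar_prod_def atLeast0LessThan)
  ultimately have "continuous_on {t0..t0 + 1} (\<lambda>s. vnorm (e s))" by (auto elim: continuous_on_eq)
  then obtain d where d: "d > 0" "\<And>s. s \<in> {t0..t0 + 1} \<Longrightarrow> dist s t0 < d \<Longrightarrow> dist (vnorm (e s)) (vnorm (e t0)) < \<epsilon>"
    using \<epsilon> unfolding continuous_on_iff by (metis atLeastAtMost_iff le_add_same_cancel1 order_refl zero_le_one)
  have e0: "vnorm (e t0) \<le> C_norm S \<psi>" using vnorm_le_C_norm[OF \<psi> zero_in_Jint] init[OF zero_in_Jint] by simp
  show thesis
  proof (rule that[of "min 1 (d / 2)"])
    fix s assume s: "t0 \<le> s" "s \<le> t0 + min 1 (d / 2)"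
    show "C_norm S (segment S e s) \<le> C_norm S \<psi> + \<epsilon>"
      unfolding C_norm_def[of S "segment S e s"]
    proof (rule cSUP_least)
      show "Jint S \<noteq> {}" using zero_in_Jint by auto
      fix \<tau> assume \<tau>: "\<tau> \<in> Jint S"
      then have seg: "segment S e s \<tau> = e (s + \<tau>)" by (simp add: segment_def)
      show "vnorm (segment S e s \<tau>) \<le> C_norm S \<psi> + \<epsilon>"
      proof (cases "s + \<tau> \<le> t0")
        case True
        then have J: "s + \<tau> - t0 \<in> Jint S" using \<tau> s by (auto simp: Jint_def)
        then show ?thesis using init[OF J] vnorm_le_C_norm[OF \<psi> J] \<epsilon> unfolding seg by simp
      next
        case False
        then have "dist (s + \<tau>) t0 < d" "s + \<tau> \<in> {t0..t0 + 1}" using s \<tau> d(1) by (auto simp: dist_real_def Jint_def)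
        then show ?thesis using d(2)[of "s + \<tau>"] e0 unfolding seg by (auto simp: dist_real_def)
      qed
    qed
  qed (use d in simp)
qed

text \<open>A Gronwall argument: \<open>lyap e t * exp (2 * \<alpha> * t)\<close> is nonincreasing,
  the factor 2 accounting for \<open>lyap\<close> being quadratic. All constants are fixed before
  any solution is considered, which makes the estimate uniform.\<close>

lemma exponentially_stable_system:
  assumes lmi: "neg_def LMI"
  shows "exponentially_stable S G"
proof -
  obtain \<alpha> where \<alpha>: "\<alpha> > 0" "\<And>e t. history S e t \<Longrightarrow> lyap_rate e (\<lambda>_. 0\<^sub>v q) t \<le> - (2 * \<alpha>) * lyap e t"
    using lyap_decay[OF lmi] by blast
  obtain K where K: "K \<ge> 0" "\<And>\<psi>. \<psi> \<in> C_space S \<Longrightarrow> lyap \<psi> 0 \<le> K * (C_norm S \<psi>)\<^sup>2" using lyap_initial_bound by blast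
  obtain b where b: "b > 0" "\<And>e t. history S e t \<Longrightarrow> b * (e t \<bullet> e t) \<le> lyap e t" using lyap_lower_bound by blast
  \<comment> \<open>The 3 absorbs the exponential factor between \<open>t0\<close> and the starting
    time; the \<open>+ 1\<close> handles \<open>t = t0\<close> and keeps \<open>M\<close> positive
    when \<open>K = 0\<close>.\<close>
  define M where "M = sqrt (3 * K / b) + 1"
  have "vnorm (e t) \<le> M * exp (- \<alpha> * (t - t0)) * C_norm S \<psi>"
    if sol: "is_solution S G t0 \<psi> (\<lambda>_. 0\<^sub>v q) e" and t: "t \<ge> t0" for t0 \<psi> e t
  proof (cases "t = t0")
    case True
    have \<psi>: "\<psi> \<in> C_space S" and "e (t0 + 0) = \<psi> 0" using sol zero_in_Jint by (auto simp: is_solution_def)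
    then have "vnorm (e t) \<le> C_norm S \<psi>" using vnorm_le_C_norm[OF \<psi> zero_in_Jint] True by simp
    also have "\<dots> \<le> M * C_norm S \<psi>" using C_norm_nonneg[OF \<psi>] K(1) b(1) by (simp add: M_def distrib_right)
    finally show ?thesis using True by simp
  next
    case False
    then have t: "t > t0" using t by simp
    have e: "signal e t0" by (rule solution_signal[OF sol])
    have \<psi>: "\<psi> \<in> C_space S" using sol by (simp add: is_solution_def)
    define N where "N = C_norm S \<psi>"
    have N: "0 \<le> N" unfolding N_def by (rule C_norm_nonneg[OF \<psi>])
    \<comment> \<open>The zero disturbance is continuous, so the derivative exists at every
      \<open>s > t0\<close> and not just almost everywhere, as the monotonicity argument
      demands.\<close>
    have deriv: "(lyap e has_real_derivative lyap_rate e (\<lambda>_. 0\<^sub>v q) s) (at s)" if s: "s > t0" for s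
      by (rule lyap_solution_derivative[OF e s solution_classical_derivative[OF sol _ Omega_carrier s]]) (simp add: cont_vec_def)
    have mono: "lyap e t * exp (2 * \<alpha> * t) \<le> lyap e s * exp (2 * \<alpha> * s)" if s: "t0 < s" "s \<le> t" for s
    proof (rule DERIV_nonpos_imp_nonincreasing[OF s(2)])
      fix x assume x: "s \<le> x" "x \<le> t"
      have "((\<lambda>x. lyap e x * exp (2 * \<alpha> * x)) has_real_derivative
        lyap_rate e (\<lambda>_. 0\<^sub>v q) x * exp (2 * \<alpha> * x) + exp (2 * \<alpha> * x) * (2 * \<alpha>) * lyap e x) (at x)"
        using s x by (auto intro!: derivative_eq_intros deriv)
      moreover have "lyap_rate e (\<lambda>_. 0\<^sub>v q) x * exp (2 * \<alpha> * x) + exp (2 * \<alpha> * x) * (2 * \<alpha>) * lyap e x \<le> 0"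
      proof -
        have "(lyap_rate e (\<lambda>_. 0\<^sub>v q) x + 2 * \<alpha> * lyap e x) * exp (2 * \<alpha> * x) \<le> 0"
          using \<alpha>(2)[OF signal_history[OF e, of x]] s x by (intro mult_nonpos_nonneg) auto
        then show ?thesis by (simp add: algebra_simps)
      qed
      ultimately show "\<exists>y. ((\<lambda>x. lyap e x * exp (2 * \<alpha> * x)) has_real_derivative y) (at x) \<and> y \<le> 0" by blast
    qed
    have bound: "lyap e t \<le> exp (- (2 * \<alpha> * (t - t0))) * 3 * K * (N + \<epsilon>)\<^sup>2" if \<epsilon>: "\<epsilon> > 0" for \<epsilon>
    proof -
      obtain \<delta> where \<delta>: "\<delta> > 0" "\<And>s. t0 \<le> s \<Longrightarrow> s \<le> t0 + \<delta> \<Longrightarrow> C_norm S (segment S e s) \<le> N + \<epsilon>"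
        using segment_norm_near_initial[OF sol \<epsilon>] unfolding N_def by blast
      \<comment> \<open>Close enough to \<open>t0\<close> for the norm bound and for
        \<open>exp (2 * \<alpha> * (s - t0)) \<le> exp 1 \<le> 3\<close>, but not beyond
        \<open>t\<close>.\<close>
      define s where "s = t0 + min (min \<delta> (1 / (2 * \<alpha>))) (t - t0)"
      have s: "t0 < s" "s \<le> t" "s \<le> t0 + \<delta>" "s - t0 \<le> 1 / (2 * \<alpha>)" using \<delta>(1) \<alpha>(1) t by (auto simp: s_def)
      have sC: "segment S e s \<in> C_space S" by (rule segment_in_C_space[OF e]) (use s in simp)
      have "lyap e s \<le> K * (C_norm S (segment S e s))\<^sup>2" using K(2)[OF sC] by (simp add: lyap_segment)
      also have "\<dots> \<le> K * (N + \<epsilon>)\<^sup>2" using \<delta>(2)[of s] s K(1) C_norm_nonneg[OF sC] by (intro mult_left_mono power_mono) auto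
      finally have ls: "lyap e s \<le> K * (N + \<epsilon>)\<^sup>2" .
      have "2 * \<alpha> * (s - t0) \<le> 1" using s(4) \<alpha>(1) by (simp add: field_simps)
      then have e3: "exp (2 * \<alpha> * (s - t0)) \<le> 3" using exp_le by (meson exp_le_cancel_iff order_trans)
      have "lyap e t = lyap e t * exp (2 * \<alpha> * t) * exp (- (2 * \<alpha> * t))" by (simp add: exp_minus)
      also have "\<dots> \<le> lyap e s * exp (2 * \<alpha> * s) * exp (- (2 * \<alpha> * t))" by (rule mult_right_mono[OF mono[OF s(1,2)]]) simp
      also have "\<dots> = lyap e s * (exp (2 * \<alpha> * (s - t0)) * exp (- (2 * \<alpha> * (t - t0))))"
        by (simp add: exp_add[symmetric] mult.assoc) (simp add: algebra_simps)
      also have "\<dots> \<le> (K * (N + \<epsilon>)\<^sup>2) * (3 * exp (- (2 * \<alpha> * (t - t0))))"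
        using ls e3 K(1) by (intro mult_mono) auto
      finally show ?thesis by (simp add: mult_ac)
    qed
    \<comment> \<open>\<open>\<delta>\<close> and \<open>s\<close> depend on
      \<open>\<epsilon>\<close>, but the bound no longer mentions them, so \<open>\<epsilon>\<close>
      can tend to 0 and only the norm of \<open>\<psi>\<close> is left.\<close>
    have "((\<lambda>\<epsilon>. exp (- (2 * \<alpha> * (t - t0))) * 3 * K * (N + \<epsilon>)\<^sup>2) \<longlongrightarrow> exp (- (2 * \<alpha> * (t - t0))) * 3 * K * (N + 0)\<^sup>2) (at_right 0)"
      by (intro tendsto_intros)
    then have "lyap e t \<le> exp (- (2 * \<alpha> * (t - t0))) * 3 * K * (N + 0)\<^sup>2"
      by (rule tendsto_lowerbound) (auto simp: eventually_at_right_less bound intro!: eventually_mono[OF eventually_at_right_less])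
    then have "b * (vnorm (e t))\<^sup>2 \<le> exp (- (2 * \<alpha> * (t - t0))) * 3 * K * N\<^sup>2"
      using b(2)[OF signal_history[OF e, of t]] t by (simp add: vnorm_square)
    then have "(vnorm (e t))\<^sup>2 \<le> 3 * K / b * exp (- (2 * \<alpha> * (t - t0))) * N\<^sup>2"
      using b(1) by (simp add: field_simps)
    also have "exp (- (2 * \<alpha> * (t - t0))) = (exp (- \<alpha> * (t - t0)))\<^sup>2" by (simp add: exp_double[symmetric])
    also have "3 * K / b * (exp (- \<alpha> * (t - t0)))\<^sup>2 * N\<^sup>2 = (sqrt (3 * K / b) * exp (- \<alpha> * (t - t0)) * N)\<^sup>2"
      using K(1) b(1) by (simp add: power_mult_distrib)
    finally have "vnorm (e t) \<le> sqrt (3 * K / b) * exp (- \<alpha> * (t - t0)) * N"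
      by (rule power2_le_imp_le) (use K(1) b(1) N in simp)
    also have "\<dots> \<le> M * exp (- \<alpha> * (t - t0)) * N"
      using N by (intro mult_right_mono) (auto simp: M_def)
    finally show ?thesis unfolding N_def .
  qed
  moreover have "M > 0" using K(1) b(1) by (simp add: M_def add_nonneg_pos)
  ultimately show ?thesis using \<alpha>(1) unfolding exponentially_stable_def by blast
qed

end

theorem theorem1:
  fixes S :: plant and G :: gains and J :: supply_rate
    and Q R :: "nat \<Rightarrow> real mat" and P1 P2 P3 :: "real mat"
  assumes plant: "admissible_plant S"
    and rate: "admissible_supply S J"
    and gains: "admissible_gains S G"
    and Q: "\<And>i. i \<in> {1..num_delays S} \<Longrightarrow> Q i \<in> sym_mats (dim_n S)"
    and R: "\<And>i. i \<in> {1..num_delays S} \<Longrightarrow> R i \<in> sym_mats (dim_n S)"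
    and P1: "P1 \<in> sym_mats (dim_n S)"
    and P2: "P2 \<in> carrier_mat (dim_n S) (d_tot S * dim_n S)"
    and P3: "P3 \<in> sym_mats (d_tot S * dim_n S)"
    and pos_P: "pos_def (four_block_mat P1 P2 (P2\<^sup>\<top>)
                  (P3 + diag_idx S (\<lambda>i. 1\<^sub>m (d_of S i) \<otimes>\<^sub>K Q i)))"
    and pos_Q: "pos_def (diag_idx S Q)"
    and pos_R: "pos_def (diag_idx S R)"
    and lmi: "neg_def (four_block_mat
                (Psi S G J Q R P1 P2 P3) ((Sigma_mat S G)\<^sup>\<top> * (sJt J)\<^sup>\<top>)
                (sJt J * Sigma_mat S G) (sJ1 J))"
  shows "four_block_mat
           (Psi S G J Q R P1 P2 P3) ((Sigma_mat S G)\<^sup>\<top> * (sJt J)\<^sup>\<top>)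
           (sJt J * Sigma_mat S G) (sJ1 J)
         = Sy ((boldP S P1 P2)\<^sup>\<top> * boldPi S G) + boldPhi S G J Q R P2 P3
     \<and> dissipative S G (supply_fun J)
     \<and> exponentially_stable S G
     \<and> real (num_unknowns S) =
           (0.5 * real (d_tot S)^2 + real (d_tot S) + real (num_delays S) + 0.5) * real (dim_n S)^2
         + (0.5 * real (d_tot S) + 0.5 + real (num_delays S) + real (beta S) * real (dim_l S)) * real (dim_n S)
         + real (beta S) * real (dim_l S) * real (dim_m S)
     \<and> (\<lambda>(d, n). 
           (let \<beta> = 1 + real (num_delays S) + real d + real (\<Sum>i=1..num_delays S. del_of S i + mu_of S i) in
             (0.5 * real d^2 + real d + real (num_delays S) + 0.5) * real n^2
           + (0.5 * real d + 0.5 + real (num_delays S) + \<beta> * real (dim_l S)) * real n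
           + \<beta> * real (dim_l S) * real (dim_m S)))
         \<in> O[at_top \<times>\<^sub>F at_top](\<lambda>(d, n). real d^2 * real n^2)"
proof -
  interpret lmi_data S Q R P1 P2 P3 G J
    by unfold_locales (rule plant Q R P1 P2 P3 pos_P pos_Q pos_R gains rate; assumption?)+
  show ?thesis
    by (intro conjI LMI_eq dissipative_system[OF lmi] exponentially_stable_system[OF lmi] num_unknowns_formula
        unknowns_bigo of_nat_0_le_iff)
qed

end
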